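(* Let $f:\mathbb{C}\to\mathbb{C}$ be a strongly subhyperbolic transcendental entire map, and let $\lambda\in\mathbb{C}$ be such that $g(z):=f(\lambda z)$ is hyperbolic with connected Fatou set. Then there exists a continuous surjection $\phi:\mathcal{J}(g)\to\mathcal{J}(f)$ such that $$f(\phi(z))=\phi(g(z))\qquad\text{for all } z\in\mathcal{J}(g).$$ Moreover, $\phi$ restricts to a homeomorphism between the escaping sets $I(g)$ and $I(f)$.
   Context: For a transcendental entire function $f$: $\mathcal{F}(f)$ is the Fatou set and $\mathcal{J}(f)=\mathbb{C}\setminus\mathcal{F}(f)$ the Julia set; $I(f)=\{z\in\mathbb{C}: f^n(z)\to\infty \text{ as } n\to\infty\}$ is the escaping set. $C(f)$ is the set of critical values, $A(f)$ the set of finite asymptotic values, $S(f)=\overline{C(f)\cup A(f)}$ the set of singular values, and $P(f)=\overline{\bigcup_{n\ge 0} f^n(S(f))}$ the postsingular set (closures taken in $\mathbb{C}$). $\deg(f,z)$ is the local degree of $f$ at $z$. A transcendental entire $f$ is subhyperbolic if $P(f)\cap\mathcal{F}(f)$ is compact and $P(f)\cap\mathcal{J}(f)$ is finite. It is hyperbolic if $P(f)$ is a compact subset of $\mathcal{F}(f)$ (i.e. subhyperbolic with $P(f)\cap\mathcal{J}(f)=\emptyset$). A subhyperbolic transcendental entire $f$ is strongly subhyperbolic if $\mathcal{J}(f)\cap A(f)=\emptyset$ and there is a constant $R<\infty$ with $\deg(f,z)<R$ for all $z\in\mathcal{J}(f)$. *)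

theory Defs
  imports "HOL-Complex_Analysis.Complex_Analysis"
begin

definition transcendental_entire :: "(complex \<Rightarrow> complex) \<Rightarrow> bool" where
  "transcendental_entire f \<longleftrightarrow> f holomorphic_on UNIV \<and> (\<nexists>p. f = poly p)"

(* Normality in the sense of Montel, with respect to the Riemann sphere: the constant
   function infinity is admitted as a limit.  For holomorphic functions on a connected
   open set this is the only limit taking the value infinity, so only connected U
   should be used. *)
definition normal_family_on :: "complex set \<Rightarrow> (complex \<Rightarrow> complex) set \<Rightarrow> bool" where
  "normal_family_on U \<F> \<longleftrightarrow>
     (\<forall>h :: nat \<Rightarrow> complex \<Rightarrow> complex. range h \<subseteq> \<F> \<longrightarrow>
       (\<exists>r :: nat \<Rightarrow> nat. strict_mono r \<and>
         ((\<exists>l. \<forall>K. compact K \<and> K \<subseteq> U \<longrightarrow> uniform_limit K (h \<circ> r) l sequentially) \<or>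
          (\<forall>K. compact K \<and> K \<subseteq> U \<longrightarrow>
             (\<forall>B::real. \<forall>\<^sub>F n in sequentially. \<forall>z\<in>K. B < norm (h (r n) z))))))"

definition fatou_set :: "(complex \<Rightarrow> complex) \<Rightarrow> complex set" where
  "fatou_set f =
     {z. \<exists>U. open U \<and> connected U \<and> z \<in> U \<and> normal_family_on U (range (\<lambda>n. f ^^ n))}"

definition julia_set :: "(complex \<Rightarrow> complex) \<Rightarrow> complex set" where
  "julia_set f = - fatou_set f"

definition escaping_set :: "(complex \<Rightarrow> complex) \<Rightarrow> complex set" where
  "escaping_set f = {z. filterlim (\<lambda>n. (f ^^ n) z) at_infinity sequentially}"

definition critical_values :: "(complex \<Rightarrow> complex) \<Rightarrow> complex set" where
  "critical_values f = f ` {z. deriv f z = 0}"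

definition asymptotic_values :: "(complex \<Rightarrow> complex) \<Rightarrow> complex set" where
  "asymptotic_values f =
     {a. \<exists>\<gamma> :: real \<Rightarrow> complex. continuous_on {0..} \<gamma> \<and>
           filterlim \<gamma> at_infinity at_top \<and> ((\<lambda>t. f (\<gamma> t)) \<longlongrightarrow> a) at_top}"

definition singular_values :: "(complex \<Rightarrow> complex) \<Rightarrow> complex set" where
  "singular_values f = closure (critical_values f \<union> asymptotic_values f)"

definition postsingular_set :: "(complex \<Rightarrow> complex) \<Rightarrow> complex set" where
  "postsingular_set f = closure (\<Union>n. (f ^^ n) ` singular_values f)"

(* The order of vanishing of f - f z at z; meaningful when f is holomorphic and
   non-constant near z, in which case zorder is at least 1. *)
definition local_degree :: "(complex \<Rightarrow> complex) \<Rightarrow> complex \<Rightarrow> nat" where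
  "local_degree f z = nat (zorder (\<lambda>w. f w - f z) z)"

definition subhyperbolic :: "(complex \<Rightarrow> complex) \<Rightarrow> bool" where
  "subhyperbolic f \<longleftrightarrow> transcendental_entire f \<and>
     compact (postsingular_set f \<inter> fatou_set f) \<and>
     finite (postsingular_set f \<inter> julia_set f)"

definition hyperbolic :: "(complex \<Rightarrow> complex) \<Rightarrow> bool" where
  "hyperbolic f \<longleftrightarrow> transcendental_entire f \<and>
     compact (postsingular_set f) \<and> postsingular_set f \<subseteq> fatou_set f"

definition strongly_subhyperbolic :: "(complex \<Rightarrow> complex) \<Rightarrow> bool" where
  "strongly_subhyperbolic f \<longleftrightarrow> subhyperbolic f \<and>
     julia_set f \<inter> asymptotic_values f = {} \<and>
     (\<exists>R::real. \<forall>z\<in>julia_set f. real (local_degree f z) < R)"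

end

theory Submission
  imports Defs "HOL-Real_Asymp.Real_Asymp"
begin

text \<open>
  Rescaling makes \<open>f\<close> and \<open>g\<close> comparable: for small \<open>k\<close> the maps \<open>F = c k f\<close> and \<open>G = k g\<close> are
  conjugate by \<open>z \<mapsto> c z\<close>. So it suffices to construct, for a strongly subhyperbolic \<open>f\<close> and a small \<open>k\<close>,
  a semiconjugacy \<open>Phi\<close> from \<open>F = k f\<close> on the set \<open>KK\<close> of points whose orbits stay outside a large disc to
  \<open>f\<close> on its Julia set, and to invert it when \<open>f\<close> is replaced by \<open>g\<close>. In the logarithmic coordinate,
  passing from a point to a point with \<open>k\<close> times its image is a translation; pulling it back by \<open>f ^^ n\<close> gives maps
  \<open>phi n\<close> with \<open>f \<circ> phi (n + 1) = phi n \<circ> F\<close>. They converge since \<open>f\<close> expands an orbifold metric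
  with cone singularities at the postsingular points in the Julia set; the uniform expansion follows from
  Landau and Montel estimates, because a lack of it would make iterates of \<open>f\<close> accumulate at the identity on a
  domain containing repelling fixed points. The image is closed and backward invariant, hence the whole Julia
  set. Two points with the same image coincide as soon as the paths
  \<open>x, phi 1 x, phi 2 x, \<dots>\<close> along their orbits can be followed in a covering half-plane of the
  complement of the postsingular set: near infinity this is the logarithm, which settles the escaping points,
  and for \<open>g\<close> the connected Fatou set provides a full continuum containing the postsingular set whose
  exterior is covered by a half-plane, which settles all points.
\<close>

section \<open>Local degree and lifts\<close>

text \<open>All estimates have to be uniform in the number of iterates, and fixed points achieve
  this: if a map misses a fixed point of \<open>f\<close>, then so does each of its lifts through
  \<open>f ^^ n\<close>. Two such points therefore subject all lifts to one and the same Landau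
  bound. A map with bounded singular set has fixed points arbitrarily far out, which serve for lifts
  over bounded discs; two fixed points of moderate size serve for lifts over a neighbourhood of
  infinity.

  Cone points enter because singular orbits may end in the Julia set. Inverse branches ramify there,
  and the weights \<open>nu\<close> are made so that the \<open>nu\<close>-fold power map onto a
  disc about such a point lifts through every iterate. The metric \<open>rho\<close> is not the
  hyperbolic orbifold metric but an explicit density that obeys the Schwarz inequality up to a
  constant \<open>C\<close>. The constant does no harm: a single step far out, or a long stretch of
  an orbit in a bounded set, contracts by any prescribed factor, and
  \<open>1 / (2 * C\<^sup>2)\<close> already pays for the loss before and after it.\<close>

lemma local_degree_eqI:
  assumes "open S" "xi \<in> S" "g holomorphic_on S" "g xi \<noteq> 0"
    and "\<And>w. w \<in> S ==> h w = h xi + (w - xi) ^ n * g w"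
  shows "local_degree h xi = n"
proof -
  have "zorder (\<lambda>w. h w - h xi) xi = int n"
    by (rule zorder_eqI[OF assms(1-4)]) (use assms(5) in \<open>auto simp: mult.commute\<close>)
  then show ?thesis by (simp add: local_degree_def)
qed

lemma local_degree_factor:
  assumes "h holomorphic_on S" "open S" "connected S" "xi \<in> S" "\<not> h constant_on S"
  obtains r g where "0 < r" "ball xi r \<subseteq> S" "g holomorphic_on ball xi r"
    "\<And>w. w \<in> ball xi r ==> g w \<noteq> 0" "0 < local_degree h xi"
    "\<And>w. w \<in> ball xi r ==> h w = h xi + (w - xi) ^ local_degree h xi * g w"
proof -
  have 1: "(\<lambda>w. h w - h xi) holomorphic_on S"
    by (intro holomorphic_intros assms)
  have 2: "\<not> (\<lambda>w. h w - h xi) constant_on S"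
    using assms(5) unfolding constant_on_def by (metis diff_add_cancel)
  obtain g r n where *: "0 < n" "0 < r" "ball xi r \<subseteq> S" "g holomorphic_on ball xi r"
    "\<And>w. w \<in> ball xi r ==> h w - h xi = (w - xi) ^ n * g w"
    "\<And>w. w \<in> ball xi r ==> g w \<noteq> 0"
    by (rule holomorphic_factor_zero_nonconstant[OF 1 assms(2-4) right_minus_eq[THEN iffD2, OF refl] 2]) (rule that; assumption)
  have eq: "h w = h xi + (w - xi) ^ n * g w" if "w \<in> ball xi r" for w
    using *(5)[OF that] by (metis add.commute diff_add_cancel)
  have "xi \<in> ball xi r" using *(2) by simp
  then have n: "local_degree h xi = n"
    using local_degree_eqI[OF open_ball _ *(4) _ eq] *(6) by blast
  show ?thesis
    using that[of r g, unfolded n, OF *(2-4) *(6) *(1) eq] by blast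
qed

text \<open>The nonvanishing factor of \<open>local_degree_factor\<close> has a logarithm on the
  disc, hence an \<open>n\<close>-th root; multiplied by \<open>w - xi\<close> the root becomes a
  coordinate in which the map is a pure power.\<close>

lemma local_degree_power:
  assumes "h holomorphic_on S" "open S" "connected S" "xi \<in> S" "\<not> h constant_on S"
  obtains r u where "0 < r" "ball xi r \<subseteq> S" "u holomorphic_on ball xi r" "u xi = 0"
    "inj_on u (ball xi r)" "0 < local_degree h xi"
    "\<And>w. w \<in> ball xi r ==> h w = h xi + u w ^ local_degree h xi"
proof -
  define n where "n = local_degree h xi"
  obtain g r where *: "0 < r" "ball xi r \<subseteq> S" "g holomorphic_on ball xi r"
    "\<And>w. w \<in> ball xi r ==> g w \<noteq> 0" "0 < n"
    "\<And>w. w \<in> ball xi r ==> h w = h xi + (w - xi) ^ n * g w"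
    by (rule local_degree_factor[OF assms, folded n_def]) (rule that; assumption)
  have "simply_connected (ball xi r)" by (simp add: convex_imp_simply_connected)
  then obtain l where l: "l holomorphic_on ball xi r" "\<And>w. w \<in> ball xi r ==> g w = exp (l w)"
    using simply_connected_eq_holomorphic_log[of "ball xi r"] *(3,4) by auto
  define u where "u = (\<lambda>w. (w - xi) * exp (l w / of_nat n))"
  have u1: "u holomorphic_on ball xi r"
    unfolding u_def by (intro holomorphic_intros l) (use * in auto)
  have u2: "u w ^ n = (w - xi) ^ n * g w" if "w \<in> ball xi r" for w
    using that *(5) l(2)[OF that]
    by (simp add: u_def power_mult_distrib flip: exp_of_nat_mult)
  define E where "E = (\<lambda>w. exp (l w / of_nat n))"
  have "E holomorphic_on ball xi r"
    unfolding E_def by (intro holomorphic_intros l) (use *(5) in auto)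
  then have dE: "(E has_field_derivative deriv E xi) (at xi)"
    by (rule holomorphic_derivI) (use *(1) in auto)
  have "((\<lambda>w. (w - xi) * E w) has_field_derivative E xi) (at xi)"
    by (rule derivative_eq_intros dE refl | simp)+
  then have "(u has_field_derivative E xi) (at xi)"
    by (simp add: u_def E_def)
  then have "deriv u xi \<noteq> 0" by (simp add: DERIV_imp_deriv E_def)
  then obtain s where s: "s > 0" "ball xi s \<subseteq> ball xi r" "inj_on u (ball xi s)"
    using has_complex_derivative_locally_injective[OF u1, of xi] * by auto
  show ?thesis
  proof (rule that[of s u])
    show "u holomorphic_on ball xi s" using u1 s(2) by (rule holomorphic_on_subset)
    show "h w = h xi + u w ^ local_degree h xi" if "w \<in> ball xi s" for w
      using *(6)[of w] u2[of w] s(2) that by (auto simp: n_def[symmetric])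
  qed (use s *(1,2,5) in \<open>auto simp: u_def n_def[symmetric]\<close>)
qed

lemma local_degree_compose:
  assumes "H holomorphic_on S" "open S" "connected S" "xi \<in> S" "\<not> H constant_on S"
    and "f holomorphic_on T" "open T" "connected T" "H xi \<in> T" "\<not> f constant_on T"
  shows "local_degree (\<lambda>w. f (H w)) xi = local_degree f (H xi) * local_degree H xi"
proof -
  obtain g r where *: "0 < r" "ball xi r \<subseteq> S" "g holomorphic_on ball xi r"
    "\<And>w. w \<in> ball xi r ==> g w \<noteq> 0" "0 < local_degree H xi"
    "\<And>w. w \<in> ball xi r ==> H w = H xi + (w - xi) ^ local_degree H xi * g w"
    by (rule local_degree_factor[OF assms(1-5)]) (rule that; assumption)
  obtain k s where #: "0 < s" "ball (H xi) s \<subseteq> T" "k holomorphic_on ball (H xi) s"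
    "\<And>w. w \<in> ball (H xi) s ==> k w \<noteq> 0" "0 < local_degree f (H xi)"
    "\<And>w. w \<in> ball (H xi) s ==> f w = f (H xi) + (w - H xi) ^ local_degree f (H xi) * k w"
    by (rule local_degree_factor[OF assms(6-10)]) (rule that; assumption)
  have cH: "continuous_on (ball xi r) H"
    using assms(1) *(2) holomorphic_on_imp_continuous_on holomorphic_on_subset by blast
  define U where "U = ball xi r \<inter> H -` ball (H xi) s"
  have U: "open U" "xi \<in> U"
    unfolding U_def using *(1) #(1) continuous_open_preimage[OF cH] by auto
  have hU: "H holomorphic_on U" using assms(1) *(2) unfolding U_def
    by (meson holomorphic_on_subset inf_le1 order_trans)
  show ?thesis
  proof (rule local_degree_eqI[OF U, where g = "\<lambda>w. g w ^ local_degree f (H xi) * k (H w)"])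
    have "(k \<circ> H) holomorphic_on U"
      by (rule holomorphic_on_compose_gen[OF hU #(3)]) (auto simp: U_def)
    then show "(\<lambda>w. g w ^ local_degree f (H xi) * k (H w)) holomorphic_on U"
      by (intro holomorphic_intros) (auto simp: o_def U_def intro: holomorphic_on_subset[OF *(3)])
    show "g xi ^ local_degree f (H xi) * k (H xi) \<noteq> 0"
      using *(1,4) #(1,4) by auto
    fix w assume w: "w \<in> U"
    have "f (H w) = f (H xi) + (H w - H xi) ^ local_degree f (H xi) * k (H w)"
      using w #(6)[of "H w"] by (auto simp: U_def)
    also have "H w - H xi = (w - xi) ^ local_degree H xi * g w"
      using w *(6)[of w] by (auto simp: U_def)
    finally show "f (H w) = f (H xi) + (w - xi) ^ (local_degree f (H xi) * local_degree H xi) *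
        (g w ^ local_degree f (H xi) * k (H w))"
      by (simp add: power_mult_distrib power_mult[symmetric] mult.commute mult.left_commute)
  qed
qed

lemma local_degree_eq_1_iff:
  assumes "h holomorphic_on S" "open S" "connected S" "xi \<in> S" "\<not> h constant_on S"
  shows "local_degree h xi = 1 \<longleftrightarrow> deriv h xi \<noteq> 0"
proof -
  obtain g r where *: "0 < r" "ball xi r \<subseteq> S" "g holomorphic_on ball xi r"
    "\<And>w. w \<in> ball xi r ==> g w \<noteq> 0" "0 < local_degree h xi"
    "\<And>w. w \<in> ball xi r ==> h w = h xi + (w - xi) ^ local_degree h xi * g w"
    by (rule local_degree_factor[OF assms]) (rule that; assumption)
  define n where "n = local_degree h xi"
  have dg: "(g has_field_derivative deriv g xi) (at xi)"
    using holomorphic_derivI[OF *(3)] *(1) by auto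
  have "((\<lambda>w. h xi + (w - xi) ^ n * g w) has_field_derivative
      (of_nat n * (xi - xi) ^ (n - 1) * g xi + deriv g xi * (xi - xi) ^ n)) (at xi)"
    by (auto intro!: derivative_eq_intros dg)
  then have "(h has_field_derivative
      (of_nat n * (xi - xi) ^ (n - 1) * g xi + deriv g xi * (xi - xi) ^ n)) (at xi)"
    by (rule has_field_derivative_transform_within_open[of _ _ _ "ball xi r"]) (use *(1) *(6)[symmetric] in \<open>simp_all add: n_def\<close>)
  then have "deriv h xi = of_nat n * (xi - xi) ^ (n - 1) * g xi + deriv g xi * (xi - xi) ^ n"
    by (rule DERIV_imp_deriv)
  moreover have "n > 0" "g xi \<noteq> 0" using *(1,4,5) by (auto simp: n_def)
  ultimately show ?thesis
    unfolding n_def[symmetric] by (cases "n = 1") (auto simp: power_0_left)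
qed

lemma holomorphic_glue:
  assumes U: "\<And>i. i \<in> I ==> open (U i)" and H: "\<And>i. i \<in> I ==> H i holomorphic_on U i"
    and eq: "\<And>i j x. i \<in> I ==> j \<in> I ==> x \<in> U i ==> x \<in> U j ==> H i x = H j x"
  obtains G where "G holomorphic_on (\<Union>i\<in>I. U i)" "\<And>i x. i \<in> I ==> x \<in> U i ==> G x = H i x"
proof -
  define G where "G x = H (SOME i. i \<in> I \<and> x \<in> U i) x" for x
  have G: "G x = H i x" if "i \<in> I" "x \<in> U i" for i x
  proof -
    have "(SOME i. i \<in> I \<and> x \<in> U i) \<in> I \<and> x \<in> U (SOME i. i \<in> I \<and> x \<in> U i)"
      by (rule someI[of _ i]) (use that in auto)
    then show ?thesis unfolding G_def using eq that by blast
  qed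
  have "G holomorphic_on U i" if "i \<in> I" for i
    using holomorphic_transform[OF H[OF that]] G that by metis
  then have "G holomorphic_on (\<Union>i\<in>I. U i)"
    by (intro holomorphic_on_UN_open) (auto intro: U)
  with G show ?thesis using that by blast
qed

section \<open>Lifting maps through an entire function\<close>

locale entire_map =
  fixes f :: "complex => complex"
  assumes entire: "f holomorphic_on UNIV" and nonconst: "\<not> f constant_on UNIV"
begin

lemma cont: "continuous_on A f"
  using entire holomorphic_on_imp_continuous_on holomorphic_on_subset by blast

lemma hol [holomorphic_intros]: "g holomorphic_on S ==> (\<lambda>x. f (g x)) holomorphic_on S"
  using holomorphic_on_compose_gen[OF _ entire, of g S] by (auto simp: o_def)

lemma has_deriv: "(f has_field_derivative deriv f z) (at z)"
  using holomorphic_derivI[OF entire] by auto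

text \<open>In power coordinates \<open>f = f z1 + v ^ d\<close> and
  \<open>h = h xi + u ^ (d * m)\<close>, so lifts are given by \<open>v = \<omega> * u ^ m\<close>
  with \<open>\<omega> ^ d = 1\<close>. The radii are fixed before \<open>a\<close> and
  \<open>b\<close>, because the point at which the lift is prescribed will only be known to lie
  close to \<open>xi\<close> and \<open>z1\<close>.\<close>

lemma local_lift:
  assumes "h holomorphic_on S" "open S" "connected S" "xi \<in> S" "\<not> h constant_on S"
    and "f z1 = h xi" and dvd: "local_degree f z1 dvd local_degree h xi"
  obtains \<delta> \<epsilon> where "0 < \<delta>" "0 < \<epsilon>" "ball xi \<delta> \<subseteq> S"
    "\<And>a b. a \<in> ball xi \<delta> ==> b \<in> ball z1 \<epsilon> ==> f b = h a ==>
       \<exists>H. H holomorphic_on ball xi \<delta> \<and> (\<forall>zeta\<in>ball xi \<delta>. f (H zeta) = h zeta) \<and> H a = b"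
proof -
  obtain u r where u: "0 < r" "ball xi r \<subseteq> S" "u holomorphic_on ball xi r" "u xi = 0"
    "0 < local_degree h xi" "\<And>w. w \<in> ball xi r ==> h w = h xi + u w ^ local_degree h xi"
    by (rule local_degree_power[OF assms(1-5)]) (rule that; assumption)
  define d where "d = local_degree f z1"
  obtain v \<epsilon> where v: "0 < \<epsilon>" "ball z1 \<epsilon> \<subseteq> UNIV" "v holomorphic_on ball z1 \<epsilon>" "v z1 = 0" "inj_on v (ball z1 \<epsilon>)"
    "0 < d" "\<And>w. w \<in> ball z1 \<epsilon> ==> f w = f z1 + v w ^ d"
    by (rule local_degree_power[OF entire open_UNIV connected_UNIV UNIV_I nonconst, of z1, folded d_def]) (rule that; assumption)
  obtain m where m: "local_degree h xi = d * m" using dvd d_def by auto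
  have "m > 0" using m u(5) by (cases m) auto
  obtain vi where vi: "vi holomorphic_on v ` ball z1 \<epsilon>" "\<And>z. z \<in> ball z1 \<epsilon> ==> vi (v z) = z"
    by (rule holomorphic_has_inverse[OF v(3) open_ball v(5)]) (rule that; assumption)
  have "open (v ` ball z1 \<epsilon>)" by (rule open_mapping_thm3[OF v(3) _ v(5)]) auto
  moreover have "0 \<in> v ` ball z1 \<epsilon>" using v(1,4) by (metis centre_in_ball image_eqI)
  ultimately obtain \<eta> where \<eta>: "\<eta> > 0" "ball 0 \<eta> \<subseteq> v ` ball z1 \<epsilon>"
    by (meson openE)
  have "continuous_on (ball xi r) (\<lambda>w. u w ^ m)"
    by (intro continuous_intros holomorphic_on_imp_continuous_on u)
  then have "open (ball xi r \<inter> (\<lambda>w. u w ^ m) -` ball 0 \<eta>)"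
    by (intro continuous_open_preimage) auto
  moreover have "xi \<in> ball xi r \<inter> (\<lambda>w. u w ^ m) -` ball 0 \<eta>"
    using u(1,4) \<eta>(1) \<open>m > 0\<close> by (simp add: power_0_left)
  ultimately obtain \<delta> where \<delta>: "\<delta> > 0" "ball xi \<delta> \<subseteq> ball xi r \<inter> (\<lambda>w. u w ^ m) -` ball 0 \<eta>"
    by (meson openE)
  show ?thesis
  proof (rule that[OF \<delta>(1) v(1)])
    show "ball xi \<delta> \<subseteq> S" using \<delta> u by blast
    fix a b assume a: "a \<in> ball xi \<delta>" and b: "b \<in> ball z1 \<epsilon>" and fb: "f b = h a"
    have "f z1 + v b ^ d = h xi + u a ^ (d * m)"
      using u(6)[of a] v(7)[OF b] fb a \<delta>(2) m by auto
    then have eq: "v b ^ d = (u a ^ m) ^ d" using assms(6) by (simp add: power_mult[symmetric] mult.commute)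
    \<comment> \<open>Both sides have the same \<open>d\<close>-th power and hence differ by a root
      of unity; if \<open>u a = 0\<close>, both vanish and 1 serves.\<close>
    obtain \<omega> where \<omega>: "\<omega> ^ d = 1" "v b = \<omega> * u a ^ m"
    proof (cases "u a = 0")
      case True then show ?thesis using that[of 1] eq v(6) \<open>m > 0\<close> by (auto simp: power_0_left)
    next
      case False then show ?thesis using that[of "v b / u a ^ m"] eq by (auto simp: power_divide)
    qed
    have n1: "norm \<omega> = 1" using \<omega>(1) v(6) by (metis norm_one norm_power norm_ge_zero power_eq_1_iff gr_implies_not0)
    have in1: "\<omega> * u zeta ^ m \<in> ball 0 \<eta>" if "zeta \<in> ball xi \<delta>" for zeta
      using that \<delta>(2) n1 by (auto simp: norm_mult)
    have in2: "vi y \<in> ball z1 \<epsilon> \<and> v (vi y) = y" if "y \<in> ball 0 \<eta>" for y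
      using that \<eta>(2) vi(2) by force
    define H where "H zeta = vi (\<omega> * u zeta ^ m)" for zeta
    have "(vi \<circ> (\<lambda>zeta. \<omega> * u zeta ^ m)) holomorphic_on ball xi \<delta>"
    proof (rule holomorphic_on_compose_gen[OF _ vi(1)])
      show "(\<lambda>zeta. \<omega> * u zeta ^ m) holomorphic_on ball xi \<delta>"
        using \<delta>(2) by (intro holomorphic_intros holomorphic_on_subset[OF u(3)]) auto
    qed (use in1 \<eta>(2) in auto)
    then have 1: "H holomorphic_on ball xi \<delta>" by (simp add: H_def[abs_def] o_def)
    have 2: "f (H zeta) = h zeta" if "zeta \<in> ball xi \<delta>" for zeta
    proof -
      have "f (H zeta) = f z1 + (\<omega> * u zeta ^ m) ^ d"
        using v(7)[of "H zeta"] in2[OF in1[OF that]] by (auto simp: H_def)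
      also have "\<dots> = h xi + u zeta ^ (d * m)"
        using \<omega>(1) assms(6) by (simp add: power_mult_distrib power_mult[symmetric] mult.commute)
      also have "\<dots> = h zeta" using u(6)[of zeta] that \<delta>(2) m by auto
      finally show ?thesis .
    qed
    have 3: "H a = b" unfolding H_def \<omega>(2)[symmetric] using vi(2)[OF b] .
    show "\<exists>H. H holomorphic_on ball xi \<delta> \<and> (\<forall>zeta\<in>ball xi \<delta>. f (H zeta) = h zeta) \<and> H a = b"
      using 1 2 3 by blast
  qed
qed

lemma locally_inj:
  assumes "deriv f z \<noteq> 0"
  obtains r where "r > 0" "inj_on f (ball z r)"
  using has_complex_derivative_locally_injective[OF entire _ _ assms] by auto

text \<open>The domain is a connected subset of any metric space, so that the lemma covers lifts of
  arcs. Without holomorphy the lift must avoid critical points everywhere, in contrast to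
  \<open>hol_lift_unique\<close>.\<close>

lemma lift_unique:
  fixes c1 c2 :: "'a::metric_space => complex"
  assumes "connected A" "continuous_on A c1" "continuous_on A c2"
    and eq: "\<And>x. x \<in> A ==> f (c1 x) = f (c2 x)" and d: "\<And>x. x \<in> A ==> deriv f (c1 x) \<noteq> 0"
    and a: "a \<in> A" "c1 a = c2 a" and "x \<in> A"
  shows "c1 x = c2 x"
proof -
  define E where "E = {x \<in> A. c1 x = c2 x}"
  have "E = {x \<in> A. c1 x - c2 x = 0}" by (auto simp: E_def)
  then have "closedin (top_of_set A) E"
    using continuous_closedin_preimage_constant[of A "\<lambda>x. c1 x - c2 x" 0]
    by (auto intro!: continuous_intros assms)
  moreover have "openin (top_of_set A) E"
    unfolding openin_contains_ball
  proof (intro conjI ballI)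
    show "E \<subseteq> A" by (auto simp: E_def)
    fix y assume y: "y \<in> E"
    then have yA: "y \<in> A" and y12: "c1 y = c2 y" by (auto simp: E_def)
    obtain r where r: "r > 0" "inj_on f (ball (c1 y) r)" using locally_inj[OF d[OF yA]] .
    obtain e1 where e1: "e1 > 0" "\<And>x. x \<in> A ==> dist x y < e1 ==> dist (c1 x) (c1 y) < r"
      using assms(2) yA r(1) unfolding continuous_on_iff by metis
    obtain e2 where e2: "e2 > 0" "\<And>x. x \<in> A ==> dist x y < e2 ==> dist (c2 x) (c2 y) < r"
      using assms(3) yA r(1) unfolding continuous_on_iff by metis
    show "\<exists>e>0. ball y e \<inter> A \<subseteq> E"
    proof (intro exI[of _ "min e1 e2"] conjI subsetI)
      show "min e1 e2 > 0" using e1 e2 by auto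
      fix x assume x: "x \<in> ball y (min e1 e2) \<inter> A"
      then have "c1 x \<in> ball (c1 y) r" "c2 x \<in> ball (c1 y) r"
        using e1(2)[of x] e2(2)[of x] y12 by (auto simp: dist_commute)
      then have "c1 x = c2 x" using r(2) eq[of x] x unfolding inj_on_def by blast
      then show "x \<in> E" using x by (auto simp: E_def)
    qed
  qed
  ultimately have "E = {} \<or> E = A" using assms(1) connected_clopen by blast
  then show ?thesis using a \<open>x \<in> A\<close> by (auto simp: E_def)
qed

text \<open>One noncritical point is enough: near it \<open>f\<close> is injective, so the lifts
  agree on an open set, and the identity theorem does the rest. Elsewhere the lifts may pass through
  critical points.\<close>

lemma hol_lift_unique:
  assumes "open D" "connected D" "H1 holomorphic_on D" "H2 holomorphic_on D"
    and eq: "\<And>x. x \<in> D ==> f (H1 x) = f (H2 x)" and a: "a \<in> D" "H1 a = H2 a" "deriv f (H1 a) \<noteq> 0"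
    and "x \<in> D"
  shows "H1 x = H2 x"
proof -
  obtain r where r: "r > 0" "inj_on f (ball (H1 a) r)" using locally_inj[OF a(3)] .
  have c: "continuous_on D H1" "continuous_on D H2"
    using assms holomorphic_on_imp_continuous_on by auto
  define U where "U = (D \<inter> H1 -` ball (H1 a) r) \<inter> (D \<inter> H2 -` ball (H1 a) r)"
  have "open U" unfolding U_def
    by (intro open_Int continuous_open_preimage c assms) auto
  moreover have "a \<in> U" using a r by (auto simp: U_def)
  moreover have "U \<subseteq> D" by (auto simp: U_def)
  moreover have "H1 y = H2 y" if "y \<in> U" for y
    using that r(2) eq[of y] unfolding inj_on_def U_def by auto
  ultimately show ?thesis
    using analytic_continuation_open[of U D H1 H2 x] assms by auto
qed

end

lemma deriv_isolated_zeros: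
  assumes "h holomorphic_on S" "open S" "connected S" "xi \<in> S" "\<not> h constant_on S"
  obtains \<rho> where "0 < \<rho>" "ball xi \<rho> \<subseteq> S" "\<And>w. w \<in> ball xi \<rho> ==> w \<noteq> xi ==> deriv h w \<noteq> 0"
proof -
  have dh: "deriv h holomorphic_on S" using assms holomorphic_deriv by blast
  have "\<exists>\<beta>\<in>S. deriv h \<beta> \<noteq> 0"
  proof (rule ccontr)
    assume "\<not> ?thesis"
    then have "\<And>x. x \<in> S ==> (h has_field_derivative 0) (at x)"
      using holomorphic_derivI[OF assms(1,2)] by metis
    then have "\<exists>c. \<forall>x\<in>S. h x = c"
      using has_field_derivative_0_imp_constant_on[OF _ assms(3,2)] unfolding constant_on_def by blast
    then show False using assms(5) by (auto simp: constant_on_def)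
  qed
  then obtain \<beta> where \<beta>: "\<beta> \<in> S" "deriv h \<beta> \<noteq> 0" by blast
  show ?thesis
  proof (cases "deriv h xi = 0")
    case True
    show ?thesis
    proof (rule isolated_zeros[OF dh assms(2-4) True \<beta>])
      fix r assume "0 < r" "ball xi r \<subseteq> S" "\<And>z. z \<in> ball xi r - {xi} ==> deriv h z \<noteq> 0"
      then show ?thesis using that[of r] by auto
    qed
  next
    case False
    have "open (S \<inter> deriv h -` (- {0}))"
      by (intro continuous_open_preimage holomorphic_on_imp_continuous_on dh assms) auto
    moreover have "xi \<in> S \<inter> deriv h -` (- {0})" using False assms by auto
    ultimately obtain e where "e > 0" "ball xi e \<subseteq> S \<inter> deriv h -` (- {0})" by (meson openE)
    then have "deriv h w \<noteq> 0" if "w \<in> ball xi e" for w using that by blast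
    moreover have "ball xi e \<subseteq> S" using \<open>ball xi e \<subseteq> S \<inter> _\<close> by blast
    ultimately show ?thesis using that[of e] \<open>e > 0\<close> by blast
  qed
qed

context entire_map
begin

lemma deriv_lift:
  assumes "open D" "H holomorphic_on D" "\<And>x. x \<in> D ==> f (H x) = h x" "a \<in> D"
  shows "deriv h a = deriv f (H a) * deriv H a"
proof -
  have "(H has_field_derivative deriv H a) (at a)"
    using holomorphic_derivI[OF assms(2,1,4)] .
  then have "((\<lambda>x. f (H x)) has_field_derivative deriv f (H a) * deriv H a) (at a)"
    by (rule DERIV_chain2[OF has_deriv])
  then have "(h has_field_derivative deriv f (H a) * deriv H a) (at a)"
    by (rule has_field_derivative_transform_within_open[OF _ assms(1,4)]) (use assms(3) in auto)
  then show ?thesis by (rule DERIV_imp_deriv)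
qed

text \<open>Along the radius to \<open>xi\<close> the lift either tends to infinity, which would
  make \<open>h xi\<close> an asymptotic value, or it accumulates at some \<open>z1\<close> with
  \<open>f z1 = h xi\<close>. In the second case a local lift near \<open>xi\<close> and
  \<open>z1\<close>, started at a point of the radius, continues \<open>H\<close>.\<close>

lemma lift_boundary:
  assumes h: "h holomorphic_on ball 0 1" "\<not> h constant_on ball 0 1"
    and r: "0 < r" "r < 1" and H: "H holomorphic_on ball 0 r" "\<And>zeta. zeta \<in> ball 0 r ==> f (H zeta) = h zeta"
    and xi: "norm xi = r" and noas: "h xi \<notin> asymptotic_values f"
    and dvd: "\<And>z. f z = h xi ==> local_degree f z dvd local_degree h xi"
  obtains \<delta> H1 where "\<delta> > 0" "H1 holomorphic_on ball xi \<delta>" "ball xi \<delta> \<subseteq> ball 0 1"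
    "\<And>zeta. zeta \<in> ball xi \<delta> ==> f (H1 zeta) = h zeta"
    "\<And>zeta. zeta \<in> ball xi \<delta> ==> zeta \<in> ball 0 r ==> H1 zeta = H zeta"
proof -
  have xi1: "xi \<in> ball 0 1" using xi r by auto
  have ch: "continuous_on (ball 0 1) h" using h(1) by (rule holomorphic_on_imp_continuous_on)
  have cH: "continuous_on (ball 0 r) H" using H(1) by (rule holomorphic_on_imp_continuous_on)
  have inr: "of_real t * xi \<in> ball 0 r" if "0 \<le> t" "t < 1" for t :: real
    using that xi r by (auto simp: norm_mult)
  have hcont: "(\<lambda>n. h (of_real (t n) * xi)) \<longlonglongrightarrow> h xi" if "t \<longlonglongrightarrow> 1" for t :: "nat => real"
  proof -
    have "isCont h xi" using ch xi1 by (simp add: continuous_on_eq_continuous_at)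
    moreover have "(\<lambda>n. of_real (t n) * xi) \<longlonglongrightarrow> of_real 1 * xi"
      by (intro tendsto_intros that)
    ultimately show ?thesis using isCont_tendsto_compose by fastforce
  qed
  have "\<not> (\<forall>B. \<exists>e>0. \<forall>t. 1 - e < t \<and> t < 1 --> norm (H (of_real t * xi)) > B)"
  proof
    assume *: "\<forall>B. \<exists>e>0. \<forall>t. 1 - e < t \<and> t < 1 --> norm (H (of_real t * xi)) > B"
    \<comment> \<open>Reparametrises the end of the radius by \<open>{0..}\<close>, the parameter
      domain of the curves in \<open>asymptotic_values\<close>.\<close>
    define \<tau> :: "real => real" where "\<tau> s = 1 - 1 / (s + 2)" for s
    define \<gamma> where "\<gamma> s = H (of_real (\<tau> s) * xi)" for s
    have \<tau>: "0 \<le> \<tau> s" "\<tau> s < 1" if "s \<ge> 0" for s using that by (auto simp: \<tau>_def field_simps)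
    have \<tau>l: "(\<tau> \<longlongrightarrow> 1) at_top"
      unfolding \<tau>_def[abs_def] by real_asymp
    have "continuous_on {0..} \<tau>" unfolding \<tau>_def by (intro continuous_intros) auto
    then have c1: "continuous_on {0..} (\<lambda>s. of_real (\<tau> s) * xi)" by (intro continuous_intros)
    have c2: "(\<lambda>s. of_real (\<tau> s) * xi) ` {0..} \<subseteq> ball 0 r"
      using \<tau> inr by (intro image_subsetI) (meson atLeast_iff)
    have "continuous_on {0..} \<gamma>"
      unfolding \<gamma>_def by (rule continuous_on_compose2[OF cH c1 c2])
    moreover have "filterlim \<gamma> at_infinity at_top"
      unfolding filterlim_at_infinity[OF order_refl]
    proof (intro allI impI)
      fix B :: real
      obtain e where e: "e > 0" "\<And>t. 1 - e < t ==> t < 1 ==> norm (H (of_real t * xi)) > B" using * by blast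
      have "\<forall>\<^sub>F s in at_top. \<tau> s > 1 - e" using order_tendstoD(1)[OF \<tau>l, of "1 - e"] e(1) by auto
      moreover have "\<forall>\<^sub>F s in at_top. s \<ge> (0::real)" by (rule eventually_ge_at_top)
      ultimately show "\<forall>\<^sub>F s in at_top. B \<le> norm (\<gamma> s)"
        by eventually_elim (use e(2) \<tau> in \<open>auto simp: \<gamma>_def less_imp_le\<close>)
    qed
    moreover have "((\<lambda>s. f (\<gamma> s)) \<longlongrightarrow> h xi) at_top"
    proof -
      have "isCont h xi" using ch xi1 by (simp add: continuous_on_eq_continuous_at)
      moreover have "((\<lambda>s. of_real (\<tau> s) * xi) \<longlongrightarrow> of_real 1 * xi) at_top" by (intro tendsto_intros \<tau>l)
      ultimately have "((\<lambda>s. h (of_real (\<tau> s) * xi)) \<longlongrightarrow> h xi) at_top"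
        using isCont_tendsto_compose by fastforce
      then show ?thesis
      proof (rule Lim_transform_eventually)
        have "\<forall>\<^sub>F s in at_top. s \<ge> (0::real)" by (rule eventually_ge_at_top)
        then show "\<forall>\<^sub>F s in at_top. h (of_real (\<tau> s) * xi) = f (\<gamma> s)"
          by eventually_elim (use H(2) inr \<tau> in \<open>auto simp: \<gamma>_def\<close>)
      qed
    qed
    ultimately have "h xi \<in> asymptotic_values f" unfolding asymptotic_values_def by blast
    then show False using noas by blast
  qed
  then obtain B where B: "\<And>e. e > 0 ==> \<exists>t. 1 - e < t \<and> t < 1 \<and> norm (H (of_real t * xi)) \<le> B"
    by (metis not_less)
  have "\<exists>t. 1 - 1 / real (n + 2) < t \<and> t < 1 \<and> norm (H (of_real t * xi)) \<le> B" for n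
    by (rule B) auto
  then obtain t where t: "\<And>n. 1 - 1 / real (n + 2) < t n" "\<And>n. t n < 1" "\<And>n. norm (H (of_real (t n) * xi)) \<le> B"
    by metis
  have t0: "0 \<le> t n" for n
  proof -
    have "1 / real (n + 2) \<le> 1" by simp
    then show ?thesis using t(1)[of n] by linarith
  qed
  have tl: "t \<longlonglongrightarrow> 1"
  proof (rule tendsto_sandwich[of "\<lambda>n. 1 - 1 / real (n + 2)" t _ "\<lambda>_. 1"])
    show "(\<lambda>n. 1 - 1 / real (n + 2)) \<longlonglongrightarrow> 1"
      by real_asymp
  qed (use t in \<open>auto intro!: always_eventually less_imp_le\<close>)
  have "\<forall>n. H (of_real (t n) * xi) \<in> cball 0 B" using t(3) by auto
  then obtain z1 k where k: "strict_mono (k::nat=>nat)" "((\<lambda>n. H (of_real (t n) * xi)) \<circ> k) \<longlonglongrightarrow> z1"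
    using compact_cball[of "0::complex" B] unfolding compact_def by meson
  have tk: "(t \<circ> k) \<longlonglongrightarrow> 1" using tl k(1) by (rule LIMSEQ_subseq_LIMSEQ)
  have "(\<lambda>n. f (H (of_real (t (k n)) * xi))) \<longlonglongrightarrow> f z1"
    using isCont_tendsto_compose[OF _ k(2)] cont[of UNIV] continuous_on_eq_continuous_at[OF open_UNIV] by (auto simp: o_def)
  moreover have "f (H (of_real (t (k n)) * xi)) = h (of_real (t (k n)) * xi)" for n
    using H(2) inr t0 t(2) by auto
  ultimately have fz1: "f z1 = h xi"
    using hcont[OF tk] LIMSEQ_unique by (auto simp: o_def)
  obtain \<delta> \<epsilon> where L: "0 < \<delta>" "0 < \<epsilon>" "ball xi \<delta> \<subseteq> ball 0 1"
    "\<And>a b. a \<in> ball xi \<delta> ==> b \<in> ball z1 \<epsilon> ==> f b = h a ==>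
       \<exists>H. H holomorphic_on ball xi \<delta> \<and> (\<forall>zeta\<in>ball xi \<delta>. f (H zeta) = h zeta) \<and> H a = b"
    by (rule local_lift[OF h(1) open_ball connected_ball xi1 h(2) fz1 dvd[OF fz1]]) (rule that; assumption)
  obtain \<rho> where \<rho>: "0 < \<rho>" "ball xi \<rho> \<subseteq> ball 0 1" "\<And>w. w \<in> ball xi \<rho> ==> w \<noteq> xi ==> deriv h w \<noteq> 0"
    by (rule deriv_isolated_zeros[OF h(1) open_ball connected_ball xi1 h(2)]) (rule that; assumption)
  have "(\<lambda>n. of_real ((t \<circ> k) n) * xi) \<longlonglongrightarrow> of_real 1 * xi" by (intro tendsto_intros tk)
  then have "\<forall>\<^sub>F n in sequentially. of_real ((t \<circ> k) n) * xi \<in> ball xi (min \<delta> \<rho>)"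
    using L(1) \<rho>(1) tendstoD[of _ xi sequentially "min \<delta> \<rho>"] by (auto simp: dist_commute)
  moreover have "\<forall>\<^sub>F n in sequentially. ((\<lambda>n. H (of_real (t n) * xi)) \<circ> k) n \<in> ball z1 \<epsilon>"
    using tendstoD[OF k(2) L(2)] by (auto simp: dist_commute)
  ultimately have "\<forall>\<^sub>F n in sequentially. of_real ((t \<circ> k) n) * xi \<in> ball xi (min \<delta> \<rho>) \<and> ((\<lambda>n. H (of_real (t n) * xi)) \<circ> k) n \<in> ball z1 \<epsilon>"
    by (rule eventually_conj)
  then obtain n where n: "of_real (t (k n)) * xi \<in> ball xi (min \<delta> \<rho>)" "H (of_real (t (k n)) * xi) \<in> ball z1 \<epsilon>"
    unfolding o_def using eventually_happens'[OF sequentially_bot] by blast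
  define a where "a = of_real (t (k n)) * xi"
  have a: "a \<in> ball 0 r" "a \<in> ball xi \<delta>" "a \<in> ball xi \<rho>" "a \<noteq> xi" "H a \<in> ball z1 \<epsilon>"
    using inr[OF t0 t(2)] n xi r t(2)[of "k n"] by (auto simp: a_def)
  obtain H1 where H1: "H1 holomorphic_on ball xi \<delta>" "\<And>zeta. zeta \<in> ball xi \<delta> ==> f (H1 zeta) = h zeta" "H1 a = H a"
    using L(4)[OF a(2,5) H(2)[OF a(1)]] by blast
  \<comment> \<open>Zeros of \<open>deriv h\<close> are isolated and \<open>a\<close> differs from
    \<open>xi\<close>, so the chain rule makes \<open>H a\<close> a noncritical point, as uniqueness
    of lifts requires.\<close>
  have "deriv h a = deriv f (H a) * deriv H a"
    by (rule deriv_lift[OF open_ball H a(1)])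
  then have df: "deriv f (H1 a) \<noteq> 0" using \<rho>(3)[OF a(3,4)] H1(3) by auto
  have "H1 zeta = H zeta" if "zeta \<in> ball xi \<delta>" "zeta \<in> ball 0 r" for zeta
  proof (rule hol_lift_unique[of "ball xi \<delta> \<inter> ball 0 r" H1 H a])
    show "connected (ball xi \<delta> \<inter> ball 0 r)" by (intro convex_connected convex_Int convex_ball)
    show "H1 holomorphic_on ball xi \<delta> \<inter> ball 0 r" "H holomorphic_on ball xi \<delta> \<inter> ball 0 r"
      using H1(1) H(1) holomorphic_on_subset by blast+
  qed (use a H1 H(2) df that in auto)
  then show ?thesis using that[OF L(1) H1(1) L(3) H1(2)] by blast
qed

end

section \<open>Lifting through maps with controlled ramification\<close>

context entire_map
begin

text \<open>The supremum \<open>s\<close> of the radii of discs that carry a lift is attained by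
  gluing. If \<open>s < 1\<close>, the continuations across all points of the circle glue to a lift
  near the closed disc, hence on a larger disc by compactness.\<close>

lemma ball_lift:
  assumes h: "h holomorphic_on ball 0 1" "\<not> h constant_on ball 0 1"
    and noas: "\<And>zeta. zeta \<in> ball 0 1 ==> h zeta \<notin> asymptotic_values f"
    and dvd: "\<And>zeta z. zeta \<in> ball 0 1 ==> f z = h zeta ==> local_degree f z dvd local_degree h zeta"
    and z0: "f z0 = h 0"
  obtains H where "H holomorphic_on ball 0 1" "\<And>zeta. zeta \<in> ball 0 1 ==> f (H zeta) = h zeta" "H 0 = z0"
proof -
  have 00: "(0::complex) \<in> ball 0 1" by simp
  obtain \<delta>0 \<epsilon> where L: "0 < \<delta>0" "0 < \<epsilon>" "ball (0::complex) \<delta>0 \<subseteq> ball 0 1"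
    "\<And>a b. a \<in> ball 0 \<delta>0 ==> b \<in> ball z0 \<epsilon> ==> f b = h a ==>
       \<exists>H. H holomorphic_on ball 0 \<delta>0 \<and> (\<forall>zeta\<in>ball 0 \<delta>0. f (H zeta) = h zeta) \<and> H a = b"
    by (rule local_lift[OF h(1) open_ball connected_ball 00 h(2) z0 dvd[OF 00 z0]]) (rule that; assumption)
  obtain H0 where H0: "H0 holomorphic_on ball 0 \<delta>0" "\<And>zeta. zeta \<in> ball 0 \<delta>0 ==> f (H0 zeta) = h zeta" "H0 0 = z0"
    using L(4)[of 0 z0] L(1,2) z0 by auto
  have \<delta>01: "\<delta>0 \<le> 1" using L(1,3) by (simp add: ball_subset_ball_iff)
  define ext where "ext r H \<longleftrightarrow> H holomorphic_on ball 0 r \<and> (\<forall>zeta\<in>ball 0 r. f (H zeta) = h zeta) \<and>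
      (\<forall>zeta\<in>ball 0 \<delta>0. H zeta = H0 zeta)" for r H
  define R where "R = {r. \<delta>0 \<le> r \<and> r \<le> 1 \<and> (\<exists>H. ext r H)}"
  have R0: "\<delta>0 \<in> R" using H0 \<delta>01 by (auto simp: R_def ext_def)
  have bdd: "bdd_above R" by (rule bdd_aboveI[of _ 1]) (auto simp: R_def)
  define s where "s = Sup R"
  have s: "\<delta>0 \<le> s" "s \<le> 1"
    unfolding s_def
  proof -
    show "\<delta>0 \<le> Sup R" by (rule cSup_upper[OF R0 bdd])
    show "Sup R \<le> 1" by (rule cSup_least) (use R0 in \<open>auto simp: R_def\<close>)
  qed
  have "\<forall>r\<in>R. \<exists>H. ext r H" by (auto simp: R_def)
  then obtain HR where HR: "\<And>r. r \<in> R ==> ext r (HR r)" by metis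
  have agree: "HR i x = HR j x" if ij: "i \<in> R" "j \<in> R" "x \<in> ball 0 i" "x \<in> ball 0 j" for i j x
  proof (rule analytic_continuation_open[of "ball 0 \<delta>0" "ball 0 (min i j)" "HR i" "HR j"])
    show "ball (0::complex) \<delta>0 \<subseteq> ball 0 (min i j)" using ij by (auto simp: R_def)
    show "HR i holomorphic_on ball 0 (min i j)" "HR j holomorphic_on ball 0 (min i j)"
      using HR[OF ij(1)] HR[OF ij(2)] by (auto simp: ext_def elim!: holomorphic_on_subset)
    show "HR i z = HR j z" if "z \<in> ball 0 \<delta>0" for z
      using HR[OF ij(1)] HR[OF ij(2)] that by (simp add: ext_def)
    show "ball (0::complex) \<delta>0 \<noteq> {}" using L(1) by simp
  qed (use ij in auto)
  obtain G where G: "G holomorphic_on (\<Union>i\<in>R. ball 0 i)" "\<And>i x. i \<in> R ==> x \<in> ball 0 i ==> G x = HR i x"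
  proof (rule holomorphic_glue[of R "\<lambda>r. ball (0::complex) r" HR])
    show "HR i holomorphic_on ball 0 i" if "i \<in> R" for i using HR[OF that] by (simp add: ext_def)
  qed (use agree that in blast)+
  have Us: "(\<Union>i\<in>R. ball (0::complex) i) = ball 0 s"
  proof (intro equalityI subsetI)
    fix x :: complex assume "x \<in> (\<Union>i\<in>R. ball 0 i)"
    then show "x \<in> ball 0 s" using cSup_upper[OF _ bdd] unfolding s_def by fastforce
  next
    fix x :: complex assume "x \<in> ball 0 s"
    then have "norm x < Sup R" by (simp add: s_def)
    then obtain i where "i \<in> R" "norm x < i" using less_cSup_iff[OF _ bdd] R0 by blast
    then show "x \<in> (\<Union>i\<in>R. ball 0 i)" by auto
  qed
  have extG: "ext s G"
    unfolding ext_def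
  proof (intro conjI ballI)
    show "G holomorphic_on ball 0 s" using G(1) Us by simp
    fix zeta :: complex
    show "f (G zeta) = h zeta" if "zeta \<in> ball 0 s"
    proof -
      from that have "zeta \<in> (\<Union>i\<in>R. ball 0 i)" by (simp only: Us)
      then obtain i where "i \<in> R" "zeta \<in> ball 0 i" by (rule UN_E)
      then show ?thesis using G(2) HR unfolding ext_def by metis
    qed
    show "G zeta = H0 zeta" if "zeta \<in> ball 0 \<delta>0"
      using G(2)[OF R0 that] HR[OF R0] that unfolding ext_def by metis
  qed
  have "s = 1"
  proof (rule ccontr)
    assume "s \<noteq> 1"
    then have s1: "s < 1" and s0: "0 < s" using s L(1) by auto
    have Gh: "G holomorphic_on ball 0 s" "\<And>zeta. zeta \<in> ball 0 s ==> f (G zeta) = h zeta"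
      using extG by (auto simp: ext_def)
    have bd: "\<exists>\<delta> H1. \<delta> > 0 \<and> H1 holomorphic_on ball xi \<delta> \<and> ball xi \<delta> \<subseteq> ball 0 1 \<and>
      (\<forall>zeta\<in>ball xi \<delta>. f (H1 zeta) = h zeta) \<and> (\<forall>zeta\<in>ball xi \<delta> \<inter> ball 0 s. H1 zeta = G zeta)"
      if xi: "norm xi = s" for xi
    proof -
      have xi1: "xi \<in> ball 0 1" using xi s1 by simp
      show ?thesis
        by (rule lift_boundary[OF h s0 s1 Gh xi noas[OF xi1] dvd[OF xi1]]) blast+
    qed
    define ok where "ok xi \<delta> H1 \<longleftrightarrow> \<delta> > 0 \<and> H1 holomorphic_on ball xi \<delta> \<and> ball xi \<delta> \<subseteq> ball 0 1 \<and>
      (\<forall>zeta\<in>ball xi \<delta>. f (H1 zeta) = h zeta) \<and> (\<forall>zeta\<in>ball xi \<delta> \<inter> ball 0 s. H1 zeta = G zeta)" for xi \<delta> H1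
    have "\<forall>xi. \<exists>\<delta> H1. norm xi = s --> ok xi \<delta> H1" unfolding ok_def using bd by blast
    then obtain \<delta> H1 where d0: "\<forall>xi. norm xi = s --> ok xi (\<delta> xi) (H1 xi)"
      by metis
    have d: "\<And>xi. norm xi = s ==> \<delta> xi > 0"
      "\<And>xi. norm xi = s ==> H1 xi holomorphic_on ball xi (\<delta> xi)" "\<And>xi. norm xi = s ==> ball xi (\<delta> xi) \<subseteq> ball 0 1"
      "\<And>xi zeta. norm xi = s ==> zeta \<in> ball xi (\<delta> xi) ==> f (H1 xi zeta) = h zeta"
      "\<And>xi zeta. norm xi = s ==> zeta \<in> ball xi (\<delta> xi) ==> zeta \<in> ball 0 s ==> H1 xi zeta = G zeta"
      using d0 unfolding ok_def by blast+
    define I where "I = insert (0::complex) (sphere 0 s)"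
    define U where "U i = (if i = 0 then ball 0 s else ball i (\<delta> i / 2))" for i :: complex
    define HH where "HH i = (if i = 0 then G else H1 i)" for i :: complex
    \<comment> \<open>The half radii are used here: if two half discs overlap, the larger full disc
      contains the centre of the smaller one, which lies on the circle. So the full discs meet
      inside \<open>ball 0 s\<close>, where both continuations equal \<open>G\<close>.\<close>
    have key: "H1 i x = H1 j x" if ij: "norm i = s" "norm j = s" "x \<in> ball i (\<delta> i / 2)" "x \<in> ball j (\<delta> j / 2)"
      "\<delta> j \<le> \<delta> i" for i j x
    proof (rule analytic_continuation_open[of "ball i (\<delta> i) \<inter> ball j (\<delta> j) \<inter> ball 0 s" "ball i (\<delta> i) \<inter> ball j (\<delta> j)" "H1 i" "H1 j"])
      have "dist i j < \<delta> i" using ij(3-5) dist_triangle_less_add[of i x "\<delta> i / 2" j "\<delta> j / 2"]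
        by (simp add: dist_commute)
      then have "j \<in> ball i (\<delta> i) \<inter> ball j (\<delta> j)" using d(1)[OF ij(2)] by auto
      moreover have "j \<in> closure (ball 0 s)" using s0 ij(2) by simp
      ultimately show "ball i (\<delta> i) \<inter> ball j (\<delta> j) \<inter> ball 0 s \<noteq> {}"
        using open_Int_closure_eq_empty[of "ball i (\<delta> i) \<inter> ball j (\<delta> j)" "ball 0 s"] by blast
      show "connected (ball i (\<delta> i) \<inter> ball j (\<delta> j))" by (intro convex_connected convex_Int convex_ball)
      show "H1 i holomorphic_on ball i (\<delta> i) \<inter> ball j (\<delta> j)" "H1 j holomorphic_on ball i (\<delta> i) \<inter> ball j (\<delta> j)"
        by (rule holomorphic_on_subset[OF d(2)[OF ij(1)] Int_lower1], rule holomorphic_on_subset[OF d(2)[OF ij(2)] Int_lower2])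
      show "H1 i z = H1 j z" if "z \<in> ball i (\<delta> i) \<inter> ball j (\<delta> j) \<inter> ball 0 s" for z
        using d(5)[OF ij(1)] d(5)[OF ij(2)] that by (metis Int_iff)
      show "x \<in> ball i (\<delta> i) \<inter> ball j (\<delta> j)" using ij(3,4) d(1)[OF ij(1)] d(1)[OF ij(2)] by auto
    qed auto
    have n0: "norm i = s" if "i \<in> I" "i \<noteq> 0" for i using that by (auto simp: I_def)
    obtain K where K: "K holomorphic_on (\<Union>i\<in>I. U i)" "\<And>i x. i \<in> I ==> x \<in> U i ==> K x = HH i x"
    proof (rule holomorphic_glue[of I U HH])
      show "open (U i)" for i by (simp add: U_def)
      show "HH i holomorphic_on U i" if "i \<in> I" for i
      proof (cases "i = 0")
        case False
        have "ball i (\<delta> i / 2) \<subseteq> ball i (\<delta> i)" using d(1)[OF n0[OF that False]] by auto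
        then show ?thesis using d(2)[OF n0[OF that False]] False holomorphic_on_subset by (auto simp: U_def HH_def)
      qed (use Gh in \<open>auto simp: U_def HH_def\<close>)
      have sub: "x \<in> ball i (\<delta> i)" if "x \<in> U i" "i \<in> I" "i \<noteq> 0" for i x
        using that d(1)[OF n0[OF that(2,3)]] by (auto simp: U_def)
      show "HH i x = HH j x" if ij: "i \<in> I" "j \<in> I" "x \<in> U i" "x \<in> U j" for i j x
      proof (cases "i = 0"; cases "j = 0")
        assume "i = 0" "j \<noteq> 0"
        then show ?thesis using d(5)[OF n0[OF ij(2)] sub[OF ij(4,2)]] ij(3) by (simp add: HH_def U_def)
      next
        assume "i \<noteq> 0" "j = 0"
        then show ?thesis using d(5)[OF n0[OF ij(1)] sub[OF ij(3,1)]] ij(4) by (simp add: HH_def U_def)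
      next
        assume "i \<noteq> 0" "j \<noteq> 0"
        then show ?thesis using key[of i j x] key[of j i x] ij n0 by (cases "\<delta> j \<le> \<delta> i") (auto simp: HH_def U_def)
      qed auto
    qed (use that in blast)
    have "cball 0 s \<subseteq> (\<Union>i\<in>I. U i)"
    proof
      fix x :: complex assume x: "x \<in> cball 0 s"
      show "x \<in> (\<Union>i\<in>I. U i)"
      proof (cases "norm x = s")
        case True
        then have "x \<in> I" "x \<in> U x" using s0 d(1)[OF True] by (auto simp: I_def U_def)
        then show ?thesis by blast
      next
        case False
        then have "x \<in> U 0" "0 \<in> I" using x by (auto simp: U_def I_def)
        then show ?thesis by blast
      qed
    qed
    moreover have "open (\<Union>i\<in>I. U i)" by (auto simp: U_def)
    ultimately obtain e where e: "e > 0" "(\<Union>x\<in>cball 0 s. ball x e) \<subseteq> (\<Union>i\<in>I. U i)"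
      using compact_subset_open_imp_ball_epsilon_subset[OF compact_cball] by metis
    define r where "r = min 1 (s + e)"
    have r: "s < r" "r \<le> 1" "r \<le> s + e" using s1 e(1) by (auto simp: r_def)
    have sub: "ball 0 r \<subseteq> (\<Union>i\<in>I. U i)"
    proof
      fix x :: complex assume x: "x \<in> ball 0 r"
      show "x \<in> (\<Union>i\<in>I. U i)"
      proof (cases "norm x \<le> s")
        case True
        then show ?thesis using e by (metis UN_I centre_in_ball mem_cball_0 subsetD)
      next
        case False
        define y where "y = of_real (s / norm x) * x"
        have "norm y = s" using False s0 by (auto simp: y_def norm_mult norm_divide)
        have "x - y = of_real (1 - s / norm x) * x" by (simp add: y_def algebra_simps)
        then have "norm (x - y) = \<bar>1 - s / norm x\<bar> * norm x" by (simp only: norm_mult norm_of_real)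
        also have "\<dots> = norm x - s" using False s0 by (auto simp: abs_if field_simps)
        finally have "x \<in> ball y e" using x r by (simp add: dist_norm norm_minus_commute)
        then show ?thesis using e(2) \<open>norm y = s\<close> by (metis UN_I mem_cball_0 order_refl subsetD)
      qed
    qed
    have lift: "f (K x) = h x" if xr: "x \<in> ball 0 r" for x
    proof -
      obtain i where i: "i \<in> I" "x \<in> U i" using subsetD[OF sub xr] by (rule UN_E)
      show ?thesis
      proof (cases "i = 0")
        case False
        then have "x \<in> ball i (\<delta> i)" using i d(1)[OF n0[OF i(1) False]] by (auto simp: U_def)
        then show ?thesis using d(4)[OF n0[OF i(1) False]] K(2)[OF i] False by (simp add: HH_def)
      qed (use i K(2)[OF i] Gh in \<open>auto simp: HH_def U_def\<close>)
    qed
    have KG: "K x = G x" if "x \<in> ball 0 s" for x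
      using K(2)[of 0 x] that by (auto simp: I_def U_def HH_def)
    have "ext r K" unfolding ext_def
    proof (intro conjI ballI lift)
      show "K holomorphic_on ball 0 r" using K(1) sub holomorphic_on_subset by blast
      show "K zeta = H0 zeta" if "zeta \<in> ball 0 \<delta>0" for zeta
        using KG[of zeta] extG s(1) that by (auto simp: ext_def)
    qed
    then have "r \<in> R" using r s by (auto simp: R_def)
    then have "r \<le> s" unfolding s_def by (rule cSup_upper[OF _ bdd])
    then show False using r by simp
  qed
  then have "G holomorphic_on ball 0 1" "\<And>zeta. zeta \<in> ball 0 1 ==> f (G zeta) = h zeta" "G 0 = z0"
    using extG H0(3) L(1) by (auto simp: ext_def)
  then show ?thesis using that by blast
qed

text \<open>\<open>ball_lift\<close> is transported by a Riemann map that sends \<open>a\<close> to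
  0; composing with it multiplies local degrees, so divisibility persists.\<close>

theorem holomorphic_lift:
  assumes D: "open D" "simply_connected D" "D \<noteq> UNIV" "a \<in> D"
    and h: "h holomorphic_on D" "\<not> h constant_on D"
    and noas: "\<And>zeta. zeta \<in> D ==> h zeta \<notin> asymptotic_values f"
    and dvd: "\<And>zeta z. zeta \<in> D ==> f z = h zeta ==> local_degree f z dvd local_degree h zeta"
    and z0: "f z0 = h a"
  obtains H where "H holomorphic_on D" "\<And>zeta. zeta \<in> D ==> f (H zeta) = h zeta" "H a = z0"
proof -
  have "connected D" using D(2) simply_connected_imp_connected by blast
  obtain p q where pq: "p holomorphic_on D" "q holomorphic_on ball 0 1"
    "\<And>z. z \<in> D ==> p z \<in> ball 0 1 \<and> q (p z) = z" "\<And>z. z \<in> ball 0 1 ==> q z \<in> D \<and> p (q z) = z"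
    using Riemann_mapping_theorem[of D] D by blast
  obtain m n where mn: "m (p a) = 0" "m holomorphic_on ball 0 1" "m ` ball 0 1 \<subseteq> ball 0 1"
    "n holomorphic_on ball 0 1" "n ` ball 0 1 \<subseteq> ball 0 1"
    "\<And>z. z \<in> ball 0 1 ==> m (n z) = z" "\<And>z. z \<in> ball 0 1 ==> n (m z) = z"
    using ball_biholomorphism_exists[of "p a"] pq(3)[OF D(4)] by (metis (no_types, lifting))
  define P where "P z = m (p z)" for z
  define Q where "Q z = q (n z)" for z
  have "(m \<circ> p) holomorphic_on D"
    by (rule holomorphic_on_compose_gen[OF pq(1) mn(2)]) (use pq in auto)
  then have P: "P holomorphic_on D" by (simp add: P_def[abs_def] o_def)
  have "(q \<circ> n) holomorphic_on ball 0 1"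
    by (rule holomorphic_on_compose_gen[OF mn(4) pq(2) mn(5)])
  then have Q: "Q holomorphic_on ball 0 1" by (simp add: Q_def[abs_def] o_def)
  have PD: "P z \<in> ball 0 1" "Q (P z) = z" if "z \<in> D" for z
    using pq(3)[OF that] subsetD[OF mn(3) imageI, of "p z"] mn(7)[of "p z"] by (auto simp: P_def Q_def)
  have QD: "Q z \<in> D" "P (Q z) = z" if "z \<in> ball 0 1" for z
  proof -
    have "n z \<in> ball 0 1" using mn(5) that by blast
    then show "Q z \<in> D" "P (Q z) = z" using pq(4) mn(6)[OF that] by (auto simp: P_def Q_def)
  qed
  have Pa: "P a = 0" by (simp add: P_def mn)
  have Q0: "Q 0 = a" using PD(2)[OF D(4)] Pa by simp
  define k where "k = (\<lambda>z. h (Q z))"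
  have "(h \<circ> Q) holomorphic_on ball 0 1"
    by (rule holomorphic_on_compose_gen[OF Q h(1)]) (use QD in auto)
  then have k1: "k holomorphic_on ball 0 1" by (simp add: k_def o_def)
  have k2: "\<not> k constant_on ball 0 1"
  proof
    assume "k constant_on ball 0 1"
    then obtain c where "\<And>z. z \<in> ball 0 1 ==> h (Q z) = c" by (auto simp: constant_on_def k_def)
    then have "\<And>z. z \<in> D ==> h z = c" using PD by metis
    then show False using h(2) by (auto simp: constant_on_def)
  qed
  have Qnc: "\<not> Q constant_on ball 0 1"
    using k2 unfolding k_def constant_on_def by metis
  obtain H where H: "H holomorphic_on ball 0 1" "\<And>zeta. zeta \<in> ball 0 1 ==> f (H zeta) = k zeta" "H 0 = z0"
  proof (rule ball_lift[OF k1 k2])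
    show "k zeta \<notin> asymptotic_values f" if "zeta \<in> ball 0 1" for zeta
      using noas QD that by (simp add: k_def)
    show "local_degree f z dvd local_degree k zeta" if "zeta \<in> ball 0 1" "f z = k zeta" for zeta z
    proof -
      have "local_degree k zeta = local_degree h (Q zeta) * local_degree Q zeta"
        unfolding k_def
        by (rule local_degree_compose[OF Q open_ball connected_ball that(1) Qnc h(1) D(1) \<open>connected D\<close> QD(1)[OF that(1)] h(2)])
      then show ?thesis using dvd[OF QD(1)[OF that(1)]] that(2) by (simp add: k_def)
    qed
    show "f z0 = k 0" using z0 Q0 by (simp add: k_def)
  qed (use that in blast)
  have "(H \<circ> P) holomorphic_on D"
    by (rule holomorphic_on_compose_gen[OF P H(1)]) (use PD in auto)
  moreover have "f ((H \<circ> P) zeta) = h zeta" if "zeta \<in> D" for zeta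
    using H(2)[OF PD(1)[OF that]] PD(2)[OF that] by (simp add: k_def)
  moreover have "(H \<circ> P) a = z0" using Pa H(3) by simp
  ultimately show ?thesis using that by blast
qed

lemma open_image: "open U ==> open (f ` U)"
  using open_mapping_thm[OF entire open_UNIV connected_UNIV _ subset_UNIV nonconst] .

lemma funpow_hol: "(f ^^ n) holomorphic_on S"
proof (induction n)
  case (Suc n)
  then have "(\<lambda>x. f ((f ^^ n) x)) holomorphic_on S" by (intro holomorphic_intros)
  then show ?case by (simp add: o_def)
qed (auto simp: id_def intro: holomorphic_intros)

lemma funpow_open_image: "open U ==> open ((f ^^ n) ` U)"
proof (induction n)
  case (Suc n)
  then have "open (f ` (f ^^ n) ` U)" using open_image by blast
  then show ?case by (simp add: image_comp)
qed auto

lemma funpow_nonconst: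
  assumes "open U" "U \<noteq> {}" shows "\<not> (f ^^ n) constant_on U"
proof
  assume "(f ^^ n) constant_on U"
  then obtain c where "\<And>x. x \<in> U ==> (f ^^ n) x = c" by (auto simp: constant_on_def)
  then have "(f ^^ n) ` U = {c}" using assms(2) by auto
  then show False using funpow_open_image[OF assms(1), of n] not_open_singleton[of c] by simp
qed

lemma funpow_entire: "entire_map (f ^^ n)"
  by unfold_locales (use funpow_hol funpow_nonconst in auto)

end

text \<open>Off \<open>PF\<close> the map is an orbifold covering for the ramification weight \<open>nu\<close>, so
  that the admissible maps (\<open>adm\<close>), which ramify enough over \<open>Q\<close>, lift through it.\<close>

locale orbimap = entire_map +
  fixes PF Q :: "complex set" and nu :: "complex => nat"
  assumes PF_inv: "f ` PF \<subseteq> PF" and asym_PF: "asymptotic_values f \<subseteq> PF"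
    and nu_off: "\<And>z. z \<notin> Q ==> nu z = 1" and nu_pos: "\<And>z. nu z > 0"
    and nu_dvd: "\<And>z. f z \<notin> PF ==> local_degree f z * nu z dvd nu (f z)"
begin

definition adm :: "complex set => (complex => complex) => bool" where
  "adm D h \<longleftrightarrow> h holomorphic_on D \<and> \<not> h constant_on D \<and>
     (\<forall>zeta\<in>D. h zeta \<notin> PF \<and> nu (h zeta) dvd local_degree h zeta)"

lemma adm_unramified:
  assumes "h holomorphic_on D" "\<not> h constant_on D" "h ` D \<inter> (PF \<union> Q) = {}"
  shows "adm D h"
  using assms by (auto simp: adm_def nu_off)

text \<open>Of the two factors in \<open>local_degree f z * nu z dvd nu (f z)\<close>, the first
  makes the lift exist and the second is left over for \<open>H\<close>. Hence the lift is
  admissible again, and lifting can be iterated.\<close>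

lemma adm_lift:
  assumes D: "open D" "simply_connected D" "D \<noteq> UNIV" "a \<in> D" and h: "adm D h" and z0: "f z0 = h a"
  obtains H where "adm D H" "\<And>zeta. zeta \<in> D ==> f (H zeta) = h zeta" "H a = z0"
proof -
  have con: "connected D" using D(2) simply_connected_imp_connected by blast
  have h': "h holomorphic_on D" "\<not> h constant_on D" "\<And>zeta. zeta \<in> D ==> h zeta \<notin> PF"
    "\<And>zeta. zeta \<in> D ==> nu (h zeta) dvd local_degree h zeta"
    using h by (auto simp: adm_def)
  obtain H where H: "H holomorphic_on D" "\<And>zeta. zeta \<in> D ==> f (H zeta) = h zeta" "H a = z0"
  proof (rule holomorphic_lift[OF D h'(1,2) _ _ z0])
    show "h zeta \<notin> asymptotic_values f" if "zeta \<in> D" for zeta using h'(3)[OF that] asym_PF by blast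
    show "local_degree f z dvd local_degree h zeta" if "zeta \<in> D" "f z = h zeta" for zeta z
    proof -
      have "local_degree f z * nu z dvd nu (h zeta)" using nu_dvd[of z] h'(3)[OF that(1)] that(2) by simp
      then have "local_degree f z dvd nu (h zeta)" by (rule dvd_mult_left)
      then show ?thesis using h'(4)[OF that(1)] by (rule dvd_trans)
    qed
  qed (use that in blast)
  have nc: "\<not> H constant_on D"
  proof
    assume "H constant_on D"
    then obtain c where "\<And>x. x \<in> D ==> H x = c" by (auto simp: constant_on_def)
    then have "\<And>x. x \<in> D ==> h x = f c" using H(2) by metis
    then show False using h'(2) by (auto simp: constant_on_def)
  qed
  have "H zeta \<notin> PF \<and> nu (H zeta) dvd local_degree H zeta" if z: "zeta \<in> D" for zeta
  proof
    show "H zeta \<notin> PF" using h'(3)[OF z] H(2)[OF z] PF_inv by (metis image_subset_iff)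
    have "local_degree (\<lambda>w. f (H w)) zeta = local_degree f (H zeta) * local_degree H zeta"
      by (rule local_degree_compose[OF H(1) D(1) con z nc entire open_UNIV connected_UNIV UNIV_I nonconst])
    also have "local_degree (\<lambda>w. f (H w)) zeta = local_degree h zeta"
    proof -
      obtain r g where rg: "0 < r" "ball zeta r \<subseteq> D" "g holomorphic_on ball zeta r"
        "\<And>w. w \<in> ball zeta r ==> g w \<noteq> 0" "0 < local_degree h zeta"
        "\<And>w. w \<in> ball zeta r ==> h w = h zeta + (w - zeta) ^ local_degree h zeta * g w"
        by (rule local_degree_factor[OF h'(1) D(1) con z h'(2)]) (rule that; assumption)
      show ?thesis
      proof (rule local_degree_eqI[OF open_ball _ rg(3)])
        show "f (H w) = f (H zeta) + (w - zeta) ^ local_degree h zeta * g w" if "w \<in> ball zeta r" for w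
          using rg(6)[OF that] H(2)[of w] H(2)[OF z] rg(2) that by auto
      qed (use rg(1,4) in auto)
    qed
    finally have eq: "local_degree h zeta = local_degree f (H zeta) * local_degree H zeta" .
    have "local_degree f (H zeta) * nu (H zeta) dvd nu (h zeta)"
      using nu_dvd[of "H zeta"] h'(3)[OF z] H(2)[OF z] by simp
    then have "local_degree f (H zeta) * nu (H zeta) dvd local_degree f (H zeta) * local_degree H zeta"
      using h'(4)[OF z] eq dvd_trans by metis
    moreover have "local_degree f (H zeta) > 0"
      by (rule local_degree_factor[OF entire open_UNIV connected_UNIV UNIV_I nonconst])
    ultimately show "nu (H zeta) dvd local_degree H zeta" by simp
  qed
  then have "adm D H" using H(1) nc by (auto simp: adm_def)
  then show ?thesis using that H by blast
qed

lemma adm_lift_funpow: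
  assumes D: "open D" "simply_connected D" "D \<noteq> UNIV" "a \<in> D" and h: "adm D h"
    and z0: "(f ^^ n) z0 = h a"
  obtains H where "adm D H" "\<And>zeta. zeta \<in> D ==> (f ^^ n) (H zeta) = h zeta" "H a = z0"
proof -
  have "\<exists>H. adm D H \<and> (\<forall>zeta\<in>D. (f ^^ n) (H zeta) = h zeta) \<and> H a = z0"
    using z0
  proof (induction n arbitrary: z0)
    case 0 then show ?case using h by auto
  next
    case (Suc n)
    then have "(f ^^ n) (f z0) = h a" by (simp add: funpow_swap1)
    from Suc.IH[OF this] obtain H' where H': "adm D H'" "\<And>zeta. zeta \<in> D ==> (f ^^ n) (H' zeta) = h zeta" "H' a = f z0"
      by blast
    obtain H where H: "adm D H" "\<And>zeta. zeta \<in> D ==> f (H zeta) = H' zeta" "H a = z0"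
      by (rule adm_lift[OF D H'(1) H'(3)[symmetric]]) (rule that; assumption)
    then show ?case using H'(2) by (metis funpow_Suc_right o_apply)
  qed
  then show ?thesis using that by blast
qed

end

section \<open>Landau and Montel estimates\<close>

text \<open>Up to constants, \<open>1 / wt\<close> is the density of the hyperbolic metric of a twice punctured plane
  near infinity, and \<open>theta\<close> the distance from the origin in it.\<close>

definition wt :: "complex => real" where "wt z = (1 + norm z) * ln (9 + (norm z)\<^sup>2)"

definition theta :: "complex => real" where "theta z = ln (ln (9 + (norm z)\<^sup>2))"

text \<open>9 exceeds \<open>exp 1\<close>: the logarithm stays above 1, so \<open>wt\<close>
  exceeds 1 everywhere and the outer logarithm in \<open>theta\<close> is positive.\<close>

lemma ln9_gt_1: "ln (9 + x\<^sup>2) > (1::real)"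
proof -
  have "exp (1::real) < 9 + x\<^sup>2" using exp_le zero_le_power2[of x] by linarith
  then have "ln (exp (1::real)) < ln (9 + x\<^sup>2)" by (subst ln_less_cancel_iff) (auto intro: add_pos_nonneg)
  then show ?thesis by simp
qed

lemma wt_gt_1: "wt z > 1" and wt_pos [simp]: "wt z > 0"
proof -
  have "1 * 1 < (1 + norm z) * ln (9 + (norm z)\<^sup>2)"
    using mult_le_less_imp_less[of 1 "1 + norm z" 1 "ln (9 + (norm z)\<^sup>2)"] ln9_gt_1[of "norm z"] by simp
  then show "wt z > 1" by (simp add: wt_def)
  then show "wt z > 0" by simp
qed

lemma le_9_plus_square: "(x::real) \<le> 9 + x\<^sup>2"
proof -
  have "0 \<le> (x - 1 / 2)\<^sup>2" by simp
  then show ?thesis by (simp add: power2_eq_square algebra_simps)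
qed

lemma norm_le_exp_exp_theta: "norm z \<le> exp (exp (theta z))"
proof -
  have "norm z \<le> 9 + (norm z)\<^sup>2" by (rule le_9_plus_square)
  moreover have "exp (exp (theta z)) = 9 + (norm z)\<^sup>2"
    using ln9_gt_1[of "norm z"] unfolding theta_def by (simp add: add_pos_nonneg)
  ultimately show ?thesis by simp
qed

lemma theta_mono: "norm z \<le> norm w ==> theta z \<le> theta w"
proof -
  assume "norm z \<le> norm w"
  then have "(norm z)\<^sup>2 \<le> (norm w)\<^sup>2" by (simp add: power_mono)
  then have "ln (9 + (norm z)\<^sup>2) \<le> ln (9 + (norm w)\<^sup>2)"
    by (subst ln_le_cancel_iff) (auto intro: add_pos_nonneg)
  then show ?thesis unfolding theta_def using ln9_gt_1[of "norm z"] by (subst ln_le_cancel_iff) auto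
qed

lemma theta_le_imp_norm_le: "theta z \<le> M ==> norm z \<le> exp (exp M)"
  using norm_le_exp_exp_theta[of z] by (smt (verit) exp_le_cancel_iff)

lemma norm_le_imp_theta_le: "norm z \<le> B ==> theta z \<le> theta (of_real B)"
  using theta_mono[of z "of_real B"] norm_ge_zero[of z] by simp

lemma wt_mono: "norm z \<le> norm w ==> wt z \<le> wt w"
  unfolding wt_def
proof (rule mult_mono)
  assume *: "norm z \<le> norm w"
  then have "(norm z)\<^sup>2 \<le> (norm w)\<^sup>2" by (simp add: power_mono)
  then show "ln (9 + (norm z)\<^sup>2) \<le> ln (9 + (norm w)\<^sup>2)"
    by (subst ln_le_cancel_iff) (auto intro: add_pos_nonneg)
  show "0 \<le> ln (9 + (norm z)\<^sup>2)" using ln9_gt_1[of "norm z"] by linarith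
qed auto

text \<open>The gradient of \<open>theta\<close> times \<open>wt\<close> is at most 4, because
  \<open>n * (1 + n) \<le> 2 * (9 + n\<^sup>2)\<close>. So \<open>theta\<close> is Lipschitz for the
  metric with density \<open>1 / wt\<close>.\<close>

lemma theta_path:
  fixes e :: "real => complex"
  assumes d: "\<And>t. t \<in> {0..1} ==> (e has_vector_derivative e' t) (at t within {0..1})"
    and K: "\<And>t. t \<in> {0..1} ==> norm (e' t) \<le> K * wt (e t)"
  shows "\<bar>theta (e 1) - theta (e 0)\<bar> \<le> 4 * K"
proof -
  define D where "D t = 2 * (e t \<bullet> e' t) / (9 + (norm (e t))\<^sup>2) / ln (9 + (norm (e t))\<^sup>2)" for t
  have der: "((\<lambda>t. theta (e t)) has_derivative (\<lambda>h. h * D t)) (at t within {0..1})" if t: "t \<in> {0..1}" for t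
  proof -
    have "((\<lambda>t. e t \<bullet> e t) has_vector_derivative (e t \<bullet> e' t + e' t \<bullet> e t)) (at t within {0..1})"
      by (rule bounded_bilinear.has_vector_derivative[OF bounded_bilinear_inner d[OF t] d[OF t]])
    then have "((\<lambda>t. e t \<bullet> e t) has_real_derivative 2 * (e t \<bullet> e' t)) (at t within {0..1})"
      by (simp add: has_real_derivative_iff_has_vector_derivative inner_commute)
    then have 1: "((\<lambda>t. (norm (e t))\<^sup>2) has_real_derivative 2 * (e t \<bullet> e' t)) (at t within {0..1})"
      by (simp add: power2_norm_eq_inner)
    have p: "9 + (norm (e t))\<^sup>2 > 0" by (simp add: add_pos_nonneg)
    have 2: "((\<lambda>t. ln (9 + (norm (e t))\<^sup>2)) has_real_derivative 2 * (e t \<bullet> e' t) / (9 + (norm (e t))\<^sup>2)) (at t within {0..1})"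
    proof -
      have "(ln has_real_derivative inverse (9 + (norm (e t))\<^sup>2)) (at (9 + (norm (e t))\<^sup>2))"
        using p by (rule DERIV_ln)
      moreover have "((\<lambda>t. 9 + (norm (e t))\<^sup>2) has_real_derivative 2 * (e t \<bullet> e' t)) (at t within {0..1})"
        using DERIV_add[OF DERIV_const 1, of 9] by simp
      ultimately show ?thesis using DERIV_chain2 by (fastforce simp: divide_inverse mult_ac)
    qed
    have "(ln has_real_derivative inverse (ln (9 + (norm (e t))\<^sup>2))) (at (ln (9 + (norm (e t))\<^sup>2)))"
      by (rule DERIV_ln) (use ln9_gt_1[of "norm (e t)"] in linarith)
    from DERIV_chain2[OF this 2] have "((\<lambda>t. ln (ln (9 + (norm (e t))\<^sup>2))) has_real_derivative D t) (at t within {0..1})"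
      by (simp add: D_def divide_inverse mult_ac)
    then show ?thesis by (simp add: theta_def has_field_derivative_def mult_commute_abs)
  qed
  have Dle: "\<bar>D t\<bar> \<le> 4 * K" if t: "t \<in> {0..1}" for t
  proof -
    let ?n = "norm (e t)" let ?l = "ln (9 + ?n\<^sup>2)"
    have l: "?l > 1" by (rule ln9_gt_1)
    have p: "9 + ?n\<^sup>2 > 0" by (simp add: add_pos_nonneg)
    have "0 < K"  if "e' t \<noteq> 0" using K[OF t] that wt_pos[of "e t"]
      by (meson le_less_trans norm_le_zero_iff not_less mult_nonpos_nonneg less_imp_le order_trans)
    then have K0: "0 \<le> K" using K[OF t] wt_pos[of "e t"] by (metis norm_ge_zero zero_le_mult_iff less_le_not_le order_trans less_imp_le)
    have "\<bar>e t \<bullet> e' t\<bar> \<le> ?n * norm (e' t)" by (rule Cauchy_Schwarz_ineq2)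
    also have "\<dots> \<le> ?n * (K * wt (e t))" by (intro mult_left_mono K t) auto
    finally have "\<bar>D t\<bar> \<le> 2 * (?n * (K * wt (e t))) / (9 + ?n\<^sup>2) / ?l"
      using p l unfolding D_def by (simp add: abs_mult divide_right_mono)
    also have "\<dots> = 2 * K * ((?n * (1 + ?n)) / (9 + ?n\<^sup>2))" using l by (simp add: wt_def)
    also have "\<dots> \<le> 2 * K * 2"
    proof (intro mult_left_mono)
      have "?n * (1 + ?n) \<le> 2 * (9 + ?n\<^sup>2)"
        using sum_squares_ge_zero[of "?n - 1" "?n"] by (simp add: power2_eq_square algebra_simps)
      then show "(?n * (1 + ?n)) / (9 + ?n\<^sup>2) \<le> 2" using p by (simp add: divide_le_eq)
    qed (use K0 in auto)
    finally show ?thesis by simp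
  qed
  have "\<exists>x\<in>{0..1}. theta (e 1) - theta (e 0) = (1 - 0) * D x"
    by (rule mvt_very_simple) (use der in auto)
  then show ?thesis using Dle by auto
qed

section \<open>Landau's and Montel's theorems for maps omitting two values\<close>

definition omits :: "complex => complex => complex set => (complex => complex) => bool" where
  "omits a b S h \<longleftrightarrow> h holomorphic_on S \<and> (\<forall>z\<in>S. h z \<noteq> a \<and> h z \<noteq> b)"

text \<open>Schottky's bound for \<open>norm z \<le> 1/2\<close>, where
  \<open>12 * (1/2) / (1 - 1/2) = 12\<close>; the factor 4 comes from the Cauchy inequality on a
  disc of radius \<open>1/4\<close>.\<close>

definition landau_const :: "real => real" where
  "landau_const r = 4 * exp (pi * exp (pi * (2 + 2 * r + 12)))"

lemma landau_small:
  assumes h: "omits 0 1 (ball 0 1) h" and r: "norm (h 0) \<le> r"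
  shows "norm (deriv h 0) \<le> landau_const r"
proof -
  \<comment> \<open>Schottky's theorem asks for holomorphy on a closed disc, hence the scaling by
    \<open>1/2\<close>.\<close>
  define k where "k z = h (z / 2)" for z
  have hh: "h holomorphic_on ball 0 1" using h by (simp add: omits_def)
  have in1: "z / 2 \<in> ball 0 1" if "z \<in> cball 0 1" for z :: complex
    using that by (simp add: norm_divide)
  have "(h \<circ> (\<lambda>z. z / 2)) holomorphic_on cball 0 1"
    by (rule holomorphic_on_compose_gen[OF _ hh]) (use in1 in \<open>auto intro!: holomorphic_intros\<close>)
  then have kh: "k holomorphic_on cball 0 1" by (simp add: k_def[abs_def] o_def)
  have bd: "norm (h w) \<le> exp (pi * exp (pi * (2 + 2 * r + 12)))" if "norm w \<le> 1/4" for w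
  proof -
    have "norm (k (2 * w)) \<le> exp (pi * exp (pi * (2 + 2 * r + 12 * (1/2) / (1 - 1/2))))"
    proof (rule Schottky[OF kh])
      show "\<not> (k z = 0 \<or> k z = 1)" if "z \<in> cball 0 1" for z
        using h in1[OF that] by (simp add: omits_def k_def)
      show "norm (2 * w) \<le> 1/2" using that by (simp add: norm_mult)
    qed (use r in \<open>auto simp: k_def\<close>)
    then show ?thesis by (simp add: k_def)
  qed
  have hc: "h holomorphic_on cball 0 (1/4)" by (rule holomorphic_on_subset[OF hh]) auto
  have "norm ((deriv ^^ 1) h 0) \<le> fact 1 * exp (pi * exp (pi * (2 + 2 * r + 12))) / (1/4) ^ 1"
  proof (rule Cauchy_inequality)
    show "h holomorphic_on ball 0 (1/4)" using hc holomorphic_on_subset ball_subset_cball by blast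
    show "continuous_on (cball 0 (1/4)) h" using hc by (rule holomorphic_on_imp_continuous_on)
  qed (use bd in auto)
  then show ?thesis by (simp add: landau_const_def)
qed

text \<open>If \<open>h 0\<close> is large, take a logarithm of \<open>h\<close>; it misses the
  multiples of \<open>2 * pi * \<i>\<close>, because \<open>h\<close> misses 1. An affine map sends
  the multiples by \<open>-k\<close> and \<open>k\<close>, with \<open>k\<close> about
  \<open>ln (norm (h 0)) / (2 * pi)\<close>, to 0 and 1 and the value at 0 to a point of size at
  most 2. Undoing it costs a factor of order \<open>ln (norm (h 0))\<close>, and the exponential
  costs \<open>norm (h 0)\<close>.\<close>

lemma landau01:
  assumes h: "omits 0 1 (ball 0 1) h"
  shows "norm (deriv h 0) \<le> (landau_const (exp (2 * pi)) + 2 * landau_const 2) * wt (h 0)"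
proof (cases "norm (h 0) \<le> exp (2 * pi)")
  case True
  have "norm (deriv h 0) \<le> landau_const (exp (2 * pi)) * 1" using landau_small[OF h True] by simp
  also have "\<dots> \<le> (landau_const (exp (2 * pi)) + 2 * landau_const 2) * wt (h 0)"
    using wt_gt_1[of "h 0"] by (intro mult_mono) (auto simp: landau_const_def)
  finally show ?thesis .
next
  case False
  define A where "A = ln (norm (h 0))"
  have h00: "h 0 \<noteq> 0" using False by auto
  have "exp (2 * pi) < norm (h 0)" using False by simp
  then have A: "2 * pi < A" unfolding A_def using h00 by (metis exp_less_cancel_iff exp_ln zero_less_norm_iff)
  define k where "k = nat \<lfloor>A / (2 * pi)\<rfloor>"
  have A1: "A / (2 * pi) > 1" using A by (simp add: field_simps)
  have k: "real k \<le> A / (2 * pi)" "A / (2 * pi) < real k + 1" "k \<ge> 1"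
  proof -
    have "\<lfloor>A / (2 * pi)\<rfloor> \<ge> 1" using A1 by linarith
    then show "real k \<le> A / (2 * pi)" "A / (2 * pi) < real k + 1" "k \<ge> 1" unfolding k_def by linarith+
  qed
  have kA: "2 * pi * real k \<le> A" "A < 2 * pi * (real k + 1)"
    using k by (simp_all add: field_simps)
  have hh: "h holomorphic_on ball 0 1" and nz: "\<And>z. z \<in> ball 0 1 ==> h z \<noteq> 0" "\<And>z. z \<in> ball 0 1 ==> h z \<noteq> 1"
    using h by (auto simp: omits_def)
  have "simply_connected (ball (0::complex) 1)" by (simp add: convex_imp_simply_connected)
  then obtain g where g: "g holomorphic_on ball 0 1" "\<And>z. z \<in> ball 0 1 ==> h z = exp (g z)"
    using simply_connected_eq_holomorphic_log[OF open_ball, of "0::complex" 1] hh nz(1) by blast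
  define u where "u z = g z - g 0 + Ln (h 0)" for z
  have u: "u holomorphic_on ball 0 1" unfolding u_def by (intro holomorphic_intros g)
  have eu: "exp (u z) = h z" if "z \<in> ball 0 1" for z
    using g(2)[OF that] g(2)[of 0] h00 by (simp add: u_def exp_add exp_diff)
  have k0: "complex_of_nat k \<noteq> 0" using k(3) by simp
  define c where "c = 4 * of_real pi * \<i> * complex_of_nat k"
  have c0: "c \<noteq> 0" using k0 by (simp add: c_def)
  define v where "v z = (u z + 2 * of_real pi * \<i> * of_nat k) / c" for z
  have e1: "exp (2 * of_real pi * \<i> * complex_of_nat k) = 1" "exp (- (2 * of_real pi * \<i> * complex_of_nat k)) = 1"
  proof -
    have "exp (2 * of_real pi * \<i> * complex_of_nat k) = exp (of_nat k * (2 * of_real pi * \<i>))" by (simp add: mult.commute)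
    also have "\<dots> = 1" by (simp add: exp_of_nat_mult)
    finally show *: "exp (2 * of_real pi * \<i> * complex_of_nat k) = 1" .
    show "exp (- (2 * of_real pi * \<i> * complex_of_nat k)) = 1" unfolding exp_minus * by simp
  qed
  have "omits 0 1 (ball 0 1) v"
    unfolding omits_def
  proof (intro conjI ballI)
    show "v holomorphic_on ball 0 1" unfolding v_def by (intro holomorphic_intros u) (use c0 in auto)
    fix z :: complex assume z: "z \<in> ball 0 1"
    show "v z \<noteq> 0"
    proof
      assume "v z = 0"
      then have "u z = - (2 * of_real pi * \<i> * of_nat k)" using c0 by (simp add: v_def eq_neg_iff_add_eq_0)
      then show False using eu[OF z] nz(2)[OF z] e1(2) by simp
    qed
    show "v z \<noteq> 1"
    proof
      assume "v z = 1"
      then have "u z + 2 * of_real pi * \<i> * of_nat k = c" using c0 by (simp add: v_def)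
      then have "u z = 2 * of_real pi * \<i> * of_nat k" by (simp add: c_def algebra_simps)
      then show False using eu[OF z] nz(2)[OF z] e1(1) by simp
    qed
  qed
  moreover have "norm (v 0) \<le> 2"
  proof -
    have "norm (u 0) \<le> A + pi"
    proof -
      have "u 0 = Ln (h 0)" by (simp add: u_def)
      moreover have "norm (Ln (h 0)) \<le> \<bar>Re (Ln (h 0))\<bar> + \<bar>Im (Ln (h 0))\<bar>" by (rule cmod_le)
      moreover have "Re (Ln (h 0)) = A" using h00 by (simp add: A_def)
      moreover have "\<bar>Im (Ln (h 0))\<bar> \<le> pi" using h00 Im_Ln_le_pi[of "h 0"] mpi_less_Im_Ln[of "h 0"] by linarith
      ultimately have "norm (u 0) \<le> \<bar>A\<bar> + pi" by simp
      then show ?thesis using A pi_gt_zero by linarith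
    qed
    moreover have "norm (2 * of_real pi * \<i> * complex_of_nat k) = 2 * pi * real k" by (simp add: norm_mult)
    ultimately have 1: "norm (u 0 + 2 * of_real pi * \<i> * of_nat k) \<le> A + pi + 2 * pi * real k"
      by (smt (verit) norm_triangle_ineq)
    have 2: "norm c = 4 * pi * real k" by (simp add: c_def norm_mult)
    have "A + pi + 2 * pi * real k \<le> 2 * (4 * pi * real k)"
    proof -
      have "pi * 1 \<le> pi * real k" using k(3) by (intro mult_left_mono) auto
      moreover have "A < 2 * (pi * real k) + 2 * pi" using kA(2) by (simp add: algebra_simps)
      moreover have "A + pi + 2 * pi * real k = A + pi + 2 * (pi * real k)" "2 * (4 * pi * real k) = 8 * (pi * real k)" by simp_all
      ultimately show ?thesis using pi_gt_zero by linarith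
    qed
    then show ?thesis using 1 2 k(3) unfolding v_def by (simp add: norm_divide divide_le_eq)
  qed
  ultimately have dv: "norm (deriv v 0) \<le> landau_const 2" by (rule landau_small)
  have du: "(u has_field_derivative deriv u 0) (at 0)" using holomorphic_derivI[OF u open_ball] by simp
  have "(v has_field_derivative deriv u 0 / c) (at 0)"
    unfolding v_def using c0 by (auto intro!: derivative_eq_intros du)
  then have v': "deriv v 0 = deriv u 0 / c" by (rule DERIV_imp_deriv)
  have "((\<lambda>z. exp (u z)) has_field_derivative exp (u 0) * deriv u 0) (at 0)"
    by (auto intro!: derivative_eq_intros du)
  then have "(h has_field_derivative exp (u 0) * deriv u 0) (at 0)"
    by (rule has_field_derivative_transform_within_open[of _ _ _ "ball 0 1"]) (use eu in auto)
  then have "deriv h 0 = h 0 * (c * deriv v 0)"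
    using eu[of 0] c0 v' by (simp add: DERIV_imp_deriv)
  then have "norm (deriv h 0) = norm (h 0) * (4 * pi * real k * norm (deriv v 0))"
    by (simp add: norm_mult c_def)
  also have "\<dots> \<le> norm (h 0) * (2 * A * landau_const 2)"
  proof (rule mult_left_mono)
    show "4 * pi * real k * norm (deriv v 0) \<le> 2 * A * landau_const 2"
    proof (rule mult_mono)
      show "4 * pi * real k \<le> 2 * A" using kA(1) by linarith
      show "0 \<le> 2 * A" using A pi_gt_zero by linarith
    qed (use dv in auto)
  qed simp
  also have "\<dots> = 2 * landau_const 2 * (norm (h 0) * A)" by simp
  also have "\<dots> \<le> 2 * landau_const 2 * wt (h 0)"
  proof (intro mult_left_mono)
    have "norm (h 0) \<le> 9 + (norm (h 0))\<^sup>2" by (rule le_9_plus_square)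
    then have "A \<le> ln (9 + (norm (h 0))\<^sup>2)" unfolding A_def using h00 by (subst ln_le_cancel_iff) (auto intro: add_pos_nonneg)
    moreover have "0 \<le> A" using A pi_gt_zero by linarith
    ultimately show "norm (h 0) * A \<le> wt (h 0)" unfolding wt_def
      by (intro mult_mono) auto
  qed (auto simp: landau_const_def)
  also have "\<dots> \<le> (landau_const (exp (2 * pi)) + 2 * landau_const 2) * wt (h 0)"
    using wt_gt_1[of "h 0"] by (intro mult_right_mono) (auto simp: landau_const_def)
  finally show ?thesis .
qed

lemma wt_affine:
  fixes a b :: complex assumes "b \<noteq> 0"
  obtains C where "C > 0" "\<And>z. wt ((z - a) / b) \<le> C * wt z"
proof -
  define M where "M = 1 + (1 + norm a) / norm b"
  have M: "M \<ge> 1" using assms by (simp add: M_def)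
  have M2: "M\<^sup>2 \<ge> 1" using M by (simp add: one_le_power)
  define C where "C = M * (ln (2 * M\<^sup>2) + 1) * 2"
  have l0: "ln (2 * M\<^sup>2) \<ge> 0" using M2 by simp
  show ?thesis
  proof (rule that[of C])
    have "ln (2 * M\<^sup>2) + 1 > 0" using l0 by linarith
    then show "C > 0" using M unfolding C_def by (intro mult_pos_pos) auto
    fix z :: complex
    let ?w = "(z - a) / b" let ?n = "norm z"
    have n0: "?n \<ge> 0" by simp
    have "norm (z - a) \<le> (1 + norm a) * (1 + ?n)"
    proof -
      have "0 \<le> norm a * ?n" by simp
      moreover have "(1 + norm a) * (1 + ?n) = 1 + norm a + ?n + norm a * ?n" by (simp add: algebra_simps)
      ultimately show ?thesis using norm_triangle_ineq4[of z a] by linarith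
    qed
    then have "norm ?w \<le> (1 + norm a) * (1 + ?n) / norm b"
      by (simp add: norm_divide divide_right_mono)
    also have "\<dots> = (M - 1) * (1 + ?n)" by (simp add: M_def)
    also have "\<dots> = M * (1 + ?n) - (1 + ?n)" by (simp add: algebra_simps)
    finally have a1: "1 + norm ?w \<le> M * (1 + ?n)" using n0 by (simp only: le_diff_eq)
    then have w: "norm ?w \<le> M * (1 + ?n)" by linarith
    have "(norm ?w)\<^sup>2 \<le> (M * (1 + ?n))\<^sup>2" using w by (intro power_mono) auto
    also have "\<dots> = M\<^sup>2 * (1 + ?n)\<^sup>2" by (simp add: power_mult_distrib)
    also have "\<dots> \<le> M\<^sup>2 * (2 + 2 * ?n\<^sup>2)"
    proof (rule mult_left_mono)
      show "(1 + ?n)\<^sup>2 \<le> 2 + 2 * ?n\<^sup>2"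
        using zero_le_power2[of "1 - ?n"] by (simp add: power2_eq_square algebra_simps)
    qed simp
    finally have "9 + (norm ?w)\<^sup>2 \<le> 9 + M\<^sup>2 * (2 + 2 * ?n\<^sup>2)" by simp
    also have "\<dots> \<le> (2 * M\<^sup>2) * (9 + ?n\<^sup>2)" using M2 by (simp add: algebra_simps)
    finally have "ln (9 + (norm ?w)\<^sup>2) \<le> ln ((2 * M\<^sup>2) * (9 + ?n\<^sup>2))"
      by (subst ln_le_cancel_iff) (use M2 in \<open>auto intro!: add_pos_nonneg mult_pos_pos\<close>)
    also have "\<dots> = ln (2 * M\<^sup>2) + ln (9 + ?n\<^sup>2)"
      by (rule ln_mult_pos) (use M2 in \<open>auto intro!: add_pos_nonneg\<close>)
    also have "\<dots> \<le> ln (2 * M\<^sup>2) * ln (9 + ?n\<^sup>2) + ln (9 + ?n\<^sup>2)"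
      using mult_left_mono[OF less_imp_le[OF ln9_gt_1[of ?n]] l0] by simp
    also have "\<dots> = (ln (2 * M\<^sup>2) + 1) * ln (9 + ?n\<^sup>2)" by (simp add: algebra_simps)
    finally have a2: "ln (9 + (norm ?w)\<^sup>2) \<le> (ln (2 * M\<^sup>2) + 1) * ln (9 + ?n\<^sup>2)" .
    have "wt ?w \<le> (M * (1 + ?n)) * ((ln (2 * M\<^sup>2) + 1) * ln (9 + ?n\<^sup>2))"
      unfolding wt_def using ln9_gt_1[of "norm ?w"] M n0 by (intro mult_mono a1 a2) auto
    also have "\<dots> = (M * (ln (2 * M\<^sup>2) + 1)) * wt z" by (simp add: wt_def)
    also have "\<dots> \<le> C * wt z"
      using M l0 less_imp_le[OF wt_pos[of z]] unfolding C_def by (intro mult_right_mono) auto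
    finally show "wt ?w \<le> C * wt z" .
  qed
qed

lemma landau:
  assumes "a \<noteq> b"
  obtains C where "C > 0" "\<And>h z r. r > 0 ==> omits a b (ball z r) h ==> norm (deriv h z) * r \<le> C * wt (h z)"
proof -
  have ba: "b - a \<noteq> 0" using assms by simp
  obtain C1 where C1: "C1 > 0" "\<And>z. wt ((z - a) / (b - a)) \<le> C1 * wt z"
    by (rule wt_affine[OF ba, of a]) (rule that; assumption)
  define C0 where "C0 = landau_const (exp (2 * pi)) + 2 * landau_const 2"
  have C0: "C0 > 0" by (auto simp: C0_def landau_const_def intro!: add_pos_pos)
  show ?thesis
  proof (rule that[of "norm (b - a) * C0 * C1"])
    show "norm (b - a) * C0 * C1 > 0" using C0 C1 ba by simp
    fix h z and r :: real assume r: "r > 0" and h: "omits a b (ball z r) h"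
    define k where "k zeta = (h (z + of_real r * zeta) - a) / (b - a)" for zeta
    have inb: "z + of_real r * zeta \<in> ball z r" if "zeta \<in> ball 0 1" for zeta
      using that r by (simp add: dist_norm norm_mult)
    have hh: "h holomorphic_on ball z r" using h by (simp add: omits_def)
    have "(h \<circ> (\<lambda>zeta. z + of_real r * zeta)) holomorphic_on ball 0 1"
      by (rule holomorphic_on_compose_gen[OF _ hh]) (use inb in \<open>auto intro!: holomorphic_intros\<close>)
    then have h1: "(\<lambda>zeta. h (z + of_real r * zeta)) holomorphic_on ball 0 1" by (simp add: o_def)
    have "omits 0 1 (ball 0 1) k"
      unfolding omits_def
    proof (intro conjI ballI)
      show "k holomorphic_on ball 0 1" unfolding k_def by (intro holomorphic_intros h1) (use ba in auto)
      fix zeta :: complex assume "zeta \<in> ball 0 1"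
      from inb[OF this] have "h (z + of_real r * zeta) \<noteq> a" "h (z + of_real r * zeta) \<noteq> b"
        using h unfolding omits_def by blast+
      then show "k zeta \<noteq> 0" "k zeta \<noteq> 1" using ba by (auto simp: k_def)
    qed
    then have *: "norm (deriv k 0) \<le> C0 * wt (k 0)" using landau01 C0_def by blast
    have dh: "(h has_field_derivative deriv h z) (at z)" using holomorphic_derivI[OF hh open_ball] r by simp
    have "((\<lambda>zeta. h (z + of_real r * zeta)) has_field_derivative deriv h z * of_real r) (at 0)"
      by (rule DERIV_chain2[of h]) (use dh in \<open>auto intro!: derivative_eq_intros\<close>)
    then have "(k has_field_derivative deriv h z * of_real r / (b - a)) (at 0)"
      unfolding k_def using ba by (auto intro!: derivative_eq_intros)
    then have "deriv k 0 = deriv h z * of_real r / (b - a)" by (rule DERIV_imp_deriv)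
    then have "norm (deriv h z) * r / norm (b - a) \<le> C0 * wt (k 0)"
      using * r by (simp add: norm_mult norm_divide)
    then have "norm (deriv h z) * r \<le> norm (b - a) * (C0 * wt (k 0))"
      using ba by (simp add: divide_le_eq mult.commute)
    also have "\<dots> \<le> norm (b - a) * (C0 * (C1 * wt (h z)))"
      using C0 C1(2)[of "h z"] by (intro mult_left_mono) (auto simp: k_def)
    finally show "norm (deriv h z) * r \<le> norm (b - a) * C0 * C1 * wt (h z)" by (simp add: mult.assoc)
  qed
qed

text \<open>The Landau bound is integrated along the segment to \<open>z\<close>; each of its points
  is the centre of a disc of radius \<open>r - s\<close> inside \<open>ball c r\<close>. Expressed
  by \<open>theta\<close> the comparison is symmetric and additive.\<close>

lemma landau_theta:
  assumes "a \<noteq> b"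
  obtains C where "C > 0" "\<And>h c r s z. 0 \<le> s ==> s < r ==> omits a b (ball c r) h ==> z \<in> cball c s ==>
     \<bar>theta (h z) - theta (h c)\<bar> \<le> C * s / (r - s)"
proof -
  obtain C where C: "C > 0" "\<And>h z r. r > 0 ==> omits a b (ball z r) h ==> norm (deriv h z) * r \<le> C * wt (h z)"
    by (rule landau[OF assms]) (rule that; assumption)
  show ?thesis
  proof (rule that[of "4 * C"])
    show "4 * C > 0" using C by simp
    fix h c and r s :: real and z assume s: "0 \<le> s" "s < r" and h: "omits a b (ball c r) h" and z: "z \<in> cball c s"
    have hh: "h holomorphic_on ball c r" using h by (simp add: omits_def)
    define p where "p t = c + of_real t * (z - c)" for t :: real
    have pd: "norm (p t - c) \<le> s" if "t \<in> {0..1}" for t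
    proof -
      have "norm (p t - c) = t * norm (z - c)" using that by (simp add: p_def norm_mult)
      also have "\<dots> \<le> 1 * s" using that z by (intro mult_mono) (auto simp: dist_norm norm_minus_commute)
      finally show ?thesis by simp
    qed
    have pb: "p t \<in> ball c r" if "t \<in> {0..1}" for t using pd[OF that] s by (simp add: dist_norm norm_minus_commute)
    have "\<bar>theta (h (p 1)) - theta (h (p 0))\<bar> \<le> 4 * (C * s / (r - s))"
    proof (rule theta_path)
      fix t :: real assume t: "t \<in> {0..1}"
      have p': "(p has_vector_derivative (z - c)) (at t within {0..1})"
        unfolding p_def by (auto intro!: derivative_eq_intros)
      have "(h has_field_derivative deriv h (p t)) (at (p t))" using holomorphic_derivI[OF hh open_ball pb[OF t]] .
      then show "((\<lambda>t. h (p t)) has_vector_derivative ((z - c) * deriv h (p t))) (at t within {0..1})"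
        using field_vector_diff_chain_within[OF p', of h "deriv h (p t)"] has_field_derivative_at_within
        by (auto simp: o_def)
      have sub: "ball (p t) (r - s) \<subseteq> ball c r"
      proof
        fix y assume "y \<in> ball (p t) (r - s)"
        then show "y \<in> ball c r" using pd[OF t] dist_triangle[of c y "p t"] by (simp add: dist_norm norm_minus_commute)
      qed
      then have "omits a b (ball (p t) (r - s)) h" using h holomorphic_on_subset[OF hh sub] by (auto simp: omits_def)
      then have "norm (deriv h (p t)) * (r - s) \<le> C * wt (h (p t))" using C(2) s by simp
      then have 1: "norm (deriv h (p t)) \<le> C * wt (h (p t)) / (r - s)" using s by (simp add: le_divide_eq)
      have "norm ((z - c) * deriv h (p t)) \<le> s * (C * wt (h (p t)) / (r - s))"
        unfolding norm_mult using z s 1 by (intro mult_mono) (auto simp: dist_norm norm_minus_commute)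
      then show "norm ((z - c) * deriv h (p t)) \<le> C * s / (r - s) * wt (h (p t))" by (simp add: mult_ac)
    qed
    then show "\<bar>theta (h z) - theta (h c)\<bar> \<le> 4 * C * s / (r - s)" by (simp add: p_def)
  qed
qed

lemma compact_subset_ball_cball:
  fixes c :: complex
  assumes "compact K" "K \<subseteq> ball c r" "r > 0"
  obtains s where "0 \<le> s" "s < r" "K \<subseteq> cball c s"
proof (cases "K = {}")
  case True then show ?thesis using that[of 0] assms by auto
next
  case False
  have "continuous_on K (\<lambda>x. dist c x)" by (intro continuous_intros)
  then obtain x where x: "x \<in> K" "\<And>y. y \<in> K ==> dist c y \<le> dist c x"
    using continuous_attains_sup[OF assms(1) False] by blast
  show ?thesis by (rule that[of "dist c x"]) (use x assms in auto)
qed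

text \<open>The bound is known only at moving points \<open>z n\<close>. As they converge inside the
  disc, they lie in one smaller closed disc, and passing from \<open>z n\<close> to the centre and
  on to any other point changes \<open>theta\<close> by a bounded amount.\<close>

lemma normal_two:
  fixes h :: "nat => complex => complex"
  assumes ab: "a \<noteq> b" and r: "r > 0" and h: "\<And>n. omits a b (ball c r) (h n)"
    and z: "z \<longlonglongrightarrow> z1" "\<And>n. z n \<in> ball c r" "z1 \<in> ball c r" and B: "\<And>n. norm (h n (z n)) \<le> B"
  obtains g k where "g holomorphic_on ball c r" "strict_mono (k :: nat => nat)"
    "\<And>K. compact K ==> K \<subseteq> ball c r ==> uniform_limit K (h \<circ> k) g sequentially"
proof -
  obtain C where C: "C > 0" "\<And>h c r s z. 0 \<le> s ==> s < r ==> omits a b (ball c r) h ==> z \<in> cball c s ==>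
     \<bar>theta (h z) - theta (h c)\<bar> \<le> C * s / (r - s)"
    by (rule landau_theta[OF ab]) (rule that; assumption)
  have cz: "compact (insert z1 (range z))" using compact_sequence_with_limit[OF z(1)] .
  have bdd: "\<exists>B'. \<forall>g\<in>range h. \<forall>x\<in>K. norm (g x) \<le> B'" if K: "compact K" "K \<subseteq> ball c r" for K
  proof -
    have "compact (K \<union> insert z1 (range z))" by (rule compact_Un[OF K(1) cz])
    moreover have "K \<union> insert z1 (range z) \<subseteq> ball c r"
      using K z by auto
    ultimately obtain s where s: "0 \<le> s" "s < r" "K \<union> insert z1 (range z) \<subseteq> cball c s"
      using compact_subset_ball_cball[OF _ _ r] by metis
    have "norm (h n x) \<le> exp (exp (theta (of_real B) + 2 * (C * s / (r - s))))" if x: "x \<in> K" for n x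
    proof -
      have xs: "x \<in> cball c s" using s(3) x by blast
      have zs: "z n \<in> cball c s" using s(3) by blast
      have "theta (h n (z n)) \<le> theta (of_real B)" by (rule norm_le_imp_theta_le[OF B])
      then have "theta (h n x) \<le> theta (of_real B) + 2 * (C * s / (r - s))"
        using C(2)[OF s(1,2) h[of n] xs] C(2)[OF s(1,2) h[of n] zs] by linarith
      then show ?thesis by (rule theta_le_imp_norm_le)
    qed
    then show ?thesis by blast
  qed
  show ?thesis
    by (rule Montel[of "ball c r" "range h" h]) (use that h bdd in \<open>auto simp: omits_def\<close>)
qed

text \<open>If no subsequence is bounded at the centre, comparing \<open>theta\<close> with its
  value there yields locally uniform divergence, the second alternative of
  \<open>normal_family_on\<close>.\<close>

lemma normal_family_omits:
  assumes ab: "a \<noteq> b" and r: "r > 0" and F: "\<And>g. g \<in> F ==> omits a b (ball c r) g"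
  shows "normal_family_on (ball c r) F"
  unfolding normal_family_on_def
proof (intro allI impI)
  fix h :: "nat => complex => complex" assume hF: "range h \<subseteq> F"
  have h: "omits a b (ball c r) (h n)" for n using F hF by blast
  show "\<exists>k::nat=>nat. strict_mono k \<and> ((\<exists>l. \<forall>K. compact K \<and> K \<subseteq> ball c r --> uniform_limit K (h \<circ> k) l sequentially) \<or>
          (\<forall>K. compact K \<and> K \<subseteq> ball c r --> (\<forall>B::real. \<forall>\<^sub>F n in sequentially. \<forall>z\<in>K. B < norm (h (k n) z))))"
  proof (cases "\<exists>B. \<forall>N. \<exists>n\<ge>N. norm (h n c) \<le> B")
    case True
    then obtain B where "\<forall>N. \<exists>n\<ge>N. norm (h n c) \<le> B" by blast
    then have "infinite {n. norm (h n c) \<le> B}" unfolding infinite_nat_iff_unbounded_le by blast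
    then obtain k1 :: "nat => nat" where k1: "strict_mono k1" "\<And>n. norm (h (k1 n) c) \<le> B"
      using infinite_enumerate by (metis mem_Collect_eq)
    obtain g k where gk: "strict_mono (k :: nat => nat)"
      "\<And>K. compact K ==> K \<subseteq> ball c r ==> uniform_limit K ((\<lambda>n. h (k1 n)) \<circ> k) g sequentially"
      by (rule normal_two[OF ab r, of c "\<lambda>n. h (k1 n)" "\<lambda>_. c" c B]) (use h k1 r in auto)
    have "strict_mono (k1 \<circ> k)" using k1(1) gk(1) strict_mono_o by blast
    moreover have "(h \<circ> (k1 \<circ> k)) = (\<lambda>n. h (k1 n)) \<circ> k" by (auto simp: o_def)
    ultimately show ?thesis using gk(2) by metis
  next
    case False
    obtain C where C: "C > 0" "\<And>h c r s z. 0 \<le> s ==> s < r ==> omits a b (ball c r) h ==> z \<in> cball c s ==>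
       \<bar>theta (h z) - theta (h c)\<bar> \<le> C * s / (r - s)"
      by (rule landau_theta[OF ab]) (rule that; assumption)
    have "\<forall>\<^sub>F n in sequentially. \<forall>z\<in>K. B < norm (h n z)" if K: "compact K" "K \<subseteq> ball c r" for K B
    proof -
      obtain s where s: "0 \<le> s" "s < r" "K \<subseteq> cball c s"
        using compact_subset_ball_cball[OF K r] by metis
      define M where "M = exp (exp (theta (of_real B) + C * s / (r - s)))"
      obtain N where N: "\<And>n. n \<ge> N ==> norm (h n c) > M" using False by (meson not_le)
      have "B < norm (h n z)" if "n \<ge> N" "z \<in> K" for n z
      proof (rule ccontr)
        assume "\<not> B < norm (h n z)"
        then have "theta (h n z) \<le> theta (of_real B)" by (intro norm_le_imp_theta_le) simp
        moreover have "\<bar>theta (h n z) - theta (h n c)\<bar> \<le> C * s / (r - s)"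
          using C(2)[OF s(1,2) h[of n]] s(3) that(2) by blast
        ultimately have "theta (h n c) \<le> theta (of_real B) + C * s / (r - s)" by linarith
        then have "norm (h n c) \<le> M" unfolding M_def by (rule theta_le_imp_norm_le)
        then show False using N[OF that(1)] by simp
      qed
      then show ?thesis unfolding eventually_sequentially by blast
    qed
    then show ?thesis by (intro exI[of _ id]) (auto simp: strict_mono_def)
  qed
qed

section \<open>Maps with bounded singular set\<close>

lemma transcendental_growth:
  assumes "transcendental_entire f"
  shows "\<exists>z. A \<le> norm z \<and> B * norm z ^ n < norm (f z)"
proof (rule ccontr)
  assume "\<not> ?thesis"
  then have "\<And>z. A \<le> norm z ==> norm (f z) \<le> B * norm z ^ n" by (meson not_le)
  then have eq: "f xi = (\<Sum>k\<le>n. (deriv ^^ k) f 0 / fact k * xi ^ k)" for xi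
    using Liouville_polynomial[of f A B n xi] assms by (simp add: transcendental_entire_def)
  have "f = poly (\<Sum>k\<le>n. monom ((deriv ^^ k) f 0 / fact k) k)"
    by (rule ext, subst eq) (simp add: poly_sum poly_monom)
  then show False using assms by (auto simp: transcendental_entire_def)
qed

lemma transcendental_entire_map:
  assumes "transcendental_entire f" shows "entire_map f"
proof
  show "f holomorphic_on UNIV" using assms by (simp add: transcendental_entire_def)
  show "\<not> f constant_on UNIV"
  proof
    assume "f constant_on UNIV"
    then obtain c where "\<And>x. f x = c" by (auto simp: constant_on_def)
    then have "f = poly [:c:]" by auto
    then show False using assms by (auto simp: transcendental_entire_def)
  qed
qed

section \<open>The logarithmic change of variable\<close>

interpretation exp_map: entire_map "exp :: complex => complex"
proof
  show "exp holomorphic_on (UNIV :: complex set)" by (intro holomorphic_intros)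
  show "\<not> (exp :: complex => complex) constant_on UNIV"
  proof
    assume "(exp :: complex => complex) constant_on UNIV"
    then obtain c :: complex where c: "\<And>x. exp x = c" by (auto simp: constant_on_def)
    have "exp (0::complex) = exp (of_real (ln 2))" using c by simp
    then show False by (simp add: exp_of_real)
  qed
qed

lemma deriv_exp [simp]: "deriv exp z = exp (z :: complex)"
  by (rule DERIV_imp_deriv) (rule DERIV_exp)

lemma holomorphic_log_convex:
  assumes "open D" "convex D" "h holomorphic_on D" "\<And>z. z \<in> D ==> h z \<noteq> 0"
  obtains u where "u holomorphic_on D" "\<And>z. z \<in> D ==> exp (u z) = h z"
  using simply_connected_eq_holomorphic_log[OF assms(1)] convex_imp_simply_connected[OF assms(2)] assms(3,4)
  by metis

text \<open>The preimage of \<open>{z. r < norm z}\<close> under \<open>exp\<close>, that is, its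
  universal covering space for \<open>r > 0\<close>.\<close>

definition rhp :: "real => complex set" where "rhp r = {s. ln r < Re s}"

lemma rhp: "open (rhp r)" "convex (rhp r)" "connected (rhp r)" "simply_connected (rhp r)" "rhp r \<noteq> UNIV"
proof -
  show 1: "open (rhp r)" unfolding rhp_def by (rule open_halfspace_Re_gt)
  show 2: "convex (rhp r)" unfolding rhp_def by (rule convex_halfspace_Re_gt)
  show "connected (rhp r)" using 2 by (rule convex_connected)
  show "simply_connected (rhp r)" using 2 by (rule convex_imp_simply_connected)
  have "of_real (ln r) \<notin> rhp r" by (simp add: rhp_def)
  then show "rhp r \<noteq> UNIV" by blast
qed

lemma exp_in_rhp: "r > 0 ==> r < norm (exp s) \<longleftrightarrow> s \<in> rhp r"
  by (simp add: rhp_def) (metis exp_less_cancel_iff exp_ln)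

lemma Ln_in_rhp: "r > 0 ==> r < norm z ==> Ln z \<in> rhp r"
  using exp_in_rhp[of r "Ln z"] by (cases "z = 0") auto

lemma not_const_exp: 
  assumes "a \<in> D" "open D" shows "\<not> (exp :: complex => complex) constant_on D"
proof
  assume "(exp :: complex => complex) constant_on D"
  then obtain c where c: "\<And>x. x \<in> D ==> exp x = c" by (auto simp: constant_on_def)
  have "open ((exp :: complex => complex) ` D)" using exp_map.open_image[OF assms(2)] .
  moreover have "exp ` D = {c}" using c assms(1) by auto
  ultimately show False using not_open_singleton[of c] by simp
qed

text \<open>The Eremenko-Lyubich class. Transcendence enters as a growth condition, which survives
  multiplication by a nonzero constant; the bound on \<open>f 0\<close> keeps lifts over
  \<open>{z. R0 < norm z}\<close> away from 0, so that they have logarithms.\<close>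

locale classB = entire_map +
  fixes R0 :: real
  assumes growth: "\<And>A B n. \<exists>z. A \<le> norm z \<and> B * norm z ^ n < norm (f z)"
    and R0: "1 \<le> R0" and asym: "asymptotic_values f \<subseteq> cball 0 R0"
    and crit: "\<And>z. deriv f z = 0 ==> norm (f z) \<le> R0" and f0: "norm (f 0) \<le> R0"
begin

lemma exp_lift:
  assumes "a \<in> rhp R0" "f z0 = exp a"
  obtains H where "H holomorphic_on rhp R0" "\<And>s. s \<in> rhp R0 ==> f (H s) = exp s" "H a = z0"
proof (rule holomorphic_lift[of "rhp R0" a exp z0])
  show "exp holomorphic_on rhp R0" by (intro holomorphic_intros)
  show "\<not> (exp :: complex => complex) constant_on rhp R0" using not_const_exp assms(1) rhp(1) by blast
  fix s assume s: "s \<in> rhp R0"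
  then have n: "R0 < norm (exp s)" using exp_in_rhp[of R0 s] R0 by auto
  then show "exp s \<notin> asymptotic_values f" using asym by auto
  show "local_degree f z dvd local_degree exp s" if "f z = exp s" for z
  proof -
    have "deriv f z \<noteq> 0" using crit[of z] that n by auto
    then have "local_degree f z = 1"
      using local_degree_eq_1_iff[OF entire open_UNIV connected_UNIV UNIV_I nonconst] by simp
    then show ?thesis by simp
  qed
qed (use that rhp assms in blast)+

lemma lift_facts:
  assumes "f (H s) = exp s" "s \<in> rhp R0"
  shows "H s \<noteq> 0" "deriv f (H s) \<noteq> 0"
proof -
  have "R0 < norm (f (H s))" using exp_in_rhp[of R0 s] R0 assms by auto
  then show "H s \<noteq> 0" "deriv f (H s) \<noteq> 0" using f0 crit[of "H s"] by auto
qed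

lemma bounded_image: "\<exists>N. \<forall>z. norm z \<le> M --> norm (f z) \<le> N"
proof -
  have "compact (f ` cball 0 M)" by (intro compact_continuous_image cont compact_cball)
  then obtain N where "\<And>x. x \<in> f ` cball 0 M ==> norm x \<le> N" using compact_imp_bounded bounded_iff by metis
  then show ?thesis by (intro exI[of _ N]) auto
qed

text \<open>A periodic lift would be a function of \<open>exp (- s / k)\<close> with a removable singularity at the
  origin; its reciprocal then covers a neighbourhood of infinity, on which \<open>f\<close> grows polynomially.\<close>

lemma no_period:
  assumes H: "H holomorphic_on rhp R0" "\<And>s. s \<in> rhp R0 ==> f (H s) = exp s"
    and k: "k > 0" and per: "\<And>s (m::int). s \<in> rhp R0 ==> H (s + of_int m * (2 * of_real pi * \<i> * of_nat k)) = H s"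
  shows False
proof -
  define \<rho> where "\<rho> = exp (- ln R0 / real k)"
  have \<rho>: "\<rho> > 0" by (simp add: \<rho>_def)
  define S where "S xi = - of_nat k * Ln xi" for xi :: complex
  have S1: "S xi \<in> rhp R0" if "xi \<noteq> 0" "norm xi < \<rho>" for xi
  proof -
    have "ln (norm xi) < - ln R0 / real k" using that ln_less_cancel_iff[of "norm xi" \<rho>] \<rho> unfolding \<rho>_def by simp
    then have "ln R0 < - (real k * ln (norm xi))" using k by (simp add: field_simps)
    then show ?thesis using that by (simp add: S_def rhp_def)
  qed
  have expS: "exp (S xi) = inverse (xi ^ k)" if "xi \<noteq> 0" for xi
    using that by (simp add: S_def exp_minus exp_of_nat_mult)
  define B where "B xi = inverse (H (S xi))" for xi
  have Hnz: "H s \<noteq> 0" if "s \<in> rhp R0" for s using lift_facts(1)[of H s] H(2) that by blast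
  have "B field_differentiable at xi" if xi: "xi \<in> ball 0 \<rho> - {0}" for xi
  proof -
    \<comment> \<open>Across the cut of \<open>Ln\<close> a local branch \<open>lg\<close> takes its
      place; the two differ by a multiple of \<open>2 * pi * \<i>\<close>, which \<open>H\<close>
      does not notice thanks to its period.\<close>
    define D where "D = ball xi (norm xi) \<inter> ball 0 \<rho>"
    have D: "open D" "convex D" "xi \<in> D" "D \<subseteq> ball 0 \<rho> - {0}" using xi by (auto simp: D_def convex_Int)
    obtain lg where l: "lg holomorphic_on D" "\<And>z. z \<in> D ==> exp (lg z) = z"
      by (rule holomorphic_log_convex[OF D(1,2) holomorphic_on_ident]) (use D(4) in blast)+
    have eq: "- of_nat k * lg z \<in> rhp R0 \<and> H (- of_nat k * lg z) = H (S z) \<and> S z \<in> rhp R0" if z: "z \<in> D" for z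
    proof -
      have z0: "z \<noteq> 0" "norm z < \<rho>" using D(4) z by auto
      have "exp (lg z) = exp (Ln z)" using l(2)[OF z] z0 by simp
      then obtain m :: int where "lg z = Ln z + of_int m * (2 * of_real pi * \<i>)" unfolding exp_eq by (auto simp: algebra_simps)
      then have "- of_nat k * lg z = S z + of_int (- m) * (2 * of_real pi * \<i> * of_nat k)" by (simp add: S_def algebra_simps)
      then show ?thesis using per[OF S1[OF z0], of "- m"] S1[OF z0] by (simp add: rhp_def)
    qed
    have "(\<lambda>z. - of_nat k * lg z) holomorphic_on D" by (intro holomorphic_intros l)
    then have "(H \<circ> (\<lambda>z. - of_nat k * lg z)) holomorphic_on D"
      by (rule holomorphic_on_compose_gen[OF _ H(1)]) (use eq in blast)
    then have "(\<lambda>z. inverse (H (S z))) holomorphic_on D"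
      using Hnz eq by (intro holomorphic_on_inverse) (auto simp: o_def cong: holomorphic_cong)
    then show ?thesis using holomorphic_on_imp_differentiable_at[OF _ D(1,3)] by (simp add: B_def[abs_def])
  qed
  then have Bh: "B holomorphic_on ball 0 \<rho> - {0}"
    by (simp add: holomorphic_on_def field_differentiable_at_within)
  have Blim: "(B \<longlongrightarrow> 0) (at 0)"
    unfolding tendsto_iff eventually_at
  proof (intro allI impI)
    fix e :: real assume e: "e > 0"
    obtain N where N: "\<And>z. norm z \<le> 1 / e ==> norm (f z) \<le> N" using bounded_image by blast
    define N' where "N' = max N 1"
    have N': "N' \<ge> 1" "N \<le> N'" by (auto simp: N'_def)
    show "\<exists>d>0. \<forall>x\<in>UNIV. x \<noteq> 0 \<and> dist x 0 < d --> dist (B x) 0 < e"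
    proof (intro exI[of _ "min \<rho> (1 / N')"] conjI ballI impI)
      show "0 < min \<rho> (1 / N')" using \<rho> N' by simp
      fix x :: complex assume x: "x \<noteq> 0 \<and> dist x 0 < min \<rho> (1 / N')"
      have sx: "S x \<in> rhp R0" using S1 x by simp
      have x1: "norm x < 1 / N'" "norm x \<le> 1" using x N' less_trans[of "norm x" "1 / N'"] by (auto simp: le_divide_eq_1 divide_le_eq intro: order_trans[OF less_imp_le])
      have "norm x ^ k \<le> norm x ^ 1" using x1 k by (intro power_decreasing) auto
      then have "norm x ^ k < 1 / N'" using x1 by simp
      then have "N' < inverse (norm x ^ k)" using N' x by (simp add: field_simps)
      moreover have "norm (f (H (S x))) = inverse (norm x ^ k)"
        using H(2)[OF sx] expS[of x] x by (simp add: norm_inverse norm_power)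
      ultimately have "1 / e < norm (H (S x))" using N[of "H (S x)"] N' by linarith
      then have "1 < e * norm (H (S x))" using e by (simp add: divide_less_eq mult.commute)
      then show "dist (B x) 0 < e" using e Hnz[OF sx]
        by (simp add: B_def norm_inverse inverse_eq_divide norm_divide divide_less_eq)
    qed
  qed
  then have "((\<lambda>z. (z - 0) * B z) \<longlongrightarrow> (0 - 0) * 0) (at 0)" by (intro tendsto_intros)
  then obtain G where G: "G holomorphic_on ball 0 \<rho>" "\<And>z. z \<in> ball 0 \<rho> - {0} ==> G z = B z"
    using holomorphic_on_extend_lim[OF Bh] \<rho> by auto
  have Gc: "continuous_on (ball 0 \<rho>) G" using G(1) by (rule holomorphic_on_imp_continuous_on)
  have "G \<midarrow>0\<rightarrow> G 0" using Gc \<rho> by (simp add: continuous_on_eq_continuous_at isCont_def)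
  moreover have "G \<midarrow>0\<rightarrow> 0"
    by (rule Lim_transform_within_open[OF Blim open_ball[of 0 \<rho>]]) (use \<rho> G(2) in auto)
  ultimately have G0: "G 0 = 0" by (rule LIM_unique)
  have Gnz: "G z \<noteq> 0" if "z \<in> ball 0 \<rho> - {0}" for z
    using G(2)[OF that] Hnz[OF S1] that by (simp add: B_def)
  have dG: "(G has_field_derivative deriv G 0) (at 0)" using holomorphic_derivI[OF G(1)] \<rho> by simp
  then have "((\<lambda>h. G h / h) \<longlongrightarrow> deriv G 0) (at 0)" using G0 by (simp add: DERIV_def)
  then have "((\<lambda>h. norm (G h / h)) \<longlongrightarrow> norm (deriv G 0)) (at 0)" by (rule tendsto_norm)
  then have "\<forall>\<^sub>F h in at 0. norm (G h / h) < norm (deriv G 0) + 1" by (rule order_tendstoD) simp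
  then obtain d where d: "d > 0" "\<And>h. h \<noteq> 0 ==> norm h < d ==> norm (G h / h) < norm (deriv G 0) + 1"
    unfolding eventually_at by auto
  define C where "C = norm (deriv G 0) + 1"
  have C: "C > 0" by (simp add: C_def add_nonneg_pos)
  define r where "r = min d \<rho>"
  have r: "r > 0" "r \<le> \<rho>" "r \<le> d" using d(1) \<rho> by (auto simp: r_def)
  have "open (G ` ball 0 r)"
  proof (rule open_mapping_thm[OF G(1) open_ball connected_ball open_ball])
    show "ball (0::complex) r \<subseteq> ball 0 \<rho>" using r by auto
    show "\<not> G constant_on ball 0 \<rho>"
    proof
      assume "G constant_on ball 0 \<rho>"
      then obtain c where c: "\<And>z. z \<in> ball 0 \<rho> ==> G z = c" by (auto simp: constant_on_def)
      have "G (of_real (\<rho> / 2)) \<noteq> 0" by (rule Gnz) (use \<rho> in auto)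
      then show False using c[of "of_real (\<rho> / 2)"] c[of 0] G0 \<rho> by auto
    qed
  qed
  moreover have "0 \<in> G ` ball 0 r" using G0 r(1) by (metis centre_in_ball image_eqI)
  ultimately obtain \<eta> where \<eta>: "\<eta> > 0" "ball 0 \<eta> \<subseteq> G ` ball 0 r" by (meson openE)
  \<comment> \<open>\<open>G\<close> covers a neighbourhood of 0, so every large \<open>z\<close> is
    \<open>H (S xi)\<close> with \<open>norm xi\<close> at least \<open>1 / (C * norm z)\<close>,
    and \<open>f z\<close> is the inverse of \<open>xi ^ k\<close>.\<close>
  have "norm (f z) \<le> C ^ k * norm z ^ k" if z: "norm z \<ge> 2 / \<eta>" for z
  proof -
    have "norm z > 0" using \<eta>(1) z by (meson divide_pos_pos less_le_trans zero_less_numeral)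
    then have z0: "z \<noteq> 0" by simp
    have "norm (1 / z) < \<eta>" using z \<eta>(1) \<open>norm z > 0\<close> by (simp add: norm_divide field_simps)
    then obtain xi where xi: "xi \<in> ball 0 r" "G xi = 1 / z" using \<eta>(2) by (metis (no_types, lifting) imageE mem_ball_0 subsetD)
    have xi0: "xi \<noteq> 0" using xi(2) G0 z0 by auto
    have xi\<rho>: "xi \<in> ball 0 \<rho> - {0}" using xi(1) xi0 r by auto
    have "H (S xi) = z" using G(2)[OF xi\<rho>] xi(2) by (simp add: B_def inverse_eq_divide)
    then have "norm (f z) = inverse (norm xi) ^ k"
      using H(2)[OF S1] xi\<rho> expS[OF xi0] by (metis DiffD1 mem_ball_0 xi0 norm_inverse norm_power power_inverse)
    also have "\<dots> \<le> (C * norm z) ^ k"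
    proof (rule power_mono)
      have "norm (G xi / xi) < C" unfolding C_def by (rule d(2)[OF xi0]) (use xi(1) r in auto)
      then show "inverse (norm xi) \<le> C * norm z" using xi(2) xi0 z0 by (simp add: norm_divide norm_mult field_simps)
    qed simp
    finally show ?thesis by (simp add: power_mult_distrib)
  qed
  then show False using growth[of "2 / \<eta>" "C ^ k" k] by (meson not_le)
qed

text \<open>\<open>u\<close> is an inverse branch of the logarithmic transform of \<open>f\<close>
  in the sense of Eremenko and Lyubich.\<close>

lemma log_lift:
  assumes a: "a \<in> rhp R0" and z: "f z = exp a" "exp b = z"
  obtains u where "u holomorphic_on rhp R0" "\<And>s. s \<in> rhp R0 ==> f (exp (u s)) = exp s" "u a = b"
proof -
  obtain H where H: "H holomorphic_on rhp R0" "\<And>s. s \<in> rhp R0 ==> f (H s) = exp s" "H a = z"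
    by (rule exp_lift[OF a z(1)]) (rule that; assumption)
  have Hnz: "H s \<noteq> 0" if "s \<in> rhp R0" for s using lift_facts(1)[of H s] H(2) that by blast
  obtain u0 where u0: "u0 holomorphic_on rhp R0" "\<And>s. s \<in> rhp R0 ==> exp (u0 s) = H s"
    by (rule holomorphic_log_convex[OF rhp(1,2) H(1) Hnz]) (assumption | (rule that; assumption))+
  show ?thesis
  proof (rule that[of "\<lambda>s. u0 s - u0 a + b"])
    show "(\<lambda>s. u0 s - u0 a + b) holomorphic_on rhp R0" by (intro holomorphic_intros u0)
    show "f (exp (u0 s - u0 a + b)) = exp s" if "s \<in> rhp R0" for s
      using u0(2)[OF that] u0(2)[OF a] H(2)[OF that] H(3) z(2) by (auto simp: exp_add exp_diff)
  qed simp
qed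

text \<open>Equal values of \<open>exp (u s)\<close> at \<open>s1\<close> and \<open>s2\<close>
  force \<open>s1 - s2\<close> to be a nonzero multiple \<open>c\<close> of
  \<open>2 * pi * \<i>\<close>; by uniqueness of lifts the branch would then have period
  \<open>c\<close>, which \<open>no_period\<close> excludes.\<close>

lemma lift_log_inj:
  assumes uh: "u holomorphic_on rhp R0" and u: "\<And>s. s \<in> rhp R0 ==> f (exp (u s)) = exp s"
    and s: "s1 \<in> rhp R0" "s2 \<in> rhp R0" and eq: "u s1 = u s2 + 2 * of_real pi * \<i>"
  shows False
proof -
  define H where "H s = exp (u s)" for s
  have H: "H holomorphic_on rhp R0" "\<And>s. s \<in> rhp R0 ==> f (H s) = exp s"
    unfolding H_def using u by (auto intro!: holomorphic_intros uh)
  have "H s1 = H s2" using eq by (simp add: H_def exp_add)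
  then have "exp s1 = exp s2" using H(2) s by metis
  then obtain n :: int where n: "s1 = s2 + (of_int (2 * n) * pi) * \<i>" unfolding exp_eq by blast
  have n0: "n \<noteq> 0" using n eq by auto
  define c where "c = 2 * of_real pi * \<i> * of_int n"
  have sc: "s + c \<in> rhp R0" if "s \<in> rhp R0" for s using that by (simp add: rhp_def c_def)
  have s12: "s1 = s2 + c" using n by (simp add: c_def)
  have "exp c = 1" unfolding exp_eq_1 c_def by auto
  have Hc: "H (s + c) = H s" if "s \<in> rhp R0" for s
  proof (rule hol_lift_unique[OF rhp(1,3), of "\<lambda>s. H (s + c)" R0 H s2])
    have "(H \<circ> (\<lambda>s. s + c)) holomorphic_on rhp R0"
      by (rule holomorphic_on_compose_gen[OF _ H(1)]) (use sc in \<open>auto intro!: holomorphic_intros\<close>)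
    then show "(\<lambda>s. H (s + c)) holomorphic_on rhp R0" by (simp add: o_def)
    show "f (H (x + c)) = f (H x)" if "x \<in> rhp R0" for x
      using H(2)[OF that] H(2)[OF sc[OF that]] \<open>exp c = 1\<close> by (simp add: exp_add)
    show "H (s2 + c) = H s2" using \<open>H s1 = H s2\<close> s12 by simp
    show "deriv f (H (s2 + c)) \<noteq> 0" using lift_facts(2)[of H s1] H(2) s s12 by auto
  qed (use H s that in auto)
  have per: "H (s + of_int m * c) = H s" if "s \<in> rhp R0" for s and m :: int
  proof (induction m rule: int_induct[of _ 0])
    case (step1 m)
    have "s + of_int m * c \<in> rhp R0" using that by (simp add: rhp_def c_def)
    from Hc[OF this] show ?case using step1 by (simp add: algebra_simps)
  next
    case (step2 m)
    have "s + of_int (m - 1) * c \<in> rhp R0" using that by (simp add: rhp_def c_def)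
    from Hc[OF this] show ?case using step2 by (simp add: algebra_simps)
  qed simp
  define k where "k = nat \<bar>n\<bar>"
  have k: "k > 0" using n0 by (simp add: k_def)
  have "of_int m * (2 * of_real pi * \<i> * of_nat k) = of_int (m * sgn n) * c" for m
    by (cases "n > 0") (auto simp: k_def c_def sgn_if)
  then have "H (s + of_int m * (2 * of_real pi * \<i> * of_nat k)) = H s" if "s \<in> rhp R0" for s and m :: int
    using per[OF that] by metis
  then show False using no_period[OF H k] by blast
qed

text \<open>By Bloch's theorem the image under \<open>u\<close> of the disc of radius
  \<open>Re a - ln R0\<close> about \<open>a\<close> contains a disc of radius
  \<open>norm (deriv u a) * (Re a - ln R0) / 12\<close>. If this exceeded \<open>pi\<close>, two
  values of \<open>u\<close> would differ by \<open>2 * pi * \<i>\<close>.\<close>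

lemma log_lift_deriv:
  assumes u: "u holomorphic_on rhp R0" "\<And>s. s \<in> rhp R0 ==> f (exp (u s)) = exp s" and a: "a \<in> rhp R0"
  shows "norm (deriv u a) * (Re a - ln R0) \<le> 12 * pi"
proof (rule ccontr)
  assume neg: "\<not> ?thesis"
  define r where "r = Re a - ln R0"
  have r: "r > 0" using a by (simp add: r_def rhp_def)
  have sub: "ball a r \<subseteq> rhp R0"
  proof
    fix s assume "s \<in> ball a r"
    then have "\<bar>Re (s - a)\<bar> < r" using abs_Re_le_cmod[of "s - a"] by (simp add: dist_norm norm_minus_commute)
    then show "s \<in> rhp R0" by (simp add: rhp_def r_def)
  qed
  define r' where "r' = r * norm (deriv u a) / 12"
  have r': "r' > pi" using neg by (simp add: r'_def r_def mult.commute)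
  obtain b where b: "ball b r' \<subseteq> u ` ball a r"
    using Bloch[OF holomorphic_on_subset[OF u(1) sub] r, of r'] by (auto simp: r'_def)
  have "b + \<i> * pi \<in> ball b r'" "b - \<i> * pi \<in> ball b r'" using r' by (auto simp: dist_norm norm_mult)
  then have "b + \<i> * pi \<in> u ` rhp R0" "b - \<i> * pi \<in> u ` rhp R0" using b sub by blast+
  then obtain s1 s2 where s: "s1 \<in> rhp R0" "b + \<i> * pi = u s1" "s2 \<in> rhp R0" "b - \<i> * pi = u s2"
    by (elim imageE)
  have "u s1 = u s2 + 2 * of_real pi * \<i>" using s(2,4)[symmetric] by simp
  then show False using lift_log_inj[OF u s(1,3)] by blast
qed

text \<open>The Eremenko-Lyubich estimate: \<open>log_lift_deriv\<close> expressed through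
  \<open>deriv f\<close> by the chain rule.\<close>

lemma expansion:
  assumes z: "R0 < norm (f z)"
  shows "norm (f z) * ln (norm (f z) / R0) \<le> 12 * pi * (norm z * norm (deriv f z))"
proof -
  define a where "a = Ln (f z)"
  have fz: "f z \<noteq> 0" using z R0 by auto
  have a: "a \<in> rhp R0" unfolding a_def by (rule Ln_in_rhp) (use z R0 in auto)
  have ea: "exp a = f z" using fz by (simp add: a_def)
  have z0: "z \<noteq> 0" using z f0 by auto
  obtain u where u: "u holomorphic_on rhp R0" "\<And>s. s \<in> rhp R0 ==> f (exp (u s)) = exp s" "u a = Ln z"
    by (rule log_lift[OF a ea[symmetric] exp_Ln[OF z0]]) (rule that; assumption)
  have "norm (deriv u a) * (Re a - ln R0) \<le> 12 * pi" by (rule log_lift_deriv[OF u(1,2) a])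
  moreover have "Re a - ln R0 = ln (norm (f z) / R0)"
    using fz R0 by (simp add: a_def ln_div)
  moreover have "deriv exp a = deriv f (exp (u a)) * deriv (\<lambda>s. exp (u s)) a"
    by (rule deriv_lift[OF rhp(1) _ u(2) a]) (intro holomorphic_intros u)
  moreover have "deriv (\<lambda>s. exp (u s)) a = exp (u a) * deriv u a"
    by (rule exp_map.deriv_lift[OF rhp(1) u(1) refl a, simplified])
  ultimately have 1: "norm (deriv u a) * ln (norm (f z) / R0) \<le> 12 * pi" and 2: "f z = deriv f z * (z * deriv u a)"
    using u(3) z0 ea by simp_all
  have "norm (f z) * ln (norm (f z) / R0) = (norm z * norm (deriv f z)) * (norm (deriv u a) * ln (norm (f z) / R0))"
    by (subst 2) (simp add: norm_mult mult_ac)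
  also have "\<dots> \<le> (norm z * norm (deriv f z)) * (12 * pi)" by (intro mult_left_mono 1) auto
  finally show ?thesis by (simp add: mult_ac)
qed

text \<open>If the whole circle were mapped outside \<open>cball 0 R0\<close>, its image would have
  a logarithm \<open>\<sigma>\<close>, and \<open>u \<circ> \<sigma>\<close> would follow the
  argument of the circle once around, ending \<open>2 * pi * \<i>\<close> away from its start;
  \<open>lift_log_inj\<close> forbids this.\<close>

lemma no_circle:
  assumes r: "r > 0" shows "\<exists>z. norm z = r \<and> norm (f z) \<le> R0"
proof (rule ccontr)
  assume "\<not> ?thesis"
  then have big: "R0 < norm (f z)" if "norm z = r" for z using that by force
  define c where "c t = of_real r * exp (\<i> * of_real t)" for t :: real
  have nc: "norm (c t) = r" for t using r by (simp add: c_def norm_mult)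
  have cc: "continuous_on A c" for A unfolding c_def by (intro continuous_intros)
  have "continuous_on {0..2*pi} (\<lambda>t. f (c t))" by (rule continuous_on_compose2[OF cont[of UNIV] cc]) auto
  moreover have "f (c t) \<noteq> 0" for t using big[OF nc[of t]] R0 by auto
  ultimately obtain \<sigma> where \<sigma>: "continuous_on {0..2*pi} \<sigma>" "\<And>t. t \<in> {0..2*pi} ==> f (c t) = exp (\<sigma> t)"
    using continuous_logarithm_on_contractible[of "{0..2*pi}" "\<lambda>t. f (c t)"]
    by (metis convex_imp_contractible convex_real_interval(5))
  have sr: "\<sigma> t \<in> rhp R0" if "t \<in> {0..2*pi}" for t
    using exp_in_rhp[of R0 "\<sigma> t"] big[OF nc[of t]] \<sigma>(2)[OF that] R0 by simp
  have t0: "(0::real) \<in> {0..2*pi}" "2 * pi \<in> {0..2*pi}" by auto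
  have c0: "c 0 \<noteq> 0" using nc[of 0] r by auto
  obtain u where u: "u holomorphic_on rhp R0" "\<And>s. s \<in> rhp R0 ==> f (exp (u s)) = exp s" "u (\<sigma> 0) = Ln (c 0)"
    by (rule log_lift[OF sr[OF t0(1)] \<sigma>(2)[OF t0(1)] exp_Ln[OF c0]]) (rule that; assumption)
  have u\<sigma>: "continuous_on {0..2*pi} (\<lambda>t. u (\<sigma> t))"
    using sr by (auto intro!: continuous_on_compose2[OF holomorphic_on_imp_continuous_on[OF u(1)] \<sigma>(1)])
  have con: "connected {0..2*pi}" by simp
  have Hc: "exp (u (\<sigma> t)) = c t" if "t \<in> {0..2*pi}" for t
    by (rule lift_unique[OF con continuous_on_exp[OF u\<sigma>] cc _ _ t0(1) _ that])
      (use u(2,3) sr \<sigma>(2) lift_facts(2)[of "\<lambda>s. exp (u s)"] c0 in auto)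
  have "u (\<sigma> (2 * pi)) = u (\<sigma> 0) + \<i> * of_real (2 * pi)"
  proof (rule exp_map.lift_unique[OF con u\<sigma>, of "\<lambda>t. u (\<sigma> 0) + \<i> * of_real t" 0 "2 * pi"])
    show "continuous_on {0..2 * pi} (\<lambda>t. u (\<sigma> 0) + \<i> * of_real t)" by (intro continuous_intros)
    show "exp (u (\<sigma> t)) = exp (u (\<sigma> 0) + \<i> * of_real t)" if "t \<in> {0..2*pi}" for t
      using Hc[OF that] Hc[OF t0(1)] by (simp add: exp_add c_def)
  qed (use t0 in auto)
  then show False using lift_log_inj[OF u(1,2) sr[OF t0(2)] sr[OF t0(1)]] by (simp add: mult_ac)
qed

lemma unbounded_circle: "\<exists>s0. \<forall>s\<ge>s0. \<exists>z. norm z = s \<and> B < norm (f z)"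
proof (rule ccontr)
  assume "\<not> ?thesis"
  then have *: "\<And>s0. \<exists>s\<ge>s0. \<forall>z. norm z = s --> norm (f z) \<le> B" by (meson not_le)
  have "norm (f z) \<le> B" for z
  proof -
    obtain s where s: "s \<ge> norm z + 1" "\<And>w. norm w = s ==> norm (f w) \<le> B" using * by blast
    have s0: "s > 0" using s(1) norm_ge_zero[of z] by linarith
    show ?thesis
      by (rule maximum_modulus_frontier[of f "cball 0 s" B z])
        (use s s0 in \<open>auto intro: cont holomorphic_on_subset[OF entire] simp: frontier_cball\<close>)
  qed
  then show False using growth[of 0 B 0] by (auto simp: not_less[symmetric])
qed

text \<open>Between a small value (\<open>no_circle\<close>) and a large one (growth), some point of
  a large circle satisfies \<open>norm (f z) = norm z\<close>. In the logarithmic coordinate an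
  inverse branch moves the corresponding point \<open>a\<close> by at most \<open>2 * pi\<close> and
  contracts, so Banach's theorem applies.\<close>

lemma large_fixed_point: "\<exists>a. norm a > R \<and> f a = a"
proof -
  have big: "\<exists>r>R'. \<exists>z. norm z = r \<and> norm (f z) \<ge> r" for R'
  proof -
    obtain z where z: "max R' 0 + 1 \<le> norm z" "1 * norm z ^ 1 < norm (f z)" using growth by blast
    then show ?thesis by (intro exI[of _ "norm z"]) auto
  qed
  \<comment> \<open>\<open>48 * pi\<close> makes the derivative bound
    \<open>12 * pi / (Re s - ln R0)\<close> at most \<open>1/4\<close> on \<open>cball a 10\<close>,
    and \<open>10 / 4 + 2 * pi < 10\<close> gives a self-map. The factor \<open>exp 10\<close> pays
    for the distance of the fixed point from \<open>a\<close>.\<close>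
  define R' where "R' = max (R0 * exp (48 * pi + 10)) (\<bar>R\<bar> * exp 10)"
  obtain r z1 where r: "r > R'" "norm z1 = r" "norm (f z1) \<ge> r" using big by blast
  have R'0: "R' \<ge> R0 * exp (48 * pi + 10)" "R' \<ge> \<bar>R\<bar> * exp 10" by (auto simp: R'_def)
  have "R0 * 1 \<le> R0 * exp (48 * pi + 10)" using R0 by (intro mult_left_mono) auto
  then have rR0: "r > R0" and r0: "r > 0" using r(1) R'0 R0 by linarith+
  obtain z2 where z2: "norm z2 = r" "norm (f z2) \<le> R0" using no_circle[OF r0] by blast
  have "connected ((\<lambda>z. norm (f z)) ` sphere 0 r)"
    by (intro connected_continuous_image connected_sphere continuous_intros cont) simp
  moreover have "norm (f z2) \<in> (\<lambda>z. norm (f z)) ` sphere 0 r" "norm (f z1) \<in> (\<lambda>z. norm (f z)) ` sphere 0 r"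
    using z2 r by auto
  ultimately have "r \<in> (\<lambda>z. norm (f z)) ` sphere 0 r"
    using connected_contains_Icc z2(2) rR0 r(3) by (smt (verit) atLeastAtMost_iff subsetD)
  then obtain z where z: "norm z = r" "norm (f z) = r" by auto
  define a where "a = Ln (f z)"
  have fz: "f z \<noteq> 0" "z \<noteq> 0" using z r0 by auto
  have a: "a \<in> rhp R0" unfolding a_def by (rule Ln_in_rhp) (use z rR0 R0 in auto)
  have ea: "exp a = f z" using fz by (simp add: a_def)
  obtain u where u: "u holomorphic_on rhp R0" "\<And>s. s \<in> rhp R0 ==> f (exp (u s)) = exp s" "u a = Ln z"
    by (rule log_lift[OF a ea[symmetric] exp_Ln[OF fz(2)]]) (rule that; assumption)
  have Rea: "Re a = ln r" using fz z by (simp add: a_def)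
  have lnr: "ln r > 48 * pi + 10 + ln R0"
  proof -
    have "0 < R0 * exp (48 * pi + 10)" using R0 by simp
    moreover have "R0 * exp (48 * pi + 10) < r" using r(1) R'0(1) by linarith
    ultimately have "ln (R0 * exp (48 * pi + 10)) < ln r" by simp
    then show ?thesis using R0 by (simp add: ln_mult)
  qed
  have dist1: "norm (u a - a) \<le> 2 * pi"
  proof -
    have e: "u a - a = Ln z - Ln (f z)" unfolding u(3) by (simp add: a_def)
    have "Re (Ln z - Ln (f z)) = 0" using fz z by simp
    then have "norm (u a - a) \<le> \<bar>Im (Ln z) - Im (Ln (f z))\<bar>"
      unfolding e using cmod_le[of "Ln z - Ln (f z)"] by simp
    then show ?thesis using Im_Ln_le_pi[of z] mpi_less_Im_Ln[of z] Im_Ln_le_pi[of "f z"] mpi_less_Im_Ln[of "f z"] fz by linarith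
  qed
  have sub: "s \<in> rhp R0 \<and> Re s - ln R0 \<ge> 48 * pi" if "s \<in> cball a 10" for s
  proof -
    have "\<bar>Re (s - a)\<bar> \<le> 10" using that abs_Re_le_cmod[of "s - a"] by (simp add: dist_norm norm_minus_commute)
    then have "Re s \<ge> ln r - 10" using Rea by simp
    then have "Re s - ln R0 \<ge> 48 * pi" "ln R0 < Re s" using lnr pi_gt_zero by linarith+
    then show ?thesis by (simp add: rhp_def)
  qed
  have dle: "norm (deriv u s) \<le> 1 / 4" if "s \<in> cball a 10" for s
  proof -
    have "norm (deriv u s) * (48 * pi) \<le> norm (deriv u s) * (Re s - ln R0)"
      using sub[OF that] by (intro mult_left_mono) auto
    also have "\<dots> \<le> 12 * pi" using log_lift_deriv[OF u(1,2)] sub[OF that] by blast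
    finally show ?thesis using pi_gt_zero by (simp add: field_simps)
  qed
  have lip: "norm (u x - u y) \<le> 1 / 4 * norm (x - y)" if "x \<in> cball a 10" "y \<in> cball a 10" for x y
  proof (rule field_differentiable_bound[OF convex_cball[of a 10], of u "deriv u"])
    fix s assume "s \<in> cball a 10"
    then show "(u has_field_derivative deriv u s) (at s within cball a 10)" "norm (deriv u s) \<le> 1 / 4"
      using holomorphic_derivI[OF u(1) rhp(1)] sub dle has_field_derivative_at_within by blast+
  qed (use that in auto)
  have "\<exists>!x\<in>cball a 10. u x = x"
  proof (rule Banach_fix[of "cball a 10" "1/4"])
    show "complete (cball a 10)" by (simp add: compact_imp_complete)
    show "u ` cball a 10 \<subseteq> cball a 10"
    proof
      fix y assume "y \<in> u ` cball a 10"
      then obtain x where x: "x \<in> cball a 10" "y = u x" by blast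
      have "norm (u x - u a) \<le> 1 / 4 * norm (x - a)" using lip x by simp
      moreover have "norm (x - a) \<le> 10" using x by (simp add: dist_norm norm_minus_commute)
      ultimately have "norm (u x - a) \<le> 10 / 4 + 2 * pi" using dist1 norm_triangle_le[of "u x - u a" "u a - a"] by (simp add: norm_triangle_le)
      then show "y \<in> cball a 10" using x pi_less_4 pi_approx by (simp add: dist_norm norm_minus_commute)
    qed
    show "dist (u x) (u y) \<le> 1 / 4 * dist x y" if "x \<in> cball a 10" "y \<in> cball a 10" for x y
      using lip[OF that] by (simp add: dist_norm)
  qed auto
  then obtain s where s: "s \<in> cball a 10" "u s = s" by blast
  have "f (exp s) = exp s" using u(2)[of s] s(2) sub[OF s(1)] by simp
  moreover have "norm (exp s) > R"
  proof -
    have "\<bar>Re (s - a)\<bar> \<le> 10" using s abs_Re_le_cmod[of "s - a"] by (simp add: dist_norm norm_minus_commute)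
    then have "Re s \<ge> ln r - 10" using Rea by simp
    then have "exp (Re s) \<ge> exp (ln r - 10)" by simp
    then have "exp (Re s) \<ge> r / exp 10" using r0 by (simp add: exp_diff)
    moreover have "r / exp 10 > \<bar>R\<bar>" using r(1) R'0(2) by (simp add: less_divide_eq)
    ultimately show ?thesis by simp
  qed
  ultimately show ?thesis by blast
qed

end

section \<open>Fatou and Julia sets\<close>

lemma infinite_subseq:
  assumes "infinite {n::nat. P n}"
  obtains r :: "nat => nat" where "strict_mono r" "\<And>n. P (r n)"
  using infinite_enumerate[OF assms] by auto

text \<open>The maximum principle for the reciprocal; it serves below where Rouche's theorem is
  customary.\<close>

lemma nonvanishing_min_modulus:
  assumes "\<phi> holomorphic_on ball c r" "continuous_on (cball c r) \<phi>" "r > 0"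
    and "\<And>z. z \<in> sphere c r ==> m \<le> norm (\<phi> z)" "norm (\<phi> c) < m"
  shows "\<exists>z\<in>ball c r. \<phi> z = 0"
proof (rule ccontr)
  assume neg: "\<not> ?thesis"
  have m: "m > 0" using assms(5) norm_ge_zero[of "\<phi> c"] by linarith
  have nz: "\<phi> z \<noteq> 0" if "z \<in> cball c r" for z
  proof (cases "z \<in> ball c r")
    case False
    then have "z \<in> sphere c r" using that by auto
    then show ?thesis using assms(4)[of z] m by auto
  qed (use neg in blast)
  have "norm (inverse (\<phi> c)) \<le> inverse m"
  proof (rule maximum_modulus_frontier[of "\<lambda>z. inverse (\<phi> z)" "cball c r"])
    show "(\<lambda>z. inverse (\<phi> z)) holomorphic_on interior (cball c r)"
      using assms(1) nz by (intro holomorphic_intros) auto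
    show "continuous_on (closure (cball c r)) (\<lambda>z. inverse (\<phi> z))"
      using assms(2) nz by (intro continuous_intros) auto
    show "norm (inverse (\<phi> z)) \<le> inverse m" if "z \<in> frontier (cball c r)" for z
      using assms(4)[of z] that m by (simp add: norm_inverse frontier_cball le_imp_inverse_le)
  qed (use assms in auto)
  then have "m \<le> norm (\<phi> c)" using m nz[of c] assms(3) by (simp add: norm_inverse inverse_le_iff_le)
  then show False using assms(5) by simp
qed

text \<open>Nothing is known on the boundary circle, so Cauchy's inequality is used on radii
  \<open>t * s\<close> with \<open>t\<close> tending to 1.\<close>

lemma cauchy_deriv_bound:
  assumes "h holomorphic_on ball a s" "s > 0" "\<And>z. z \<in> ball a s ==> norm (h z) \<le> B"
  shows "norm (deriv h a) \<le> B / s"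
proof (rule field_le_mult_one_interval)
  fix t :: real assume t: "0 < t" "t < 1"
  have ts: "t * s < s" "t * s > 0" using t assms(2) by auto
  have sub: "cball a (t * s) \<subseteq> ball a s" using ts by auto
  have "norm ((deriv ^^ 1) h a) \<le> fact 1 * B / (t * s) ^ 1"
  proof (rule Cauchy_inequality)
    show "h holomorphic_on ball a (t * s)" using assms(1) sub ball_subset_cball holomorphic_on_subset by blast
    show "continuous_on (cball a (t * s)) h"
      using assms(1) sub holomorphic_on_imp_continuous_on continuous_on_subset by blast
    show "norm (h x) \<le> B" if "norm (a - x) = t * s" for x
      using assms(3)[of x] that ts by (auto simp: dist_norm)
  qed (use ts in auto)
  then show "t * norm (deriv h a) \<le> B / s" using t assms(2) by (simp add: field_simps)
qed

lemma entire_power: "m > 0 ==> entire_map (\<lambda>z. z ^ m)"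
proof
  assume m: "m > 0"
  show "(\<lambda>z. z ^ m) holomorphic_on (UNIV :: complex set)" by (intro holomorphic_intros)
  show "\<not> (\<lambda>z::complex. z ^ m) constant_on UNIV"
  proof
    assume "(\<lambda>z::complex. z ^ m) constant_on UNIV"
    then obtain c :: complex where "\<And>z. z ^ m = c" by (auto simp: constant_on_def)
    from this[of 0] this[of 1] show False using m by (simp add: power_0_left)
  qed
qed

text \<open>A root is a lift through the power map, which ramifies only over 0 and has no finite
  asymptotic values.\<close>

lemma holomorphic_root:
  assumes D: "open D" "simply_connected D" "D \<noteq> UNIV" "a \<in> D" and h: "h holomorphic_on D" "\<not> h constant_on D"
    and m: "m > 0" and dvd: "\<And>zeta. zeta \<in> D ==> h zeta = 0 ==> m dvd local_degree h zeta"
  obtains u where "u holomorphic_on D" "\<And>zeta. zeta \<in> D ==> u zeta ^ m = h zeta"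
proof -
  interpret pw: entire_map "\<lambda>z::complex. z ^ m" using entire_power[OF m] .
  define z0 where "z0 = (if h a = 0 then 0 else exp (Ln (h a) / of_nat m))"
  have z0: "z0 ^ m = h a" using m by (simp add: z0_def exp_of_nat_mult[symmetric])
  show ?thesis
  proof (rule pw.holomorphic_lift[OF D h, of z0])
    fix zeta assume zeta: "zeta \<in> D"
    show "h zeta \<notin> asymptotic_values (\<lambda>z. z ^ m)"
    proof
      assume "h zeta \<in> asymptotic_values (\<lambda>z. z ^ m)"
      then obtain \<gamma> where g: "filterlim \<gamma> at_infinity at_top" "((\<lambda>t. \<gamma> t ^ m) \<longlongrightarrow> h zeta) (at_top :: real filter)"
        by (auto simp: asymptotic_values_def)
      have "filterlim (\<lambda>t. \<gamma> t ^ m) at_infinity at_top"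
        by (rule filterlim_compose[OF filterlim_power_at_infinity g(1)]) (use m in simp)
      then show False using not_tendsto_and_filterlim_at_infinity[OF trivial_limit_at_top_linorder g(2)] by auto
    qed
    show "local_degree (\<lambda>z. z ^ m) z dvd local_degree h zeta" if z: "z ^ m = h zeta" for z
    proof (cases "z = 0")
      case True
      have "local_degree (\<lambda>z::complex. z ^ m) 0 = m"
        by (rule local_degree_eqI[of UNIV _ "\<lambda>_. 1"]) (use m in \<open>auto simp: power_0_left\<close>)
      then show ?thesis using dvd[OF zeta] z True m by (simp add: power_0_left)
    next
      case False
      have "((\<lambda>z::complex. z ^ m) has_field_derivative of_nat m * z ^ (m - 1)) (at z)"
        by (auto intro!: derivative_eq_intros)
      then have "deriv (\<lambda>z::complex. z ^ m) z \<noteq> 0" using False m by (simp add: DERIV_imp_deriv)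
      then have "local_degree (\<lambda>z. z ^ m) z = 1"
        using local_degree_eq_1_iff[OF pw.entire open_UNIV connected_UNIV UNIV_I pw.nonconst] by simp
      then show ?thesis by simp
    qed
  qed (use z0 that in auto)
qed

lemma open_fatou: "open (fatou_set f)"
  unfolding fatou_set_def open_subopen[of "{z. _ z}"] by blast

definition sphere_limit :: "complex set => (nat => complex => complex) => bool" where
  "sphere_limit S h \<longleftrightarrow> (\<exists>l. uniform_limit S h l sequentially) \<or> (\<forall>B. \<forall>\<^sub>F n in sequentially. \<forall>w\<in>S. B < norm (h n w))"

text \<open>No continuity of \<open>p\<close> is asked for, so that a merely set-theoretic section
  of \<open>f\<close> can push normality forward.\<close>

lemma sphere_limit_pullback:
  assumes h: "sphere_limit T h" and p: "\<And>x. x \<in> S ==> p x \<in> T" "\<And>n x. x \<in> S ==> h' n x = h n (p x)"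
  shows "sphere_limit S h'"
  using h[unfolded sphere_limit_def]
proof
  assume "\<exists>l. uniform_limit T h l sequentially"
  then obtain l where l: "uniform_limit T h l sequentially" by blast
  have "uniform_limit S h' (\<lambda>x. l (p x)) sequentially"
    unfolding uniform_limit_iff
  proof (intro allI impI)
    fix e :: real assume "e > 0"
    then have "\<forall>\<^sub>F n in sequentially. \<forall>x\<in>T. dist (h n x) (l x) < e" using l by (simp only: uniform_limit_iff)
    then show "\<forall>\<^sub>F n in sequentially. \<forall>x\<in>S. dist (h' n x) (l (p x)) < e" by eventually_elim (simp add: p)
  qed
  then show ?thesis by (auto simp: sphere_limit_def)
next
  assume *: "\<forall>B. \<forall>\<^sub>F n in sequentially. \<forall>w\<in>T. B < norm (h n w)"
  have "\<forall>\<^sub>F n in sequentially. \<forall>w\<in>S. B < norm (h' n w)" for B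
    using *[rule_format, of B] by eventually_elim (simp add: p)
  then show ?thesis by (simp add: sphere_limit_def)
qed

definition normal_iterates :: "(complex => complex) => complex set => bool" where
  "normal_iterates f S \<longleftrightarrow> (\<forall>k::nat=>nat. \<exists>r. strict_mono r \<and> sphere_limit S (\<lambda>n. f ^^ k (r n)))"

text \<open>Uniform convergence on one closed disc is easier to transport through \<open>f\<close>
  than convergence on all compact subsets of an open set.\<close>

lemma fatou_iff: "z \<in> fatou_set f \<longleftrightarrow> (\<exists>e>0. normal_iterates f (cball z e))"
proof
  assume "z \<in> fatou_set f"
  then obtain U where U: "open U" "z \<in> U" "normal_family_on U (range (\<lambda>n. f ^^ n))" by (auto simp: fatou_set_def)
  obtain e where e: "e > 0" "cball z e \<subseteq> U" using U(1,2) open_contains_cball by blast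
  have "\<exists>r. strict_mono r \<and> sphere_limit (cball z e) (\<lambda>n. f ^^ k (r n))" for k :: "nat => nat"
  proof -
    have "range (\<lambda>n. f ^^ k n) \<subseteq> range (\<lambda>n. f ^^ n)" by auto
    moreover have "compact (cball z e) \<and> cball z e \<subseteq> U" using e(2) by simp
    ultimately show ?thesis using U(3) unfolding normal_family_on_def sphere_limit_def comp_def by meson
  qed
  then show "\<exists>e>0. normal_iterates f (cball z e)" using e(1) unfolding normal_iterates_def by blast
next
  assume "\<exists>e>0. normal_iterates f (cball z e)"
  then obtain e where e: "e > 0" "normal_iterates f (cball z e)" by blast
  have "normal_family_on (ball z e) (range (\<lambda>n. f ^^ n))"
    unfolding normal_family_on_def
  proof (intro allI impI)
    fix h :: "nat => complex => complex" assume "range h \<subseteq> range (\<lambda>n. f ^^ n)"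
    then have "\<forall>n. \<exists>k. h n = f ^^ k" by auto
    then obtain k where k: "\<And>n. h n = f ^^ k n" by metis
    obtain r where r: "strict_mono (r :: nat => nat)" and l0: "sphere_limit (cball z e) (\<lambda>n. f ^^ k (r n))"
      using e(2) unfolding normal_iterates_def by blast
    have l: "sphere_limit (ball z e) (h \<circ> r)" by (rule sphere_limit_pullback[OF l0, where p = "\<lambda>x. x"]) (auto simp: k)
    show "\<exists>r. strict_mono r \<and> ((\<exists>l. \<forall>K. compact K \<and> K \<subseteq> ball z e --> uniform_limit K (h \<circ> r) l sequentially) \<or>
      (\<forall>K. compact K \<and> K \<subseteq> ball z e --> (\<forall>B::real. \<forall>\<^sub>F n in sequentially. \<forall>z\<in>K. B < norm (h (r n) z))))"
      using l[unfolded sphere_limit_def]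
    proof
      assume "\<exists>l. uniform_limit (ball z e) (h \<circ> r) l sequentially"
      then show ?thesis using r uniform_limit_on_subset by blast
    next
      assume *: "\<forall>B. \<forall>\<^sub>F n in sequentially. \<forall>w\<in>ball z e. B < norm ((h \<circ> r) n w)"
      have "\<forall>\<^sub>F n in sequentially. \<forall>w\<in>K. B < norm (h (r n) w)" if "compact K \<and> K \<subseteq> ball z e" for K B
        using *[rule_format, of B] by eventually_elim (use that in auto)
      then show ?thesis using r by blast
    qed
  qed
  then show "z \<in> fatou_set f" unfolding fatou_set_def using e(1) by (auto intro!: exI[of _ "ball z e"])
qed

lemma fatou_dichotomy:
  assumes f: "f holomorphic_on UNIV" and z: "z \<in> fatou_set f"
  obtains e where "e > 0" "\<And>k::nat=>nat. \<exists>r. strict_mono r \<and>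
    ((\<exists>B. \<forall>n. \<forall>w\<in>cball z e. norm ((f ^^ k (r n)) w) \<le> B) \<or>
     (\<forall>B. \<forall>\<^sub>F n in sequentially. \<forall>w\<in>cball z e. B < norm ((f ^^ k (r n)) w)))"
proof -
  obtain e where e: "e > 0" "normal_iterates f (cball z e)" using z fatou_iff by blast
  have fc: "continuous_on A (f ^^ n)" for A n
  proof (induction n)
    case (Suc n)
    then show ?case
      using continuous_on_compose[OF Suc, of f] continuous_on_subset[OF holomorphic_on_imp_continuous_on[OF f]]
      by auto
  qed (auto simp: id_def)
  show ?thesis
  proof (rule that[OF e(1)])
    fix k :: "nat => nat"
    obtain r where r: "strict_mono (r :: nat => nat)" "sphere_limit (cball z e) (\<lambda>n. f ^^ k (r n))"
      using e(2) unfolding normal_iterates_def by blast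
    from r(2)[unfolded sphere_limit_def] show "\<exists>r. strict_mono r \<and>
      ((\<exists>B. \<forall>n. \<forall>w\<in>cball z e. norm ((f ^^ k (r n)) w) \<le> B) \<or>
       (\<forall>B. \<forall>\<^sub>F n in sequentially. \<forall>w\<in>cball z e. B < norm ((f ^^ k (r n)) w)))"
    proof
      assume "\<exists>l. uniform_limit (cball z e) (\<lambda>n. f ^^ k (r n)) l sequentially"
      then obtain l where l: "uniform_limit (cball z e) (\<lambda>n. f ^^ k (r n)) l sequentially" by blast
      have "continuous_on (cball z e) l"
        by (rule uniform_limit_theorem[OF _ l]) (auto intro: fc always_eventually)
      then have "compact (l ` cball z e)" by (intro compact_continuous_image compact_cball)
      then obtain B where B: "\<And>w. w \<in> cball z e ==> norm (l w) \<le> B"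
        using compact_imp_bounded bounded_iff by (metis image_eqI)
      have "\<forall>\<^sub>F n in sequentially. \<forall>w\<in>cball z e. dist ((f ^^ k (r n)) w) (l w) < 1"
        using l by (auto simp: uniform_limit_iff)
      then obtain N where N: "\<And>n w. n \<ge> N ==> w \<in> cball z e ==> dist ((f ^^ k (r n)) w) (l w) < 1"
        unfolding eventually_sequentially by blast
      have "norm ((f ^^ k (r (n + N))) w) \<le> B + 1" if "w \<in> cball z e" for n w
        using N[of "n + N" w] B[OF that] that norm_triangle_sub[of "(f ^^ k (r (n + N))) w" "l w"]
        by (simp add: dist_norm)
      moreover have "strict_mono (\<lambda>n. r (n + N))" using r(1) by (simp add: strict_mono_def)
      ultimately show ?thesis by (intro exI[of _ "\<lambda>n. r (n + N)"]) blast
    qed (use r(1) in blast)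
  qed
qed

context entire_map
begin

lemma funpow_has_deriv: "((f ^^ n) has_field_derivative deriv (f ^^ n) z) (at z)"
  using holomorphic_derivI[OF funpow_hol open_UNIV] by blast

lemma deriv_funpow_add: "deriv (f ^^ (m + n)) z = deriv (f ^^ m) ((f ^^ n) z) * deriv (f ^^ n) z"
proof -
  have "((\<lambda>x. (f ^^ m) ((f ^^ n) x)) has_field_derivative deriv (f ^^ m) ((f ^^ n) z) * deriv (f ^^ n) z) (at z)"
    by (rule DERIV_chain2[OF funpow_has_deriv funpow_has_deriv])
  then show ?thesis by (simp add: funpow_add o_def DERIV_imp_deriv)
qed

lemma funpow_cont: "continuous_on A (f ^^ n)"
  using funpow_hol holomorphic_on_imp_continuous_on by blast

lemma fixed_funpow: "f a = a ==> (f ^^ n) a = a"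
  by (induction n) auto

lemma fixed_deriv_funpow: "f a = a ==> deriv (f ^^ n) a = deriv f a ^ n"
proof (induction n)
  case 0 then show ?case by (simp add: id_def[symmetric])
next
  case (Suc n)
  then show ?case using deriv_funpow_add[of 1 n a] fixed_funpow[of a n] by (simp add: o_def)
qed

text \<open>A bound on a disc about the fixed point would bound the derivatives there by Cauchy's
  inequality, but these are powers of the multiplier.\<close>

lemma repelling_no_bound:
  assumes "f a = a" "norm (deriv f a) > 1" "e > 0" and k: "\<And>N. \<exists>n. k n \<ge> (N::nat)"
  shows "\<exists>n. \<exists>w\<in>ball a e. norm ((f ^^ k n) w) > B"
proof (rule ccontr)
  assume "\<not> ?thesis"
  then have b: "\<And>n w. w \<in> ball a e ==> norm ((f ^^ k n) w) \<le> B" by (meson not_le)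
  have le: "norm (deriv f a) ^ k n \<le> B / e" for n
  proof -
    have "norm (deriv (f ^^ k n) a) \<le> B / e" by (rule cauchy_deriv_bound[OF funpow_hol assms(3) b])
    then show ?thesis using fixed_deriv_funpow[OF assms(1), of "k n"] by (simp add: norm_power)
  qed
  obtain N where N: "B / e < norm (deriv f a) ^ N" using real_arch_pow[OF assms(2)] by blast
  obtain n where "k n \<ge> N" using k by blast
  then have "norm (deriv f a) ^ N \<le> norm (deriv f a) ^ k n" using assms(2) by (intro power_increasing) auto
  then show False using le[of n] N by simp
qed

lemma julia_blowup:
  assumes "z \<in> julia_set f" "open U" "z \<in> U" "b1 \<noteq> b2"
  obtains n u where "u \<in> U" "(f ^^ n) u = b1 \<or> (f ^^ n) u = b2"
proof -
  obtain e where e: "e > 0" "ball z e \<subseteq> U" using assms openE by blast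
  have "\<exists>n u. u \<in> U \<and> ((f ^^ n) u = b1 \<or> (f ^^ n) u = b2)"
  proof (rule ccontr)
    assume "\<not> ?thesis"
    then have "\<And>g. g \<in> range (\<lambda>n. f ^^ n) ==> omits b1 b2 (ball z e) g"
      using e(2) by (auto simp: omits_def funpow_hol)
    then have "normal_family_on (ball z e) (range (\<lambda>n. f ^^ n))"
      by (rule normal_family_omits[OF assms(4) e(1)])
    then have "z \<in> fatou_set f" unfolding fatou_set_def using e(1) by (auto intro!: exI[of _ "ball z e"])
    then show False using assms(1) by (simp add: julia_set_def)
  qed
  then show ?thesis using that by blast
qed

lemma fatou_backward:
  assumes "f z \<in> fatou_set f" shows "z \<in> fatou_set f"
proof -
  obtain e where e: "e > 0" "normal_iterates f (cball (f z) e)" using assms fatou_iff by blast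
  obtain d where d: "d > 0" "\<And>x. dist x z < d ==> dist (f x) (f z) < e"
    using cont[of UNIV] e(1) unfolding continuous_on_iff by blast
  have fS: "f x \<in> cball (f z) e" if "x \<in> cball z (d / 2)" for x
    using d(2)[of x] d(1) that by (simp add: dist_commute)
  \<comment> \<open>Exponents equal to 0 are split off, since the orbit of \<open>f z\<close>
    provides the iterate \<open>k n\<close> at \<open>z\<close> only as its iterate
    \<open>k n - 1\<close>.\<close>
  have "\<exists>r. strict_mono r \<and> sphere_limit (cball z (d/2)) (\<lambda>n. f ^^ k (r n))" for k :: "nat => nat"
  proof (cases "infinite {n. k n = 0}")
    case True
    then obtain r :: "nat => nat" where r: "strict_mono r" "\<And>n. k (r n) = 0"
      by (rule infinite_subseq) (rule that; assumption)
    have "uniform_limit (cball z (d/2)) (\<lambda>n. f ^^ k (r n)) id sequentially"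
      by (simp add: r(2) uniform_limit_const)
    then show ?thesis using r(1) unfolding sphere_limit_def by blast
  next
    case False
    then have "infinite {n. k n \<noteq> 0}" using finite_Collect_not by blast
    then obtain q :: "nat => nat" where q: "strict_mono q" "\<And>n. k (q n) \<noteq> 0"
      by (rule infinite_subseq) (rule that; assumption)
    obtain r where r: "strict_mono (r :: nat => nat)" "sphere_limit (cball (f z) e) (\<lambda>n. f ^^ (k (q (r n)) - 1))"
      using e(2)[unfolded normal_iterates_def, rule_format, of "\<lambda>n. k (q n) - 1"] by blast
    have "(f ^^ k (q m)) x = (f ^^ (k (q m) - 1)) (f x)" for m x
      using q(2)[of m] funpow_Suc_right[of "k (q m) - 1" f] by simp
    then have "sphere_limit (cball z (d/2)) (\<lambda>n. f ^^ k ((q \<circ> r) n))"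
      by (intro sphere_limit_pullback[OF r(2), of _ f] fS) (auto simp del: funpow.simps)
    then show ?thesis using strict_mono_o[OF q(1) r(1)] by blast
  qed
  then have "normal_iterates f (cball z (d / 2))" by (simp add: normal_iterates_def)
  then show ?thesis using fatou_iff d(1) half_gt_zero by blast
qed

lemma fatou_forward:
  assumes "z \<in> fatou_set f" shows "f z \<in> fatou_set f"
proof -
  obtain e where e: "e > 0" "normal_iterates f (cball z e)" using assms fatou_iff by blast
  have "open (f ` ball z e)" by (rule open_image) simp
  then obtain d where d: "d > 0" "cball (f z) d \<subseteq> f ` ball z e" using e(1) open_contains_cball by (metis centre_in_ball imageI)
  define s where "s = inv_into (ball z e) f"
  have s: "s w \<in> cball z e" "f (s w) = w" if "w \<in> cball (f z) d" for w
  proof -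
    have w: "w \<in> f ` ball z e" using d(2) that by blast
    show "s w \<in> cball z e" unfolding s_def using inv_into_into[OF w] ball_subset_cball by blast
    show "f (s w) = w" unfolding s_def by (rule f_inv_into_f[OF w])
  qed
  have "\<exists>r. strict_mono r \<and> sphere_limit (cball (f z) d) (\<lambda>n. f ^^ k (r n))" for k :: "nat => nat"
  proof -
    obtain r where r: "strict_mono (r :: nat => nat)" "sphere_limit (cball z e) (\<lambda>n. f ^^ Suc (k (r n)))"
      using e(2)[unfolded normal_iterates_def, rule_format, of "\<lambda>n. Suc (k n)"] by blast
    have "sphere_limit (cball (f z) d) (\<lambda>n. f ^^ k (r n))"
      by (rule sphere_limit_pullback[OF r(2), of _ s]) (simp_all add: s funpow_swap1 del: mem_cball)
    then show ?thesis using r(1) by blast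
  qed
  then show ?thesis using fatou_iff d(1) by (auto simp: normal_iterates_def)
qed

end

context classB
begin

text \<open>At a fixed point \<open>expansion\<close> reads
  \<open>ln (norm a / R0) \<le> 12 * pi * norm (deriv f a)\<close>, so all fixed points beyond
  \<open>R0 * exp (12 * pi)\<close> repel.\<close>

lemma large_repelling: "\<exists>a. norm a > R \<and> f a = a \<and> norm (deriv f a) > 1"
proof -
  define R' where "R' = max R (R0 * exp (12 * pi))"
  obtain a where a: "norm a > R'" "f a = a" using large_fixed_point by blast
  have aR: "norm a > R" "norm a > R0 * exp (12 * pi)" using a(1) by (auto simp: R'_def)
  have "R0 * 1 \<le> R0 * exp (12 * pi)" using R0 by (intro mult_left_mono) auto
  then have aR0: "norm a > R0" "norm a > 0" using aR R0 by linarith+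
  have "exp (12 * pi) < norm a / R0" using aR(2) R0 by (simp add: less_divide_eq mult.commute)
  then have "ln (exp (12 * pi)) < ln (norm a / R0)" by (subst ln_less_cancel_iff) (use aR0 R0 in auto)
  then have l: "12 * pi < ln (norm a / R0)" by simp
  have "norm a * ln (norm a / R0) \<le> 12 * pi * (norm a * norm (deriv f a))"
    using expansion[of a] a(2) aR0 by simp
  then have "ln (norm a / R0) \<le> 12 * pi * norm (deriv f a)" using aR0(2) by simp
  then have "12 * pi * 1 < 12 * pi * norm (deriv f a)" using l by linarith
  moreover have "0 < 12 * pi" by simp
  ultimately have "norm (deriv f a) > 1" by (simp only: mult_less_cancel_left_pos)
  then show ?thesis using aR(1) a(2) by blast
qed

end

section \<open>The orbifold metric and its Schwarz lemma\<close>

context orbimap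
begin

text \<open>\<open>sig\<close> has a cone singularity of angle \<open>2 \<pi> / nu q\<close> at each \<open>q \<in> Q\<close>.\<close>

definition sig :: "complex => real" where
  "sig z = 1 + (\<Sum>q\<in>Q. norm (z - q) powr (1 / real (nu q) - 1))"

text \<open>Stands in for the hyperbolic orbifold density: comparable to \<open>1 / wt\<close> away
  from \<open>Q\<close>, with the cone factor \<open>sig\<close> at the points of
  \<open>Q\<close>.\<close>

definition rho :: "complex => real" where "rho z = sig z / wt z"

lemma sig_ge_1: "sig z \<ge> 1" unfolding sig_def by (simp add: sum_nonneg)

lemma rho_ge: "1 / wt z \<le> rho z"
  unfolding rho_def using sig_ge_1 wt_pos[of z] by (simp add: divide_right_mono less_imp_le)

lemma rho_pos: "rho z > 0"
  using rho_ge[of z] wt_pos[of z] by (meson divide_pos_pos less_le_trans zero_less_one)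

text \<open>Write \<open>h - q = u ^ m\<close> with \<open>m = nu q\<close>. The cone factor at
  \<open>h a\<close> is \<open>norm (u a)\<close> to the power \<open>1 - m\<close>, which cancels
  the factor \<open>u a ^ (m - 1)\<close> of \<open>deriv h a\<close>; only the Cauchy bound for
  \<open>deriv u a\<close> is left.\<close>

lemma cone_bound_general:
  assumes hh: "h holomorphic_on ball a s" "\<not> h constant_on ball a s"
    and dvd: "\<And>zeta. zeta \<in> ball a s ==> h zeta = q ==> nu q dvd local_degree h zeta"
    and s: "s > 0" and ne: "h a \<noteq> q"
    and B: "\<And>zeta. zeta \<in> ball a s ==> norm (h zeta - q) \<le> B"
  shows "norm (deriv h a) * norm (h a - q) powr (1 / real (nu q) - 1) * s \<le> real (nu q) * B powr (1 / real (nu q))"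
proof -
  define m where "m = nu q"
  have m: "m > 0" using nu_pos by (simp add: m_def)
  have as: "a \<in> ball a s" using s by simp
  have "ball a s \<noteq> UNIV" using bounded_ball[of a s] not_bounded_UNIV by metis
  have k1: "(\<lambda>zeta. h zeta - q) holomorphic_on ball a s" by (intro holomorphic_intros hh)
  have k2: "\<not> (\<lambda>zeta. h zeta - q) constant_on ball a s"
    using hh(2) unfolding constant_on_def by (metis diff_add_cancel)
  obtain u where u: "u holomorphic_on ball a s" "\<And>zeta. zeta \<in> ball a s ==> u zeta ^ m = h zeta - q"
  proof (rule holomorphic_root[OF open_ball _ \<open>ball a s \<noteq> UNIV\<close> as k1 k2 m])
    show "simply_connected (ball a s)" by (simp add: convex_imp_simply_connected)
    show "m dvd local_degree (\<lambda>zeta. h zeta - q) zeta" if "zeta \<in> ball a s" "h zeta - q = 0" for zeta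
    proof -
      have "local_degree (\<lambda>zeta. h zeta - q) zeta = local_degree h zeta" by (simp add: local_degree_def)
      then show ?thesis using dvd[OF that(1)] that(2) by (simp add: m_def)
    qed
  qed (use that in blast)
  have ub: "norm (u zeta) \<le> B powr (1 / real m)" if "zeta \<in> ball a s" for zeta
  proof -
    have "norm (u zeta) ^ m \<le> B" using B[OF that] u(2)[OF that] by (metis norm_power)
    then have "(norm (u zeta) ^ m) powr (1 / real m) \<le> B powr (1 / real m)" by (intro powr_mono2) auto
    moreover have "(norm (u zeta) ^ m) powr (1 / real m) = norm (u zeta)"
      using m by (cases "u zeta = 0") (auto simp: powr_realpow[symmetric] powr_powr power_0_left)
    ultimately show ?thesis by simp
  qed
  have du: "norm (deriv u a) \<le> B powr (1 / real m) / s" by (rule cauchy_deriv_bound[OF u(1) s ub])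
  have u': "(u has_field_derivative deriv u a) (at a)" using holomorphic_derivI[OF u(1) open_ball as] .
  have "((\<lambda>zeta. q + u zeta ^ m) has_field_derivative of_nat m * u a ^ (m - 1) * deriv u a) (at a)"
    by (auto intro!: derivative_eq_intros u')
  then have "(h has_field_derivative of_nat m * u a ^ (m - 1) * deriv u a) (at a)"
    by (rule has_field_derivative_transform_within_open[OF _ open_ball as]) (use u(2) in auto)
  then have dh: "norm (deriv h a) = real m * norm (u a) ^ (m - 1) * norm (deriv u a)"
    by (simp add: DERIV_imp_deriv norm_mult norm_power)
  have ua: "norm (u a) > 0" using u(2)[OF as] ne m by (cases "u a = 0") (auto simp: power_0_left)
  have "norm (h a - q) = norm (u a) powr real m" using u(2)[OF as] ua by (metis norm_power powr_realpow)
  then have "norm (h a - q) powr (1 / real m - 1) = norm (u a) powr (real m * (1 / real m - 1))" by (simp add: powr_powr)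
  also have "real m * (1 / real m - 1) = 1 - real m" using m by (simp add: field_simps)
  finally have "norm (u a) ^ (m - 1) * norm (h a - q) powr (1 / real m - 1) = norm (u a) powr real (m - 1) * norm (u a) powr (1 - real m)"
    using ua by (simp add: powr_realpow)
  also have "\<dots> = 1" using ua m by (simp add: powr_add[symmetric] of_nat_diff)
  finally have 1: "norm (u a) ^ (m - 1) * norm (h a - q) powr (1 / real m - 1) = 1" .
  have "norm (deriv h a) * norm (h a - q) powr (1 / real m - 1) * s =
      real m * (norm (deriv u a) * s) * (norm (u a) ^ (m - 1) * norm (h a - q) powr (1 / real m - 1))"
    unfolding dh by (simp add: mult_ac)
  also have "\<dots> = real m * (norm (deriv u a) * s)" by (simp only: 1 mult_1_right)
  also have "\<dots> \<le> real m * B powr (1 / real m)" using du s by (intro mult_left_mono) (auto simp: le_divide_eq)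
  finally show ?thesis unfolding m_def .
qed

lemma cone_bound:
  assumes h: "adm (ball a s) h" and s: "s > 0" and ne: "h a \<noteq> q"
    and B: "\<And>zeta. zeta \<in> ball a s ==> norm (h zeta - q) \<le> B"
  shows "norm (deriv h a) * norm (h a - q) powr (1 / real (nu q) - 1) * s \<le> real (nu q) * B powr (1 / real (nu q))"
  by (rule cone_bound_general) (use h s ne B in \<open>auto simp: adm_def\<close>)

lemma adm_subset:
  assumes "adm D h" "open E" "E \<subseteq> D" "E \<noteq> {}" "open D" "connected D"
  shows "adm E h"
proof -
  have hE: "h holomorphic_on E" using assms holomorphic_on_subset by (auto simp: adm_def)
  have "\<not> h constant_on E"
  proof
    assume "h constant_on E"
    then obtain c where c: "\<And>x. x \<in> E ==> h x = c" by (auto simp: constant_on_def)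
    have "h x = c" if "x \<in> D" for x
      by (rule analytic_continuation_open[of E D h "\<lambda>_. c"]) (use assms c that in \<open>auto simp: adm_def\<close>)
    then show False using assms(1) by (auto simp: adm_def constant_on_def)
  qed
  then show ?thesis using hE assms by (auto simp: adm_def)
qed

text \<open>A summand of \<open>sig\<close> at a point \<open>q\<close> with
  \<open>norm (h a - q) \<ge> 1\<close> is at most 1 and adds a multiple of the Landau bound. If
  \<open>h a\<close> is nearer to \<open>q\<close>, the comparison of \<open>theta\<close> bounds
  \<open>h\<close> on half the disc, where \<open>cone_bound\<close> applies.\<close>

lemma adm_metric:
  assumes Q: "finite Q" and e12: "e1 \<noteq> e2"
  obtains C where "C > 0"
    "\<And>h a s. s > 0 ==> adm (ball a s) h ==> omits e1 e2 (ball a s) h ==> h a \<notin> Q ==>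
      rho (h a) * norm (deriv h a) * s \<le> C"
proof -
  obtain C1 where C1: "C1 > 0" "\<And>h z r. r > 0 ==> omits e1 e2 (ball z r) h ==> norm (deriv h z) * r \<le> C1 * wt (h z)"
    by (rule landau[OF e12]) (rule that; assumption)
  obtain C2 where C2: "C2 > 0" "\<And>h c r s z. 0 \<le> s ==> s < r ==> omits e1 e2 (ball c r) h ==> z \<in> cball c s ==>
     \<bar>theta (h z) - theta (h c)\<bar> \<le> C2 * s / (r - s)"
    by (rule landau_theta[OF e12]) (rule that; assumption)
  define B where "B q = exp (exp (theta (of_real (norm q + 1)) + C2)) + norm q" for q :: complex
  define K where "K q = C1 + 2 * (real (nu q) * B q powr (1 / real (nu q)))" for q
  have Kpos: "K q \<ge> C1" for q by (simp add: K_def)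
  show ?thesis
  proof (rule that[of "C1 + (\<Sum>q\<in>Q. K q)"])
    show "C1 + (\<Sum>q\<in>Q. K q) > 0" using C1(1) Kpos sum_nonneg[of Q K] by (smt (verit))
    fix h a and s :: real assume s: "s > 0" and h: "adm (ball a s) h" and om: "omits e1 e2 (ball a s) h" and ha: "h a \<notin> Q"
    have l: "norm (deriv h a) * s / wt (h a) \<le> C1" using C1(2)[OF s om] wt_pos[of "h a"] by (simp add: divide_le_eq)
    have "norm (h a - q) powr (1 / real (nu q) - 1) / wt (h a) * (norm (deriv h a) * s) \<le> K q" if q: "q \<in> Q" for q
    proof (cases "norm (h a - q) \<ge> 1")
      case True
      have "norm (h a - q) powr (1 / real (nu q) - 1) \<le> 1"
      proof -
        have "1 / real (nu q) - 1 \<le> 0" using nu_pos[of q] by (simp add: divide_le_eq_1)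
        then show ?thesis using True powr_mono[of "1 / real (nu q) - 1" 0 "norm (h a - q)"] by (simp split: if_splits)
      qed
      then have "norm (h a - q) powr (1 / real (nu q) - 1) * (norm (deriv h a) * s / wt (h a)) \<le> 1 * C1"
        using l s less_imp_le[OF wt_pos[of "h a"]] by (intro mult_mono) auto
      then show ?thesis using Kpos[of q] by simp
    next
      case False
      then have "norm (h a) \<le> norm q + 1" using norm_triangle_sub[of "h a" q] by linarith
      then have t: "theta (h a) \<le> theta (of_real (norm q + 1))" by (rule norm_le_imp_theta_le)
      have hB: "norm (h zeta - q) \<le> B q" if zeta: "zeta \<in> ball a (s / 2)" for zeta
      proof -
        have "\<bar>theta (h zeta) - theta (h a)\<bar> \<le> C2 * (s / 2) / (s - s / 2)"
          by (rule C2(2)[OF _ _ om]) (use s zeta in auto)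
        also have "\<dots> = C2" using s by simp
        finally have "theta (h zeta) \<le> theta (of_real (norm q + 1)) + C2" using t by linarith
        then have "norm (h zeta) \<le> exp (exp (theta (of_real (norm q + 1)) + C2))" by (rule theta_le_imp_norm_le)
        then show ?thesis unfolding B_def using norm_triangle_ineq4[of "h zeta" q] by linarith
      qed
      have "adm (ball a (s / 2)) h" by (rule adm_subset[OF h]) (use s in auto)
      then have "norm (deriv h a) * norm (h a - q) powr (1 / real (nu q) - 1) * (s / 2) \<le> real (nu q) * B q powr (1 / real (nu q))"
        by (rule cone_bound) (use s ha q hB in auto)
      then have 1: "norm (h a - q) powr (1 / real (nu q) - 1) * (norm (deriv h a) * s) \<le> K q"
        using C1(1) by (simp add: K_def mult_ac)
      have "norm (h a - q) powr (1 / real (nu q) - 1) * (norm (deriv h a) * s) / wt (h a) \<le>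
          norm (h a - q) powr (1 / real (nu q) - 1) * (norm (deriv h a) * s) / 1"
        using wt_gt_1[of "h a"] s by (intro divide_left_mono) auto
      then show ?thesis using 1 by simp
    qed
    then have "(\<Sum>q\<in>Q. norm (h a - q) powr (1 / real (nu q) - 1) / wt (h a) * (norm (deriv h a) * s)) \<le> (\<Sum>q\<in>Q. K q)"
      by (rule sum_mono)
    then show "rho (h a) * norm (deriv h a) * s \<le> C1 + (\<Sum>q\<in>Q. K q)"
      using l by (simp add: rho_def sig_def add_divide_distrib sum_divide_distrib sum_distrib_right distrib_right mult.assoc)
  qed
qed

end

section \<open>Expansion with respect to an orbifold metric\<close>

text \<open>Monotonicity lets the maximum over a finite subcover serve everywhere. The order is kept
  general because \<open>C\<close> is sometimes a constant and sometimes a number of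
  iterates.\<close>

lemma compact_local_bound:
  fixes P :: "'b::linorder => complex => bool"
  assumes S: "compact S" and loc: "\<And>w. w \<in> S ==> \<exists>r>0. \<exists>C. \<forall>v\<in>ball w r. P C v"
    and mono: "\<And>C C' v. P C v ==> C \<le> C' ==> P C' v"
  shows "\<exists>C. \<forall>v\<in>S. P C v"
proof (cases "S = {}")
  case False
  have "\<forall>w\<in>S. \<exists>r. r > 0 \<and> (\<exists>C. \<forall>v\<in>ball w r. P C v)" using loc by blast
  from bchoice[OF this] obtain r where r: "\<forall>w\<in>S. r w > 0 \<and> (\<exists>C. \<forall>v\<in>ball w (r w). P C v)" by blast
  then have "\<forall>w\<in>S. \<exists>C. \<forall>v\<in>ball w (r w). P C v" by blast
  from bchoice[OF this] obtain C where C: "\<forall>w\<in>S. \<forall>v\<in>ball w (r w). P (C w) v" by blast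
  have cov: "S \<subseteq> (\<Union>w\<in>S. ball w (r w))" using r by fastforce
  obtain T where T: "T \<subseteq> S" "finite T" "S \<subseteq> (\<Union>w\<in>T. ball w (r w))"
    by (rule compactE_image[OF S _ cov]) auto
  have "T \<noteq> {}" using T(3) False by auto
  have "P (Max (C ` T)) v" if "v \<in> S" for v
  proof -
    obtain w where w: "w \<in> T" "v \<in> ball w (r w)" using T(3) \<open>v \<in> S\<close> by blast
    have "P (C w) v" using C w T(1) by blast
    moreover have "C w \<le> Max (C ` T)" using T(2) w(1) by simp
    ultimately show ?thesis by (rule mono)
  qed
  then show ?thesis by blast
qed auto

lemma wt_le: assumes "norm v \<ge> 4" shows "wt v \<le> 8 * (norm v * ln (norm v))"
proof -
  let ?n = "norm v"
  have "9 + ?n\<^sup>2 \<le> ?n ^ 4"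
  proof -
    have "16 \<le> ?n\<^sup>2" using power_mono[OF assms, of 2] by simp
    then have "16 * ?n\<^sup>2 \<le> ?n\<^sup>2 * ?n\<^sup>2" by (intro mult_right_mono) auto
    then show ?thesis using \<open>16 \<le> ?n\<^sup>2\<close> by (simp add: power4_eq_xxxx power2_eq_square)
  qed
  then have "ln (9 + ?n\<^sup>2) \<le> ln (?n ^ 4)" by (subst ln_le_cancel_iff) (use assms in \<open>auto intro: add_pos_nonneg\<close>)
  also have "\<dots> = 4 * ln ?n" using assms by (simp add: ln_realpow)
  finally have "(1 + ?n) * ln (9 + ?n\<^sup>2) \<le> (2 * ?n) * (4 * ln ?n)"
    using assms ln9_gt_1[of ?n] by (intro mult_mono) auto
  then show ?thesis by (simp add: wt_def)
qed

lemma norm_ln_le_wt: "norm z * ln (9 + (norm z)\<^sup>2) \<le> wt z"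
  unfolding wt_def using ln9_gt_1[of "norm z"] by (intro mult_right_mono) auto

text \<open>In the application \<open>PF\<close> and \<open>Q\<close> are the parts of the
  postsingular set in the Fatou and in the Julia set; only these consequences are kept.
  \<open>orbit_bound\<close> separates \<open>PF\<close> from the points with large orbits, and
  \<open>fixp\<close> supplies the values omitted by lifts over
  \<open>{z. L < norm z}\<close>.\<close>

locale expanding = orbimap f PF Q nu + classB f R0 for f PF Q nu R0 +
  fixes L \<epsilon> :: real
  assumes PF_compact: "compact PF" and Q_finite: "finite Q" and Q_inv: "f ` Q \<subseteq> Q" and disj: "PF \<inter> Q = {}"
    and L: "1 \<le> L" "R0 \<le> L" "PF \<union> Q \<subseteq> ball 0 L"
    and eps: "0 < \<epsilon>" and orbit_bound: "\<And>p z n. p \<in> PF ==> dist z p < \<epsilon> ==> norm ((f ^^ n) z) \<le> L"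
    and fixp: "\<exists>e1 e2. e1 \<noteq> e2 \<and> f e1 = e1 \<and> f e2 = e2 \<and> norm e1 \<le> L \<and> norm e2 \<le> L"
begin

definition Y :: "complex set" where "Y = {z. \<exists>n. L < norm ((f ^^ n) z)}"

lemma big_Y: "L < norm z ==> z \<in> Y" unfolding Y_def by (auto intro!: exI[of _ 0])

lemma Y_back: "f z \<in> Y ==> z \<in> Y"
  unfolding Y_def mem_Collect_eq by (metis funpow_Suc_right o_apply)

lemma clY_back: assumes "f z \<in> closure Y" shows "z \<in> closure Y"
  unfolding closure_iff_nhds_not_empty
proof (intro allI impI)
  fix A S assume S: "S \<subseteq> A" "open S" "z \<in> S"
  have "open (f ` S)" using open_image S(2) .
  then obtain y where "y \<in> f ` S" "y \<in> Y" using assms S(3) unfolding closure_iff_nhds_not_empty by blast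
  then show "Y \<inter> A \<noteq> {}" using S(1) Y_back by blast
qed

text \<open>The points over which inverse iterates are controlled. Closeness to large orbits keeps
  them off \<open>PF\<close>. The set \<open>Q\<close> is removed because \<open>sig\<close> has its
  poles there; \<open>0 powr x = 0\<close> would make its value meaningless.\<close>

definition good :: "complex => bool" where "good z \<longleftrightarrow> z \<in> closure Y \<and> z \<notin> Q"

lemma good_back1: "good (f z) ==> good z"
  using clY_back Q_inv by (auto simp: good_def)

lemma good_back: "good ((f ^^ n) z) ==> good z"
  by (induction n) (auto dest: good_back1)

lemma good_big: "L < norm z ==> good z"
  using big_Y closure_subset L(3) by (fastforce simp: good_def)

lemma clY_PF: "w \<in> closure Y ==> w \<notin> PF"
proof
  assume w: "w \<in> closure Y" "w \<in> PF"
  obtain y where y: "y \<in> Y" "dist y w < \<epsilon>" using w(1) eps closure_approachable by blast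
  then obtain n where "L < norm ((f ^^ n) y)" by (auto simp: Y_def)
  then show False using orbit_bound[OF w(2) y(2), of n] by simp
qed

lemma far_fixed: "\<exists>e1 e2. e1 \<noteq> e2 \<and> f e1 = e1 \<and> f e2 = e2 \<and> norm e1 > B \<and> norm e2 > B"
proof -
  obtain e1 where e1: "norm e1 > B" "f e1 = e1" using large_fixed_point by blast
  obtain e2 where e2: "norm e2 > norm e1" "f e2 = e2" using large_fixed_point by blast
  then have "e1 \<noteq> e2" by auto
  moreover have "norm e2 > B" using e1 e2 by linarith
  ultimately show ?thesis using e1 e2 by blast
qed

section \<open>Orbifold charts and expansion bounds uniform in the iterate\<close>

lemma lift_omits:
  assumes "K holomorphic_on D" "\<And>zeta. zeta \<in> D ==> (f ^^ n) (K zeta) = h zeta" "f e1 = e1" "f e2 = e2"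
    "\<And>zeta. zeta \<in> D ==> h zeta \<noteq> e1 \<and> h zeta \<noteq> e2"
  shows "omits e1 e2 D K"
  unfolding omits_def
proof (intro conjI ballI assms)
  fix z assume "z \<in> D"
  then show "K z \<noteq> e1" "K z \<noteq> e2"
    using assms(2)[of z] assms(5)[of z] fixed_funpow[OF assms(3), of n] fixed_funpow[OF assms(4), of n] by auto
qed

lemma funpow_deriv_lift:
  assumes "open D" "K holomorphic_on D" "\<And>x. x \<in> D ==> (f ^^ n) (K x) = h x" "a \<in> D"
  shows "deriv h a = deriv (f ^^ n) (K a) * deriv K a"
  by (rule entire_map.deriv_lift[OF funpow_entire assms])

lemma omits_subset: "omits a b S h ==> T \<subseteq> S ==> omits a b T h"
  using holomorphic_on_subset by (auto simp: omits_def)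

text \<open>\<open>w + r0 * zeta ^ nu w\<close> is an orbifold chart. Where \<open>nu w > 1\<close>,
  its derivative vanishes at the centre, but the pole of \<open>sig\<close> at \<open>w\<close>
  compensates for this and leaves the lower bound \<open>c\<close>.\<close>

lemma chart:
  assumes w: "w \<notin> PF"
  obtains H r c where "adm (ball 0 1) H" "H ` ball 0 1 \<subseteq> ball w 1" "H 0 = w" "r > 0" "c > 0"
    "\<And>v. v \<in> ball w r ==> v \<notin> Q ==> \<exists>a\<in>ball 0 (1/2). H a = v \<and> c \<le> rho v * norm (deriv H a)"
proof -
  have "open (- (PF \<union> (Q - {w})))"
    by (intro open_Compl closed_Un compact_imp_closed PF_compact finite_imp_closed finite_Diff Q_finite)
  moreover have "w \<in> - (PF \<union> (Q - {w}))" using w by auto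
  ultimately obtain r1 where r1: "r1 > 0" "ball w r1 \<subseteq> - (PF \<union> (Q - {w}))" by (meson openE)
  define r0 where "r0 = min r1 1"
  have r0: "r0 > 0" "r0 \<le> 1" "ball w r0 \<subseteq> - (PF \<union> (Q - {w}))" using r1 by (auto simp: r0_def)
  define m where "m = nu w"
  have m: "m > 0" using nu_pos by (simp add: m_def)
  define H where "H zeta = w + of_real r0 * zeta ^ m" for zeta
  have Hball: "H zeta \<in> ball w r0" if "zeta \<in> ball 0 1" for zeta
  proof -
    have "norm zeta ^ m < 1" using that m by (simp add: power_less_one_iff)
    then have "r0 * norm zeta ^ m < r0" using r0 by simp
    then show ?thesis using r0 by (simp add: H_def dist_norm norm_mult norm_power)
  qed
  have Hh: "H holomorphic_on S" for S unfolding H_def by (intro holomorphic_intros)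
  have Hd: "deriv H a = of_real r0 * (of_nat m * a ^ (m - 1))" for a
    unfolding H_def by (rule DERIV_imp_deriv) (auto intro!: derivative_eq_intros)
  have admH: "adm (ball 0 1) H"
    unfolding adm_def
  proof (intro conjI ballI Hh)
    show "\<not> H constant_on ball 0 1"
    proof
      assume "H constant_on ball 0 1"
      then obtain c where c: "\<And>z. z \<in> ball 0 1 ==> H z = c" by (auto simp: constant_on_def)
      have "H 0 = H (1/2)" using c[of 0] c[of "1/2"] by simp
      then show False using r0 m by (simp add: H_def power_0_left)
    qed
    fix zeta :: complex assume zeta: "zeta \<in> ball 0 1"
    show "H zeta \<notin> PF" using Hball[OF zeta] r0(3) by blast
    show "nu (H zeta) dvd local_degree H zeta"
    proof (cases "zeta = 0")
      case True
      have "local_degree H 0 = m"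
        by (rule local_degree_eqI[of UNIV _ "\<lambda>_. of_real r0"]) (use r0 m in \<open>auto simp: H_def power_0_left\<close>)
      moreover have "H 0 = w" using m by (simp add: H_def power_0_left)
      ultimately show ?thesis using True by (simp add: m_def)
    next
      case False
      then have "H zeta \<noteq> w" using r0 by (simp add: H_def)
      then have "H zeta \<notin> Q" using Hball[OF zeta] r0(3) by blast
      then show ?thesis by (simp add: nu_off)
    qed
  qed
  define W where "W = wt (of_real (norm w + 1))"
  have W: "W > 0" by (simp add: W_def)
  \<comment> \<open>Points this close to \<open>w\<close> have chart coordinates of size below
    \<open>1/2\<close>, so a disc of radius \<open>1/2\<close> about the coordinate still lies in
    the chart.\<close>
  define r where "r = r0 * (1/2) ^ m"
  have r: "r > 0" "r \<le> r0" using r0 by (auto simp: r_def power_le_one mult_le_cancel_left1)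
  have "\<exists>a\<in>ball 0 (1/2). H a = v \<and> r0 / W \<le> rho v * norm (deriv H a)" if v: "v \<in> ball w r" "v \<notin> Q" for v
  proof -
    have "norm v \<le> norm w + 1" using v(1) r(2) r0(2) norm_triangle_sub[of v w] by (simp add: dist_norm norm_minus_commute)
    then have wtv: "wt v \<le> W" unfolding W_def by (intro wt_mono) auto
    have vd: "norm (v - w) < r" using v(1) by (simp add: dist_norm norm_minus_commute)
    show ?thesis
    proof (cases "v = w")
      case True
      then have m1: "m = 1" using v(2) nu_off by (simp add: m_def)
      have "r0 / W \<le> r0 / wt v" by (intro divide_left_mono mult_pos_pos wt_pos W wtv less_imp_le[OF r0(1)])
      also have "\<dots> \<le> rho v * r0" using mult_right_mono[OF rho_ge[of v], of r0] r0 by simp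
      finally have "r0 / W \<le> rho v * norm (deriv H 0)" using m1 r0 Hd by simp
      moreover have "H 0 = v" using True m1 by (simp add: H_def)
      ultimately show ?thesis by (intro bexI[of _ 0]) auto
    next
      case False
      define x where "x = (v - w) / of_real r0"
      have x0: "x \<noteq> 0" using False r0 by (simp add: x_def)
      define a where "a = exp (Ln x / of_nat m)"
      have am: "a ^ m = x" using m x0 by (simp add: a_def exp_of_nat_mult[symmetric])
      have "norm x < (1/2) ^ m" using vd r0 by (simp add: x_def norm_divide r_def divide_less_eq mult.commute)
      then have "norm a ^ m < (1/2) ^ m" using am by (metis norm_power)
      then have a12: "norm a < 1/2" using power_less_imp_less_base by fastforce
      have na: "norm a > 0" by (simp add: a_def)
      have Ha: "H a = v" using am r0 by (simp add: H_def x_def)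
      have "r0 \<le> sig v * norm (deriv H a)"
      proof (cases "w \<in> Q")
        case True
        have "norm (v - w) = r0 * norm a ^ m" using Ha r0 by (auto simp: H_def norm_mult norm_power)
        then have "norm (v - w) powr (1 / real m - 1) = r0 powr (1 / real m - 1) * norm a powr (real m * (1 / real m - 1))"
          using na r0 by (simp add: powr_mult powr_realpow[symmetric] powr_powr)
        also have "real m * (1 / real m - 1) = - real (m - 1)" using m by (simp add: field_simps of_nat_diff)
        finally have e: "norm (v - w) powr (1 / real m - 1) * norm a ^ (m - 1) = r0 powr (1 / real m - 1)"
          using na by (simp add: powr_minus powr_realpow)
        have "norm (v - w) powr (1 / real m - 1) \<le> (\<Sum>q\<in>Q. norm (v - q) powr (1 / real (nu q) - 1))"
          unfolding m_def by (rule member_le_sum[OF True _ Q_finite]) auto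
        then have s: "norm (v - w) powr (1 / real m - 1) \<le> sig v" by (simp add: sig_def)
        have "r0 powr 1 \<le> r0 powr (1 / real m)" using r0 m by (intro powr_mono') auto
        then have "r0 \<le> r0 powr (1 / real m)" using r0 by simp
        also have "\<dots> = r0 powr (1 / real m - 1) * r0" using r0 by (simp add: powr_diff)
        also have "\<dots> = norm (v - w) powr (1 / real m - 1) * (r0 * (1 * norm a ^ (m - 1)))" by (simp add: e[symmetric])
        also have "\<dots> \<le> sig v * (r0 * (real m * norm a ^ (m - 1)))"
          using s r0 m sig_ge_1[of v] by (intro mult_mono) auto
        also have "\<dots> = sig v * norm (deriv H a)" using r0 by (simp add: Hd norm_mult norm_power)
        finally show ?thesis .
      next
        case False
        then have "m = 1" using nu_off by (simp add: m_def)
        then show ?thesis using r0 sig_ge_1[of v] Hd by simp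
      qed
      then have "r0 / W \<le> sig v * norm (deriv H a) / W" using W by (simp add: divide_right_mono)
      also have "\<dots> \<le> sig v * norm (deriv H a) / wt v"
        using wtv sig_ge_1[of v] W by (intro divide_left_mono) auto
      finally have "r0 / W \<le> rho v * norm (deriv H a)" by (simp add: rho_def)
      then show ?thesis using Ha a12 by (intro bexI[of _ a]) auto
    qed
  qed
  moreover have "H ` ball 0 1 \<subseteq> ball w 1" using Hball r0(2) by fastforce
  moreover have "H 0 = w" using m by (simp add: H_def power_0_left)
  ultimately show ?thesis using that[of H r "r0 / W"] admH r(1) r0(1) W by auto
qed

lemma chart_lift:
  assumes H: "adm (ball 0 1) H" and a: "a \<in> ball 0 (1/2)" and z: "(f ^^ n) z = H a"
    and e: "f e1 = e1" "f e2 = e2" "\<And>zeta. zeta \<in> ball 0 1 ==> H zeta \<noteq> e1 \<and> H zeta \<noteq> e2"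
  obtains K where "adm (ball 0 1) K" "\<And>zeta. zeta \<in> ball 0 1 ==> (f ^^ n) (K zeta) = H zeta" "K a = z"
    "omits e1 e2 (ball 0 1) K" "deriv H a = deriv (f ^^ n) z * deriv K a"
    "adm (ball a (1/2)) K" "omits e1 e2 (ball a (1/2)) K"
proof -
  have a1: "a \<in> ball 0 1" using a by auto
  have nu: "ball (0::complex) 1 \<noteq> UNIV" using bounded_ball[of "0::complex" 1] not_bounded_UNIV by metis
  have sc: "simply_connected (ball (0::complex) 1)" by (simp add: convex_imp_simply_connected)
  obtain K where K: "adm (ball 0 1) K" "\<And>zeta. zeta \<in> ball 0 1 ==> (f ^^ n) (K zeta) = H zeta" "K a = z"
    by (rule adm_lift_funpow[OF open_ball sc nu a1 H z]) (rule that; assumption)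
  have Kh: "K holomorphic_on ball 0 1" using K(1) by (simp add: adm_def)
  have o: "omits e1 e2 (ball 0 1) K" by (rule lift_omits[OF Kh K(2) e])
  have d: "deriv H a = deriv (f ^^ n) z * deriv K a"
    using funpow_deriv_lift[OF open_ball Kh K(2) a1] K(3) by simp
  have sub: "ball a (1/2) \<subseteq> ball 0 1"
  proof
    fix x assume "x \<in> ball a (1/2)"
    then show "x \<in> ball 0 1" using a norm_triangle_sub[of x a] by (simp add: dist_norm norm_minus_commute)
  qed
  have "adm (ball a (1/2)) K" by (rule adm_subset[OF K(1) _ sub]) auto
  moreover have "omits e1 e2 (ball a (1/2)) K" by (rule omits_subset[OF o sub])
  ultimately show ?thesis using that K o d by blast
qed

text \<open>The chart is lifted through \<open>f ^^ n\<close>; \<open>adm_metric\<close> for the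
  lift bounds \<open>rho z\<close> from above while the chart bounds \<open>rho v\<close> from
  below. Neither constant depends on \<open>n\<close>, since all lifts omit the same two fixed
  points.\<close>

lemma expand_local:
  assumes w: "w \<notin> PF"
  shows "\<exists>r>0. \<exists>C. \<forall>v\<in>ball w r. v \<notin> Q --> (\<forall>n z. (f ^^ n) z = v --> rho z \<le> C * (rho v * norm (deriv (f ^^ n) z)))"
proof -
  obtain H r c where H: "adm (ball 0 1) H" "H ` ball 0 1 \<subseteq> ball w 1" "H 0 = w" "r > 0" "c > 0"
    "\<And>v. v \<in> ball w r ==> v \<notin> Q ==> \<exists>a\<in>ball 0 (1/2). H a = v \<and> c \<le> rho v * norm (deriv H a)"
    by (rule chart[OF w]) (rule that; assumption)
  obtain e1 e2 where e: "e1 \<noteq> e2" "f e1 = e1" "f e2 = e2" "norm e1 > norm w + 1" "norm e2 > norm w + 1"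
    using far_fixed by blast
  have He: "H zeta \<noteq> e1 \<and> H zeta \<noteq> e2" if "zeta \<in> ball 0 1" for zeta
  proof -
    have "norm (H zeta) \<le> norm w + 1" using subsetD[OF H(2) imageI[OF that]] norm_triangle_sub[of "H zeta" w] by (simp add: dist_norm norm_minus_commute)
    then show ?thesis using e by auto
  qed
  obtain C where C: "C > 0" "\<And>h a s. s > 0 ==> adm (ball a s) h ==> omits e1 e2 (ball a s) h ==> h a \<notin> Q ==>
      rho (h a) * norm (deriv h a) * s \<le> C"
    by (rule adm_metric[OF Q_finite e(1)]) (rule that; assumption)
  have "rho z \<le> (2 * C / c) * (rho v * norm (deriv (f ^^ n) z))" if v: "v \<in> ball w r" "v \<notin> Q" "(f ^^ n) z = v" for v n z
  proof -
    obtain a where a: "a \<in> ball 0 (1/2)" "H a = v" "c \<le> rho v * norm (deriv H a)" using H(6)[OF v(1,2)] by blast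
    have za: "(f ^^ n) z = H a" using a(2) v(3) by simp
    obtain K where K: "K a = z" "deriv H a = deriv (f ^^ n) z * deriv K a"
      "adm (ball a (1/2)) K" "omits e1 e2 (ball a (1/2)) K"
      by (rule chart_lift[OF H(1) a(1) za e(2,3) He]) (assumption | rule that; assumption)+
    have zQ: "z \<notin> Q"
    proof
      assume "z \<in> Q"
      then have "(f ^^ n) z \<in> Q" using Q_inv by (induction n) auto
      then show False using v by simp
    qed
    have 1: "rho z * norm (deriv K a) \<le> 2 * C" using C(2)[OF _ K(3,4)] zQ K(1) by simp
    have "c * rho z \<le> rho v * norm (deriv H a) * rho z" using a(3) rho_pos[of z] by (intro mult_right_mono) auto
    also have "\<dots> = (rho v * norm (deriv (f ^^ n) z)) * (rho z * norm (deriv K a))" by (simp add: K(2) norm_mult)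
    also have "\<dots> \<le> (rho v * norm (deriv (f ^^ n) z)) * (2 * C)" using 1 rho_pos[of v] by (intro mult_left_mono) auto
    finally show ?thesis using H(5) by (simp add: field_simps)
  qed
  then show ?thesis using H(4) by blast
qed

lemma adm_exp: "adm (rhp L) exp"
proof (rule adm_unramified)
  show "exp holomorphic_on rhp L" by (intro holomorphic_intros)
  have "of_real (ln L + 1) \<in> rhp L" by (simp add: rhp_def)
  then show "\<not> (exp :: complex => complex) constant_on rhp L" using not_const_exp rhp(1) by blast
  show "exp ` rhp L \<inter> (PF \<union> Q) = {}" using exp_in_rhp[of L] L by force
qed

lemma exp_funpow_lift:
  assumes "a \<in> rhp L" "(f ^^ n) z = exp a"
  obtains K where "adm (rhp L) K" "K holomorphic_on rhp L" "\<And>s. s \<in> rhp L ==> (f ^^ n) (K s) = exp s" "K a = z"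
proof -
  obtain K where K: "adm (rhp L) K" "\<And>s. s \<in> rhp L ==> (f ^^ n) (K s) = exp s" "K a = z"
    by (rule adm_lift_funpow[OF rhp(1,4,5) assms(1) adm_exp assms(2)]) (rule that; assumption)
  then have "K holomorphic_on rhp L" by (simp add: adm_def)
  then show ?thesis using that K by blast
qed

text \<open>Near infinity the chart is \<open>exp\<close> on a disc of radius
  \<open>ln (norm v / L)\<close>, which is at least \<open>ln (norm v) / 2\<close> as soon as
  \<open>norm v > L\<^sup>2\<close>. This radius matches the factor \<open>ln (norm v)\<close> in
  \<open>wt v\<close>, so the constant is independent of \<open>v\<close>.\<close>

lemma expand_infinity:
  "\<exists>R1 C. L\<^sup>2 \<le> R1 \<and> 4 \<le> R1 \<and> (\<forall>n z. R1 < norm ((f ^^ n) z) --> rho z \<le> C * (rho ((f ^^ n) z) * norm (deriv (f ^^ n) z)))"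
proof -
  obtain e1 e2 where e: "e1 \<noteq> e2" "f e1 = e1" "f e2 = e2" "norm e1 \<le> L" "norm e2 \<le> L" using fixp by blast
  obtain C where C: "C > 0" "\<And>h a s. s > 0 ==> adm (ball a s) h ==> omits e1 e2 (ball a s) h ==> h a \<notin> Q ==>
      rho (h a) * norm (deriv h a) * s \<le> C"
    by (rule adm_metric[OF Q_finite e(1)]) (rule that; assumption)
  define R1 where "R1 = max 4 (L\<^sup>2)"
  have "rho z \<le> 16 * C * (rho v * norm (deriv (f ^^ n) z))" if v: "R1 < norm v" "(f ^^ n) z = v" for v n z
  proof -
    have v4: "norm v > 4" "norm v > L\<^sup>2" using v by (auto simp: R1_def)
    have v0: "v \<noteq> 0" using v4 by auto
    have "L \<le> L\<^sup>2" using L(1) by (simp add: power2_eq_square)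
    then have vL: "norm v > L" using v4 by linarith
    define a where "a = Ln v"
    have a: "a \<in> rhp L" unfolding a_def by (rule Ln_in_rhp) (use vL L(1) in auto)
    have ea: "exp a = v" using v0 by (simp add: a_def)
    define s where "s = Re a - ln L"
    have "ln (L\<^sup>2) < ln (norm v)" by (subst ln_less_cancel_iff) (use v4 L(1) v0 in auto)
    then have "2 * ln L < ln (norm v)" using L(1) by (simp add: ln_realpow)
    then have s: "s \<ge> ln (norm v) / 2" using v0 by (simp add: s_def a_def)
    have lnv: "ln (norm v) > 0" using v4 by (intro ln_gt_zero) linarith
    have s0: "s > 0" using s lnv by linarith
    have sub: "ball a s \<subseteq> rhp L"
    proof
      fix x assume "x \<in> ball a s"
      then have "\<bar>Re (x - a)\<bar> < s" using abs_Re_le_cmod[of "x - a"] by (simp add: dist_norm norm_minus_commute)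
      then show "x \<in> rhp L" by (simp add: rhp_def s_def)
    qed
    have za: "(f ^^ n) z = exp a" using v(2) ea by simp
    obtain K where K: "adm (rhp L) K" "K holomorphic_on rhp L" "\<And>s. s \<in> rhp L ==> (f ^^ n) (K s) = exp s" "K a = z"
      by (rule exp_funpow_lift[OF a za]) (rule that; assumption)
    have "omits e1 e2 (rhp L) K"
    proof (rule lift_omits[OF K(2,3) e(2,3)])
      show "exp zeta \<noteq> e1 \<and> exp zeta \<noteq> e2" if "zeta \<in> rhp L" for zeta
        using exp_in_rhp[of L zeta] that L(1) e(4,5) by auto
    qed
    then have om: "omits e1 e2 (ball a s) K" using sub by (rule omits_subset)
    have ad: "adm (ball a s) K" by (rule adm_subset[OF K(1) _ sub]) (use s0 rhp in auto)
    have zQ: "K a \<notin> Q" using good_back[of n z] good_big[OF vL] v(2) K(4) by (auto simp: good_def)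
    have 1: "rho z * norm (deriv K a) * s \<le> C" using C(2)[OF s0 ad om zQ] K(4) by simp
    have "deriv exp a = deriv (f ^^ n) (K a) * deriv K a" by (rule funpow_deriv_lift[OF rhp(1) K(2,3) a])
    then have nv: "norm v = norm (deriv (f ^^ n) z) * norm (deriv K a)" using ea K(4) by (simp add: norm_mult)
    have "1 \<le> rho v * wt v" using rho_ge[of v] wt_pos[of v] by (simp add: divide_le_eq)
    also have "\<dots> \<le> rho v * (8 * (norm v * ln (norm v)))" using wt_le[of v] v4 rho_pos[of v] by (intro mult_left_mono) auto
    also have "\<dots> \<le> rho v * (16 * (norm v * s))"
    proof (rule mult_left_mono)
      have "norm v * ln (norm v) \<le> norm v * (2 * s)" using s by (intro mult_left_mono) auto
      moreover have "norm v * (2 * s) = 2 * (norm v * s)" by simp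
      ultimately show "8 * (norm v * ln (norm v)) \<le> 16 * (norm v * s)" by linarith
    qed (use rho_pos[of v] in simp)
    finally have "rho z * 1 \<le> rho z * (rho v * (16 * (norm v * s)))" using rho_pos[of z] by (intro mult_left_mono) auto
    also have "\<dots> = 16 * (rho v * norm (deriv (f ^^ n) z)) * (rho z * norm (deriv K a) * s)" by (simp add: nv)
    also have "\<dots> \<le> 16 * (rho v * norm (deriv (f ^^ n) z)) * C" using 1 rho_pos[of v] by (intro mult_left_mono) auto
    finally show ?thesis by (simp add: mult_ac)
  qed
  then show ?thesis by (intro exI[of _ R1] exI[of _ "16 * C"]) (auto simp: R1_def)
qed

lemma expand_uniform:
  "\<exists>C\<ge>1. \<forall>n z. good ((f ^^ n) z) --> rho z \<le> C * (rho ((f ^^ n) z) * norm (deriv (f ^^ n) z))"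
proof -
  obtain R1 C1 where R1: "\<And>n z. R1 < norm ((f ^^ n) z) ==> rho z \<le> C1 * (rho ((f ^^ n) z) * norm (deriv (f ^^ n) z))"
    using expand_infinity by blast
  have "\<exists>C. \<forall>v\<in>closure Y \<inter> cball 0 R1. v \<notin> Q --> (\<forall>n z. (f ^^ n) z = v --> rho z \<le> C * (rho v * norm (deriv (f ^^ n) z)))"
  proof (rule compact_local_bound)
    show "compact (closure Y \<inter> cball 0 R1)" by (intro closed_Int_compact) auto
    show "\<exists>r>0. \<exists>C. \<forall>v\<in>ball w r. v \<notin> Q --> (\<forall>n z. (f ^^ n) z = v --> rho z \<le> C * (rho v * norm (deriv (f ^^ n) z)))"
      if "w \<in> closure Y \<inter> cball 0 R1" for w using expand_local clY_PF that by blast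
    show "v \<notin> Q --> (\<forall>n z. (f ^^ n) z = v --> rho z \<le> C' * (rho v * norm (deriv (f ^^ n) z)))"
      if *: "v \<notin> Q --> (\<forall>n z. (f ^^ n) z = v --> rho z \<le> C * (rho v * norm (deriv (f ^^ n) z)))" "C \<le> C'" for C C' v
    proof (intro impI allI)
      fix n z assume "v \<notin> Q" "(f ^^ n) z = v"
      then have "rho z \<le> C * (rho v * norm (deriv (f ^^ n) z))" using * by blast
      also have "\<dots> \<le> C' * (rho v * norm (deriv (f ^^ n) z))" using *(2) rho_pos[of v] by (intro mult_right_mono) auto
      finally show "rho z \<le> C' * (rho v * norm (deriv (f ^^ n) z))" .
    qed
  qed
  then obtain C2 where C2': "\<forall>v\<in>closure Y \<inter> cball 0 R1. v \<notin> Q --> (\<forall>n z. (f ^^ n) z = v --> rho z \<le> C2 * (rho v * norm (deriv (f ^^ n) z)))" ..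
  have C2: "rho z \<le> C2 * (rho ((f ^^ n) z) * norm (deriv (f ^^ n) z))" if "good ((f ^^ n) z)" "norm ((f ^^ n) z) \<le> R1" for n z
    using C2' that by (auto simp: good_def)
  define C where "C = max 1 (max C1 C2)"
  have "rho z \<le> C * (rho ((f ^^ n) z) * norm (deriv (f ^^ n) z))" if g: "good ((f ^^ n) z)" for n z
  proof -
    let ?D = "rho ((f ^^ n) z) * norm (deriv (f ^^ n) z)"
    have "?D \<ge> 0" using rho_pos[of "(f ^^ n) z"] by simp
    then have "C1 * ?D \<le> C * ?D" "C2 * ?D \<le> C * ?D" by (auto simp: C_def intro!: mult_right_mono)
    then show ?thesis using R1[of n z] C2[OF g] by linarith
  qed
  then show ?thesis by (intro exI[of _ C]) (auto simp: C_def)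
qed

section \<open>Strong expansion at points that are far out\<close>

lemma rho_far: "\<exists>S R. S > 0 \<and> (\<forall>z::complex. R \<le> norm z --> rho z * (norm z * ln (9 + (norm z)\<^sup>2)) \<le> S)"
proof (intro exI conjI allI impI)
  show "0 < 1 + real (card Q)" by simp
  fix z :: complex assume z: "L + 1 \<le> norm z"
  have "norm (z - q) powr (1 / real (nu q) - 1) \<le> 1" if "q \<in> Q" for q
  proof -
    have "norm q < L" using L(3) that by auto
    then have "norm (z - q) \<ge> 1" using z norm_triangle_ineq2[of z q] by linarith
    moreover have "1 / real (nu q) - 1 \<le> 0" using nu_pos[of q] by (simp add: divide_le_eq_1)
    ultimately show ?thesis using powr_mono[of "1 / real (nu q) - 1" 0 "norm (z - q)"] by (simp split: if_splits)
  qed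
  then have "(\<Sum>q\<in>Q. norm (z - q) powr (1 / real (nu q) - 1)) \<le> (\<Sum>q\<in>Q. 1)" by (rule sum_mono)
  then have "sig z \<le> 1 + real (card Q)" by (simp add: sig_def)
  moreover have "rho z * (norm z * ln (9 + (norm z)\<^sup>2)) \<le> rho z * wt z"
    using norm_ln_le_wt rho_pos[of z] by (intro mult_left_mono) auto
  moreover have "rho z * wt z = sig z"
  proof -
    have "wt z \<noteq> 0" using wt_pos[of z] by linarith
    then show ?thesis by (simp add: rho_def)
  qed
  ultimately show "rho z * (norm z * ln (9 + (norm z)\<^sup>2)) \<le> 1 + real (card Q)" by linarith
qed

lemma ln_far: "\<exists>R. \<forall>z::complex. R \<le> norm z --> A \<le> ln (9 + (norm z)\<^sup>2)"
proof (intro exI[of _ "exp A"] allI impI)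
  fix z :: complex assume z: "exp A \<le> norm z"
  have "exp A \<le> 9 + (norm z)\<^sup>2" using z le_9_plus_square[of "norm z"] by linarith
  then have "ln (exp A) \<le> ln (9 + (norm z)\<^sup>2)" by (subst ln_le_cancel_iff) (auto intro: add_pos_nonneg)
  then show "A \<le> ln (9 + (norm z)\<^sup>2)" by simp
qed

text \<open>\<open>rho z\<close> is of order \<open>1 / (norm z * ln (norm z))\<close>, while the
  hypothesis makes \<open>D\<close> at least of order \<open>1 / norm z\<close>; the additional
  logarithm beats any \<open>\<epsilon>'\<close>.\<close>

lemma far_contract:
  assumes "\<epsilon>' > 0" "M > 0"
  shows "\<exists>R. \<forall>(z::complex) D. R \<le> norm z --> 1 \<le> M * (norm z * D) --> 0 \<le> D --> rho z \<le> \<epsilon>' * D"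
proof -
  obtain S R where S: "S > 0" "\<And>z. R \<le> norm z ==> rho z * (norm z * ln (9 + (norm z)\<^sup>2)) \<le> S" using rho_far by blast
  have "S * M / \<epsilon>' > 0" using assms S by simp
  obtain R' where R': "\<And>z::complex. R' \<le> norm z ==> S * M / \<epsilon>' \<le> ln (9 + (norm z)\<^sup>2)" using ln_far by blast
  have "rho z \<le> \<epsilon>' * D" if z: "max 1 (max R R') \<le> norm z" "1 \<le> M * (norm z * D)" "0 \<le> D" for z :: complex and D
  proof -
    define l where "l = ln (9 + (norm z)\<^sup>2)"
    have l: "l > 1" "S * M / \<epsilon>' \<le> l" using ln9_gt_1[of "norm z"] R'[of z] z by (auto simp: l_def)
    have "rho z * (norm z * l) * 1 \<le> S * (M * (norm z * D))"
      using S z by (intro mult_mono) (auto simp: l_def)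
    then have "norm z * (rho z * l) \<le> norm z * (S * M * D)" by (simp add: mult_ac)
    then have "rho z * l \<le> S * M * D" using z(1) by (auto simp: mult_le_cancel_left)
    moreover have "S * M \<le> \<epsilon>' * l" using l(2) assms by (simp add: field_simps)
    then have "S * M * D \<le> \<epsilon>' * l * D" using z(3) by (intro mult_right_mono) auto
    ultimately have "l * rho z \<le> l * (\<epsilon>' * D)" by (simp add: mult_ac)
    then show ?thesis using l(1) by simp
  qed
  then show ?thesis by blast
qed

text \<open>A lift \<open>K\<close> of the chart that starts far out stays far out on a smaller
  disc. If its logarithm had derivative above \<open>48 * pi\<close>, Bloch's theorem would put a
  whole circle into the image of \<open>K\<close>; on this circle \<open>f\<close> takes large
  values, whereas \<open>f \<circ> K\<close> is the bounded chart. So \<open>deriv K\<close> is at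
  most of order \<open>norm z\<close>, and \<open>far_contract\<close> applies.\<close>

lemma contract_local:
  assumes w: "w \<notin> PF" and \<epsilon>': "\<epsilon>' > 0"
  shows "\<exists>r>0. \<exists>R. \<forall>v\<in>ball w r. v \<notin> Q --> (\<forall>z. R \<le> norm z --> f z = v --> rho z \<le> \<epsilon>' * (rho v * norm (deriv f z)))"
proof -
  obtain H r c where H: "adm (ball 0 1) H" "H ` ball 0 1 \<subseteq> ball w 1" "H 0 = w" "r > 0" "c > 0"
    "\<And>v. v \<in> ball w r ==> v \<notin> Q ==> \<exists>a\<in>ball 0 (1/2). H a = v \<and> c \<le> rho v * norm (deriv H a)"
    by (rule chart[OF w]) (rule that; assumption)
  obtain e1 e2 where e: "e1 \<noteq> e2" "f e1 = e1" "f e2 = e2" "norm e1 > norm w + 1" "norm e2 > norm w + 1"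
    using far_fixed by blast
  have HB: "norm (H zeta) \<le> norm w + 1" if "zeta \<in> ball 0 1" for zeta
    using subsetD[OF H(2) imageI[OF that]] norm_triangle_sub[of "H zeta" w] by (simp add: dist_norm norm_minus_commute)
  have He: "H zeta \<noteq> e1 \<and> H zeta \<noteq> e2" if "zeta \<in> ball 0 1" for zeta using HB[OF that] e by auto
  obtain s0 where s0: "\<And>s. s \<ge> s0 ==> \<exists>z. norm z = s \<and> norm w + 1 < norm (f z)" using unbounded_circle by blast
  define s1 where "s1 = max s0 1"
  obtain C2 where C2: "C2 > 0" "\<And>h c r s z. 0 \<le> s ==> s < r ==> omits e1 e2 (ball c r) h ==> z \<in> cball c s ==>
     \<bar>theta (h z) - theta (h c)\<bar> \<le> C2 * s / (r - s)"
    by (rule landau_theta[OF e(1)]) (rule that; assumption)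
  define R0' where "R0' = exp (exp (theta (of_real s1) + C2)) + 1"
  have "48 * pi / c > 0" using H(5) by simp
  then obtain R where R: "\<And>z D. R \<le> norm z ==> 1 \<le> (48 * pi / c) * (norm z * D) ==> 0 \<le> D ==> rho z \<le> \<epsilon>' * D"
    using far_contract[OF \<epsilon>'] by blast
  have "rho z \<le> \<epsilon>' * (rho v * norm (deriv f z))" if v: "v \<in> ball w r" "v \<notin> Q" "max R0' R \<le> norm z" "f z = v" for v z
  proof -
    obtain a where a: "a \<in> ball 0 (1/2)" "H a = v" "c \<le> rho v * norm (deriv H a)" using H(6)[OF v(1,2)] by blast
    have za: "(f ^^ 1) z = H a" using a(2) v(4) by simp
    obtain K where K: "adm (ball 0 1) K" "\<And>zeta. zeta \<in> ball 0 1 ==> (f ^^ 1) (K zeta) = H zeta" "K a = z" "omits e1 e2 (ball 0 1) K"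
      "deriv H a = deriv (f ^^ 1) z * deriv K a"
      "adm (ball a (1/2)) K" "omits e1 e2 (ball a (1/2)) K"
      by (rule chart_lift[OF H(1) a(1) za e(2,3) He]) (assumption | rule that; assumption)+
    have big: "norm (K zeta) > s1" if "zeta \<in> ball a (1/4)" for zeta
    proof (rule ccontr)
      assume "\<not> norm (K zeta) > s1"
      then have "theta (K zeta) \<le> theta (of_real s1)" by (intro norm_le_imp_theta_le) simp
      moreover have "\<bar>theta (K zeta) - theta (K a)\<bar> \<le> C2 * (1/4) / (1/2 - 1/4)"
        by (rule C2(2)[OF _ _ K(7)]) (use that in auto)
      ultimately have "theta z \<le> theta (of_real s1) + C2" using K(3) by simp
      then have "norm z \<le> exp (exp (theta (of_real s1) + C2))" by (rule theta_le_imp_norm_le)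
      then show False using v(3) by (simp add: R0'_def)
    qed
    have sub: "ball a (1/4) \<subseteq> ball 0 1"
    proof
      fix x assume "x \<in> ball a (1/4)"
      then show "x \<in> ball 0 1" using a(1) norm_triangle_sub[of x a] by (simp add: dist_norm norm_minus_commute)
    qed
    have Kh: "K holomorphic_on ball a (1/4)" using K(1) sub holomorphic_on_subset by (auto simp: adm_def)
    have Knz: "K zeta \<noteq> 0" if "zeta \<in> ball a (1/4)" for zeta using big[OF that] by (auto simp: s1_def)
    obtain u where u: "u holomorphic_on ball a (1/4)" "\<And>zeta. zeta \<in> ball a (1/4) ==> exp (u zeta) = K zeta"
      by (rule holomorphic_log_convex[OF open_ball convex_ball Kh Knz]) (assumption | rule that; assumption)+
    have du: "norm (deriv u a) \<le> 48 * pi"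
    proof (rule ccontr)
      assume neg: "\<not> norm (deriv u a) \<le> 48 * pi"
      define r' where "r' = (1/4) * norm (deriv u a) / 12"
      have r': "r' > pi" using neg by (simp add: r'_def)
      obtain b where b: "ball b r' \<subseteq> u ` ball a (1/4)"
        using Bloch[OF u(1), of r'] by (auto simp: r'_def)
      have seg: "\<exists>zeta\<in>ball a (1/4). K zeta = y" if y: "norm y = exp (Re b)" for y
      proof -
        define t where "t = Im (Ln (y / exp b))"
        have y0: "y / exp b \<noteq> 0" using y by auto
        have t: "\<bar>t\<bar> \<le> pi" using Im_Ln_le_pi[OF y0] mpi_less_Im_Ln[OF y0] by (simp add: t_def abs_le_iff)
        have "Ln (y / exp b) = \<i> * of_real t"
          using y y0 by (intro complex_eqI) (auto simp: t_def norm_divide)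
        then have "exp (\<i> * of_real t) = y / exp b" using exp_Ln[OF y0] by simp
        then have ey: "exp (b + \<i> * of_real t) = y" by (simp add: exp_add)
        have "b + \<i> * of_real t \<in> ball b r'" using t r' by (simp add: dist_norm norm_mult)
        then obtain zeta where "zeta \<in> ball a (1/4)" "u zeta = b + \<i> * of_real t" using b by (metis (no_types, lifting) imageE subsetD)
        then show ?thesis using u(2) ey by metis
      qed
      have "norm (exp b) = exp (Re b)" by simp
      then obtain zeta where zeta: "zeta \<in> ball a (1/4)" "K zeta = exp b" using seg by blast
      have "exp (Re b) \<ge> s0" using big[OF zeta(1)] zeta(2) by (simp add: s1_def)
      then obtain y where y: "norm y = exp (Re b)" "norm w + 1 < norm (f y)" using s0 by blast
      obtain xi where xi: "xi \<in> ball a (1/4)" "K xi = y" using seg[OF y(1)] by blast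
      then have "f y = H xi" using K(2)[of xi] sub by auto
      then show False using y(2) HB[of xi] xi(1) sub by auto
    qed
    have "deriv K a = exp (u a) * deriv u a"
      using exp_map.deriv_lift[OF open_ball u, of a] by simp
    then have dK: "norm (deriv K a) \<le> norm z * (48 * pi)"
      using du u(2)[of a] K(3) by (simp add: norm_mult mult_left_mono)
    have "c \<le> rho v * norm (deriv H a)" by (rule a(3))
    also have "\<dots> = rho v * norm (deriv f z) * norm (deriv K a)" using K(5) by (simp add: norm_mult)
    also have "\<dots> \<le> rho v * norm (deriv f z) * (norm z * (48 * pi))" using dK rho_pos[of v] by (intro mult_left_mono) auto
    finally have "1 \<le> (48 * pi / c) * (norm z * (rho v * norm (deriv f z)))" using H(5) by (simp add: field_simps)
    then show ?thesis using R v(3) rho_pos[of v] by simp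
  qed
  then show ?thesis using H(4) by blast
qed

text \<open>Over compact sets this is \<open>contract_local\<close>. Near infinity
  \<open>expansion\<close> gives
  \<open>wt (f z) \<le> 192 * pi * (norm z * norm (deriv f z))\<close>, where
  \<open>192 = 16 * 12\<close>.\<close>

lemma contract_far:
  assumes \<epsilon>': "\<epsilon>' > 0"
  shows "\<exists>R. \<forall>z. R \<le> norm z --> good (f z) --> rho z \<le> \<epsilon>' * (rho (f z) * norm (deriv f z))"
proof -
  define R1 where "R1 = max 4 (L\<^sup>2)"
  obtain R where R: "\<And>z D. R \<le> norm z ==> 1 \<le> (192 * pi) * (norm z * D) ==> 0 \<le> D ==> rho z \<le> \<epsilon>' * D"
    using far_contract[OF \<epsilon>', of "192 * pi"] by auto
  have far: "rho z \<le> \<epsilon>' * (rho (f z) * norm (deriv f z))" if z: "R \<le> norm z" "R1 < norm (f z)" for z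
  proof -
    have v: "norm (f z) > 4" "norm (f z) > L\<^sup>2" using z by (auto simp: R1_def)
    have "R0\<^sup>2 \<le> L\<^sup>2" using R0 L(2) by (intro power_mono) auto
    then have vR: "norm (f z) > R0\<^sup>2" using v by linarith
    have "R0 \<le> R0\<^sup>2" using R0 by (simp add: power2_eq_square)
    then have vR0: "norm (f z) > R0" using vR by linarith
    have fz0: "f z \<noteq> 0" using v by auto
    have "ln (R0\<^sup>2) < ln (norm (f z))" by (subst ln_less_cancel_iff) (use vR R0 fz0 in auto)
    then have "ln (norm (f z)) \<le> 2 * ln (norm (f z) / R0)" using R0 fz0 by (simp add: ln_realpow ln_div)
    then have "wt (f z) \<le> 8 * (norm (f z) * (2 * ln (norm (f z) / R0)))"
      using wt_le[of "f z"] v mult_left_mono[of "ln (norm (f z))" "2 * ln (norm (f z) / R0)" "norm (f z)"] by linarith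
    also have "\<dots> \<le> 16 * (12 * pi * (norm z * norm (deriv f z)))" using expansion[OF vR0] by simp
    finally have w: "wt (f z) \<le> 192 * pi * (norm z * norm (deriv f z))" by simp
    have "1 \<le> rho (f z) * wt (f z)" using rho_ge[of "f z"] wt_pos[of "f z"] by (simp add: divide_le_eq)
    also have "\<dots> \<le> rho (f z) * (192 * pi * (norm z * norm (deriv f z)))" using w rho_pos[of "f z"] by (intro mult_left_mono) auto
    finally have "1 \<le> 192 * pi * (norm z * (rho (f z) * norm (deriv f z)))" by (simp add: mult_ac)
    then show ?thesis using R[OF z(1)] rho_pos[of "f z"] by simp
  qed
  have "\<exists>R. \<forall>v\<in>closure Y \<inter> cball 0 R1. v \<notin> Q --> (\<forall>z. R \<le> norm z --> f z = v --> rho z \<le> \<epsilon>' * (rho v * norm (deriv f z)))"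
  proof (rule compact_local_bound)
    show "compact (closure Y \<inter> cball 0 R1)" by (intro closed_Int_compact) auto
    show "\<exists>r>0. \<exists>R. \<forall>v\<in>ball w r. v \<notin> Q --> (\<forall>z. R \<le> norm z --> f z = v --> rho z \<le> \<epsilon>' * (rho v * norm (deriv f z)))"
      if "w \<in> closure Y \<inter> cball 0 R1" for w using contract_local[OF clY_PF \<epsilon>'] that by blast
  qed auto
  then obtain R2 where R2': "\<forall>v\<in>closure Y \<inter> cball 0 R1. v \<notin> Q --> (\<forall>z. R2 \<le> norm z --> f z = v --> rho z \<le> \<epsilon>' * (rho v * norm (deriv f z)))" ..
  have R2: "rho z \<le> \<epsilon>' * (rho (f z) * norm (deriv f z))" if "good (f z)" "norm (f z) \<le> R1" "R2 \<le> norm z" for z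
    using R2' that by (auto simp: good_def)
  show ?thesis
  proof (intro exI[of _ "max R R2"] allI impI)
    fix z assume "max R R2 \<le> norm z" "good (f z)"
    then show "rho z \<le> \<epsilon>' * (rho (f z) * norm (deriv f z))"
      using far[of z] R2[of z] by (cases "R1 < norm (f z)") auto
  qed
qed

end

section \<open>Strong expansion along long orbits between bounded sets\<close>

lemma eventually_seq_pick:
  assumes "\<And>i. \<forall>\<^sub>F j in sequentially. \<exists>u. P i j u" and inf: "infinite {j::nat. B j}"
  obtains q u where "\<And>i. (i::nat) \<le> q i" "\<And>i. B (q i)" "\<And>i::nat. P i (q i) (u i)"
proof -
  have "\<exists>j u. i \<le> j \<and> B j \<and> P i j u" for i
  proof -
    obtain N where N: "\<And>j. j \<ge> N ==> \<exists>u. P i j u" using assms(1)[of i] unfolding eventually_sequentially by blast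
    obtain j where "j \<ge> max N i" "B j" using inf unfolding infinite_nat_iff_unbounded_le by blast
    then show ?thesis using N[of j] by auto
  qed
  then obtain q u where "\<And>i. i \<le> q i \<and> B (q i) \<and> P i (q i) (u i)" by metis
  then show ?thesis using that by blast
qed

text \<open>\<open>h - v\<close> is at least \<open>d / 2\<close> on the boundary circle and smaller
  at the centre, so it has a zero.\<close>

lemma near_identity_surj:
  assumes h: "h holomorphic_on ball v d" "continuous_on (cball v d) h" and d: "d > 0"
    and near: "\<And>u. u \<in> cball v d ==> norm (h u - u) < d / 2"
  shows "\<exists>u\<in>ball v d. h u = v"
proof -
  have "\<exists>u\<in>ball v d. h u - v = 0"
  proof (rule nonvanishing_min_modulus[where m = "d / 2"])
    show "norm (h v - v) < d / 2" using near d by simp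
    show "d / 2 \<le> norm (h u - v)" if u: "u \<in> sphere v d" for u
    proof -
      have "norm (u - v) = d" using u by (simp add: dist_norm norm_minus_commute)
      then show ?thesis using near[of u] u norm_triangle_ineq2[of "u - v" "u - h u"] by (simp add: norm_minus_commute)
    qed
  qed (use d in \<open>auto intro!: holomorphic_intros continuous_intros h\<close>)
  then show ?thesis by simp
qed

context expanding
begin

lemma Q_inv_funpow: "z \<in> Q ==> (f ^^ n) z \<in> Q"
  using Q_inv by (induction n) auto

text \<open>Lifts of a disc along iterates tending to the identity near one of its points again tend to
  the identity, so the iterates tend to the identity near its centre too.\<close>

lemma identity_spreads:
  assumes m: "r > 0" "ball w r \<inter> (PF \<union> Q) = {}" and w': "w' \<in> ball w (r/2)"
    and e': "e' > 0" "uniform_limit (ball w' e') (\<lambda>j. f ^^ m j) (\<lambda>z. z) sequentially"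
  shows "uniform_limit (ball w (r/4)) (\<lambda>j. f ^^ m j) (\<lambda>z. z) sequentially"
proof (rule ccontr)
  assume "\<not> ?thesis"
  then obtain \<tau> where \<tau>: "\<tau> > 0" "\<not> (\<forall>\<^sub>F j in sequentially. \<forall>v\<in>ball w (r/4). dist ((f ^^ m j) v) v < \<tau>)"
    unfolding uniform_limit_iff by blast
  have w'r: "w' \<in> ball w r" using w' m(1) by auto
  define bad where "bad j \<longleftrightarrow> (\<exists>v\<in>ball w (r/4). \<not> dist ((f ^^ m j) v) v < \<tau>)" for j
  have inf: "infinite {j. bad j}"
    unfolding infinite_nat_iff_unbounded_le
  proof
    fix N
    show "\<exists>n\<ge>N. n \<in> {j. bad j}" using \<tau>(2) unfolding eventually_sequentially bad_def by blast
  qed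
  \<comment> \<open>Iterates close to the identity near \<open>w'\<close> take the value
    \<open>w'\<close> at points \<open>u\<close> tending to \<open>w'\<close>; there the lifts
    start.\<close>
  have zero: "\<forall>\<^sub>F j in sequentially. \<exists>u. dist u w' < 1 / real (Suc i) \<and> (f ^^ m j) u = w'" for i
  proof -
    define d where "d = min (e' / 2) (1 / real (Suc i))"
    have d: "d > 0" "d < e'" "d \<le> 1 / real (Suc i)" using e'(1) by (auto simp: d_def)
    have "\<forall>\<^sub>F j in sequentially. \<forall>z\<in>ball w' e'. dist ((f ^^ m j) z) z < d / 2"
      using e'(2) d(1) unfolding uniform_limit_iff by (meson half_gt_zero)
    then show ?thesis
    proof eventually_elim
      case (elim j)
      have "norm ((f ^^ m j) u - u) < d / 2" if "u \<in> cball w' d" for u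
        using elim that d(2) by (simp add: dist_norm)
      then obtain u where "u \<in> ball w' d" "(f ^^ m j) u = w'"
        using near_identity_surj[OF funpow_hol funpow_cont d(1)] by blast
      then show ?case using d(3) by (intro exI[of _ u]) (simp add: dist_commute)
    qed
  qed
  obtain q u where q: "\<And>i. i \<le> q i" "\<And>i. bad (q i)" "\<And>i. dist (u i) w' < 1 / real (Suc i) \<and> (f ^^ m (q i)) (u i) = w'"
    by (rule eventually_seq_pick[OF zero inf]) (rule that; assumption)
  have ul: "u \<longlonglongrightarrow> w'"
    unfolding tendsto_iff
  proof (intro allI impI)
    fix e :: real assume "e > 0"
    then have "\<forall>\<^sub>F i in sequentially. 1 / real (Suc i) < e" by real_asymp
    then show "\<forall>\<^sub>F i in sequentially. dist (u i) w' < e" by eventually_elim (use q(3) less_trans in blast)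
  qed
  have qtop: "filterlim q at_top sequentially"
    by (rule filterlim_at_top_mono[OF filterlim_ident]) (simp add: q(1))
  have ulq: "uniform_limit (ball w' e') (\<lambda>i. f ^^ m (q i)) (\<lambda>z. z) sequentially"
    using filterlim_compose[OF e'(2) qtop] by (simp add: o_def)
  obtain e1 e2 where e: "e1 \<noteq> e2" "f e1 = e1" "f e2 = e2" "norm e1 > norm w + r" "norm e2 > norm w + r"
    using far_fixed by blast
  have wr: "w \<in> ball w r" using m by simp
  have admid: "adm (ball w r) (\<lambda>z. z)"
  proof (rule adm_unramified)
    show "\<not> (\<lambda>z. z) constant_on ball w r"
    proof
      assume "(\<lambda>z. z) constant_on ball w r"
      then obtain c where c: "\<forall>z\<in>ball w r. z = c" unfolding constant_on_def ..
      have "w + of_real (r / 2) \<in> ball w r" using m by (simp add: dist_norm)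
      from bspec[OF c this] bspec[OF c wr] have "w + of_real (r / 2) = w" by (rule trans[OF _ sym])
      then show False using m by simp
    qed
  qed (use m(2) in auto)
  have nU: "ball w r \<noteq> UNIV" using bounded_ball[of w r] not_bounded_UNIV by metis
  have sc: "simply_connected (ball w r)" by (simp add: convex_imp_simply_connected)
  have "\<exists>K. K holomorphic_on ball w r \<and> (\<forall>zeta\<in>ball w r. (f ^^ m (q i)) (K zeta) = zeta) \<and> K w' = u i" for i
  proof -
    have "(f ^^ m (q i)) (u i) = w'" using q(3) by blast
    then obtain K where "adm (ball w r) K" "\<And>zeta. zeta \<in> ball w r ==> (f ^^ m (q i)) (K zeta) = zeta" "K w' = u i"
      using adm_lift_funpow[OF open_ball sc nU w'r admid] by blast
    then show ?thesis unfolding adm_def by blast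
  qed
  then obtain K where K: "\<And>i. K i holomorphic_on ball w r" "\<And>i zeta. zeta \<in> ball w r ==> (f ^^ m (q i)) (K i zeta) = zeta"
    "\<And>i. K i w' = u i" by metis
  have om: "omits e1 e2 (ball w r) (K i)" for i
  proof (rule lift_omits[OF K(1) K(2) e(2,3)])
    show "zeta \<noteq> e1 \<and> zeta \<noteq> e2" if "zeta \<in> ball w r" for zeta
      using that e norm_triangle_sub[of zeta w] by (auto simp: dist_norm norm_minus_commute)
  qed
  have bd: "norm (K i w') \<le> norm w' + 1" for i
  proof -
    have "dist (u i) w' < 1 / real (Suc i)" using q(3) by blast
    also have "\<dots> \<le> 1" by simp
    finally show ?thesis using K(3) norm_triangle_sub[of "u i" w'] by (simp add: dist_norm)
  qed
  obtain G s where G: "G holomorphic_on ball w r" "strict_mono (s :: nat => nat)"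
    "\<And>X. compact X ==> X \<subseteq> ball w r ==> uniform_limit X (K \<circ> s) G sequentially"
    by (rule normal_two[OF e(1) m(1) om tendsto_const w'r w'r bd]) (rule that; assumption)
  have pt: "(\<lambda>i. K (s i) zeta) \<longlonglongrightarrow> G zeta" if "zeta \<in> ball w r" for zeta
    using tendsto_uniform_limitI[OF G(3)[of "{zeta}"], of zeta] that by (simp add: o_def)
  have us: "(\<lambda>i. u (s i)) \<longlonglongrightarrow> w'" using LIMSEQ_subseq_LIMSEQ[OF ul G(2)] by (simp add: o_def)
  have Gw': "G w' = w'" using LIMSEQ_unique[OF pt[OF w'r]] us K(3) by simp
  have cG: "continuous_on (ball w r) G" using G(1) by (rule holomorphic_on_imp_continuous_on)
  define V where "V = ball w r \<inter> G -` ball w' e'"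
  have V: "open V" "w' \<in> V" unfolding V_def
    using continuous_open_preimage[OF cG open_ball open_ball] w'r Gw' e'(1) by auto
  \<comment> \<open>The lifted points eventually lie where the iterates are close to the identity,
    and the iterates carry them to \<open>zeta\<close>; so their limit is
    \<open>zeta\<close>.\<close>
  have Gid1: "G zeta = zeta" if "zeta \<in> V" for zeta
  proof -
    have zeta: "zeta \<in> ball w r" "G zeta \<in> ball w' e'" using that by (auto simp: V_def)
    have ev: "\<forall>\<^sub>F i in sequentially. K (s i) zeta \<in> ball w' e'"
      using topological_tendstoD[OF pt[OF zeta(1)] open_ball zeta(2)] .
    have ul2: "uniform_limit (ball w' e') (\<lambda>i. f ^^ m (q (s i))) (\<lambda>z. z) sequentially"
      using filterlim_compose[OF ulq filterlim_subseq[OF G(2)]] by (simp add: o_def)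
    have "(\<lambda>i. zeta - K (s i) zeta) \<longlonglongrightarrow> 0"
      unfolding tendsto_iff
    proof (intro allI impI)
      fix e :: real assume "e > 0"
      then have "\<forall>\<^sub>F i in sequentially. \<forall>z\<in>ball w' e'. dist ((f ^^ m (q (s i))) z) z < e"
        using ul2 unfolding uniform_limit_iff by blast
      with ev show "\<forall>\<^sub>F i in sequentially. dist (zeta - K (s i) zeta) 0 < e"
        by eventually_elim (use K(2)[OF zeta(1)] in \<open>fastforce simp: dist_norm\<close>)
    qed
    moreover have "(\<lambda>i. zeta - K (s i) zeta) \<longlonglongrightarrow> zeta - G zeta" by (intro tendsto_intros pt zeta(1))
    ultimately show ?thesis using LIMSEQ_unique by fastforce
  qed
  have Gid: "G zeta = zeta" if "zeta \<in> ball w r" for zeta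
    by (rule analytic_continuation_open[OF V(1) open_ball _ connected_ball _ G(1) _ _ that])
      (use V Gid1 in \<open>auto simp: V_def intro: holomorphic_intros\<close>)
  define d where "d = min \<tau> (r / 4)"
  have d: "d > 0" "d \<le> \<tau>" "d \<le> r / 4" using \<tau>(1) m(1) by (auto simp: d_def)
  have "cball w (r / 2) \<subseteq> ball w r" using m(1) by auto
  then have "uniform_limit (cball w (r / 2)) (K \<circ> s) G sequentially" using G(3) compact_cball by blast
  then have "\<forall>\<^sub>F i in sequentially. \<forall>zeta\<in>cball w (r / 2). dist (K (s i) zeta) (G zeta) < d / 2"
    unfolding uniform_limit_iff o_def using d(1) by (meson half_gt_zero)
  then obtain i where i: "\<And>zeta. zeta \<in> cball w (r / 2) ==> dist (K (s i) zeta) (G zeta) < d / 2"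
    using eventually_happens'[OF sequentially_bot] by blast
  have i': "norm (K (s i) zeta - zeta) < d / 2" if "zeta \<in> cball w (r / 2)" for zeta
    using i[OF that] Gid[of zeta] that m(1) by (simp add: dist_norm)
  obtain v where v: "v \<in> ball w (r / 4)" "\<not> dist ((f ^^ m (q (s i))) v) v < \<tau>" using q(2)[of "s i"] by (auto simp: bad_def)
  have sub: "cball v d \<subseteq> cball w (r / 2)"
  proof
    fix x assume "x \<in> cball v d"
    then show "x \<in> cball w (r / 2)" using v(1) d(3) dist_triangle[of w x v] by simp
  qed
  have Kh: "K (s i) holomorphic_on cball v d"
  proof (rule holomorphic_on_subset[OF K(1)])
    have "cball w (r / 2) \<subseteq> ball w r" using m(1) by auto
    with sub show "cball v d \<subseteq> ball w r" by (rule subset_trans)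
  qed
  \<comment> \<open>A lift close to the identity attains \<open>v\<close>, and the iterate undoes
    the lift: it sends \<open>v\<close> to a point within \<open>\<tau>\<close> of \<open>v\<close>,
    although the index is bad.\<close>
  obtain zeta where zeta: "zeta \<in> ball v d" "K (s i) zeta = v"
    using near_identity_surj[OF holomorphic_on_subset[OF Kh ball_subset_cball] holomorphic_on_imp_continuous_on[OF Kh] d(1)] i' sub by blast
  have "zeta \<in> cball w (r / 2)" using zeta(1) sub ball_subset_cball by blast
  then have "zeta \<in> ball w r" using m(1) by auto
  then have "(f ^^ m (q (s i))) v = zeta" using K(2)[of zeta "s i"] zeta(2) by simp
  then show False using v(2) zeta(1) d(2) by (simp add: dist_commute)
qed

definition X0 :: "complex set" where "X0 = connected_component_set (- PF) (of_real (L + 1))"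

lemma X0: "open X0" "connected X0" "X0 \<subseteq> - PF" "- cball 0 L \<subseteq> X0"
proof -
  show "open X0" unfolding X0_def using PF_compact compact_imp_closed by (intro open_connected_component) auto
  show "connected X0" "X0 \<subseteq> - PF" unfolding X0_def by (simp_all add: connected_component_subset)
  show "- cball 0 L \<subseteq> X0" unfolding X0_def
  proof (rule connected_component_maximal)
    show "complex_of_real (L + 1) \<in> - cball 0 L" using L(1) by simp
    show "connected (- cball (0::complex) L)"
      by (rule connected_complement_bounded_convex) auto
    show "- cball 0 L \<subseteq> - PF" using L(3) by auto
  qed
qed

text \<open>On a bounded component of \<open>- PF\<close> the maximum principle bounds every iterate
  by \<open>L\<close>, which is its bound on \<open>PF\<close>.\<close>

lemma Y_subset_X0: "Y \<subseteq> X0"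
proof
  fix y assume y: "y \<in> Y"
  then obtain n where n: "L < norm ((f ^^ n) y)" by (auto simp: Y_def)
  show "y \<in> X0"
  proof (rule ccontr)
    assume yX: "y \<notin> X0"
    have yP: "y \<notin> PF" using y clY_PF closure_subset by blast
    define C where "C = connected_component_set (- PF) y"
    have Cy: "y \<in> C" using yP by (simp add: C_def)
    have "C \<inter> X0 = {}"
      unfolding C_def X0_def using yX yP X0_def connected_component_nonoverlap[of "- PF" y "of_real (L + 1)"]
      by (metis connected_component_disjoint)
    then have Csub: "C \<subseteq> cball 0 L" using X0(4) by blast
    then have Cb: "bounded C" using bounded_cball bounded_subset by blast
    have Cc: "C \<in> components (- PF)" using yP by (auto simp: C_def components_def)
    have fr: "frontier C \<subseteq> PF"
      using frontier_of_components_closed_complement[OF compact_imp_closed[OF PF_compact] Cc] .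
    have "norm ((f ^^ n) y) \<le> L"
    proof (rule maximum_modulus_frontier[OF funpow_hol funpow_cont Cb _ Cy])
      show "norm ((f ^^ n) z) \<le> L" if "z \<in> frontier C" for z
        using orbit_bound[of z z n] fr that eps by auto
    qed
    then show False using n by simp
  qed
qed

text \<open>A nonconstant limit of lifts of a disc along higher and higher iterates would make
  some iterates tend to the identity near a point, hence on all of the unbounded complementary
  component, which contains repelling fixed points.\<close>

lemma lift_limit_constant:
  assumes w: "w \<in> closure Y" and H: "adm (ball 0 1) H" "H 0 = w"
    and n: "strict_mono n" and K: "\<And>j. K j holomorphic_on ball 0 1" "\<And>j zeta. zeta \<in> ball 0 1 ==> (f ^^ n j) (K j zeta) = H zeta"
    and g: "g holomorphic_on ball 0 1" "\<And>X. compact X ==> X \<subseteq> ball 0 1 ==> uniform_limit X K g sequentially"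
  shows "g constant_on ball 0 1"
proof (rule ccontr)
  assume nc: "\<not> g constant_on ball 0 1"
  have Hh: "H holomorphic_on ball 0 1" "\<not> H constant_on ball 0 1" using H by (auto simp: adm_def)
  have b0: "(0::complex) \<in> ball 0 1" by simp
  obtain \<rho> where \<rho>: "0 < \<rho>" "ball 0 \<rho> \<subseteq> ball (0::complex) 1" "\<And>w. w \<in> ball 0 \<rho> ==> w \<noteq> 0 ==> deriv g w \<noteq> 0"
    by (rule deriv_isolated_zeros[OF g(1) open_ball connected_ball b0 nc]) (rule that; assumption)
  have oH: "open (H ` U)" if "open U" "U \<subseteq> ball 0 1" for U
    by (rule open_mapping_thm[OF Hh(1) open_ball connected_ball that Hh(2)])
  have "\<not> H ` (ball 0 \<rho> - {0}) \<subseteq> Q"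
  proof
    assume "H ` (ball 0 \<rho> - {0}) \<subseteq> Q"
    then have "finite (H ` (ball 0 \<rho> - {0}))" using Q_finite finite_subset by blast
    moreover have "open (H ` (ball 0 \<rho> - {0}))" by (rule oH) (use \<rho>(2) in auto)
    moreover have "of_real (\<rho> / 2) \<in> ball (0::complex) \<rho> - {0}" using \<rho>(1) by auto
    ultimately show False using finite_imp_not_open by blast
  qed
  then obtain zeta0 where zeta0: "zeta0 \<in> ball 0 \<rho>" "zeta0 \<noteq> 0" "H zeta0 \<notin> Q" by blast
  have zeta01: "zeta0 \<in> ball 0 1" using zeta0(1) \<rho>(2) by blast
  have "deriv g zeta0 \<noteq> 0" using \<rho>(3) zeta0 by blast
  then obtain r1 where r1: "r1 > 0" "ball zeta0 r1 \<subseteq> ball 0 1" "inj_on g (ball zeta0 r1)"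
    by (rule has_complex_derivative_locally_injective[OF g(1) zeta01 open_ball]) (rule that; assumption)
  define B where "B = cball zeta0 (3 * r1 / 4)"
  have B: "compact B" "B \<subseteq> ball zeta0 r1" "B \<subseteq> ball 0 1" using r1 by (auto simp: B_def subset_iff)
  have cg: "continuous_on B g" using g(1) B(3) holomorphic_on_imp_continuous_on continuous_on_subset by blast
  have cH: "continuous_on B H" using Hh(1) B(3) holomorphic_on_imp_continuous_on continuous_on_subset by blast
  \<comment> \<open>Doubling the index makes \<open>m j\<close> tend to infinity, and
    \<open>n (2 * j) = m j + n j\<close> relates two lifts of the same sequence.\<close>
  define m where "m j = n (2 * j) - n j" for j
  have nj: "n (i + j) \<ge> n i + j" for i j
  proof (induction j)
    case (Suc j)
    have "n (i + j) < n (i + Suc j)" using n by (simp add: strict_mono_def)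
    then show ?case using Suc by simp
  qed simp
  have mj: "m j \<ge> j" "n (2 * j) = m j + n j" for j
  proof -
    have "n (2 * j) \<ge> n j + j" using nj[of j j] by (simp add: mult_2)
    then show "m j \<ge> j" "n (2 * j) = m j + n j" by (auto simp: m_def)
  qed
  define V where "V = H ` ball zeta0 (r1 / 2)"
  have V: "open V" "H zeta0 \<in> V" unfolding V_def
    using r1 by (auto intro!: oH)
  obtain e where e: "e > 0" "ball (H zeta0) e \<subseteq> V" using V openE by blast
  have base: "uniform_limit (ball (H zeta0) e) (\<lambda>j. f ^^ m j) (\<lambda>z. z) sequentially"
    unfolding uniform_limit_iff
  proof (intro allI impI)
    fix \<tau> :: real assume \<tau>: "\<tau> > 0"
    have "uniformly_continuous_on B H" using cH B(1) by (rule compact_uniformly_continuous)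
    then obtain d0 where d0: "d0 > 0" "\<And>x y. x \<in> B ==> y \<in> B ==> dist y x < d0 ==> dist (H y) (H x) < \<tau>"
      using \<tau> unfolding uniformly_continuous_on_def by metis
    define d where "d = min d0 (r1 / 4)"
    have d: "d > 0" "d \<le> d0" "d \<le> r1 / 4" using d0 r1 by (auto simp: d_def)
    define S where "S = cball zeta0 (r1 / 2) \<times> sphere (0::complex) d"
    have S: "compact S" unfolding S_def by (intro compact_Times) auto
    have inB: "x \<in> B \<and> x + u \<in> B" if "x \<in> cball zeta0 (r1 / 2)" "norm u \<le> d" for x u
    proof -
      have "dist zeta0 (x + u) \<le> dist zeta0 x + norm u" using norm_triangle_ineq4[of "zeta0 - x" u] by (simp add: dist_norm algebra_simps)
      then show ?thesis using that d(3) r1(1) by (auto simp: B_def)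
    qed
    have inB1: "x \<in> B" if "dist zeta0 x * 2 \<le> r1" for x using that r1(1) by (auto simp: B_def)
    have cS: "continuous_on S (\<lambda>p. norm (g (fst p + snd p) - g (fst p)))"
      unfolding S_def using inB inB1
      by (intro continuous_intros continuous_on_compose2[OF cg]) (auto simp: split_beta)
    have Sne: "S \<noteq> {}" using d(1) r1(1) by (auto simp: S_def)
    obtain p where p: "p \<in> S" "\<And>p'. p' \<in> S ==> norm (g (fst p + snd p) - g (fst p)) \<le> norm (g (fst p' + snd p') - g (fst p'))"
      using continuous_attains_inf[OF S Sne cS] by blast
    define c where "c = norm (g (fst p + snd p) - g (fst p))"
    have "c > 0"
    proof -
      have p1: "fst p \<in> cball zeta0 (r1 / 2)" "norm (snd p) = d" using p(1) by (auto simp: S_def)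
      then have "fst p \<in> B" "fst p + snd p \<in> B" using inB by auto
      then have "fst p \<in> ball zeta0 r1" "fst p + snd p \<in> ball zeta0 r1" using B(2) by blast+
      moreover have "fst p + snd p \<noteq> fst p" using p1 d(1) by auto
      ultimately have "g (fst p + snd p) \<noteq> g (fst p)" using r1(3) unfolding inj_on_def by blast
      then show ?thesis by (simp add: c_def)
    qed
    have "\<forall>\<^sub>F j in sequentially. \<forall>x\<in>B. dist (K j x) (g x) < c / 4"
      using g(2)[OF B(1,3)] \<open>c > 0\<close> unfolding uniform_limit_iff by (meson divide_pos_pos zero_less_numeral)
    then obtain N where N: "\<And>j x. j \<ge> N ==> x \<in> B ==> norm (K j x - g x) < c / 4"
      unfolding eventually_sequentially dist_norm by blast
    show "\<forall>\<^sub>F j in sequentially. \<forall>v\<in>ball (H zeta0) e. dist ((f ^^ m j) v) v < \<tau>"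
      unfolding eventually_sequentially
    proof (intro exI[of _ N] allI impI ballI)
      fix j v assume j: "j \<ge> N" and "v \<in> ball (H zeta0) e"
      then obtain x where x: "x \<in> ball zeta0 (r1 / 2)" "v = H x" using e(2) by (auto simp: V_def)
      have xB: "x \<in> B" using inB[of x 0] x(1) d(1) by auto
      have x1: "x \<in> ball 0 1" using xB B(3) by blast
      have subB: "cball x d \<subseteq> B"
      proof
        fix y assume "y \<in> cball x d"
        then show "y \<in> B" using inB[of x "y - x"] x(1) by (auto simp: dist_norm norm_minus_commute)
      qed
      \<comment> \<open>Both lifts are close to \<open>g\<close>, which is injective here, so the
        later one takes the value \<open>K j x\<close> at some \<open>y\<close> near
        \<open>x\<close>. Then \<open>f ^^ m j\<close> sends \<open>H x\<close> to the nearby point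
        \<open>H y\<close>.\<close>
      have "\<exists>y\<in>ball x d. K (2 * j) y - K j x = 0"
      proof (rule nonvanishing_min_modulus[where m = "c / 2"])
        have "cball x d \<subseteq> ball 0 1" using subB B(3) by blast
        then have h: "K (2 * j) holomorphic_on cball x d" using K(1) holomorphic_on_subset by blast
        show "(\<lambda>y. K (2 * j) y - K j x) holomorphic_on ball x d"
          by (intro holomorphic_intros holomorphic_on_subset[OF h]) auto
        show "continuous_on (cball x d) (\<lambda>y. K (2 * j) y - K j x)"
          by (intro continuous_intros holomorphic_on_imp_continuous_on[OF h])
        have 1: "norm (K j x - g x) < c / 4" "norm (K (2 * j) x - g x) < c / 4" using N[OF _ xB] j by auto
        then show "norm (K (2 * j) x - K j x) < c / 2"
          using norm_triangle_ineq4[of "K (2 * j) x - g x" "K j x - g x"] by simp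
        show "c / 2 \<le> norm (K (2 * j) y - K j x)" if y: "y \<in> sphere x d" for y
        proof -
          have "y \<in> B" using y subB by auto
          then have 2: "norm (K (2 * j) y - g y) < c / 4" using N j by auto
          have "(x, y - x) \<in> S" using x(1) y by (auto simp: S_def dist_norm norm_minus_commute)
          then have "c \<le> norm (g y - g x)" using p(2)[of "(x, y - x)"] by (simp add: c_def)
          moreover have "norm (g y - g x) \<le> norm (K (2 * j) y - K j x) + norm (K (2 * j) y - g y) + norm (K j x - g x)"
            using norm_triangle_ineq4[of "K (2 * j) y - K j x" "(K (2 * j) y - g y)"]
              norm_triangle_ineq[of "K (2 * j) y - K j x - (K (2 * j) y - g y)" "K j x - g x"] by simp
          ultimately show ?thesis using 1(1) 2 by linarith
        qed
      qed (use d in auto)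
      then obtain y where y: "y \<in> ball x d" "K (2 * j) y = K j x" by auto
      have yB: "y \<in> B" using y(1) subB ball_subset_cball by blast
      then have y1: "y \<in> ball 0 1" using B(3) by blast
      have "(f ^^ m j) v = (f ^^ m j) ((f ^^ n j) (K j x))" using K(2)[OF x1] x(2) by simp
      also have "\<dots> = (f ^^ n (2 * j)) (K (2 * j) y)" using y(2) mj(2) by (simp add: funpow_add)
      also have "\<dots> = H y" using K(2)[OF y1] .
      finally show "dist ((f ^^ m j) v) v < \<tau>" using d0(2)[OF xB yB] y(1) d(2) x(2) by (simp add: dist_commute)
    qed
  qed
  define D where "D = X0 - Q"
  have D: "open D" "connected D" unfolding D_def
    using X0 Q_finite by (auto intro!: open_Diff finite_imp_closed connected_open_delete_finite)
  have dPQ: "D \<inter> (PF \<union> Q) = {}" using X0(3) by (auto simp: D_def)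
  define E where "E = {x \<in> D. \<exists>e>0. uniform_limit (ball x e) (\<lambda>j. f ^^ m j) (\<lambda>z. z) sequentially}"
  have "H ` ball 0 1 \<subseteq> X0"
  proof -
    have "open (H ` ball 0 1)" by (rule oH) auto
    moreover have "w \<in> H ` ball 0 1" using H(2) by force
    ultimately have "H ` ball 0 1 \<inter> Y \<noteq> {}" using w unfolding closure_iff_nhds_not_empty by blast
    then obtain y where y: "y \<in> H ` ball 0 1" "y \<in> X0" using Y_subset_X0 by blast
    have "connected (H ` ball 0 1)"
      by (intro connected_continuous_image holomorphic_on_imp_continuous_on Hh connected_ball)
    moreover have "H ` ball 0 1 \<subseteq> - PF" using H(1) by (auto simp: adm_def)
    ultimately have "H ` ball 0 1 \<subseteq> connected_component_set (- PF) y" using y(1) by (intro connected_component_maximal)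
    also have "\<dots> = X0" using y(2) unfolding X0_def by (simp add: connected_component_eq)
    finally show ?thesis .
  qed
  then have HD: "H zeta0 \<in> D" using zeta0(3) zeta01 by (auto simp: D_def)
  \<comment> \<open>\<open>GPicard2\<close> is the connectedness argument for a nonempty, open and
    relatively closed subset.\<close>
  have "E = D"
  proof (rule GPicard2[OF _ D(2)])
    show "E \<subseteq> D" "E \<noteq> {}" using base e(1) HD by (auto simp: E_def)
    show "open E" unfolding open_contains_ball
    proof
      fix x assume "x \<in> E"
      then obtain e where x: "x \<in> D" "e > 0" "uniform_limit (ball x e) (\<lambda>j. f ^^ m j) (\<lambda>z. z) sequentially"
        by (auto simp: E_def)
      obtain e' where e': "e' > 0" "ball x e' \<subseteq> D" using D(1) x(1) openE by blast
      have "ball x (min e e') \<subseteq> E"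
      proof
        fix y assume y: "y \<in> ball x (min e e')"
        have "ball y (e - dist x y) \<subseteq> ball x e"
        proof
          fix z assume "z \<in> ball y (e - dist x y)"
          then show "z \<in> ball x e" using dist_triangle[of x z y] by simp
        qed
        then have "uniform_limit (ball y (e - dist x y)) (\<lambda>j. f ^^ m j) (\<lambda>z. z) sequentially"
          using x(3) uniform_limit_on_subset by blast
        moreover have "e - dist x y > 0" "y \<in> D" using y e'(2) by auto
        ultimately show "y \<in> E" unfolding E_def by blast
      qed
      then show "\<exists>e>0. ball x e \<subseteq> E" using x(2) e'(1) by (intro exI[of _ "min e e'"]) auto
    qed
    show "x \<in> E" if x: "x islimpt E" "x \<in> D" for x
    proof -
      obtain r where r: "r > 0" "ball x r \<subseteq> D" using D(1) x(2) openE by blast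
      obtain y where y: "y \<in> E" "dist y x < r / 2" using x(1) r(1) unfolding islimpt_approachable by (meson half_gt_zero)
      obtain e where e: "e > 0" "uniform_limit (ball y e) (\<lambda>j. f ^^ m j) (\<lambda>z. z) sequentially" using y(1) by (auto simp: E_def)
      have "uniform_limit (ball x (r / 4)) (\<lambda>j. f ^^ m j) (\<lambda>z. z) sequentially"
        by (rule identity_spreads[OF r(1) _ _ e]) (use r(2) dPQ y(2) in \<open>auto simp: dist_commute\<close>)
      then show ?thesis using x(2) r(1) by (auto simp: E_def intro!: exI[of _ "r / 4"])
    qed
  qed
  obtain a where a: "norm a > L" "f a = a" "norm (deriv f a) > 1" using large_repelling by blast
  have "a \<in> D" using a(1) X0(4) L(3) by (auto simp: D_def)
  then obtain e where e: "e > 0" "uniform_limit (ball a e) (\<lambda>j. f ^^ m j) (\<lambda>z. z) sequentially"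
    using \<open>E = D\<close> by (auto simp: E_def)
  have "\<forall>\<^sub>F j in sequentially. \<forall>z\<in>ball a e. dist ((f ^^ m j) z) z < 1" using e(2) unfolding uniform_limit_iff by (meson zero_less_one)
  then obtain N where N: "\<And>j z. j \<ge> N ==> z \<in> ball a e ==> dist ((f ^^ m j) z) z < 1" unfolding eventually_sequentially by blast
  have "\<exists>j. m (j + N) \<ge> M" for M using mj(1)[of "M + N"] by (intro exI[of _ M]) simp
  from repelling_no_bound[OF a(2,3) e(1) this, of "norm a + e + 1"]
  obtain j z where jz: "z \<in> ball a e" "norm ((f ^^ m (j + N)) z) > norm a + e + 1" by blast
  have "norm z < norm a + e" using jz(1) norm_triangle_sub[of z a] by (simp add: dist_norm norm_minus_commute)
  moreover have "norm ((f ^^ m (j + N)) z) < norm z + 1"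
    using N[of "j + N" z] jz(1) norm_triangle_sub[of "(f ^^ m (j + N)) z" z] by (simp add: dist_norm)
  ultimately show False using jz(2) by linarith
qed

text \<open>Cone points other than \<open>c\<close> stay at a distance, so their part of
  \<open>sig\<close> is bounded by \<open>T\<close>. The cone factor at \<open>c\<close> is absorbed
  by \<open>cone_bound\<close>, whose right-hand side tends to 0 with \<open>\<eta>\<close>.\<close>

lemma adm_small:
  assumes \<delta>: "\<delta> > 0"
  shows "\<exists>\<eta>>0. \<forall>h a. adm (ball a (1/4)) h --> h ` ball a (1/4) \<subseteq> ball c \<eta> --> h a \<notin> Q --> rho (h a) * norm (deriv h a) \<le> \<delta>"
proof -
  have "open (- (Q - {c}))" by (intro open_Compl finite_imp_closed finite_Diff Q_finite)
  then obtain d where d: "d > 0" "ball c d \<subseteq> - (Q - {c})" using openE[of "- (Q - {c})" c] by blast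
  define A where "A q = (d / 2) powr (1 / real (nu q) - 1)" for q
  define T where "T = 1 + (\<Sum>q\<in>Q. A q)"
  have T: "T \<ge> 1" unfolding T_def A_def by (simp add: sum_nonneg)
  define m where "m = nu c"
  have m: "m > 0" using nu_pos by (simp add: m_def)
  define x where "x = \<delta> / (8 * real m)"
  have x: "x > 0" using \<delta> m by (simp add: x_def)
  define \<eta> where "\<eta> = min (d / 2) (min (\<delta> / (8 * T)) (x powr real m))"
  have \<eta>: "\<eta> > 0" "\<eta> \<le> d / 2" "\<eta> \<le> \<delta> / (8 * T)" "\<eta> \<le> x powr real m"
    using d(1) \<delta> T x by (auto simp: \<eta>_def)
  have "rho (h a) * norm (deriv h a) \<le> \<delta>"
    if h: "adm (ball a (1/4)) h" "h ` ball a (1/4) \<subseteq> ball c \<eta>" "h a \<notin> Q" for h a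
  proof -
    have hb: "norm (h zeta - c) \<le> \<eta>" if "zeta \<in> ball a (1/4)" for zeta
      using h(2) that by (auto simp: dist_norm norm_minus_commute image_subset_iff less_imp_le)
    have hh: "h holomorphic_on ball a (1/4)" using h by (simp add: adm_def)
    have aa: "a \<in> ball a (1/4)" by simp
    have dh: "norm (deriv h a) \<le> 4 * \<eta>"
    proof -
      have "norm (deriv (\<lambda>zeta. h zeta - c) a) \<le> \<eta> / (1/4)"
        by (rule cauchy_deriv_bound) (use hb hh in \<open>auto intro!: holomorphic_intros\<close>)
      moreover have "deriv (\<lambda>zeta. h zeta - c) a = deriv h a"
      proof (rule DERIV_imp_deriv)
        have "(h has_field_derivative deriv h a) (at a)" using holomorphic_derivI[OF hh open_ball aa] .
        then show "((\<lambda>zeta. h zeta - c) has_field_derivative deriv h a) (at a)" by (auto intro!: derivative_eq_intros)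
      qed
      ultimately show ?thesis by simp
    qed
    have far: "norm (h a - q) powr (1 / real (nu q) - 1) \<le> A q" if q: "q \<in> Q" "q \<noteq> c" for q
    proof -
      have "norm (q - c) \<ge> d" using d(2) q by (force simp: dist_norm norm_minus_commute)
      moreover have "norm (q - c) \<le> norm (h a - q) + norm (h a - c)"
        using norm_triangle_ineq4[of "h a - c" "h a - q"] by (simp add: norm_minus_commute)
      ultimately have "norm (h a - q) \<ge> d / 2" using hb[OF aa] \<eta>(2) by linarith
      moreover have "1 / real (nu q) - 1 \<le> 0" using nu_pos[of q] by (simp add: divide_le_eq_1)
      ultimately show ?thesis unfolding A_def using d(1) by (intro powr_mono2') auto
    qed
    have near: "norm (deriv h a) * norm (h a - c) powr (1 / real m - 1) \<le> \<delta> / 2" if c: "c \<in> Q"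
    proof -
      have "norm (deriv h a) * norm (h a - c) powr (1 / real (nu c) - 1) * (1/4) \<le> real (nu c) * \<eta> powr (1 / real (nu c))"
        by (rule cone_bound[OF h(1)]) (use h(3) c hb in auto)
      also have "\<dots> \<le> real m * (x powr real m) powr (1 / real m)"
        unfolding m_def[symmetric] using \<eta> m by (intro mult_left_mono powr_mono2) auto
      also have "(x powr real m) powr (1 / real m) = x" using x m by (simp add: powr_powr)
      also have "real m * x = \<delta> / 8" using m by (simp add: x_def)
      finally show ?thesis unfolding m_def[symmetric] by simp
    qed
    have "sig (h a) * norm (deriv h a) \<le> T * norm (deriv h a) + (if c \<in> Q then norm (h a - c) powr (1 / real m - 1) else 0) * norm (deriv h a)"
    proof -
      have "(\<Sum>q\<in>Q. norm (h a - q) powr (1 / real (nu q) - 1)) \<le> (\<Sum>q\<in>Q. A q + (if q = c then norm (h a - c) powr (1 / real m - 1) else 0))"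
      proof (rule sum_mono)
        fix q assume q: "q \<in> Q"
        show "norm (h a - q) powr (1 / real (nu q) - 1) \<le> A q + (if q = c then norm (h a - c) powr (1 / real m - 1) else 0)"
          using far[OF q] by (cases "q = c") (auto simp: m_def A_def)
      qed
      also have "\<dots> = (\<Sum>q\<in>Q. A q) + (if c \<in> Q then norm (h a - c) powr (1 / real m - 1) else 0)"
        using Q_finite by (simp add: sum.distrib sum.delta)
      finally have "sig (h a) \<le> T + (if c \<in> Q then norm (h a - c) powr (1 / real m - 1) else 0)" by (simp add: sig_def T_def)
      then show ?thesis unfolding distrib_right[symmetric] by (rule mult_right_mono) simp
    qed
    also have "T * norm (deriv h a) \<le> T * (4 * \<eta>)" using dh T by (intro mult_left_mono) auto
    also have "T * (4 * \<eta>) \<le> \<delta> / 2" using \<eta>(3) T by (simp add: field_simps)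
    also have "(if c \<in> Q then norm (h a - c) powr (1 / real m - 1) else 0) * norm (deriv h a) \<le> \<delta> / 2"
      using near \<delta> by (simp add: mult.commute)
    finally have s: "sig (h a) * norm (deriv h a) \<le> \<delta>" by simp
    have "rho (h a) * norm (deriv h a) = sig (h a) * norm (deriv h a) / wt (h a)" by (simp add: rho_def)
    also have "\<dots> \<le> sig (h a) * norm (deriv h a) / 1"
      using wt_gt_1[of "h a"] sig_ge_1[of "h a"] by (intro divide_left_mono mult_nonneg_nonneg) auto
    finally show ?thesis using s by simp
  qed
  then show ?thesis using \<eta>(1) by blast
qed

text \<open>Otherwise there are lifts of the chart along higher and higher iterates through bounded
  points. By \<open>normal_two\<close> they have a holomorphic limit, which is constant by
  \<open>lift_limit_constant\<close>, and by \<open>adm_small\<close> nearly constant lifts have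
  small derivative with respect to \<open>rho\<close>.\<close>

lemma contract_compact_local:
  assumes w: "w \<in> closure Y" and \<epsilon>': "\<epsilon>' > 0"
  shows "\<exists>r>0. \<exists>N. \<forall>v\<in>ball w r. v \<notin> Q --> (\<forall>n\<ge>N. \<forall>z. norm z \<le> R --> (f ^^ n) z = v --> rho z \<le> \<epsilon>' * (rho v * norm (deriv (f ^^ n) z)))"
proof -
  have wP: "w \<notin> PF" using clY_PF w by blast
  obtain H r c where H: "adm (ball 0 1) H" "H ` ball 0 1 \<subseteq> ball w 1" "H 0 = w" "r > 0" "c > 0"
    "\<And>v. v \<in> ball w r ==> v \<notin> Q ==> \<exists>a\<in>ball 0 (1/2). H a = v \<and> c \<le> rho v * norm (deriv H a)"
    by (rule chart[OF wP]) (rule that; assumption)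
  obtain e1 e2 where e: "e1 \<noteq> e2" "f e1 = e1" "f e2 = e2" "norm e1 > norm w + 1" "norm e2 > norm w + 1"
    using far_fixed by blast
  have He: "H zeta \<noteq> e1 \<and> H zeta \<noteq> e2" if "zeta \<in> ball 0 1" for zeta
  proof -
    have "norm (H zeta) \<le> norm w + 1" using subsetD[OF H(2) imageI[OF that]] norm_triangle_sub[of "H zeta" w] by (simp add: dist_norm norm_minus_commute)
    then show ?thesis using e by auto
  qed
  show ?thesis
  proof (rule ccontr)
    assume neg: "\<not> ?thesis"
    define bad where "bad n \<longleftrightarrow> (\<exists>z. norm z \<le> R \<and> (f ^^ n) z \<in> ball w r - Q \<and> \<not> rho z \<le> \<epsilon>' * (rho ((f ^^ n) z) * norm (deriv (f ^^ n) z)))" for n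
    have "infinite {n. bad n}" unfolding infinite_nat_iff_unbounded_le
    proof
      fix N
      have "\<not> (\<forall>v\<in>ball w r. v \<notin> Q --> (\<forall>n\<ge>N. \<forall>z. norm z \<le> R --> (f ^^ n) z = v --> rho z \<le> \<epsilon>' * (rho v * norm (deriv (f ^^ n) z))))"
        using neg H(4) by blast
      then show "\<exists>n\<ge>N. n \<in> {n. bad n}" unfolding bad_def by blast
    qed
    then obtain n where n: "strict_mono (n :: nat => nat)" "\<And>j. bad (n j)"
      by (rule infinite_subseq) (rule that; assumption)
    have "\<exists>z a K. norm z \<le> R \<and> (f ^^ n j) z \<notin> Q \<and> \<not> rho z \<le> \<epsilon>' * (rho ((f ^^ n j) z) * norm (deriv (f ^^ n j) z)) \<and>
        a \<in> ball 0 (1/2) \<and> c \<le> rho ((f ^^ n j) z) * norm (deriv H a) \<and>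
        adm (ball 0 1) K \<and> (\<forall>zeta\<in>ball 0 1. (f ^^ n j) (K zeta) = H zeta) \<and> K a = z \<and> omits e1 e2 (ball 0 1) K \<and>
        deriv H a = deriv (f ^^ n j) z * deriv K a" for j
    proof -
      obtain z where z: "norm z \<le> R" "(f ^^ n j) z \<in> ball w r" "(f ^^ n j) z \<notin> Q" "\<not> rho z \<le> \<epsilon>' * (rho ((f ^^ n j) z) * norm (deriv (f ^^ n j) z))"
        using n(2)[of j] unfolding bad_def by blast
      obtain a where a: "a \<in> ball 0 (1/2)" "H a = (f ^^ n j) z" "c \<le> rho ((f ^^ n j) z) * norm (deriv H a)"
        using H(6)[OF z(2,3)] by blast
      obtain K where K: "adm (ball 0 1) K" "\<And>zeta. zeta \<in> ball 0 1 ==> (f ^^ n j) (K zeta) = H zeta" "K a = z" "omits e1 e2 (ball 0 1) K"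
        "deriv H a = deriv (f ^^ n j) z * deriv K a"
        by (rule chart_lift[OF H(1) a(1) a(2)[symmetric] e(2,3) He]) (assumption | rule that; assumption)+
      show ?thesis using z a K by blast
    qed
    then obtain z a K where zaK: "\<And>j. norm (z j) \<le> R" "\<And>j. (f ^^ n j) (z j) \<notin> Q"
        "\<And>j. \<not> rho (z j) \<le> \<epsilon>' * (rho ((f ^^ n j) (z j)) * norm (deriv (f ^^ n j) (z j)))"
        "\<And>j. a j \<in> ball 0 (1/2)" "\<And>j. c \<le> rho ((f ^^ n j) (z j)) * norm (deriv H (a j))"
        "\<And>j. adm (ball 0 1) (K j)" "\<And>j. (\<forall>zeta\<in>ball 0 1. (f ^^ n j) (K j zeta) = H zeta)" "\<And>j. K j (a j) = z j"
        "\<And>j. omits e1 e2 (ball 0 1) (K j)"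
        "\<And>j. deriv H (a j) = deriv (f ^^ n j) (z j) * deriv (K j) (a j)" by metis
    have "\<forall>j. a j \<in> cball 0 (1/2)" using zaK(4) by (meson ball_subset_cball subsetD)
    then obtain a0 k where k: "a0 \<in> cball 0 (1/2)" "strict_mono (k::nat=>nat)" "(a \<circ> k) \<longlonglongrightarrow> a0"
      using compact_cball[of "0::complex" "1/2"] unfolding compact_def by meson
    have a1: "a j \<in> ball 0 1" for j using zaK(4)[of j] by auto
    have a01: "a0 \<in> ball 0 1" using k(1) by auto
    have bdK: "norm (K (k j) ((a \<circ> k) j)) \<le> R" for j using zaK(8,1) by simp
    have a1k: "(a \<circ> k) j \<in> ball 0 1" for j using a1 by simp
    obtain g l where g: "g holomorphic_on ball 0 1" "strict_mono (l :: nat => nat)"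
      "\<And>X. compact X ==> X \<subseteq> ball 0 1 ==> uniform_limit X ((\<lambda>j. K (k j)) \<circ> l) g sequentially"
      by (rule normal_two[OF e(1) zero_less_one zaK(9) k(3) a1k a01 bdK]) (rule that; assumption)
    have sm: "strict_mono (n \<circ> k \<circ> l)" using n(1) k(2) g(2) strict_mono_o by blast
    have "g constant_on ball 0 1"
    proof (rule lift_limit_constant[OF w H(1,3) sm])
      show "K (k (l j)) holomorphic_on ball 0 1" for j using zaK(6) by (simp add: adm_def)
      show "(f ^^ (n \<circ> k \<circ> l) j) (K (k (l j)) zeta) = H zeta" if "zeta \<in> ball 0 1" for j zeta
        using zaK(7) that by simp
    qed (use g in \<open>auto simp: o_def\<close>)
    then obtain p where p: "\<And>x. x \<in> ball 0 1 ==> g x = p" by (auto simp: constant_on_def)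
    have "c * \<epsilon>' > 0" using H(5) \<epsilon>' by simp
    then obtain \<eta> where \<eta>: "\<eta> > 0" "\<And>h a. adm (ball a (1/4)) h ==> h ` ball a (1/4) \<subseteq> ball p \<eta> ==> h a \<notin> Q ==> rho (h a) * norm (deriv h a) \<le> c * \<epsilon>'"
      using adm_small[of "c * \<epsilon>'" p] by blast
    have "cball 0 (3/4) \<subseteq> ball (0::complex) 1" by auto
    then have "uniform_limit (cball 0 (3/4)) (\<lambda>j. K (k (l j))) g sequentially" using g(3)[of "cball 0 (3/4)"] by (simp add: o_def)
    then have "\<forall>\<^sub>F j in sequentially. \<forall>x\<in>cball 0 (3/4). dist (K (k (l j)) x) (g x) < \<eta>" using \<eta>(1) unfolding uniform_limit_iff by blast
    then obtain j where j: "\<And>x. x \<in> cball 0 (3/4) ==> dist (K (k (l j)) x) (g x) < \<eta>"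
      using eventually_happens'[OF sequentially_bot] by blast
    define i where "i = k (l j)"
    have sub: "ball (a i) (1/4) \<subseteq> cball 0 (3/4)"
    proof
      fix x assume "x \<in> ball (a i) (1/4)"
      then show "x \<in> cball 0 (3/4)" using zaK(4)[of i] norm_triangle_sub[of x "a i"] by (simp add: dist_norm norm_minus_commute)
    qed
    have "K i ` ball (a i) (1/4) \<subseteq> ball p \<eta>"
    proof
      fix y assume "y \<in> K i ` ball (a i) (1/4)"
      then obtain x where x: "x \<in> ball (a i) (1/4)" "y = K i x" by blast
      have "x \<in> cball 0 (3/4)" using x(1) sub by blast
      then show "y \<in> ball p \<eta>" using j[of x] p[of x] x(2) by (simp add: i_def dist_commute)
    qed
    moreover have "adm (ball (a i) (1/4)) (K i)"
      by (rule adm_subset[OF zaK(6)]) (use sub in auto)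
    moreover have zQ: "K i (a i) \<notin> Q"
    proof
      assume "K i (a i) \<in> Q"
      then have "(f ^^ n i) (K i (a i)) \<in> Q" by (rule Q_inv_funpow)
      then show False using zaK(2)[of i] zaK(8)[of i] by simp
    qed
    ultimately have 1: "rho (z i) * norm (deriv (K i) (a i)) \<le> c * \<epsilon>'" using \<eta>(2) zaK(8)[of i] by metis
    let ?v = "(f ^^ n i) (z i)"
    have "c * rho (z i) \<le> rho ?v * norm (deriv H (a i)) * rho (z i)" using zaK(5)[of i] rho_pos[of "z i"] by (intro mult_right_mono) auto
    also have "\<dots> = (rho ?v * norm (deriv (f ^^ n i) (z i))) * (rho (z i) * norm (deriv (K i) (a i)))" by (simp add: zaK(10) norm_mult)
    also have "\<dots> \<le> (rho ?v * norm (deriv (f ^^ n i) (z i))) * (c * \<epsilon>')" using 1 rho_pos[of ?v] by (intro mult_left_mono) auto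
    finally have "rho (z i) \<le> \<epsilon>' * (rho ?v * norm (deriv (f ^^ n i) (z i)))" using H(5) by (simp add: mult_ac)
    then show False using zaK(3) by blast
  qed
qed

lemma contract_compact:
  assumes \<epsilon>': "\<epsilon>' > 0"
  shows "\<exists>N. \<forall>n\<ge>N. \<forall>z. norm z \<le> R --> good ((f ^^ n) z) --> norm ((f ^^ n) z) \<le> R' --> rho z \<le> \<epsilon>' * (rho ((f ^^ n) z) * norm (deriv (f ^^ n) z))"
proof -
  have "\<exists>N. \<forall>v\<in>closure Y \<inter> cball 0 R'. v \<notin> Q --> (\<forall>n\<ge>N. \<forall>z. norm z \<le> R --> (f ^^ n) z = v --> rho z \<le> \<epsilon>' * (rho v * norm (deriv (f ^^ n) z)))"
  proof (rule compact_local_bound)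
    show "compact (closure Y \<inter> cball 0 R')" by (intro closed_Int_compact) auto
    show "\<exists>r>0. \<exists>N. \<forall>v\<in>ball w r. v \<notin> Q --> (\<forall>n\<ge>N. \<forall>z. norm z \<le> R --> (f ^^ n) z = v --> rho z \<le> \<epsilon>' * (rho v * norm (deriv (f ^^ n) z)))"
      if "w \<in> closure Y \<inter> cball 0 R'" for w using contract_compact_local[OF _ \<epsilon>'] that by blast
    show "v \<notin> Q --> (\<forall>n\<ge>N'. \<forall>z. norm z \<le> R --> (f ^^ n) z = v --> rho z \<le> \<epsilon>' * (rho v * norm (deriv (f ^^ n) z)))"
      if "v \<notin> Q --> (\<forall>n\<ge>N. \<forall>z. norm z \<le> R --> (f ^^ n) z = v --> rho z \<le> \<epsilon>' * (rho v * norm (deriv (f ^^ n) z)))" "N \<le> N'" for N N' :: nat and v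
    proof (intro impI allI)
      fix n z assume "v \<notin> Q" "N' \<le> n" "norm z \<le> R" "(f ^^ n) z = v"
      moreover from this that(2) have "N \<le> n" by linarith
      ultimately show "rho z \<le> \<epsilon>' * (rho v * norm (deriv (f ^^ n) z))" using that(1) by blast
    qed
  qed
  then obtain N where N: "\<forall>v\<in>closure Y \<inter> cball 0 R'. v \<notin> Q --> (\<forall>n\<ge>N. \<forall>z. norm z \<le> R --> (f ^^ n) z = v --> rho z \<le> \<epsilon>' * (rho v * norm (deriv (f ^^ n) z)))" ..
  show ?thesis
    by (intro exI[of _ N] allI impI) (use N in \<open>auto simp: good_def\<close>)
qed

text \<open>Either some orbit point before time \<open>N\<close> is far out, and the gain
  \<open>1 / (2 * C\<^sup>2)\<close> there outweighs a loss of \<open>C\<close> before it and after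
  it, or the first \<open>N\<close> points stay bounded and \<open>contract_compact\<close>
  applies.\<close>

lemma contract_step:
  "\<exists>N>0. \<forall>z. good ((f ^^ N) z) --> rho z \<le> 1/2 * (rho ((f ^^ N) z) * norm (deriv (f ^^ N) z))"
proof -
  obtain C where C: "C \<ge> 1" "\<And>n z. good ((f ^^ n) z) ==> rho z \<le> C * (rho ((f ^^ n) z) * norm (deriv (f ^^ n) z))"
    using expand_uniform by blast
  have "1 / (2 * C\<^sup>2) > 0" using C by simp
  then obtain R where R: "\<And>z. R \<le> norm z ==> good (f z) ==> rho z \<le> 1 / (2 * C\<^sup>2) * (rho (f z) * norm (deriv f z))"
    using contract_far by blast
  obtain R1 where R1: "\<And>z. norm z \<le> R ==> norm (f z) \<le> R1" using bounded_image by blast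
  obtain N0 where N0: "\<And>n z. n \<ge> N0 ==> norm z \<le> R ==> good ((f ^^ n) z) ==> norm ((f ^^ n) z) \<le> R1 ==> rho z \<le> 1/2 * (rho ((f ^^ n) z) * norm (deriv (f ^^ n) z))"
    using contract_compact[of "1/2" R R1] by auto
  \<comment> \<open>One more than \<open>N0\<close>, so that the point at time \<open>N0\<close> is
    still among the bounded ones and bounds \<open>(f ^^ N) z\<close>.\<close>
  define N where "N = Suc N0"
  have "rho z \<le> 1/2 * (rho ((f ^^ N) z) * norm (deriv (f ^^ N) z))" if g: "good ((f ^^ N) z)" for z
  proof (cases "\<exists>j<N. R \<le> norm ((f ^^ j) z)")
    case True
    then obtain j where j: "j < N" "R \<le> norm ((f ^^ j) z)" by blast
    define k where "k = N - Suc j"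
    have Nk: "N = k + (1 + j)" using j(1) by (simp add: k_def)
    have gj: "good ((f ^^ k) ((f ^^ (1 + j)) z))" using g unfolding Nk by (simp only: funpow_add o_apply)
    then have g1: "good ((f ^^ (1 + j)) z)" by (rule good_back)
    then have g2: "good (f ((f ^^ j) z))" by simp
    then have g3: "good ((f ^^ j) z)" by (rule good_back1)
    let ?a = "(f ^^ j) z" let ?b = "(f ^^ (1 + j)) z" let ?c = "(f ^^ N) z"
    have ba: "?b = f ?a" by simp
    have ca: "(f ^^ k) ?b = ?c" unfolding Nk by (simp only: funpow_add o_apply)
    have "rho z \<le> C * (rho ?a * norm (deriv (f ^^ j) z))" by (rule C(2)[OF g3])
    also have "\<dots> \<le> C * ((1 / (2 * C\<^sup>2) * (rho ?b * norm (deriv f ?a))) * norm (deriv (f ^^ j) z))"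
      using R[OF j(2) g2] C(1) unfolding ba by (intro mult_left_mono mult_right_mono) auto
    also have "\<dots> \<le> C * ((1 / (2 * C\<^sup>2) * ((C * (rho ?c * norm (deriv (f ^^ k) ?b))) * norm (deriv f ?a))) * norm (deriv (f ^^ j) z))"
      using C(2)[OF gj] C(1) unfolding ca by (intro mult_left_mono mult_right_mono) auto
    also have "\<dots> = 1/2 * (rho ?c * (norm (deriv (f ^^ k) ?b) * (norm (deriv f ?a) * norm (deriv (f ^^ j) z))))"
      using C(1) by (simp add: field_simps power2_eq_square)
    also have "norm (deriv (f ^^ k) ?b) * (norm (deriv f ?a) * norm (deriv (f ^^ j) z)) = norm (deriv (f ^^ N) z)"
    proof -
      have "deriv (f ^^ (1 + j)) z = deriv f ?a * deriv (f ^^ j) z" using deriv_funpow_add[of 1 j z] by (simp add: o_def)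
      then show ?thesis unfolding Nk deriv_funpow_add[of k "1 + j" z] by (simp only: norm_mult)
    qed
    finally show ?thesis .
  next
    case False
    then have lt: "norm ((f ^^ j) z) \<le> R" if "j < N" for j using that by force
    have "norm ((f ^^ N) z) \<le> R1" using R1[OF lt[of N0]] by (simp add: N_def)
    then show ?thesis using N0[of N z] lt[of 0] g by (simp add: N_def)
  qed
  then show ?thesis by (intro exI[of _ N]) (simp add: N_def)
qed

theorem exponential_contraction:
  "\<exists>C>0. \<exists>q. 0 < q \<and> q < 1 \<and> (\<forall>n z. good ((f ^^ n) z) --> rho z \<le> C * q ^ n * (rho ((f ^^ n) z) * norm (deriv (f ^^ n) z)))"
proof -
  obtain C where C: "C \<ge> 1" "\<And>n z. good ((f ^^ n) z) ==> rho z \<le> C * (rho ((f ^^ n) z) * norm (deriv (f ^^ n) z))"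
    using expand_uniform by blast
  obtain N where N: "N > 0" "\<And>z. good ((f ^^ N) z) ==> rho z \<le> 1/2 * (rho ((f ^^ N) z) * norm (deriv (f ^^ N) z))"
    using contract_step by blast
  \<comment> \<open>Chosen with \<open>q ^ N = 1/2\<close>; an incomplete block of fewer than
    \<open>N\<close> steps costs at most a factor 2.\<close>
  define q :: real where "q = (1/2) powr (1 / real N)"
  have q: "0 < q" "q < 1" "q ^ N = 1/2"
  proof -
    show "0 < q" by (simp add: q_def)
    show "q < 1" using powr_less_mono2[of "1 / real N" "1/2" 1] N(1) by (simp add: q_def)
    show "q ^ N = 1/2" unfolding q_def using N(1) by (simp add: powr_realpow[symmetric] powr_powr)
  qed
  have it: "rho z \<le> (1/2) ^ k * (rho ((f ^^ (k * N)) z) * norm (deriv (f ^^ (k * N)) z))" if "good ((f ^^ (k * N)) z)" for k z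
    using that
  proof (induction k arbitrary: z)
    case (Suc k)
    have e: "(f ^^ (Suc k * N)) z = (f ^^ (k * N)) ((f ^^ N) z)" by (simp only: mult_Suc add.commute[of N] funpow_add o_apply)
    have g: "good ((f ^^ (k * N)) ((f ^^ N) z))" using Suc.prems e by simp
    have "rho z \<le> 1/2 * (rho ((f ^^ N) z) * norm (deriv (f ^^ N) z))" by (rule N(2)[OF good_back[OF g]])
    also have "\<dots> \<le> 1/2 * (((1/2) ^ k * (rho ((f ^^ (k * N)) ((f ^^ N) z)) * norm (deriv (f ^^ (k * N)) ((f ^^ N) z)))) * norm (deriv (f ^^ N) z))"
      using Suc.IH[OF g] by (intro mult_left_mono mult_right_mono) auto
    also have "\<dots> = (1/2) ^ Suc k * (rho ((f ^^ (Suc k * N)) z) * (norm (deriv (f ^^ (k * N)) ((f ^^ N) z)) * norm (deriv (f ^^ N) z)))"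
      unfolding e power_Suc by (simp only: mult_ac)
    also have "norm (deriv (f ^^ (k * N)) ((f ^^ N) z)) * norm (deriv (f ^^ N) z) = norm (deriv (f ^^ (Suc k * N)) z)"
      by (simp only: mult_Suc add.commute[of N] deriv_funpow_add norm_mult)
    finally show ?case .
  qed (simp add: id_def[symmetric])
  have "rho z \<le> 2 * C * q ^ n * (rho ((f ^^ n) z) * norm (deriv (f ^^ n) z))" if g: "good ((f ^^ n) z)" for n z
  proof -
    define k where "k = n div N"
    define j where "j = n mod N"
    have n: "n = k * N + j" "j < N" using N(1) by (simp_all add: k_def j_def)
    have e: "(f ^^ n) z = (f ^^ (k * N)) ((f ^^ j) z)" unfolding n(1) by (simp only: funpow_add o_apply)
    have g1: "good ((f ^^ (k * N)) ((f ^^ j) z))" using g e by simp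
    have h: "(1/2 :: real) ^ k \<le> 2 * q ^ n"
    proof -
      have "q ^ n = (1/2) ^ k * q ^ j" unfolding n(1) by (simp add: power_add power_mult q(3)[symmetric] mult.commute)
      moreover have "q ^ j \<ge> q ^ N" using q n(2) by (intro power_decreasing) auto
      ultimately have "q ^ n \<ge> (1/2) ^ k * (1/2)" using q(3) by (simp add: mult_left_mono)
      then show ?thesis by simp
    qed
    have "rho z \<le> C * (rho ((f ^^ j) z) * norm (deriv (f ^^ j) z))" by (rule C(2)[OF good_back[OF g1]])
    also have "\<dots> \<le> C * (((1/2) ^ k * (rho ((f ^^ n) z) * norm (deriv (f ^^ (k * N)) ((f ^^ j) z)))) * norm (deriv (f ^^ j) z))"
      using it[OF g1] C(1) unfolding e by (intro mult_left_mono mult_right_mono) auto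
    also have "\<dots> = C * (1/2) ^ k * (rho ((f ^^ n) z) * norm (deriv (f ^^ n) z))"
      unfolding n(1) deriv_funpow_add norm_mult by (simp only: mult_ac)
    also have "\<dots> \<le> C * (2 * q ^ n) * (rho ((f ^^ n) z) * norm (deriv (f ^^ n) z))"
      using h C(1) rho_pos[of "(f ^^ n) z"] by (intro mult_right_mono mult_left_mono) auto
    finally show ?thesis by (simp add: mult_ac)
  qed
  then show ?thesis using C(1) q(1,2) by (intro exI[of _ "2 * C"] conjI exI[of _ q]) auto
qed

end

section \<open>The semiconjugacy from a rescaled model\<close>

text \<open>The bound on \<open>theta\<close> confines the path and hence bounds \<open>wt\<close>
  along it, which turns the speed relative to \<open>wt\<close> into a Euclidean one.\<close>

lemma theta_path_move:
  fixes e :: "real => complex"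
  assumes d: "\<And>t. t \<in> {0..1} ==> (e has_vector_derivative e' t) (at t within {0..1})"
    and K: "\<And>t. t \<in> {0..1} ==> norm (e' t) \<le> K * wt (e t)"
  shows "\<bar>theta (e 1) - theta (e 0)\<bar> \<le> 4 * K"
    and "theta (e 0) + 4 * K \<le> M ==> norm (e 1 - e 0) \<le> K * wt (of_real (exp (exp M)))"
    and "t \<in> {0..1} ==> \<bar>theta (e t) - theta (e 0)\<bar> \<le> 4 * K"
proof -
  have K0: "0 \<le> K"
  proof (rule ccontr)
    assume "\<not> 0 \<le> K"
    then have "K * wt (e 0) < 0" using wt_pos[of "e 0"] by (simp add: mult_neg_pos)
    then show False using K[of 0] norm_ge_zero[of "e' 0"] by simp
  qed
  show "\<bar>theta (e 1) - theta (e 0)\<bar> \<le> 4 * K" by (rule theta_path[OF d K])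
  have th: "\<bar>theta (e t) - theta (e 0)\<bar> \<le> 4 * K" if t: "t \<in> {0..1}" for t
  proof -
    have "\<bar>theta (e (t * 1)) - theta (e (t * 0))\<bar> \<le> 4 * K"
    proof (rule theta_path)
      fix x :: real assume x: "x \<in> {0..1}"
      have tx: "t * x \<in> {0..1}" using t x mult_le_one[of t x] by auto
      have 1: "((\<lambda>x. t * x) has_vector_derivative t) (at x within {0..1})" by (auto intro!: derivative_eq_intros)
      have im: "(\<lambda>x. t * x) ` {0..1} \<subseteq> {0..1}" using t by (auto intro: mult_le_one)
      have "(e has_vector_derivative e' (t * x)) (at (t * x) within (\<lambda>x. t * x) ` {0..1})"
        using d[OF tx] im by (rule has_vector_derivative_within_subset)
      from vector_diff_chain_within[OF 1 this]
      show "((\<lambda>x. e (t * x)) has_vector_derivative t *\<^sub>R e' (t * x)) (at x within {0..1})" by (simp add: o_def)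
      have "norm (t *\<^sub>R e' (t * x)) \<le> 1 * (K * wt (e (t * x)))"
        unfolding norm_scaleR using K[OF tx] t by (intro mult_mono) auto
      then show "norm (t *\<^sub>R e' (t * x)) \<le> K * wt (e (t * x))" by simp
    qed
    then show ?thesis by simp
  qed
  then show "t \<in> {0..1} ==> \<bar>theta (e t) - theta (e 0)\<bar> \<le> 4 * K" .
  assume M: "theta (e 0) + 4 * K \<le> M"
  have "norm (e 1 - e 0) \<le> (K * wt (of_real (exp (exp M)))) * norm (1 - 0 :: real)"
  proof (rule differentiable_bound[where S = "{0..1}" and f' = "\<lambda>t h. h *\<^sub>R e' t"])
    fix t :: real assume t: "t \<in> {0..1}"
    show "(e has_derivative (\<lambda>h. h *\<^sub>R e' t)) (at t within {0..1})"
      using d[OF t] by (simp add: has_vector_derivative_def)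
    have "norm (e t) \<le> exp (exp M)" by (rule theta_le_imp_norm_le) (use th[OF t] M in linarith)
    then have "wt (e t) \<le> wt (of_real (exp (exp M)))" by (intro wt_mono) simp
    then have "norm (e' t) \<le> K * wt (of_real (exp (exp M)))"
      using K[OF t] K0 by (meson mult_left_mono order_trans)
    then show "onorm (\<lambda>h. h *\<^sub>R e' t) \<le> K * wt (of_real (exp (exp M)))"
      by (intro onorm_le) (auto simp: mult.commute mult_left_mono)
  qed auto
  then show "norm (e 1 - e 0) \<le> K * wt (of_real (exp (exp M)))" by simp
qed

lemma segment_path:
  fixes E :: "complex => complex"
  assumes D: "open D" "convex D" and E: "E holomorphic_on D" and s: "s \<in> D" "s + l \<in> D" and t: "t \<in> {0..1}"
  shows "s + of_real t * l \<in> D"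
    "((\<lambda>t. E (s + of_real t * l)) has_vector_derivative (l * deriv E (s + of_real t * l))) (at t within {0..1})"
proof -
  have e: "s + of_real t * l = (1 - t) *\<^sub>R s + t *\<^sub>R (s + l)" by (simp add: scaleR_conv_of_real algebra_simps)
  show in': "s + of_real t * l \<in> D" unfolding e by (rule convexD[OF D(2) s]) (use t in auto)
  have p': "((\<lambda>t. s + of_real t * l) has_vector_derivative l) (at t within {0..1})"
    by (auto intro!: derivative_eq_intros)
  have "(E has_field_derivative deriv E (s + of_real t * l)) (at (s + of_real t * l))"
    using holomorphic_derivI[OF E D(1) in'] .
  then show "((\<lambda>t. E (s + of_real t * l)) has_vector_derivative (l * deriv E (s + of_real t * l))) (at t within {0..1})"
    using field_vector_diff_chain_within[OF p', of E "deriv E (s + of_real t * l)"] has_field_derivative_at_within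
    by (auto simp: o_def)
qed

section \<open>Branches of inverse iterates in the logarithmic coordinate\<close>

context expanding
begin

text \<open>A branch of the inverse of \<open>f ^^ n\<close> over the exterior of
  \<open>cball 0 L\<close>, made single-valued by the covering \<open>exp\<close>.\<close>

definition lift :: "nat => (complex => complex) => bool" where
  "lift n E \<longleftrightarrow> E holomorphic_on rhp L \<and> (\<forall>s\<in>rhp L. (f ^^ n) (E s) = exp s)"

lemma lift_exists:
  assumes "s \<in> rhp L" "(f ^^ n) z = exp s"
  obtains E where "lift n E" "E s = z"
  using exp_funpow_lift[OF assms] unfolding lift_def by metis

lemma lift_deriv:
  assumes "lift n E" "s \<in> rhp L"
  shows "exp s = deriv (f ^^ n) (E s) * deriv E s" "deriv (f ^^ n) (E s) \<noteq> 0" "deriv E s \<noteq> 0"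
proof -
  have "deriv exp s = deriv (f ^^ n) (E s) * deriv E s"
    by (rule funpow_deriv_lift[OF rhp(1)]) (use assms in \<open>auto simp: lift_def\<close>)
  then show *: "exp s = deriv (f ^^ n) (E s) * deriv E s" by simp
  show "deriv (f ^^ n) (E s) \<noteq> 0" "deriv E s \<noteq> 0" using * by auto
qed

lemma lift_eq:
  assumes "lift n E1" "lift n E2" "s \<in> rhp L" "E1 s = E2 s" "t \<in> rhp L"
  shows "E1 t = E2 t"
  by (rule entire_map.hol_lift_unique[OF funpow_entire rhp(1,3), of E1 L E2 n s])
    (use assms lift_deriv[OF assms(1,3)] in \<open>auto simp: lift_def\<close>)

lemma lift_shift:
  assumes "lift n E"
  shows "lift n (\<lambda>t. E (t + of_int k * (2 * of_real pi * \<i>)))"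
proof -
  let ?c = "of_int k * (2 * complex_of_real pi * \<i>)"
  have in': "t + ?c \<in> rhp L" if "t \<in> rhp L" for t using that by (simp add: rhp_def)
  have ec: "exp ?c = 1" unfolding exp_eq_1 by auto
  have "(E \<circ> (\<lambda>t. t + ?c)) holomorphic_on rhp L"
    by (rule holomorphic_on_compose_gen[of _ _ E "rhp L"]) (use assms in' in \<open>auto simp: lift_def intro!: holomorphic_intros\<close>)
  then show ?thesis using assms in' ec by (simp add: lift_def o_def exp_add)
qed

lemma lift_comp: "lift (n + k) E ==> lift k (\<lambda>s. (f ^^ n) (E s))"
proof -
  assume E: "lift (n + k) E"
  have "((f ^^ n) \<circ> E) holomorphic_on rhp L"
    by (rule holomorphic_on_compose_gen[of _ _ _ UNIV]) (use E funpow_hol in \<open>auto simp: lift_def\<close>)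
  moreover have "(f ^^ k) ((f ^^ n) (E s)) = exp s" if "s \<in> rhp L" for s
    using E that by (simp add: lift_def funpow_add[symmetric] add.commute[of k n] o_def[symmetric] del: o_apply) (metis add.commute funpow_add o_apply)
  ultimately show ?thesis by (simp add: lift_def o_def)
qed

lemma lift_Y: "lift n E ==> s \<in> rhp L ==> E s \<in> Y"
  unfolding Y_def lift_def using exp_in_rhp[of L s] L(1) by (auto intro!: exI[of _ n])

lemma sig_bounded: "\<exists>S\<ge>1. \<forall>v. L < norm v --> sig v \<le> S"
proof (intro exI conjI allI impI)
  let ?S = "1 + (\<Sum>q\<in>Q. (L - norm q) powr (1 / real (nu q) - 1))"
  show "1 \<le> ?S" by (simp add: sum_nonneg)
  fix v :: complex assume v: "L < norm v"
  have "(\<Sum>q\<in>Q. norm (v - q) powr (1 / real (nu q) - 1)) \<le> (\<Sum>q\<in>Q. (L - norm q) powr (1 / real (nu q) - 1))"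
  proof (rule sum_mono)
    fix q assume "q \<in> Q"
    then have "norm q < L" using L(3) by auto
    moreover have "L - norm q \<le> norm (v - q)" using v norm_triangle_ineq2[of v q] by linarith
    moreover have "1 / real (nu q) - 1 \<le> 0" using nu_pos[of q] by (simp add: divide_le_eq_1)
    ultimately show "norm (v - q) powr (1 / real (nu q) - 1) \<le> (L - norm q) powr (1 / real (nu q) - 1)"
      by (intro powr_mono2') auto
  qed
  then show "sig v \<le> ?S" by (simp add: sig_def)
qed

lemma rho_norm_bounded: "\<exists>S\<ge>1. \<forall>v. L < norm v --> rho v * norm v \<le> S"
proof -
  obtain S where S: "S \<ge> 1" "\<And>v. L < norm v ==> sig v \<le> S" using sig_bounded by blast
  have "rho v * norm v \<le> S" if "L < norm v" for v
  proof -
    have "norm v * 1 \<le> (1 + norm v) * ln (9 + (norm v)\<^sup>2)" using ln9_gt_1[of "norm v"] by (intro mult_mono) auto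
    then have "norm v \<le> wt v" by (simp add: wt_def)
    then have "norm v / wt v \<le> 1" using wt_pos[of v] by (simp add: divide_le_eq)
    then have "sig v * (norm v / wt v) \<le> S * 1" using S(2)[OF that] sig_ge_1[of v] less_imp_le[OF wt_pos[of v]] by (intro mult_mono) auto
    then show ?thesis by (simp add: rho_def)
  qed
  then show ?thesis using S(1) by blast
qed

text \<open>\<open>rho v * norm v\<close> is bounded over the exterior, so a unit step in the
  logarithmic coordinate has bounded length for \<open>rho\<close>, and a branch of order
  \<open>n\<close> shrinks it by the factor \<open>C * q ^ n\<close> of
  \<open>exponential_contraction\<close>.\<close>

lemma lift_contraction:
  "\<exists>C>0. \<exists>q. 0 < q \<and> q < 1 \<and> (\<forall>n E s. lift n E --> s \<in> rhp L --> norm (deriv E s) \<le> C * q ^ n * wt (E s))"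
proof -
  obtain C q where C: "C > 0" "0 < q" "q < 1" "\<And>n z. good ((f ^^ n) z) ==> rho z \<le> C * q ^ n * (rho ((f ^^ n) z) * norm (deriv (f ^^ n) z))"
    using exponential_contraction by blast
  obtain S where S: "S \<ge> 1" "\<And>v. L < norm v ==> rho v * norm v \<le> S" using rho_norm_bounded by blast
  have "norm (deriv E s) \<le> C * S * q ^ n * wt (E s)" if E: "lift n E" "s \<in> rhp L" for n E s
  proof -
    have big: "L < norm (exp s)" using exp_in_rhp[of L s] E(2) L(1) by simp
    have fe: "(f ^^ n) (E s) = exp s" using E by (simp add: lift_def)
    have "1 / wt (E s) \<le> C * q ^ n * (rho (exp s) * norm (deriv (f ^^ n) (E s)))"
      using rho_ge[of "E s"] C(4)[of n "E s"] good_big[OF big] fe by simp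
    then have "1 / wt (E s) * norm (deriv E s) \<le> C * q ^ n * (rho (exp s) * norm (deriv (f ^^ n) (E s))) * norm (deriv E s)"
      by (intro mult_right_mono) auto
    also have "\<dots> = C * q ^ n * (rho (exp s) * norm (exp s))"
      using lift_deriv(1)[OF E] by (simp add: norm_mult mult_ac)
    also have "\<dots> \<le> C * q ^ n * S" using S(2)[OF big] C by (intro mult_left_mono) auto
    finally show ?thesis using wt_pos[of "E s"] by (simp add: divide_le_eq mult_ac)
  qed
  then show ?thesis using C(1-3) S(1) by (intro exI[of _ "C * S"] conjI exI[of _ q]) auto
qed

text \<open>Along a good orbit the derivatives of the iterates explode with respect to \<open>rho\<close>,
  which is incompatible with normality by the Landau and Schwarz estimates.\<close>

lemma good_orbit_julia:
  assumes g: "\<And>n. good ((f ^^ n) p)" and QJ: "Q \<subseteq> julia_set f"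
  shows "p \<in> julia_set f"
proof (rule ccontr)
  assume "p \<notin> julia_set f"
  then have pF: "p \<in> fatou_set f" by (simp add: julia_set_def)
  obtain C q where C: "C > 0" "0 < q" "q < 1" "\<And>n z. good ((f ^^ n) z) ==> rho z \<le> C * q ^ n * (rho ((f ^^ n) z) * norm (deriv (f ^^ n) z))"
    using exponential_contraction by blast
  obtain e0 where e0: "e0 > 0" "\<And>k::nat=>nat. \<exists>r. strict_mono r \<and>
    ((\<exists>B. \<forall>n. \<forall>w\<in>cball p e0. norm ((f ^^ k (r n)) w) \<le> B) \<or>
     (\<forall>B. \<forall>\<^sub>F n in sequentially. \<forall>w\<in>cball p e0. B < norm ((f ^^ k (r n)) w)))"
    by (rule fatou_dichotomy[OF entire pF]) (rule that; assumption)
  obtain e1 where e1: "e1 > 0" "ball p e1 \<subseteq> fatou_set f" using open_fatou pF openE by blast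
  define e where "e = min e0 e1"
  have e: "e > 0" "ball p e \<subseteq> cball p e0" "ball p e \<subseteq> fatou_set f" using e0(1) e1 by (auto simp: e_def)
  obtain r where r: "strict_mono (r::nat=>nat)" "(\<exists>B. \<forall>n. \<forall>w\<in>cball p e0. norm ((f ^^ r n) w) \<le> B) \<or>
     (\<forall>B. \<forall>\<^sub>F n in sequentially. \<forall>w\<in>cball p e0. B < norm ((f ^^ r n) w))"
    using e0(2)[of id] by auto
  have "\<exists>T. \<forall>\<^sub>F n in sequentially. rho ((f ^^ r n) p) * norm (deriv (f ^^ r n) p) \<le> T"
    using r(2)
  proof
    assume "\<exists>B. \<forall>n. \<forall>w\<in>cball p e0. norm ((f ^^ r n) w) \<le> B"
    then obtain B where B: "\<And>n w. w \<in> cball p e0 ==> norm ((f ^^ r n) w) \<le> B" by blast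
    have fatou_n: "(f ^^ n) w \<in> fatou_set f" if "w \<in> fatou_set f" for n w
      using that by (induction n) (auto intro: fatou_forward)
    define T where "T = B / e + (\<Sum>q\<in>Q. real (nu q) * (B + norm q) powr (1 / real (nu q)) / e)"
    have "rho ((f ^^ n) p) * norm (deriv (f ^^ n) p) \<le> T" if n: "n \<in> range r" for n
    proof -
      let ?h = "f ^^ n"
      have Bn: "norm (?h w) \<le> B" if "w \<in> ball p e" for w using B that e(2) n by auto
      have 1: "norm (deriv ?h p) \<le> B / e" by (rule cauchy_deriv_bound[OF funpow_hol e(1) Bn])
      have 2: "norm (?h p - q) powr (1 / real (nu q) - 1) * norm (deriv ?h p) \<le> real (nu q) * (B + norm q) powr (1 / real (nu q)) / e"
        if q: "q \<in> Q" for q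
      proof -
        \<comment> \<open>The disc consists of Fatou points, whose orbits never meet
          \<open>Q\<close>; so the divisibility condition of the cone bound holds vacuously.\<close>
        have ne: "?h w \<noteq> q" if "w \<in> ball p e" for w
          using fatou_n[of w n] subsetD[OF e(3) that] q QJ by (auto simp: julia_set_def)
        have "norm (deriv ?h p) * norm (?h p - q) powr (1 / real (nu q) - 1) * e \<le> real (nu q) * (B + norm q) powr (1 / real (nu q))"
        proof (rule cone_bound_general[OF funpow_hol _ _ e(1)])
          show "\<not> ?h constant_on ball p e" by (rule funpow_nonconst) (use e(1) in auto)
          show "norm (?h w - q) \<le> B + norm q" if "w \<in> ball p e" for w
            using Bn[OF that] norm_triangle_ineq4[of "?h w" q] by linarith
        qed (use ne e(1) in auto)
        then show ?thesis using e(1) by (simp add: le_divide_eq mult_ac)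
      qed
      have "sig (?h p) * norm (deriv ?h p) = norm (deriv ?h p) + (\<Sum>q\<in>Q. norm (?h p - q) powr (1 / real (nu q) - 1) * norm (deriv ?h p))"
        by (simp add: sig_def distrib_right sum_distrib_right)
      also have "\<dots> \<le> T" unfolding T_def using 1 2 by (intro add_mono sum_mono)
      finally have 3: "sig (?h p) * norm (deriv ?h p) \<le> T" .
      have "rho (?h p) * norm (deriv ?h p) \<le> sig (?h p) * norm (deriv ?h p)"
      proof (rule mult_right_mono)
        have "sig (?h p) / wt (?h p) \<le> sig (?h p) / 1"
          using wt_gt_1[of "?h p"] sig_ge_1[of "?h p"] by (intro divide_left_mono) auto
        then show "rho (?h p) \<le> sig (?h p)" by (simp add: rho_def)
      qed simp
      then show ?thesis using 3 by linarith
    qed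
    then show ?thesis by (intro exI[of _ T] always_eventually) auto
  next
    assume inf: "\<forall>B. \<forall>\<^sub>F n in sequentially. \<forall>w\<in>cball p e0. B < norm ((f ^^ r n) w)"
    \<comment> \<open>Iterates larger than \<open>L\<close> omit all of \<open>cball 0 L\<close>, so
      Landau's theorem applies although there is no finite limit.\<close>
    obtain a1 a2 :: complex where a: "a1 \<noteq> a2" "norm a1 \<le> L" "norm a2 \<le> L" using fixp by blast
    obtain C1 where C1: "C1 > 0" "\<And>h z r. r > 0 ==> omits a1 a2 (ball z r) h ==> norm (deriv h z) * r \<le> C1 * wt (h z)"
      by (rule landau[OF a(1)]) (rule that; assumption)
    obtain S where S: "S \<ge> 1" "\<And>v. L < norm v ==> sig v \<le> S" using sig_bounded by blast
    have "\<forall>\<^sub>F n in sequentially. \<forall>w\<in>cball p e0. L < norm ((f ^^ r n) w)" using inf by blast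
    then have "\<forall>\<^sub>F n in sequentially. rho ((f ^^ r n) p) * norm (deriv (f ^^ r n) p) \<le> S * (C1 / e)"
    proof eventually_elim
      case (elim n)
      let ?h = "f ^^ r n"
      have "omits a1 a2 (ball p e) ?h"
        unfolding omits_def
      proof (intro conjI ballI funpow_hol)
        fix w assume "w \<in> ball p e"
        then have "L < norm (?h w)" using elim e(2) by blast
        then show "?h w \<noteq> a1" "?h w \<noteq> a2" using a by auto
      qed
      then have "norm (deriv ?h p) * e \<le> C1 * wt (?h p)" using C1(2) e(1) by blast
      then have "norm (deriv ?h p) / wt (?h p) \<le> C1 / e" using e(1) wt_pos[of "?h p"] by (simp add: divide_le_eq le_divide_eq mult_ac)
      moreover have "L < norm (?h p)" using elim e0(1) by simp
      ultimately have "sig (?h p) * (norm (deriv ?h p) / wt (?h p)) \<le> S * (C1 / e)"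
        using S less_imp_le[OF wt_pos[of "?h p"]] by (intro mult_mono) auto
      then show ?case by (simp add: rho_def)
    qed
    then show ?thesis by blast
  qed
  then obtain T where T: "\<forall>\<^sub>F n in sequentially. rho ((f ^^ r n) p) * norm (deriv (f ^^ r n) p) \<le> T" by blast
  have le: "rho p \<le> C * q ^ r n * (rho ((f ^^ r n) p) * norm (deriv (f ^^ r n) p))" for n using C(4) g by blast
  have "(\<lambda>n. q ^ n) \<longlonglongrightarrow> 0" using C(2,3) by (intro LIMSEQ_power_zero) simp
  then have "((\<lambda>n. q ^ n) \<circ> r) \<longlonglongrightarrow> 0" using r(1) by (rule LIMSEQ_subseq_LIMSEQ)
  then have "(\<lambda>n. C * q ^ r n * T) \<longlonglongrightarrow> C * 0 * T" unfolding o_def by (intro tendsto_intros)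
  moreover have "\<forall>\<^sub>F n in sequentially. rho p \<le> C * q ^ r n * T"
    using T
  proof eventually_elim
    case (elim n)
    have "C * q ^ r n * (rho ((f ^^ r n) p) * norm (deriv (f ^^ r n) p)) \<le> C * q ^ r n * T"
      using elim C(1,2) by (intro mult_left_mono) auto
    then show ?case using le[of n] by linarith
  qed
  ultimately have "rho p \<le> C * 0 * T" by (intro tendsto_lowerbound[where F = sequentially]) auto
  then show False using rho_pos[of p] by simp
qed

text \<open>Large points are good, and goodness passes backwards along orbits.\<close>

lemma escaping_subset_julia:
  assumes "Q \<subseteq> julia_set f" shows "escaping_set f \<subseteq> julia_set f"
proof
  fix y assume "y \<in> escaping_set f"
  then have lim: "filterlim (\<lambda>n. (f ^^ n) y) at_infinity sequentially" by (simp add: escaping_set_def)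
  then have "\<forall>\<^sub>F n in sequentially. L + 1 \<le> norm ((f ^^ n) y)" unfolding filterlim_at_infinity[OF order_refl] using L(1) by auto
  then obtain N where N: "\<And>n. n \<ge> N ==> L + 1 \<le> norm ((f ^^ n) y)" unfolding eventually_sequentially by blast
  show "y \<in> julia_set f"
  proof (rule good_orbit_julia[OF _ assms])
    fix n
    have "(f ^^ N) ((f ^^ n) y) = (f ^^ (N + n)) y" by (simp add: funpow_add)
    then have "good ((f ^^ N) ((f ^^ n) y))" using N[of "N + n"] by (intro good_big) simp
    then show "good ((f ^^ n) y)" by (rule good_back)
  qed
qed

end

text \<open>The rescaled map \<open>F = k f\<close> has a single attracting basin containing its singular values;
  \<open>phi n\<close> lifts the straight path from \<open>F\<close> to \<open>f\<close> in the logarithmic coordinate \<open>n\<close> times.\<close>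

locale model = expanding f PF Q nu R0 L \<epsilon> for f PF Q nu R0 L \<epsilon> +
  fixes k :: complex
  assumes k0: "k \<noteq> 0" and kR0: "norm k * R0 \<le> 1" and kL: "\<And>z. norm z \<le> L + 1 ==> norm (k * f z) < L"
    and Lbig: "24 * pi \<le> ln L" and QJ: "Q \<subseteq> julia_set f"
begin

definition F :: "complex => complex" where "F z = k * f z"

definition l :: complex where "l = Ln k"

text \<open>The domain of \<open>phi n\<close>: each of the \<open>n\<close> steps needs one more
  point of the \<open>F\<close>-orbit outside \<open>cball 0 L\<close>.\<close>

definition Om :: "nat => complex set" where "Om n = {x. \<forall>j\<le>n. L < norm ((F ^^ j) x)}"

definition KK :: "complex set" where "KK = {x. \<forall>n. L < norm ((F ^^ n) x)}"

lemma k1: "norm k \<le> 1"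
  using mult_left_mono[OF R0 norm_ge_zero[of k]] kR0 by simp

lemma exp_l: "exp l = k" using k0 by (simp add: l_def)

lemma Re_l: "Re l \<le> 0" using k0 k1 by (simp add: l_def)

lemma rhp_minus_l: "s \<in> rhp L ==> s - l \<in> rhp L"
  using Re_l by (simp add: rhp_def)

lemma KK_Om: "x \<in> KK ==> x \<in> Om n" by (simp add: KK_def Om_def)

lemma Om_Suc: "x \<in> Om (Suc n) ==> x \<in> Om n" by (simp add: Om_def)

lemma Om_F: "x \<in> Om (Suc n) ==> F x \<in> Om n"
  by (auto simp: Om_def funpow_swap1 dest: spec[of _ "Suc _"])

lemma KK_F: "x \<in> KK ==> F x \<in> KK"
  by (auto simp: KK_def funpow_swap1 dest: spec[of _ "Suc _"])

lemma KK_funpow: "x \<in> KK ==> (F ^^ n) x \<in> KK"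
  by (induction n) (auto intro: KK_F)

lemma F_big: assumes "L < norm (F x)" shows "L + 1 < norm x" "L < norm (f x)"
proof -
  show "L + 1 < norm x" using kL[of x] assms by (force simp: F_def)
  have "norm (F x) \<le> 1 * norm (f x)" unfolding F_def norm_mult using k1 by (intro mult_right_mono) auto
  then show "L < norm (f x)" using assms by simp
qed

text \<open>\<open>F\<close> maps \<open>cball 0 (L + 1)\<close> into \<open>ball 0 L\<close>, so
  orbits in \<open>KK\<close> even avoid the larger disc; as a closed condition this shows that
  \<open>KK\<close> is closed.\<close>

lemma KK_iff: "x \<in> KK \<longleftrightarrow> (\<forall>n. L + 1 \<le> norm ((F ^^ n) x))"
proof
  assume "x \<in> KK"
  then have "L < norm (F ((F ^^ n) x))" for n unfolding KK_def by (metis (mono_tags) funpow.simps(2) mem_Collect_eq o_apply)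
  then show "\<forall>n. L + 1 \<le> norm ((F ^^ n) x)" using F_big(1) less_imp_le by blast
next
  assume *: "\<forall>n. L + 1 \<le> norm ((F ^^ n) x)"
  have "L < norm ((F ^^ n) x)" for n using spec[OF *, of n] by linarith
  then show "x \<in> KK" by (simp add: KK_def)
qed

lemma KK_backward: "F x \<in> KK ==> x \<in> KK"
proof -
  assume *: "F x \<in> KK"
  have "L < norm ((F ^^ n) x)" for n
  proof (cases n)
    case 0
    have "L < norm (F x)" using * unfolding KK_def by (auto dest: spec[of _ 0])
    then show ?thesis using F_big(1)[of x] 0 by simp
  next
    case (Suc m)
    have "L < norm ((F ^^ m) (F x))" using * by (simp add: KK_def)
    then show ?thesis using Suc by (simp add: funpow_swap1)
  qed
  then show ?thesis by (simp add: KK_def)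
qed

lemma F_entire: "entire_map F"
proof
  show "F holomorphic_on UNIV" unfolding F_def by (intro holomorphic_intros)
  show "\<not> F constant_on UNIV" using nonconst k0 unfolding F_def constant_on_def by (metis mult_left_cancel)
qed

lemma KK_closed: "closed KK"
proof -
  have "KK = (\<Inter>n. {x. L + 1 \<le> norm ((F ^^ n) x)})" using KK_iff by auto
  moreover have "closed {x. L + 1 \<le> norm ((F ^^ n) x)}" for n
    by (intro closed_Collect_le continuous_intros entire_map.funpow_cont[OF F_entire])
  ultimately show ?thesis by (simp add: closed_INT)
qed

text \<open>Multiplication by \<open>k\<close> pulled back by \<open>f ^^ Suc n\<close>: for a
  branch \<open>E\<close> with \<open>E s = y\<close> the value is \<open>E (s + l)\<close>. The
  principal logarithm and an arbitrary branch fix it; by \<open>step_eq\<close> these choices have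
  no influence.\<close>

definition step :: "nat => complex => complex" where
  "step n y = (SOME E. lift (Suc n) E \<and> E (Ln ((f ^^ Suc n) y)) = y) (Ln ((f ^^ Suc n) y) + l)"

text \<open>Two logarithms of the same point differ by a period of \<open>exp\<close>, and shifting
  the branch by that period gives the unique branch that takes the value \<open>y\<close> at the
  other logarithm.\<close>

lemma step_eq:
  assumes E: "lift (Suc n) E" and s: "s \<in> rhp L" "s + l \<in> rhp L" and y: "E s = y"
  shows "step n y = E (s + l)"
proof -
  define s' where "s' = Ln ((f ^^ Suc n) y)"
  have fy: "(f ^^ Suc n) y = exp s" using E s(1) y unfolding lift_def by blast
  have es': "exp s' = exp s" unfolding s'_def fy by simp
  then obtain j :: int where j: "s' = s + of_int j * (2 * of_real pi * \<i>)" unfolding exp_eq by (auto simp: algebra_simps)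
  have s'r: "s' \<in> rhp L" using s(1) j by (simp add: rhp_def)
  have s'l: "s' + l \<in> rhp L" using s(2) j by (simp add: rhp_def)
  define E2 where "E2 t = E (t + of_int (- j) * (2 * of_real pi * \<i>))" for t
  have E2: "lift (Suc n) E2" unfolding E2_def by (rule lift_shift[OF E])
  have E2s: "E2 s' = y" using y by (simp add: E2_def j)
  define E' where "E' = (SOME E. lift (Suc n) E \<and> E s' = y)"
  have E': "lift (Suc n) E' \<and> E' s' = y" unfolding E'_def by (rule someI[of _ E2]) (use E2 E2s in blast)
  have "step n y = E' (s' + l)" by (simp only: step_def E'_def s'_def)
  also have "\<dots> = E2 (s' + l)" by (rule lift_eq[OF _ E2 s'r _ s'l]) (use E' E2s in auto)
  also have "\<dots> = E (s + l)" by (simp add: E2_def j)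
  finally show ?thesis .
qed

primrec phi :: "nat => complex => complex" where
  "phi 0 x = x"
| "phi (Suc n) x = step n (phi n x)"

lemma phi_step:
  assumes x: "x \<in> Om (Suc n)" and IH: "(f ^^ n) (phi n x) = (F ^^ n) x"
  obtains E s where "lift (Suc n) E" "s \<in> rhp L" "s + l \<in> rhp L" "exp s = f ((F ^^ n) x)"
    "E s = phi n x" "phi (Suc n) x = E (s + l)" "exp (s + l) = (F ^^ Suc n) x"
proof -
  have "L < norm ((F ^^ Suc n) x)" using x unfolding Om_def by blast
  then have b: "L < norm (F ((F ^^ n) x))" by simp
  then have b2: "L < norm (f ((F ^^ n) x))" by (rule F_big(2))
  have "norm (f ((F ^^ n) x)) > 0" using b2 L(1) by linarith
  then have nz: "f ((F ^^ n) x) \<noteq> 0" by auto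
  define s where "s = Ln (f ((F ^^ n) x))"
  have es: "exp s = f ((F ^^ n) x)" using nz by (simp add: s_def)
  have esl: "exp (s + l) = (F ^^ Suc n) x" using es exp_l by (simp add: exp_add F_def)
  have s: "s \<in> rhp L" "s + l \<in> rhp L"
    using exp_in_rhp[of L s] exp_in_rhp[of L "s + l"] es esl b b2 L(1) by auto
  have "(f ^^ Suc n) (phi n x) = exp s" using IH es by simp
  then obtain E where E: "lift (Suc n) E" "E s = phi n x" using lift_exists[OF s(1)] by blast
  have "phi (Suc n) x = E (s + l)" using step_eq[OF E(1) s E(2)] by simp
  then show ?thesis using that E s es esl by blast
qed

lemma phi_funpow: "x \<in> Om n ==> (f ^^ n) (phi n x) = (F ^^ n) x"
proof (induction n)
  case (Suc n)
  obtain E s where *: "lift (Suc n) E" "s + l \<in> rhp L" "phi (Suc n) x = E (s + l)" "exp (s + l) = (F ^^ Suc n) x"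
    by (rule phi_step[OF Suc.prems Suc.IH[OF Om_Suc[OF Suc.prems]]])
  then show ?case unfolding lift_def by metis
qed simp

lemma phi_lift:
  assumes x: "x \<in> Om (Suc n)"
  obtains E s where "lift (Suc n) E" "s \<in> rhp L" "s + l \<in> rhp L" "exp s = f ((F ^^ n) x)"
    "E s = phi n x" "phi (Suc n) x = E (s + l)" "exp (s + l) = (F ^^ Suc n) x"
  using phi_step[OF x phi_funpow[OF Om_Suc[OF x]]] .

text \<open>If \<open>E\<close> is a branch of order \<open>Suc (Suc n)\<close>, then
  \<open>f \<circ> E\<close> is one of order \<open>Suc n\<close>; so \<open>f\<close> carries each
  step to the step of the preceding order.\<close>

lemma phi_semiconj: "x \<in> Om (Suc n) ==> f (phi (Suc n) x) = phi n (F x)"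
proof (induction n)
  case 0
  obtain E s where *: "lift (Suc 0) E" "s + l \<in> rhp L" "phi (Suc 0) x = E (s + l)" "exp (s + l) = (F ^^ Suc 0) x"
    by (rule phi_lift[OF 0])
  have "(f ^^ Suc 0) (E (s + l)) = exp (s + l)" using *(1,2) unfolding lift_def by blast
  then show ?case using *(3,4) by simp
next
  case (Suc n)
  obtain E s where *: "lift (Suc (Suc n)) E" "s \<in> rhp L" "s + l \<in> rhp L" "E s = phi (Suc n) x"
     "phi (Suc (Suc n)) x = E (s + l)"
    by (rule phi_lift[OF Suc.prems])
  have "lift (Suc n) (\<lambda>s. f (E s))" using lift_comp[of 1 "Suc n" E] *(1) by simp
  moreover have "f (E s) = phi n (F x)" using Suc.IH[OF Om_Suc[OF Suc.prems]] *(4) by simp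
  ultimately have "step n (phi n (F x)) = f (E (s + l))" using step_eq *(2,3) by blast
  then show ?case using *(5) by simp
qed

text \<open>Near \<open>y\<close>, \<open>step n\<close> is the translation by \<open>l\<close>
  conjugated by the locally injective branch \<open>E\<close>.\<close>

lemma isCont_step:
  assumes E: "lift (Suc n) E" and s: "s \<in> rhp L" "s + l \<in> rhp L" and y: "E s = y"
  shows "isCont (step n) y"
proof -
  have Eh: "E holomorphic_on rhp L" using E by (simp add: lift_def)
  obtain r where r: "r > 0" "ball s r \<subseteq> rhp L" "inj_on E (ball s r)"
    by (rule has_complex_derivative_locally_injective[OF Eh s(1) rhp(1) lift_deriv(3)[OF E s(1)]]) (rule that; assumption)
  obtain r' where r': "r' > 0" "ball (s + l) r' \<subseteq> rhp L" using rhp(1) s(2) openE by blast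
  define V where "V = ball s (min r r')"
  have V: "open V" "s \<in> V" "V \<subseteq> rhp L" "inj_on E V" using r r' by (auto simp: V_def intro: inj_on_subset)
  have Vl: "t + l \<in> rhp L" if "t \<in> V" for t
  proof -
    have "t + l \<in> ball (s + l) r'" using that by (simp add: V_def dist_norm)
    then show ?thesis using r'(2) by blast
  qed
  have EV: "E holomorphic_on V" using Eh V(3) holomorphic_on_subset by blast
  obtain g where g: "g holomorphic_on E ` V" "\<And>z. z \<in> V ==> g (E z) = z"
    by (rule holomorphic_has_inverse[OF EV V(1,4)]) (rule that; assumption)
  have oV: "open (E ` V)" by (rule open_mapping_thm3[OF EV V(1,4)])
  have yV: "y \<in> E ` V" using y V(2) by blast
  have eq: "step n z = E (g z + l)" if zV: "z \<in> E ` V" for z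
  proof -
    obtain t where t: "t \<in> V" "z = E t" using zV by auto
    show ?thesis using step_eq[OF E _ Vl[OF t(1)] t(2)[symmetric]] t V(3) g(2)[OF t(1)] by auto
  qed
  have "(E \<circ> (\<lambda>z. g z + l)) holomorphic_on E ` V"
    by (rule holomorphic_on_compose_gen[OF _ Eh]) (use g Vl in \<open>auto intro!: holomorphic_intros\<close>)
  then have "continuous_on (E ` V) (\<lambda>z. E (g z + l))" using holomorphic_on_imp_continuous_on by (auto simp: o_def)
  then have "continuous_on (E ` V) (step n)" using eq by (subst continuous_on_cong[OF refl, of _ _ "\<lambda>z. E (g z + l)"]) auto
  then show ?thesis using oV yV continuous_on_eq_continuous_at by blast
qed

lemma phi_continuous: "continuous_on (Om n) (phi n)"
proof (induction n)
  case 0 then show ?case by (simp add: continuous_on_id[unfolded id_def] continuous_on_eq[OF continuous_on_id])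
next
  case (Suc n)
  have sub: "Om (Suc n) \<subseteq> Om n" using Om_Suc by blast
  have 1: "continuous_on (Om (Suc n)) (phi n)" using Suc sub continuous_on_subset by blast
  show ?case
    unfolding continuous_on_eq_continuous_within
  proof
    fix x assume x: "x \<in> Om (Suc n)"
    obtain E s where *: "lift (Suc n) E" "s \<in> rhp L" "s + l \<in> rhp L" "E s = phi n x"
      by (rule phi_lift[OF x])
    have "isCont (step n) (phi n x)" by (rule isCont_step[OF *])
    moreover have "continuous (at x within Om (Suc n)) (phi n)" using 1 x by (simp add: continuous_on_eq_continuous_within)
    ultimately have "continuous (at x within Om (Suc n)) (\<lambda>x. step n (phi n x))"
      using continuous_within_compose3 by blast
    moreover have "phi (Suc n) = (\<lambda>x. step n (phi n x))" by auto
    ultimately show "continuous (at x within Om (Suc n)) (phi (Suc n))" by simp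
  qed
qed

text \<open>A step can be undone: translating back by \<open>l\<close> gives the same point for all
  choices of the branch. Injectivity of every \<open>phi n\<close> follows.\<close>

lemma lift_inj:
  assumes E: "lift (Suc n) E" "lift (Suc n) E'" and s: "s \<in> rhp L" "s + l \<in> rhp L" "s' \<in> rhp L" "s' + l \<in> rhp L"
    and eq: "E (s + l) = E' (s' + l)"
  shows "E s = E' s'"
proof -
  have "exp (s + l) = (f ^^ Suc n) (E (s + l))" "exp (s' + l) = (f ^^ Suc n) (E' (s' + l))"
    using E s unfolding lift_def by metis+
  then have "exp (s' + l) = exp (s + l)" using eq by simp
  then have "exp s' = exp s" by (simp add: exp_add)
  then obtain j :: int where j: "s' = s + of_int j * (2 * of_real pi * \<i>)" unfolding exp_eq by (auto simp: algebra_simps)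
  define E2 where "E2 t = E' (t + of_int j * (2 * of_real pi * \<i>))" for t
  have E2: "lift (Suc n) E2" unfolding E2_def by (rule lift_shift[OF E(2)])
  have "E (s + l) = E2 (s + l)" unfolding E2_def using eq by (simp add: j algebra_simps)
  then have "E s = E2 s" by (rule lift_eq[OF E(1) E2 s(2) _ s(1)])
  then show ?thesis by (simp add: E2_def j)
qed

lemma phi_inj: "x \<in> Om n ==> x' \<in> Om n ==> phi n x = phi n x' ==> x = x'"
proof (induction n)
  case (Suc n)
  obtain E s where *: "lift (Suc n) E" "s \<in> rhp L" "s + l \<in> rhp L" "E s = phi n x" "phi (Suc n) x = E (s + l)"
    by (rule phi_lift[OF Suc.prems(1)])
  obtain E' s' where **: "lift (Suc n) E'" "s' \<in> rhp L" "s' + l \<in> rhp L" "E' s' = phi n x'" "phi (Suc n) x' = E' (s' + l)"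
    by (rule phi_lift[OF Suc.prems(2)])
  have "E s = E' s'" by (rule lift_inj[OF *(1) **(1) *(2,3) **(2,3)]) (use * ** Suc.prems(3) in metis)
  then show ?case using Suc.IH[OF Om_Suc[OF Suc.prems(1)] Om_Suc[OF Suc.prems(2)]] *(4) **(4) by simp
qed simp

text \<open>Steps are undone by translation by \<open>- l\<close>, which in the base case stays in
  the half-plane because \<open>Re l \<le> 0\<close>. In the limit this yields backward invariance
  of the image of \<open>Phi\<close>.\<close>

lemma phi_backward:
  assumes "y \<in> KK" "f u = phi n y"
  shows "\<exists>x. F x = y \<and> phi (Suc n) x = u"
  using assms(2)
proof (induction n arbitrary: u)
  case 0
  then have fu: "f u = y" by simp
  have yL: "L < norm y" using assms(1) unfolding KK_def by (auto dest: spec[of _ 0])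
  have y0: "y \<noteq> 0" using yL L(1) by auto
  define t where "t = Ln y"
  have t: "t \<in> rhp L" "exp t = y" using Ln_in_rhp[OF _ yL] L(1) y0 by (auto simp: t_def)
  have "(f ^^ Suc 0) u = exp t" using fu t by simp
  then obtain E where E: "lift (Suc 0) E" "E t = u" using lift_exists[OF t(1)] by blast
  have s: "t - l \<in> rhp L" by (rule rhp_minus_l[OF t(1)])
  have "(f ^^ Suc 0) (E (t - l)) = exp (t - l)" using E(1) s unfolding lift_def by blast
  then have "F (E (t - l)) = y" using t exp_l k0 by (simp add: F_def exp_diff)
  moreover have "phi (Suc 0) (E (t - l)) = u" using step_eq[OF E(1) s _ refl] t E(2) by simp
  ultimately show ?case by blast
next
  case (Suc n)
  obtain E' s where *: "lift (Suc n) E'" "s \<in> rhp L" "s + l \<in> rhp L" "E' s = phi n y" "phi (Suc n) y = E' (s + l)" "exp (s + l) = (F ^^ Suc n) y"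
    by (rule phi_lift[OF KK_Om[OF assms(1)]])
  have "(f ^^ Suc (Suc n)) u = (f ^^ Suc n) (f u)" by (simp add: funpow_swap1)
  also have "\<dots> = exp (s + l)" using Suc.prems phi_funpow[OF KK_Om[OF assms(1)], of "Suc n"] *(6) by simp
  finally obtain E where E: "lift (Suc (Suc n)) E" "E (s + l) = u" using lift_exists[OF *(3)] by blast
  have fE: "lift (Suc n) (\<lambda>s. f (E s))" using lift_comp[of 1 "Suc n" E] E(1) by simp
  have "f (E s) = E' s" by (rule lift_eq[OF fE *(1) *(3) _ *(2)]) (use E Suc.prems *(5) in simp)
  then obtain x where x: "F x = y" "phi (Suc n) x = E s" using Suc.IH[of "E s"] *(4) by auto
  have "phi (Suc (Suc n)) x = E (s + l)" using step_eq[OF E(1) *(2,3) refl] x(2) by simp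
  then show ?case using x(1) E(2) by blast
qed

end

section \<open>Convergence of the approximations and the image of the limit\<close>

lemma theta_tendsto: "(g \<longlongrightarrow> a) T ==> ((\<lambda>x. theta (g x)) \<longlongrightarrow> theta a) T"
  unfolding theta_def using ln9_gt_1[of "norm a"] zero_le_power2[of "norm a"]
  by (intro tendsto_intros) linarith+

context model
begin

lemma Fk: "F = (\<lambda>z. k * f z)" by (simp add: F_def fun_eq_iff)

text \<open>Multiplication by \<open>k\<close> scales the singular values, and
  \<open>norm k * R0 \<le> 1\<close> brings them into the closed unit disc; the estimates of
  \<open>classB\<close> become available for the model with bound 1.\<close>

lemma F_classB: "classB F 1"
proof -
  interpret F: entire_map F by (rule F_entire)
  show ?thesis
  proof
    fix A B :: real and n :: nat
    obtain z where z: "A \<le> norm z" "(B / norm k) * norm z ^ n < norm (f z)" using growth by blast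
    have "B * norm z ^ n = norm k * ((B / norm k) * norm z ^ n)" using k0 by simp
    also have "\<dots> < norm k * norm (f z)" using z(2) k0 by (intro mult_strict_left_mono) auto
    finally show "\<exists>z. A \<le> norm z \<and> B * norm z ^ n < norm (F z)" using z(1) by (auto simp: F_def norm_mult)
  next
    show "asymptotic_values F \<subseteq> cball 0 1"
    proof
      fix a assume "a \<in> asymptotic_values F"
      then obtain \<gamma> :: "real => complex" where g: "continuous_on {0..} \<gamma>" "filterlim \<gamma> at_infinity at_top" "((\<lambda>t. F (\<gamma> t)) \<longlongrightarrow> a) at_top"
        unfolding asymptotic_values_def by blast
      have "((\<lambda>t. F (\<gamma> t) / k) \<longlongrightarrow> a / k) at_top" using k0 by (intro tendsto_intros g)
      then have "((\<lambda>t. f (\<gamma> t)) \<longlongrightarrow> a / k) at_top" using k0 by (simp add: F_def)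
      then have "a / k \<in> asymptotic_values f" using g unfolding asymptotic_values_def by blast
      then have "norm (a / k) \<le> R0" using asym by auto
      then have "norm k * norm (a / k) \<le> norm k * R0" by (intro mult_left_mono) auto
      then show "a \<in> cball 0 1" using kR0 k0 by (simp add: norm_divide)
    qed
  next
    fix z assume "deriv F z = 0"
    then have "deriv f z = 0" using k0 has_deriv[of z, THEN DERIV_cmult[of f _ _ UNIV k], THEN DERIV_imp_deriv] by (simp add: Fk)
    then have "norm k * norm (f z) \<le> norm k * R0" using crit by (intro mult_left_mono) auto
    then show "norm (F z) \<le> 1" using kR0 by (simp add: F_def norm_mult)
  next
    have "norm k * norm (f 0) \<le> norm k * R0" using f0 by (intro mult_left_mono) auto
    then show "norm (F 0) \<le> 1" using kR0 by (simp add: F_def norm_mult)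
  qed simp
qed

lemma lift_move:
  obtains C q where "C > 0" "0 < q" "q < 1"
    "\<And>n E s. lift n E ==> s \<in> rhp L ==> norm (deriv E s) \<le> C * q ^ n * wt (E s)"
    "\<And>n E s v. lift n E ==> s \<in> rhp L ==> s + v \<in> rhp L ==> \<bar>theta (E (s + v)) - theta (E s)\<bar> \<le> 4 * (norm v * (C * q ^ n))"
    "\<And>n E s v M. lift n E ==> s \<in> rhp L ==> s + v \<in> rhp L ==> theta (E s) + 4 * (norm v * (C * q ^ n)) \<le> M ==>
      norm (E (s + v) - E s) \<le> norm v * (C * q ^ n) * wt (of_real (exp (exp M)))"
proof -
  obtain C q where C: "C > 0" "0 < q" "q < 1" and d: "\<And>n E s. lift n E ==> s \<in> rhp L ==> norm (deriv E s) \<le> C * q ^ n * wt (E s)"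
    using lift_contraction by blast
  have path: "s + of_real t * v \<in> rhp L"
    "((\<lambda>t. E (s + of_real t * v)) has_vector_derivative (v * deriv E (s + of_real t * v))) (at t within {0..1})"
    "norm (v * deriv E (s + of_real t * v)) \<le> norm v * (C * q ^ n) * wt (E (s + of_real t * v))"
    if "lift n E" "s \<in> rhp L" "s + v \<in> rhp L" "t \<in> {0..1}" for n E s v t
  proof -
    note * = segment_path[OF rhp(1,2) _ that(2-4), of E]
    have E: "E holomorphic_on rhp L" using that(1) by (simp add: lift_def)
    show 1: "s + of_real t * v \<in> rhp L" using *(1)[OF E] .
    show "((\<lambda>t. E (s + of_real t * v)) has_vector_derivative (v * deriv E (s + of_real t * v))) (at t within {0..1})" using *(2)[OF E] .
    show "norm (v * deriv E (s + of_real t * v)) \<le> norm v * (C * q ^ n) * wt (E (s + of_real t * v))"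
      using mult_left_mono[OF d[OF that(1) 1] norm_ge_zero[of v]] by (simp add: norm_mult mult_ac)
  qed
  show ?thesis
  proof (rule that[OF C d])
    fix n E s v assume *: "lift n E" "s \<in> rhp L" "s + v \<in> rhp L"
    show "\<bar>theta (E (s + v)) - theta (E s)\<bar> \<le> 4 * (norm v * (C * q ^ n))"
      using theta_path_move(1)[OF path(2,3)[OF *]] by simp
    show "norm (E (s + v) - E s) \<le> norm v * (C * q ^ n) * wt (of_real (exp (exp M)))"
      if "theta (E s) + 4 * (norm v * (C * q ^ n)) \<le> M" for M
      using theta_path_move(2)[OF path(2,3)[OF *], of M] that by simp
  qed
qed

lemma phi_move:
  obtains C q where "C > 0" "0 < q" "q < 1"
    "\<And>n x. x \<in> Om (Suc n) ==> \<bar>theta (phi (Suc n) x) - theta (phi n x)\<bar> \<le> C * q ^ n"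
    "\<And>n x M. x \<in> Om (Suc n) ==> theta (phi n x) + C * q ^ n \<le> M ==>
      norm (phi (Suc n) x - phi n x) \<le> C * q ^ n * wt (of_real (exp (exp M)))"
proof -
  obtain C q where C: "C > 0" "0 < q" "q < 1"
    "\<And>n E s. lift n E ==> s \<in> rhp L ==> norm (deriv E s) \<le> C * q ^ n * wt (E s)"
    "\<And>n E s v. lift n E ==> s \<in> rhp L ==> s + v \<in> rhp L ==> \<bar>theta (E (s + v)) - theta (E s)\<bar> \<le> 4 * (norm v * (C * q ^ n))"
    "\<And>n E s v M. lift n E ==> s \<in> rhp L ==> s + v \<in> rhp L ==> theta (E s) + 4 * (norm v * (C * q ^ n)) \<le> M ==>
      norm (E (s + v) - E s) \<le> norm v * (C * q ^ n) * wt (of_real (exp (exp M)))"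
    by (rule lift_move) (rule that; assumption)
  \<comment> \<open>The summand 1 secures \<open>C' > 0\<close> also if
    \<open>l = 0\<close>.\<close>
  define C' where "C' = 4 * (norm l * C) + 1"
  have le: "4 * (norm l * (C * q ^ Suc n)) \<le> C' * q ^ n" for n
  proof -
    have "4 * (norm l * (C * q ^ Suc n)) = (4 * (norm l * C) * q) * q ^ n" by simp
    also have "4 * (norm l * C) * q \<le> 4 * (norm l * C) * 1" using C by (intro mult_left_mono) auto
    also have "4 * (norm l * C) * 1 \<le> C'" by (simp add: C'_def)
    finally show ?thesis using C(2) by simp
  qed
  show ?thesis
  proof (rule that[of C' q])
    fix n x assume x: "x \<in> Om (Suc n)"
    obtain E s where *: "lift (Suc n) E" "s \<in> rhp L" "s + l \<in> rhp L" "E s = phi n x" "phi (Suc n) x = E (s + l)"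
      by (rule phi_lift[OF x])
    show "\<bar>theta (phi (Suc n) x) - theta (phi n x)\<bar> \<le> C' * q ^ n"
      using C(5)[OF *(1-3)] le[of n] * by auto
    show "norm (phi (Suc n) x - phi n x) \<le> C' * q ^ n * wt (of_real (exp (exp M)))" if "theta (phi n x) + C' * q ^ n \<le> M" for M
    proof -
      have "norm (E (s + l) - E s) \<le> norm l * (C * q ^ Suc n) * wt (of_real (exp (exp M)))"
        by (rule C(6)[OF *(1-3)]) (use that le[of n] * in auto)
      also have "\<dots> \<le> C' * q ^ n * wt (of_real (exp (exp M)))"
      proof (rule mult_right_mono[OF _ less_imp_le[OF wt_pos]])
        have "0 \<le> norm l * (C * q ^ Suc n)" using C by simp
        then show "norm l * (C * q ^ Suc n) \<le> C' * q ^ n" using le[of n] by linarith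
      qed
      finally show ?thesis using * by simp
    qed
  qed (use C in \<open>auto simp: C'_def add_nonneg_pos\<close>)
qed

lemma geometric_partial: assumes "0 < q" "q < (1::real)" shows "(\<Sum>i<n. q ^ i) \<le> 1 / (1 - q)"
  using sum_le_suminf[OF summable_geometric[of q], of "{..<n}"] suminf_geometric[of q] assms by auto

text \<open>The steps form a geometric series, so \<open>phi n\<close> changes \<open>theta\<close>
  by a bounded amount, uniformly up to infinity. This makes \<open>Phi\<close> proper and lets it
  preserve escape.\<close>

lemma phi_theta: "\<exists>M\<ge>0. \<forall>n x. x \<in> Om n --> \<bar>theta (phi n x) - theta x\<bar> \<le> M"
proof -
  obtain C q where C: "C > 0" "0 < q" "q < 1"
    "\<And>n x. x \<in> Om (Suc n) ==> \<bar>theta (phi (Suc n) x) - theta (phi n x)\<bar> \<le> C * q ^ n"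
    by (rule phi_move) (rule that; assumption)+
  have "\<bar>theta (phi n x) - theta x\<bar> \<le> C * (\<Sum>i<n. q ^ i)" if "x \<in> Om n" for n x
    using that
  proof (induction n)
    case (Suc n)
    show ?case using Suc.IH[OF Om_Suc[OF Suc.prems]] C(4)[OF Suc.prems] by (simp add: distrib_left)
  qed simp
  moreover have "C * (\<Sum>i<n. q ^ i) \<le> C * (1 / (1 - q))" for n using C geometric_partial by (intro mult_left_mono) auto
  ultimately have "\<forall>n x. x \<in> Om n --> \<bar>theta (phi n x) - theta x\<bar> \<le> C * (1 / (1 - q))" by (meson order_trans)
  then show ?thesis using C by (intro exI[of _ "C * (1 / (1 - q))"]) auto
qed

definition Phi :: "complex => complex" where "Phi x = lim (\<lambda>n. phi n x)"

text \<open>The steps are geometrically small relative to \<open>wt\<close>, hence small in the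
  Euclidean sense only where \<open>theta\<close> is bounded; this is why discs appear.\<close>

lemma Phi_uniform: "uniform_limit (KK \<inter> cball 0 B) phi Phi sequentially"
proof -
  obtain C q where C: "C > 0" "0 < q" "q < 1"
    "\<And>n x M. x \<in> Om (Suc n) ==> theta (phi n x) + C * q ^ n \<le> M ==>
      norm (phi (Suc n) x - phi n x) \<le> C * q ^ n * wt (of_real (exp (exp M)))"
    by (rule phi_move) (rule that; assumption)
  obtain M where M: "\<And>n x. x \<in> Om n ==> \<bar>theta (phi n x) - theta x\<bar> \<le> M" using phi_theta by blast
  define W where "W = wt (of_real (exp (exp (theta (of_real B) + M + C))))"
  have le: "norm (phi (Suc n) x - phi n x) \<le> C * W * q ^ n" if x: "x \<in> KK \<inter> cball 0 B" for n x
  proof -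
    have "C * q ^ n \<le> C * 1" using C by (intro mult_left_mono power_le_one) auto
    moreover have "theta x \<le> theta (of_real B)" using x by (intro norm_le_imp_theta_le) auto
    moreover have "\<bar>theta (phi n x) - theta x\<bar> \<le> M" using M KK_Om x by blast
    ultimately have "theta (phi n x) + C * q ^ n \<le> theta (of_real B) + M + C" by linarith
    then show ?thesis using C(4)[of x n] KK_Om x unfolding W_def by (simp add: mult_ac)
  qed
  have sm: "summable (\<lambda>n. C * W * q ^ n)" using C by (intro summable_mult summable_geometric) auto
  define G where "G x = x + (\<Sum>i. phi (Suc i) x - phi i x)" for x
  have "uniform_limit (KK \<inter> cball 0 B) (\<lambda>n x. \<Sum>i<n. phi (Suc i) x - phi i x) (\<lambda>x. \<Sum>i. phi (Suc i) x - phi i x) sequentially"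
    by (rule Weierstrass_m_test[OF le sm])
  then have "uniform_limit (KK \<inter> cball 0 B) (\<lambda>n x. x + (\<Sum>i<n. phi (Suc i) x - phi i x)) G sequentially"
    unfolding G_def by (intro uniform_limit_intros)
  moreover have "(\<Sum>i<n. phi (Suc i) x - phi i x) = phi n x - x" for n x
    using sum_lessThan_telescope[of "\<lambda>i. phi i x" n] by simp
  ultimately have u: "uniform_limit (KK \<inter> cball 0 B) phi G sequentially" by (simp del: phi.simps)
  have "Phi x = G x" if "x \<in> KK \<inter> cball 0 B" for x
    unfolding Phi_def by (rule limI) (rule tendsto_uniform_limitI[OF u that])
  then show ?thesis using u by (subst uniform_limit_cong'[where g = phi and i = G]) auto
qed

lemma Phi_lim: "x \<in> KK ==> (\<lambda>n. phi n x) \<longlonglongrightarrow> Phi x"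
  by (rule tendsto_uniform_limitI[OF Phi_uniform[of "norm x"]]) simp

lemma Phi_continuous: "continuous_on KK Phi"
  unfolding continuous_on_eq_continuous_within
proof
  fix x assume x: "x \<in> KK"
  let ?B = "norm x + 1"
  have "continuous_on (KK \<inter> cball 0 ?B) Phi"
    by (rule uniform_limit_theorem[OF _ Phi_uniform])
      (auto intro!: always_eventually continuous_on_subset[OF phi_continuous] KK_Om simp del: phi.simps)
  then have "continuous (at x within (KK \<inter> cball 0 ?B)) Phi" using x by (simp add: continuous_on_eq_continuous_within)
  moreover have "at x within (KK \<inter> cball 0 ?B) = at x within KK"
    by (rule at_within_nhd[of _ "ball 0 ?B"]) auto
  ultimately show "continuous (at x within KK) Phi" by simp
qed

lemma Phi_theta: "\<exists>M\<ge>0. \<forall>x\<in>KK. \<bar>theta (Phi x) - theta x\<bar> \<le> M"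
proof -
  obtain M where M: "M \<ge> 0" "\<And>n x. x \<in> Om n ==> \<bar>theta (phi n x) - theta x\<bar> \<le> M" using phi_theta by blast
  have "\<bar>theta (Phi x) - theta x\<bar> \<le> M" if x: "x \<in> KK" for x
    by (rule tendsto_upperbound[where F = sequentially and f = "\<lambda>n. \<bar>theta (phi n x) - theta x\<bar>"])
      (use M x KK_Om in \<open>auto intro!: tendsto_intros theta_tendsto Phi_lim always_eventually\<close>)
  then show ?thesis using M(1) by blast
qed

lemma Phi_semiconj: assumes x: "x \<in> KK" shows "f (Phi x) = Phi (F x)"
proof -
  have "(\<lambda>n. f (phi (Suc n) x)) \<longlonglongrightarrow> f (Phi x)"
    using cont[of UNIV] continuous_on_eq_continuous_at[OF open_UNIV, of f] LIMSEQ_Suc[OF Phi_lim[OF x]]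
    by (intro isCont_tendsto_compose[of "Phi x" f]) auto
  moreover have "(\<lambda>n. f (phi (Suc n) x)) = (\<lambda>n. phi n (F x))" using phi_semiconj KK_Om x by blast
  ultimately show ?thesis using Phi_lim[OF KK_F[OF x]] LIMSEQ_unique by metis
qed

lemma Phi_funpow: "x \<in> KK ==> (f ^^ n) (Phi x) = Phi ((F ^^ n) x)"
  by (induction n) (auto simp: Phi_semiconj KK_funpow)

lemma phi_Y: assumes "x \<in> Om n" shows "phi n x \<in> Y"
  using phi_funpow[OF assms] assms unfolding Y_def Om_def by (auto intro!: exI[of _ n])

lemma Phi_clY: "x \<in> KK ==> Phi x \<in> closure Y"
  unfolding closure_sequential by (intro exI[of _ "\<lambda>n. phi n x"] conjI allI Phi_lim phi_Y KK_Om)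

lemma theta_bound: "\<bar>theta a - theta b\<bar> \<le> M ==> norm b \<le> B ==> norm a \<le> exp (exp (theta (of_real B) + M))"
  using norm_le_imp_theta_le[of b B] by (intro theta_le_imp_norm_le) linarith

text \<open>Bounded change of \<open>theta\<close> means that bounded images come from bounded
  points, and then compactness applies.\<close>

lemma Phi_closed_map: assumes T: "closed T" "T \<subseteq> KK" shows "closed (Phi ` T)"
  unfolding closed_sequential_limits
proof (intro allI impI, elim conjE)
  fix y :: "nat => complex" and z assume y: "\<forall>n. y n \<in> Phi ` T" and lim: "y \<longlonglongrightarrow> z"
  obtain M where M: "\<And>x. x \<in> KK ==> \<bar>theta (Phi x) - theta x\<bar> \<le> M" using Phi_theta by blast
  have "bounded (range y)" using lim convergent_imp_bounded convergent_def by blast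
  then obtain R where R: "\<And>n. norm (y n) \<le> R" by (auto simp: bounded_iff)
  define B where "B = exp (exp (theta (of_real R) + M))"
  have "compact (Phi ` (T \<inter> cball 0 B))"
    by (intro compact_continuous_image continuous_on_subset[OF Phi_continuous] closed_Int_compact T) (use T in auto)
  moreover have "y n \<in> Phi ` (T \<inter> cball 0 B)" for n
  proof -
    obtain x where x: "x \<in> T" "y n = Phi x" using y by blast
    then have xK: "x \<in> KK" using T(2) by blast
    have "norm x \<le> B" unfolding B_def by (rule theta_bound[of _ "Phi x"]) (use M[OF xK] R[of n] x(2) in auto)
    then show ?thesis using x by auto
  qed
  ultimately have "z \<in> Phi ` (T \<inter> cball 0 B)" using lim compact_imp_closed closed_sequentially by metis
  then show "z \<in> Phi ` T" by blast
qed

text \<open>\<open>u\<close> is approximated by points \<open>w i\<close> with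
  \<open>f (w i) = phi (m i) y\<close>, which exist because \<open>f\<close> is open. By
  \<open>phi_backward\<close> they are values of \<open>phi (Suc (m i))\<close> at points
  \<open>x i\<close>, and an accumulation point of the bounded sequence \<open>x\<close> is mapped
  to \<open>u\<close>.\<close>

lemma Phi_backward: assumes y: "y \<in> KK" and u: "f u = Phi y" shows "u \<in> Phi ` KK"
proof -
  obtain M where M: "\<And>n x. x \<in> Om n ==> \<bar>theta (phi n x) - theta x\<bar> \<le> M" using phi_theta by blast
  have "\<forall>\<^sub>F j in sequentially. \<exists>w. dist w u < 1 / Suc i \<and> f w = phi j y" for i
  proof -
    have "open (f ` ball u (1 / Suc i))" by (rule open_image) simp
    moreover have "Phi y \<in> f ` ball u (1 / Suc i)" using u by (intro image_eqI[of _ _ u]) auto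
    ultimately have "\<forall>\<^sub>F j in sequentially. phi j y \<in> f ` ball u (1 / Suc i)" using Phi_lim[OF y] topological_tendstoD by blast
    then show ?thesis by eventually_elim (auto simp: dist_commute)
  qed
  then obtain m w where m: "\<And>i. (i::nat) \<le> m i" and w: "\<And>i::nat. dist (w i) u < 1 / Suc i \<and> f (w i) = phi (m i) y"
    by (rule eventually_seq_pick[where B = "\<lambda>_. True"]) (simp, rule that, assumption, assumption)
  have wu: "w \<longlonglongrightarrow> u"
    by (rule Lim_null_comparison[OF _ LIMSEQ_inverse_real_of_nat, of "\<lambda>i. w i - u", unfolded LIM_zero_iff])
      (use w in \<open>auto intro!: always_eventually less_imp_le simp: dist_norm inverse_eq_divide\<close>)
  have "\<exists>x. F x = y \<and> phi (Suc (m i)) x = w i" for i using phi_backward[OF y] w by blast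
  then obtain x where x: "\<And>i. F (x i) = y" "\<And>i. phi (Suc (m i)) (x i) = w i" by metis
  have xK: "x i \<in> KK" for i using KK_backward x(1) y by metis
  have "bounded (range w)" using wu convergent_imp_bounded convergent_def by blast
  then obtain R where R: "\<And>n. norm (w n) \<le> R" by (auto simp: bounded_iff)
  define B where "B = exp (exp (theta (of_real R) + M))"
  have xB: "x i \<in> KK \<inter> cball 0 B" for i
  proof -
    have "\<bar>theta (w i) - theta (x i)\<bar> \<le> M" using M[OF KK_Om[OF xK], of "Suc (m i)" i] x(2)[of i] by simp
    then have "norm (x i) \<le> B" unfolding B_def by (intro theta_bound[of _ "w i"]) (use R in auto)
    then show ?thesis using xK by auto
  qed
  have c: "compact (KK \<inter> cball 0 B)" by (intro closed_Int_compact KK_closed compact_cball)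
  then obtain x0 r where r: "x0 \<in> KK \<inter> cball 0 B" "strict_mono r" "(x \<circ> r) \<longlonglongrightarrow> x0"
    using xB unfolding compact_def by blast
  have "(\<lambda>i. w i - Phi (x i)) \<longlonglongrightarrow> 0"
  proof (rule metric_LIMSEQ_I)
    fix e :: real assume "e > 0"
    then obtain N where N: "\<And>n v. n \<ge> N ==> v \<in> KK \<inter> cball 0 B ==> dist (phi n v) (Phi v) < e"
      using Phi_uniform[of B] unfolding uniform_limit_iff eventually_sequentially by blast
    have "dist (w i - Phi (x i)) 0 < e" if "i \<ge> N" for i
      using N[of "Suc (m i)" "x i"] m[of i] that xB[of i] x(2)[of i] by (simp add: dist_norm)
    then show "\<exists>N. \<forall>i\<ge>N. dist (w i - Phi (x i)) 0 < e" by blast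
  qed
  then have "(\<lambda>i. w (r i) - Phi (x (r i))) \<longlonglongrightarrow> 0" using LIMSEQ_subseq_LIMSEQ[OF _ r(2)] by (auto simp: o_def)
  moreover have "(\<lambda>i. w (r i)) \<longlonglongrightarrow> u" using LIMSEQ_subseq_LIMSEQ[OF wu r(2)] by (simp add: o_def)
  moreover have "(\<lambda>i. Phi (x (r i))) \<longlonglongrightarrow> Phi x0"
    using continuous_on_tendsto_compose[OF Phi_continuous r(3)] r(1) xK by (simp add: o_def)
  ultimately have "(\<lambda>i. w (r i) - Phi (x (r i))) \<longlonglongrightarrow> u - Phi x0" "(\<lambda>i. w (r i) - Phi (x (r i))) \<longlonglongrightarrow> 0"
    by (auto intro: tendsto_diff)
  then have "u - Phi x0 = 0" using LIMSEQ_unique by blast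
  then show ?thesis using r(1) by auto
qed

lemma Phi_backward_funpow: "(f ^^ n) u \<in> Phi ` KK ==> u \<in> Phi ` KK"
proof (induction n arbitrary: u)
  case (Suc n)
  then have "f u \<in> Phi ` KK" by (simp add: funpow_swap1)
  then show ?case using Phi_backward by blast
qed simp

text \<open>By \<open>julia_blowup\<close>, every neighbourhood of a Julia point contains preimages
  of one of two prescribed points; two points of the image are taken, so that backward invariance
  and closedness finish. They are images of fixed points of \<open>F\<close>, the second so far out
  that a bounded change of \<open>theta\<close> keeps the images apart.\<close>

lemma Phi_image: "Phi ` KK = julia_set f"
proof
  show "Phi ` KK \<subseteq> julia_set f"
  proof
    fix p assume "p \<in> Phi ` KK"
    then obtain x where x: "x \<in> KK" "p = Phi x" by blast
    have J_back: "p \<in> julia_set f" if "(f ^^ n) p \<in> julia_set f" for n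
      using that
    proof (induction n)
      case (Suc n) then show ?case using fatou_forward by (auto simp: julia_set_def)
    qed simp
    show "p \<in> julia_set f"
    proof (cases "\<exists>n. (f ^^ n) p \<in> Q")
      case True then show ?thesis using J_back QJ by blast
    next
      case False
      show ?thesis
      proof (rule good_orbit_julia[OF _ QJ])
        show "good ((f ^^ n) p)" for n
          using False Phi_funpow[OF x(1)] Phi_clY[OF KK_funpow[OF x(1)]] x(2) by (simp add: good_def)
      qed
    qed
  qed
  show "julia_set f \<subseteq> Phi ` KK"
  proof
    fix z assume z: "z \<in> julia_set f"
    interpret F: classB F 1 by (rule F_classB)
    obtain M where M: "\<And>x. x \<in> KK ==> \<bar>theta (Phi x) - theta x\<bar> \<le> M" using Phi_theta by blast
    have fixK: "a \<in> KK" if "norm a > L" "F a = a" for a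
    proof -
      have "(F ^^ n) a = a" for n using that by (induction n) auto
      then show ?thesis using that by (simp add: KK_def)
    qed
    obtain a1 where a1: "norm a1 > L" "F a1 = a1" using F.large_fixed_point by blast
    obtain a2 where a2: "norm a2 > max L (exp (exp (theta a1 + 2 * M)))" "F a2 = a2" using F.large_fixed_point by blast
    have aK: "a1 \<in> KK" "a2 \<in> KK" using fixK a1 a2 by auto
    have ne: "Phi a1 \<noteq> Phi a2"
    proof
      assume "Phi a1 = Phi a2"
      then have "theta a2 \<le> theta a1 + 2 * M" using M[OF aK(1)] M[OF aK(2)] by (simp add: abs_le_iff)
      then show False using theta_le_imp_norm_le[of a2 "theta a1 + 2 * M"] a2(1) by simp
    qed
    have "z \<in> closure (Phi ` KK)"
      unfolding closure_iff_nhds_not_empty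
    proof (intro allI impI)
      fix A V assume V: "V \<subseteq> A" "open V" "z \<in> V"
      obtain n u where u: "u \<in> V" "(f ^^ n) u = Phi a1 \<or> (f ^^ n) u = Phi a2" by (rule julia_blowup[OF z V(2,3) ne])
      then have "(f ^^ n) u \<in> Phi ` KK" using aK by auto
      then have "u \<in> Phi ` KK" by (rule Phi_backward_funpow)
      then show "Phi ` KK \<inter> A \<noteq> {}" using u(1) V(1) by blast
    qed
    then show "z \<in> Phi ` KK" using Phi_closed_map[OF KK_closed] by simp
  qed
qed

lemma at_infinity_transfer:
  assumes M: "\<And>n. \<bar>theta (a n) - theta (b n)\<bar> \<le> M" and a: "filterlim a at_infinity sequentially"
  shows "filterlim b at_infinity sequentially"
  unfolding filterlim_at_infinity[OF order_refl]
proof (intro allI impI)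
  fix B :: real assume "0 < B"
  let ?R = "exp (exp (theta (of_real B) + M))"
  have "0 < ?R + 1" by (simp add: add_pos_pos)
  then have "\<forall>\<^sub>F n in sequentially. ?R + 1 \<le> norm (a n)" using a unfolding filterlim_at_infinity[OF order_refl] by blast
  then show "\<forall>\<^sub>F n in sequentially. B \<le> norm (b n)"
  proof eventually_elim
    case (elim n)
    show ?case
    proof (rule ccontr)
      assume "\<not> B \<le> norm (b n)"
      then have "norm (a n) \<le> ?R" using theta_bound[OF M[of n], of B] by simp
      then show False using elim by simp
    qed
  qed
qed

lemma Phi_escaping: assumes x: "x \<in> KK" shows "Phi x \<in> escaping_set f \<longleftrightarrow> x \<in> escaping_set F"
proof -
  obtain M where M: "\<And>x. x \<in> KK ==> \<bar>theta (Phi x) - theta x\<bar> \<le> M" using Phi_theta by blast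
  have 1: "\<bar>theta ((f ^^ n) (Phi x)) - theta ((F ^^ n) x)\<bar> \<le> M" for n using M[OF KK_funpow[OF x], of n] Phi_funpow[OF x, of n] by simp
  have 2: "\<bar>theta ((F ^^ n) x) - theta ((f ^^ n) (Phi x))\<bar> \<le> M" for n using 1[of n] by linarith
  show ?thesis unfolding escaping_set_def mem_Collect_eq
    using at_infinity_transfer[of "\<lambda>n. (f ^^ n) (Phi x)" "\<lambda>n. (F ^^ n) x", OF 1] at_infinity_transfer[of "\<lambda>n. (F ^^ n) x" "\<lambda>n. (f ^^ n) (Phi x)", OF 2] by blast
qed

end

section \<open>Injectivity of the semiconjugacy\<close>

context model
begin

text \<open>\<open>D\<close> is the branch of the inverse of \<open>F ^^ n\<close> that corresponds
  to the branch \<open>E\<close> of the inverse of \<open>f ^^ n\<close>, and thus inverts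
  \<open>phi n\<close> along all of \<open>E\<close>. It is built one step at a time by translating
  back by \<open>l\<close>.\<close>

lemma model_chart:
  assumes "lift n E" "\<sigma> \<in> rhp L" "x \<in> Om n" "exp \<sigma> = (F ^^ n) x" "E \<sigma> = phi n x"
  shows "\<exists>D. D holomorphic_on rhp L \<and> D \<sigma> = x \<and> (\<forall>s\<in>rhp L. D s \<in> Om n \<and> (F ^^ n) (D s) = exp s \<and> phi n (D s) = E s)"
  using assms
proof (induction n arbitrary: E \<sigma> x)
  case 0
  have "exp s \<in> Om 0" if "s \<in> rhp L" for s using exp_in_rhp[of L s] that L(1) by (simp add: Om_def)
  then show ?case using 0 by (intro exI[of _ exp]) (auto simp: lift_def intro: holomorphic_intros)
next
  case (Suc n)
  define G where "G s = E (s - l)" for s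
  define w where "w s = (f ^^ n) (G s)" for s
  have Eh: "E holomorphic_on rhp L" using Suc.prems(1) by (simp add: lift_def)
  have "(E \<circ> (\<lambda>s. s - l)) holomorphic_on rhp L"
    by (rule holomorphic_on_compose_gen[OF _ Eh]) (use rhp_minus_l in \<open>auto intro!: holomorphic_intros\<close>)
  then have G: "G holomorphic_on rhp L" by (simp add: G_def[abs_def] o_def)
  have "((f ^^ n) \<circ> G) holomorphic_on rhp L" by (rule holomorphic_on_compose[OF G funpow_hol])
  then have w: "w holomorphic_on rhp L" by (simp add: w_def[abs_def] o_def)
  have Fw: "F (w s) = exp s" if "s \<in> rhp L" for s
  proof -
    have "f (w s) = exp (s - l)" using Suc.prems(1) rhp_minus_l[OF that] by (simp add: lift_def w_def G_def)
    then show ?thesis using exp_l k0 by (simp add: F_def exp_diff)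
  qed
  have wL: "L < norm (w s)" if "s \<in> rhp L" for s
    using F_big(1)[of "w s"] Fw[OF that] exp_in_rhp[of L s] L(1) that by simp
  have w0: "w s \<noteq> 0" if "s \<in> rhp L" for s using wL[OF that] L(1) by auto
  obtain t where t: "t holomorphic_on rhp L" "\<And>s. s \<in> rhp L ==> exp (t s) = w s"
    by (rule holomorphic_log_convex[OF rhp(1,2) w w0]) (assumption | rule that; assumption)+
  have tr: "t s \<in> rhp L" if "s \<in> rhp L" for s
    using exp_in_rhp[of L "t s"] t(2)[OF that] wL[OF that] L(1) by auto
  have "(f ^^ n) (G \<sigma>) = exp (t \<sigma>)" using t(2)[OF Suc.prems(2)] by (simp add: w_def)
  then obtain E' where E': "lift n E'" "E' (t \<sigma>) = G \<sigma>" using lift_exists[OF tr[OF Suc.prems(2)]] by blast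
  obtain E2 s2 where *: "lift (Suc n) E2" "s2 \<in> rhp L" "s2 + l \<in> rhp L" "E2 s2 = phi n x" "phi (Suc n) x = E2 (s2 + l)"
    by (rule phi_lift[OF Suc.prems(3)])
  have "E2 s2 = E (\<sigma> - l)"
    by (rule lift_inj[OF *(1) Suc.prems(1) *(2,3) rhp_minus_l[OF Suc.prems(2)]]) (use Suc.prems * in auto)
  then have Gx: "G \<sigma> = phi n x" using * by (simp add: G_def)
  have "exp (t \<sigma>) = (F ^^ n) x" using t(2)[OF Suc.prems(2)] phi_funpow[OF Om_Suc[OF Suc.prems(3)]] Gx by (simp add: w_def)
  then obtain D where D: "D holomorphic_on rhp L" "D (t \<sigma>) = x"
    "\<And>s. s \<in> rhp L ==> D s \<in> Om n \<and> (F ^^ n) (D s) = exp s \<and> phi n (D s) = E' s"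
    using Suc.IH[OF E'(1) tr[OF Suc.prems(2)] Om_Suc[OF Suc.prems(3)]] E'(2) Gx by auto
  have comp: "(h \<circ> t) holomorphic_on rhp L" if "h holomorphic_on rhp L" for h
    by (rule holomorphic_on_compose_gen[OF t(1) that]) (use tr in auto)
  have E'G: "(E' \<circ> t) s = G s" if "s \<in> rhp L" for s
  proof (rule entire_map.hol_lift_unique[OF funpow_entire rhp(1,3) comp G _ Suc.prems(2) _ _ that, of E' n])
    show "E' holomorphic_on rhp L" using E' by (simp add: lift_def)
    show "(f ^^ n) ((E' \<circ> t) s) = (f ^^ n) (G s)" if "s \<in> rhp L" for s
      using E'(1) tr[OF that] t(2)[OF that] by (simp add: lift_def w_def)
    show "(E' \<circ> t) \<sigma> = G \<sigma>" using E' by simp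
    show "deriv (f ^^ n) ((E' \<circ> t) \<sigma>) \<noteq> 0" using lift_deriv(2)[OF E'(1) tr[OF Suc.prems(2)]] by simp
  qed
  show ?case
  proof (intro exI[of _ "D \<circ> t"] conjI ballI comp D(1))
    show "(D \<circ> t) \<sigma> = x" using D(2) by simp
    fix s assume s: "s \<in> rhp L"
    have Ds: "D (t s) \<in> Om n" "(F ^^ n) (D (t s)) = w s" "phi n (D (t s)) = E (s - l)"
      using D(3)[OF tr[OF s]] t(2)[OF s] E'G[OF s] by (auto simp: G_def)
    show Fs: "(F ^^ Suc n) ((D \<circ> t) s) = exp s" using Ds(2) Fw[OF s] by simp
    have "L < norm (exp s)" using exp_in_rhp[of L s] L(1) s by simp
    then show "(D \<circ> t) s \<in> Om (Suc n)" using Ds(1) Fs by (auto simp: Om_def le_Suc_eq simp del: funpow.simps)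
    show "phi (Suc n) ((D \<circ> t) s) = E s"
      using step_eq[OF Suc.prems(1) rhp_minus_l[OF s] _ refl] s Ds(3) by simp
  qed
qed

text \<open>\<open>1 / (norm z * ln (norm z))\<close> is the hyperbolic density of
  \<open>{z. 1 < norm z}\<close> up to normalisation. The constant \<open>12 * pi\<close> of
  \<open>expansion\<close> against \<open>ln L \<ge> 24 * pi\<close> gives the factor 2.\<close>

lemma F_expand:
  assumes "L < norm z" "L < norm (F z)"
  shows "1 / (norm z * ln (norm z)) \<le> 1/2 * (norm (deriv F z) / (norm (F z) * ln (norm (F z))))"
proof -
  interpret F: classB F 1 by (rule F_classB)
  have e: "norm (F z) * ln (norm (F z)) \<le> 12 * pi * (norm z * norm (deriv F z))" using F.expansion[of z] assms L(1) by simp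
  have p: "0 < norm z" "0 < norm (F z)" "0 < ln (norm (F z))" using assms L(1) by (auto intro!: ln_gt_zero)
  have "ln L \<le> ln (norm z)" by (rule ln_mono) (use assms L(1) in linarith)+
  then have lz: "24 * pi \<le> ln (norm z)" using Lbig by linarith
  then have lz0: "0 < ln (norm z)" using pi_gt_zero by linarith
  have "24 * pi * (norm (F z) * ln (norm (F z))) \<le> ln (norm z) * (12 * pi * (norm z * norm (deriv F z)))"
    by (rule mult_mono[OF lz e]) (use p lz0 in auto)
  then have "pi * (2 * (norm (F z) * ln (norm (F z)))) \<le> pi * (norm (deriv F z) * (norm z * ln (norm z)))" by (simp add: mult_ac)
  then have "2 * (norm (F z) * ln (norm (F z))) \<le> norm (deriv F z) * (norm z * ln (norm z))" by (simp only: mult_le_cancel_left_pos[OF pi_gt_zero])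
  moreover have "0 < norm z * ln (norm z)" "0 < norm (F z) * ln (norm (F z))" using p lz0 by simp_all
  ultimately show ?thesis by (simp add: divide_simps mult_ac)
qed

lemma F_expand_funpow:
  assumes "x \<in> Om n"
  shows "1 / (norm x * ln (norm x)) \<le> (1/2) ^ n * (norm (deriv (F ^^ n) x) / (norm ((F ^^ n) x) * ln (norm ((F ^^ n) x))))"
  using assms
proof (induction n)
  case 0 then show ?case by simp
next
  case (Suc n)
  interpret F: classB F 1 by (rule F_classB)
  let ?y = "(F ^^ n) x"
  have "L < norm ?y" "L < norm (F ?y)" using Suc.prems by (auto simp: Om_def dest: spec[of _ n] spec[of _ "Suc n"])
  then have e: "1 / (norm ?y * ln (norm ?y)) \<le> 1/2 * (norm (deriv F ?y) / (norm (F ?y) * ln (norm (F ?y))))" by (rule F_expand)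
  have "1 / (norm x * ln (norm x)) \<le> ((1/2) ^ n * norm (deriv (F ^^ n) x)) * (1 / (norm ?y * ln (norm ?y)))"
    using Suc.IH[OF Om_Suc[OF Suc.prems]] by simp
  also have "\<dots> \<le> ((1/2) ^ n * norm (deriv (F ^^ n) x)) * (1/2 * (norm (deriv F ?y) / (norm (F ?y) * ln (norm (F ?y)))))"
    by (rule mult_left_mono[OF e]) simp
  also have "\<dots> = (1/2) ^ Suc n * (norm (deriv (F ^^ Suc n) x) / (norm ((F ^^ Suc n) x) * ln (norm ((F ^^ Suc n) x))))"
    using F.deriv_funpow_add[of 1 n x] by (simp add: norm_mult mult_ac)
  finally show ?case .
qed

text \<open>In the logarithmic coordinate the density of \<open>F_expand\<close> becomes
  \<open>1 / Re s\<close>, so the segment from \<open>\<sigma>\<close> to \<open>\<sigma>'\<close>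
  has length at most \<open>C\<close>. The branch \<open>D\<close> of the inverse of
  \<open>F ^^ n\<close> maps it to a path from \<open>x\<close> to \<open>x'\<close> that is shorter
  by the factor \<open>(1/2) ^ n\<close>.\<close>

lemma inj_criterion:
  assumes x: "x \<in> KK" "x' \<in> KK" and C: "C \<ge> 0"
    and ex: "\<And>N. \<exists>n\<ge>N. \<exists>\<sigma> \<sigma>' E. lift n E \<and> \<sigma> \<in> rhp L \<and> \<sigma>' \<in> rhp L \<and> exp \<sigma> = (F ^^ n) x \<and> exp \<sigma>' = (F ^^ n) x' \<and>
      E \<sigma> = phi n x \<and> E \<sigma>' = phi n x' \<and> norm (\<sigma>' - \<sigma>) \<le> C * Re \<sigma> \<and> norm (\<sigma>' - \<sigma>) \<le> C * Re \<sigma>'"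
  shows "x = x'"
proof (rule ccontr)
  assume ne: "x \<noteq> x'"
  define W where "W = wt (of_real (exp (exp (theta x + 4 * C))))"
  have "(\<lambda>n. (1/2) ^ n * (C * W)) \<longlonglongrightarrow> 0 * (C * W)" by (intro tendsto_intros LIMSEQ_power_zero) simp
  then have "\<forall>\<^sub>F n in sequentially. (1/2) ^ n * (C * W) < norm (x' - x)" by (rule order_tendstoD) (use ne in simp)
  then obtain N where N: "\<And>n. n \<ge> N ==> (1/2) ^ n * (C * W) < norm (x' - x)" unfolding eventually_sequentially by blast
  obtain n \<sigma> \<sigma>' E where n: "n \<ge> N" and E: "lift n E" and s: "\<sigma> \<in> rhp L" "\<sigma>' \<in> rhp L" and es: "exp \<sigma> = (F ^^ n) x" "exp \<sigma>' = (F ^^ n) x'"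
    and Es: "E \<sigma> = phi n x" "E \<sigma>' = phi n x'" and C1: "norm (\<sigma>' - \<sigma>) \<le> C * Re \<sigma>" and C2: "norm (\<sigma>' - \<sigma>) \<le> C * Re \<sigma>'"
    using ex[of N] by blast
  obtain D where D: "D holomorphic_on rhp L" "D \<sigma> = x" "\<And>s. s \<in> rhp L ==> D s \<in> Om n"
    "\<And>s. s \<in> rhp L ==> (F ^^ n) (D s) = exp s" "\<And>s. s \<in> rhp L ==> phi n (D s) = E s"
    using model_chart[OF E s(1) KK_Om[OF x(1)] es(1) Es(1)] by blast
  have Dx': "D \<sigma>' = x'" by (rule phi_inj[OF D(3)[OF s(2)] KK_Om[OF x(2)]]) (use D(5)[OF s(2)] Es in simp)
  interpret F: classB F 1 by (rule F_classB)
  have ln0: "0 \<le> ln L" using L(1) by simp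
  define e where "e t = D (\<sigma> + of_real t * (\<sigma>' - \<sigma>))" for t :: real
  define K where "K = (1/2) ^ n * C"
  have KC: "K \<le> C" using C mult_right_mono[of "(1/2::real) ^ n" 1 C] by (simp add: K_def power_le_one)
  note seg = segment_path[OF rhp(1,2) D(1) s(1), of "\<sigma>' - \<sigma>"]
  have b: "norm ((\<sigma>' - \<sigma>) * deriv D (\<sigma> + of_real t * (\<sigma>' - \<sigma>))) \<le> K * wt (e t)" if t: "t \<in> {0..1}" for t
  proof -
    define p where "p = \<sigma> + of_real t * (\<sigma>' - \<sigma>)"
    have p: "p \<in> rhp L" unfolding p_def by (rule seg(1)[OF _ t]) (use s in simp)
    have Rp: "Re p > 0" using p ln0 by (simp add: rhp_def)
    have "norm (\<sigma>' - \<sigma>) = (1 - t) * norm (\<sigma>' - \<sigma>) + t * norm (\<sigma>' - \<sigma>)" by (simp add: algebra_simps)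
    also have "\<dots> \<le> (1 - t) * (C * Re \<sigma>) + t * (C * Re \<sigma>')" using t C1 C2 by (intro add_mono mult_left_mono) auto
    also have "\<dots> = C * Re p" by (simp add: p_def algebra_simps)
    finally have sp: "norm (\<sigma>' - \<sigma>) \<le> C * Re p" .
    have "deriv exp p = deriv (F ^^ n) (D p) * deriv D p"
      by (rule entire_map.deriv_lift[OF F.funpow_entire rhp(1) D(1,4) p])
    then have dp: "norm (exp p) = norm (deriv (F ^^ n) (D p)) * norm (deriv D p)" by (simp add: norm_mult)
    have Dn: "L < norm (D p)" using D(3)[OF p] unfolding Om_def by (auto dest: spec[of _ 0])
    have h0: "0 < norm (D p) * ln (norm (D p))" using Dn L(1) by (intro mult_pos_pos ln_gt_zero) auto
    have "1 / (norm (D p) * ln (norm (D p))) \<le> (1/2) ^ n * (norm (deriv (F ^^ n) (D p)) / (norm (exp p) * Re p))"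
      using F_expand_funpow[OF D(3)[OF p]] D(4)[OF p] by simp
    then have "1 / (norm (D p) * ln (norm (D p))) * norm (deriv D p) \<le> (1/2) ^ n * (norm (deriv (F ^^ n) (D p)) / (norm (exp p) * Re p)) * norm (deriv D p)"
      by (rule mult_right_mono) simp
    also have "\<dots> = (1/2) ^ n * (norm (exp p) / (norm (exp p) * Re p))" unfolding dp by simp
    also have "\<dots> = (1/2) ^ n / Re p" by simp
    finally have "norm (deriv D p) \<le> (1/2) ^ n / Re p * (norm (D p) * ln (norm (D p)))" using h0 by (simp add: divide_le_eq)
    moreover have "norm (D p) * ln (norm (D p)) \<le> wt (D p)"
      unfolding wt_def using Dn L(1) le_9_plus_square[of "norm (D p)"] by (intro mult_mono ln_mono) auto
    ultimately have "norm (deriv D p) \<le> (1/2) ^ n / Re p * wt (D p)" using Rp by (meson mult_left_mono order_trans divide_nonneg_pos zero_le_power zero_le_divide_1_iff zero_le_numeral)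
    then have "norm (\<sigma>' - \<sigma>) * norm (deriv D p) \<le> (C * Re p) * ((1/2) ^ n / Re p * wt (D p))" using sp C Rp by (intro mult_mono) auto
    also have "\<dots> = K * wt (D p)" using Rp by (simp add: K_def)
    finally show ?thesis by (simp add: norm_mult p_def e_def)
  qed
  have "norm (e 1 - e 0) \<le> K * W" unfolding W_def
    by (rule theta_path_move(2)[of e "\<lambda>t. (\<sigma>' - \<sigma>) * deriv D (\<sigma> + of_real t * (\<sigma>' - \<sigma>))"])
      (use b KC seg(2) s(2) D(2) in \<open>auto simp: e_def[abs_def]\<close>)
  then show False using N[OF n] D(2) Dx' by (simp add: e_def K_def)
qed

lemma phi_funpow_shift: "x \<in> Om (n + m) ==> (f ^^ n) (phi (n + m) x) = phi m ((F ^^ n) x)"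
proof (induction n arbitrary: x)
  case (Suc n)
  have "(f ^^ Suc n) (phi (Suc n + m) x) = (f ^^ n) (f (phi (Suc (n + m)) x))" by (simp add: funpow_swap1)
  also have "\<dots> = (f ^^ n) (phi (n + m) (F x))" using phi_semiconj Suc.prems by simp
  also have "\<dots> = phi m ((F ^^ Suc n) x)" using Suc.IH[of "F x"] Om_F Suc.prems by (simp add: funpow_swap1)
  finally show ?case .
qed simp

lemma Phi_escaping_image: "Phi ` (KK \<inter> escaping_set F) = escaping_set f"
proof
  show "Phi ` (KK \<inter> escaping_set F) \<subseteq> escaping_set f" using Phi_escaping by auto
  show "escaping_set f \<subseteq> Phi ` (KK \<inter> escaping_set F)"
  proof
    fix y assume y: "y \<in> escaping_set f"
    then obtain x where "x \<in> KK" "y = Phi x" using escaping_subset_julia[OF QJ] Phi_image by blast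
    then show "y \<in> Phi ` (KK \<inter> escaping_set F)" using y Phi_escaping by auto
  qed
qed

text \<open>A point of \<open>S\<close> shares its image with no other point of \<open>KK\<close>;
  this, rather than injectivity on \<open>S\<close> alone, makes images of relatively closed subsets
  relatively closed.\<close>

lemma Phi_homeo:
  assumes S: "S \<subseteq> KK" and inj: "\<And>x x'. x \<in> S ==> x' \<in> KK ==> Phi x = Phi x' ==> x = x'"
  obtains g where "homeomorphism S (Phi ` S) Phi g"
proof (rule homeomorphism_injective_closed_map[of S Phi "Phi ` S"])
  show "continuous_on S Phi" using Phi_continuous S continuous_on_subset by blast
  show "inj_on Phi S" using inj S by (auto intro!: inj_onI)
  show "closedin (top_of_set (Phi ` S)) (Phi ` U)" if U: "closedin (top_of_set S) U" for U
  proof -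
    obtain T where T: "closed T" "U = S \<inter> T" using U unfolding closedin_closed by auto
    have "Phi ` U = Phi ` S \<inter> Phi ` (KK \<inter> T)" using T(2) S inj by blast
    moreover have "closed (Phi ` (KK \<inter> T))" using T(1) KK_closed by (intro Phi_closed_map) auto
    ultimately show ?thesis by (simp add: closedin_closed_Int)
  qed
qed (use that in auto)

end

text \<open>\<open>psi \<circ> exp\<close> covers \<open>W\<close> by a half-plane. The map
  \<open>j\<close> passes from the logarithm near infinity to this covering; it respects the deck
  transformations and moves points by a bounded amount.\<close>

locale exterior = model f PF Q nu R0 L \<epsilon> k for f PF Q nu R0 L \<epsilon> k +
  fixes r c :: real and W :: "complex set" and psi psii j :: "complex => complex"
  assumes r: "0 < r" and W: "open W" "W \<inter> (PF \<union> Q) = {}" and psi: "psi holomorphic_on {u. r < norm u}" "psii holomorphic_on W"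
    and psi_in: "\<And>u. r < norm u ==> psi u \<in> W \<and> psii (psi u) = u" and psii_in: "\<And>z. z \<in> W ==> r < norm (psii z) \<and> psi (psii z) = z"
    and j: "j holomorphic_on rhp L" "\<And>s. s \<in> rhp L ==> exp (j s) = psii (exp s)" "\<And>s. s \<in> rhp L ==> exp s \<in> W"
    "\<And>s (m::int). s \<in> rhp L ==> j (s + of_int m * (2 * of_real pi * \<i>)) = j s + of_int m * (2 * of_real pi * \<i>)"
    "\<And>s. s \<in> rhp L ==> norm (j s - s) \<le> c"
begin

definition P :: "complex => complex" where "P u = psi (exp u)"

lemma exp_rhp: "u \<in> rhp r \<longleftrightarrow> r < norm (exp u)" using exp_in_rhp[OF r] by simp

lemma P_in: "u \<in> rhp r ==> P u \<in> W" "u \<in> rhp r ==> psii (P u) = exp u"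
  using psi_in exp_rhp by (auto simp: P_def)

lemma P_hol: "P holomorphic_on rhp r"
proof -
  have "(psi \<circ> exp) holomorphic_on rhp r"
    by (rule holomorphic_on_compose_gen[OF _ psi(1)]) (use exp_rhp in \<open>auto intro!: holomorphic_intros\<close>)
  then show ?thesis by (simp add: P_def[abs_def] o_def)
qed

lemma P_eq: assumes "u \<in> rhp r" "v \<in> rhp r" "P u = P v" obtains m :: int where "v = u + of_int m * (2 * of_real pi * \<i>)"
proof -
  have "exp v = exp u" using P_in(2)[OF assms(1)] P_in(2)[OF assms(2)] assms(3) by simp
  then show ?thesis using that unfolding exp_eq by (auto simp: algebra_simps)
qed

lemma P_deriv: assumes "u \<in> rhp r" shows "deriv P u \<noteq> 0"
proof -
  have "((psii \<circ> P) has_field_derivative deriv psii (P u) * deriv P u) (at u)"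
    by (rule DERIV_chain[OF holomorphic_derivI[OF psi(2) W(1) P_in(1)[OF assms]] holomorphic_derivI[OF P_hol rhp(1) assms]])
  moreover have "((psii \<circ> P) has_field_derivative exp u) (at u)"
    by (rule has_field_derivative_transform_within_open[OF DERIV_exp rhp(1) assms]) (use P_in in simp)
  ultimately have "deriv psii (P u) * deriv P u = exp u" by (rule DERIV_unique)
  then show ?thesis by auto
qed

definition plift :: "nat => (complex => complex) => bool" where
  "plift n E \<longleftrightarrow> E holomorphic_on rhp r \<and> (\<forall>u\<in>rhp r. (f ^^ n) (E u) = P u)"

lemma plift_exists:
  assumes t: "t \<in> rhp r" and z: "(f ^^ n) z = P t"
  obtains E where "plift n E" "E t = z"
proof -
  have "\<not> P constant_on rhp r"
  proof
    assume "P constant_on rhp r"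
    then obtain d where "\<And>u. u \<in> rhp r ==> P u = d" by (auto simp: constant_on_def)
    then have "exp u = psii d" if "u \<in> rhp r" for u using P_in(2)[OF that] that by metis
    then show False using not_const_exp[OF t rhp(1)] by (auto simp: constant_on_def)
  qed
  then have "adm (rhp r) P" using P_hol P_in(1) W(2) by (intro adm_unramified) auto
  from adm_lift_funpow[OF rhp(1,4,5) t this z]
  obtain H where "adm (rhp r) H" "\<And>zeta. zeta \<in> rhp r ==> (f ^^ n) (H zeta) = P zeta" "H t = z" by blast
  then show ?thesis using that[of H] by (simp add: plift_def adm_def)
qed

lemma plift_eq:
  assumes "plift n E1" "plift n E2" "t \<in> rhp r" "E1 t = E2 t" "u \<in> rhp r"
  shows "E1 u = E2 u"
proof -
  have "deriv P t = deriv (f ^^ n) (E1 t) * deriv E1 t"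
    by (rule funpow_deriv_lift[OF rhp(1) _ _ assms(3)]) (use assms in \<open>auto simp: plift_def\<close>)
  then have "deriv (f ^^ n) (E1 t) \<noteq> 0" using P_deriv[OF assms(3)] by auto
  then show ?thesis
    using assms by (intro entire_map.hol_lift_unique[OF funpow_entire rhp(1,3) _ _ _ assms(3) _ _ assms(5), of E1 E2 n]) (simp_all add: plift_def)
qed

text \<open>Near \<open>a\<close>, as measured by \<open>theta\<close>, the logarithm of
  \<open>psii\<close> has derivative at most \<open>b / wt\<close>. A path of given length for the
  density \<open>1 / wt\<close> therefore lifts to the half-plane with at most \<open>b\<close>
  times that Euclidean length.\<close>

definition tame :: "real => complex => real => bool" where
  "tame M a b \<longleftrightarrow> (\<forall>z\<in>closure Y. \<bar>theta z - theta a\<bar> \<le> M --> z \<in> W \<and> norm (deriv psii z) * wt z \<le> b * norm (psii z))"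

text \<open>The path \<open>a, phi 1 a, phi 2 a, \<dots>\<close> towards \<open>Phi a\<close>, followed in the covering half-plane, ends at a
  point which the branch of \<open>f ^^ (-n)\<close> through \<open>phi n x\<close> maps to \<open>Phi x\<close>.\<close>

lemma path_limit:
  obtains M C where "C \<ge> 0"
    "\<And>x n b t0 E. x \<in> KK ==> b \<ge> 0 ==> tame M ((F ^^ n) x) b ==> t0 \<in> rhp r ==> P t0 = (F ^^ n) x ==> plift n E ==> E t0 = phi n x ==>
      \<exists>t\<in>rhp r. P t = Phi ((F ^^ n) x) \<and> E t = Phi x \<and> norm (t - t0) \<le> b * C"
proof -
  obtain C q where C: "C > 0" "0 < q" "q < 1"
    and Cd: "\<And>n E s. lift n E ==> s \<in> rhp L ==> norm (deriv E s) \<le> C * q ^ n * wt (E s)"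
    and Cm: "\<And>n E s v. lift n E ==> s \<in> rhp L ==> s + v \<in> rhp L ==> \<bar>theta (E (s + v)) - theta (E s)\<bar> \<le> 4 * (norm v * (C * q ^ n))"
    by (rule lift_move) (rule that; assumption)+
  obtain M1 where M1: "M1 \<ge> 0" "\<And>n x. x \<in> Om n ==> \<bar>theta (phi n x) - theta x\<bar> \<le> M1" using phi_theta by blast
  obtain M2 where M2: "M2 \<ge> 0" "\<And>x. x \<in> KK ==> \<bar>theta (Phi x) - theta x\<bar> \<le> M2" using Phi_theta by blast
  \<comment> \<open>\<open>M1\<close> accounts for the points \<open>phi m a\<close>,
    \<open>M2\<close> for their limit, and the last term for the convex neighbourhood
    \<open>V\<close> of the segment that belongs to one step.\<close>
  define M where "M = M1 + M2 + 4 * ((norm l + 1) * C)"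
  have M12: "M1 \<le> M" "M2 \<le> M" "M1 + 4 * ((norm l + 1) * C) \<le> M" using M1(1) M2(1) C(1) by (auto simp: M_def intro!: add_nonneg_nonneg)
  show ?thesis
  proof (rule that[of "norm l * C / (1 - q)" M])
    show "0 \<le> norm l * C / (1 - q)" using C by simp
    fix x n b t0 Ep
    assume x: "x \<in> KK" and b: "(b::real) \<ge> 0" and tame: "tame M ((F ^^ n) x) b" and t0: "t0 \<in> rhp r" "P t0 = (F ^^ n) x"
      and Ep: "plift n Ep" "Ep t0 = phi n x"
    define a where "a = (F ^^ n) x"
    have aK: "a \<in> KK" unfolding a_def by (rule KK_funpow[OF x])
    have tame': "z \<in> W" "norm (deriv psii z) * wt z \<le> b * norm (psii z)" if "z \<in> closure Y" "\<bar>theta z - theta a\<bar> \<le> M" for z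
      using tame that by (auto simp: tame_def a_def)
    let ?R = "\<lambda>m t. t \<in> rhp r \<and> P t = phi m a \<and> Ep t = phi (n + m) x"
    \<comment> \<open>\<open>g m\<close> lies over \<open>phi m a\<close>, and the branch
      \<open>Ep\<close> carries it to \<open>phi (n + m) x\<close>; the side condition pins down
      \<open>g 0 = t0\<close>.\<close>
    have "\<exists>g. \<forall>m. (?R m (g m) \<and> (m = 0 --> g m = t0)) \<and> norm (g (Suc m) - g m) \<le> norm l * (b * C * q ^ m)"
    proof (rule dependent_nat_choice)
      show "\<exists>t. ?R 0 t \<and> (0 = 0 --> t = t0)" using t0 Ep by (simp add: a_def)
      fix tm :: complex and m :: nat assume "?R m tm \<and> (m = 0 --> tm = t0)"
      then have tm: "tm \<in> rhp r" "P tm = phi m a" "Ep tm = phi (n + m) x" by auto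
      obtain E s where E: "lift (Suc (n + m)) E" and s: "s \<in> rhp L" "s + l \<in> rhp L" and Es: "E s = phi (n + m) x" "phi (Suc (n + m)) x = E (s + l)"
        by (rule phi_lift[OF KK_Om[OF x], of "n + m"])
      define A where "A t = (f ^^ n) (E t)" for t
      have A: "lift (Suc m) A" unfolding A_def using lift_comp[of n "Suc m" E] E by simp
      have As: "A s = phi m a" "A (s + l) = phi (Suc m) a"
        using phi_funpow_shift[OF KK_Om[OF x], of n m] phi_funpow_shift[OF KK_Om[OF x], of n "Suc m"] Es by (auto simp: A_def a_def simp del: phi.simps)
      \<comment> \<open>An open convex set in place of the segment, so that holomorphic logarithms
        and uniqueness of lifts are at hand.\<close>
      define V where "V = rhp L \<inter> ball s (norm l + 1)"
      have V: "open V" "convex V" "connected V" "V \<subseteq> rhp L" "s \<in> V" "s + l \<in> V"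
        using s rhp(1,2)[of L] by (auto simp: V_def convex_Int dist_norm add_nonneg_pos intro!: convex_connected)
      have qm: "q ^ k \<le> 1" for k using C by (simp add: power_le_one)
      have AV: "A t \<in> closure Y" "\<bar>theta (A t) - theta a\<bar> \<le> M" if t: "t \<in> V" for t
      proof -
        show "A t \<in> closure Y" using lift_Y[OF A] V(4) t closure_subset by blast
        have "\<bar>theta (A (s + (t - s))) - theta (A s)\<bar> \<le> 4 * (norm (t - s) * (C * q ^ Suc m))"
          by (rule Cm[OF A s(1)]) (use V(4) t in auto)
        moreover have "norm (t - s) * (C * q ^ Suc m) \<le> (norm l + 1) * (C * 1)"
          using C qm[of "Suc m"] t by (intro mult_mono) (auto simp: V_def dist_norm norm_minus_commute)
        ultimately have "\<bar>theta (A t) - theta (phi m a)\<bar> \<le> 4 * ((norm l + 1) * C)" using As(1) by simp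
        then show "\<bar>theta (A t) - theta a\<bar> \<le> M" using M1(2)[OF KK_Om[OF aK], of m] M12(3) by linarith
      qed
      have Ah: "A holomorphic_on V" using A V(4) holomorphic_on_subset by (auto simp: lift_def)
      have Eh: "E holomorphic_on V" using E V(4) holomorphic_on_subset by (auto simp: lift_def)
      have AW: "A t \<in> W" if "t \<in> V" for t using tame'(1) AV that by blast
      have pA: "(psii \<circ> A) holomorphic_on V" by (rule holomorphic_on_compose_gen[OF Ah psi(2)]) (use AW in auto)
      have pnz: "(psii \<circ> A) t \<noteq> 0" if "t \<in> V" for t using psii_in[OF AW[OF that]] r by auto
      obtain u0 where u0: "u0 holomorphic_on V" "\<And>t. t \<in> V ==> exp (u0 t) = (psii \<circ> A) t"
        by (rule holomorphic_log_convex[OF V(1,2) pA pnz]) (assumption | rule that; assumption)+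
      define u where "u t = u0 t - u0 s + tm" for t
      have u: "u holomorphic_on V" unfolding u_def by (intro holomorphic_intros u0)
      have us: "u s = tm" by (simp add: u_def)
      have eu: "exp (u t) = psii (A t)" if "t \<in> V" for t
        using u0(2)[OF that] u0(2)[OF V(5)] P_in(2)[OF tm(1)] tm(2) As(1) psii_in[OF AW[OF V(5)]] r by (auto simp: u_def exp_add exp_diff)
      have ur: "u t \<in> rhp r" if "t \<in> V" for t using exp_rhp eu[OF that] psii_in[OF AW[OF that]] by metis
      have Pu: "P (u t) = A t" if "t \<in> V" for t using eu[OF that] psii_in[OF AW[OF that]] by (simp add: P_def)
      have Epu: "(Ep \<circ> u) holomorphic_on V"
        by (rule holomorphic_on_compose_gen[OF u]) (use Ep ur in \<open>auto simp: plift_def\<close>)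
      have dn: "deriv (f ^^ n) (E s) \<noteq> 0"
        using lift_deriv(2)[OF E s(1)] deriv_funpow_add[of "Suc m" n "E s"] by (simp add: add.commute)
      \<comment> \<open>Both sides are lifts of \<open>A\<close> through \<open>f ^^ n\<close> that
        agree at \<open>s\<close>; so the branch \<open>Ep\<close>, followed along the step of
        \<open>a\<close>, reproduces the step of \<open>x\<close>.\<close>
      have EpE: "(Ep \<circ> u) t = E t" if "t \<in> V" for t
      proof (rule entire_map.hol_lift_unique[OF funpow_entire V(1,3) Epu Eh _ V(5) _ _ that, of n])
        show "(f ^^ n) ((Ep \<circ> u) t) = (f ^^ n) (E t)" if "t \<in> V" for t using Ep(1) ur[OF that] Pu[OF that] by (simp add: plift_def A_def)
        show eq: "(Ep \<circ> u) s = E s" using us tm(3) Es(1) by simp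
        show "deriv (f ^^ n) ((Ep \<circ> u) s) \<noteq> 0" using eq dn by simp
      qed
      have du: "norm (deriv u t) \<le> b * C * q ^ m" if t: "t \<in> V" for t
      proof -
        have "deriv (psii \<circ> A) t = exp (u t) * deriv u t"
          by (rule exp_map.deriv_lift[OF V(1) u _ t, simplified]) (use eu in simp)
        moreover have "((psii \<circ> A) has_field_derivative deriv psii (A t) * deriv A t) (at t)"
          by (rule DERIV_chain[OF holomorphic_derivI[OF psi(2) W(1) AW[OF t]] holomorphic_derivI[OF Ah V(1) t]])
        ultimately have "psii (A t) * deriv u t = deriv psii (A t) * deriv A t" using DERIV_imp_deriv eu[OF t] by metis
        then have "norm (psii (A t)) * norm (deriv u t) = norm (deriv psii (A t)) * norm (deriv A t)" by (metis norm_mult)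
        also have "\<dots> \<le> norm (deriv psii (A t)) * (C * q ^ Suc m * wt (A t))"
          using Cd[OF A] V(4) t by (intro mult_left_mono) auto
        also have "\<dots> = C * q ^ Suc m * (norm (deriv psii (A t)) * wt (A t))" by simp
        also have "\<dots> \<le> C * q ^ Suc m * (b * norm (psii (A t)))"
          using tame'(2)[OF AV[OF t]] C by (intro mult_left_mono) auto
        finally have "norm (psii (A t)) * norm (deriv u t) \<le> norm (psii (A t)) * (b * C * q ^ Suc m)" by (simp add: mult_ac)
        moreover have "0 < norm (psii (A t))" using psii_in[OF AW[OF t]] r by linarith
        ultimately have "norm (deriv u t) \<le> b * C * q ^ Suc m" by (simp only: mult_le_cancel_left_pos)
        also have "\<dots> \<le> b * C * q ^ m" using C b by (intro mult_left_mono) (auto simp: mult_left_le_one_le)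
        finally show ?thesis .
      qed
      have "norm (u (s + l) - u s) \<le> b * C * q ^ m * norm (s + l - s)"
        by (rule field_differentiable_bound[OF V(2) _ du V(6,5)]) (use holomorphic_derivI[OF u V(1)] has_field_derivative_at_within in blast)+
      then have "norm (u (s + l) - tm) \<le> norm l * (b * C * q ^ m)" using us by (simp add: mult_ac)
      moreover have "?R (Suc m) (u (s + l))" using ur[OF V(6)] Pu[OF V(6)] EpE[OF V(6)] As(2) Es(2) by (simp del: phi.simps)
      ultimately show "\<exists>t. (?R (Suc m) t \<and> (Suc m = 0 --> t = t0)) \<and> norm (t - tm) \<le> norm l * (b * C * q ^ m)" by blast
    qed
    then obtain g where g: "\<And>m. g m \<in> rhp r" "\<And>m. P (g m) = phi m a" "\<And>m. Ep (g m) = phi (n + m) x" "g 0 = t0"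
      and gd: "\<And>m. norm (g (Suc m) - g m) \<le> (norm l * b * C) * q ^ m" by (auto simp: mult_ac)
    have "summable (\<lambda>m. (norm l * b * C) * q ^ m)" using C by (intro summable_mult summable_geometric) auto
    then have sn: "summable (\<lambda>m. norm (g (Suc m) - g m))" by (rule summable_comparison_test'[where N = 0]) (use gd in simp)
    define t where "t = g 0 + (\<Sum>m. g (Suc m) - g m)"
    have "(\<lambda>m. \<Sum>i<m. g (Suc i) - g i) \<longlonglongrightarrow> (\<Sum>m. g (Suc m) - g m)" using summable_LIMSEQ[OF summable_norm_cancel[OF sn]] .
    then have "(\<lambda>m. g m - g 0) \<longlonglongrightarrow> (\<Sum>m. g (Suc m) - g m)" by (simp add: sum_lessThan_telescope)
    then have gt: "g \<longlonglongrightarrow> t" unfolding t_def using tendsto_add[OF tendsto_const[of "g 0"]] by fastforce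
    have "norm (t - t0) \<le> (\<Sum>m. norm (g (Suc m) - g m))" unfolding t_def g(4) using summable_norm[OF sn] by simp
    also have "\<dots> \<le> (\<Sum>m. (norm l * b * C) * q ^ m)" by (rule suminf_le[OF gd sn]) fact
    also have "\<dots> = (norm l * b * C) * (1 / (1 - q))" using C by (subst suminf_mult) (auto simp: suminf_geometric summable_geometric)
    finally have tb: "norm (t - t0) \<le> b * (norm l * C / (1 - q))" by (simp add: mult_ac)
    have aW: "Phi a \<in> W" using tame'(1)[OF Phi_clY[OF aK]] M2(2)[OF aK] M12(2) by linarith
    have "(\<lambda>m. psii (phi m a)) \<longlonglongrightarrow> psii (Phi a)"
      using holomorphic_on_imp_continuous_on[OF psi(2)] continuous_on_eq_continuous_at[OF W(1)] aW Phi_lim[OF aK] by (intro isCont_tendsto_compose[of "Phi a" psii]) auto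
    moreover have "(\<lambda>m. psii (phi m a)) = (\<lambda>m. exp (g m))" using P_in(2)[OF g(1)] g(2) by auto
    moreover have "(\<lambda>m. exp (g m)) \<longlonglongrightarrow> exp t" by (intro tendsto_intros gt)
    ultimately have et: "exp t = psii (Phi a)" using LIMSEQ_unique by metis
    then have tr: "t \<in> rhp r" using exp_rhp psii_in[OF aW] by metis
    have "continuous_on (rhp r) Ep" using Ep(1) holomorphic_on_imp_continuous_on by (auto simp: plift_def)
    then have "(\<lambda>m. Ep (g m)) \<longlonglongrightarrow> Ep t"
      using continuous_on_eq_continuous_at[OF rhp(1)] tr gt by (intro isCont_tendsto_compose[of t Ep]) auto
    moreover have "(\<lambda>m. Ep (g m)) \<longlonglongrightarrow> Phi x"
      using LIMSEQ_ignore_initial_segment[OF Phi_lim[OF x], of n] g(3) by (simp add: add.commute)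
    ultimately have "Ep t = Phi x" using LIMSEQ_unique by blast
    moreover have "P t = Phi a" using et psii_in[OF aW] by (simp add: P_def)
    ultimately show "\<exists>t\<in>rhp r. P t = Phi ((F ^^ n) x) \<and> Ep t = Phi x \<and> norm (t - t0) \<le> b * (norm l * C / (1 - q))"
      using tr tb by (auto simp: a_def)
  qed
qed

end

section \<open>Comparison of two points with the same image\<close>

context exterior
begin

text \<open>The two paths end over the same point, so their end points differ by a deck
  transformation \<open>d\<close>. After a shift by \<open>d\<close> the branches through
  \<open>phi n x\<close> and \<open>phi n x'\<close> agree at the common end point, where both have
  the value \<open>Phi x = Phi x'\<close>, and hence everywhere. Transported by \<open>j\<close>,
  this is the situation of \<open>inj_criterion\<close>, with the logarithms at distance at most
  \<open>2 * (b * C0) + 2 * c\<close>.\<close>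

lemma Phi_inj_tame:
  obtains M where "M \<ge> 0"
    "\<And>x x' C. x \<in> KK ==> x' \<in> KK ==> Phi x = Phi x' ==> C \<ge> 0 ==>
      (\<And>N. \<exists>n\<ge>N. \<exists>b\<ge>0. tame M ((F ^^ n) x) b \<and> tame M ((F ^^ n) x') b \<and>
        b \<le> C * ln (norm ((F ^^ n) x)) \<and> b \<le> C * ln (norm ((F ^^ n) x'))) ==> x = x'"
proof -
  obtain M0 C0 where C0: "C0 \<ge> 0" and
    path: "\<And>x n b t0 E. x \<in> KK ==> b \<ge> 0 ==> tame M0 ((F ^^ n) x) b ==> t0 \<in> rhp r ==> P t0 = (F ^^ n) x ==> plift n E ==> E t0 = phi n x ==>
      \<exists>t\<in>rhp r. P t = Phi ((F ^^ n) x) \<and> E t = Phi x \<and> norm (t - t0) \<le> b * C0"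
    by (rule path_limit) (rule that; assumption)
  have tame_mono: "tame M a b ==> M' \<le> M ==> tame M' a b" for M M' a b by (force simp: tame_def)
  show ?thesis
  proof (rule that[of "max M0 0"])
    fix x x' C
    assume x: "x \<in> KK" "x' \<in> KK" and eq: "Phi x = Phi x'" and C: "C \<ge> (0::real)"
      and ex: "\<And>N. \<exists>n\<ge>N. \<exists>b\<ge>0. tame (max M0 0) ((F ^^ n) x) b \<and> tame (max M0 0) ((F ^^ n) x') b \<and>
        b \<le> C * ln (norm ((F ^^ n) x)) \<and> b \<le> C * ln (norm ((F ^^ n) x'))"
    have "of_real (ln L + 1) \<in> rhp L" by (simp add: rhp_def)
    from j(5)[OF this] have c0: "0 \<le> c" by (rule order_trans[OF norm_ge_zero])
    show "x = x'"
    proof (rule inj_criterion[OF x, of "2 * C0 * C + 2 * c"])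
      show "0 \<le> 2 * C0 * C + 2 * c" using C C0 c0 by simp
      fix N
      obtain n b where n: "n \<ge> N" and b0: "b \<ge> 0" "tame (max M0 0) ((F ^^ n) x) b \<and> tame (max M0 0) ((F ^^ n) x') b \<and>
        b \<le> C * ln (norm ((F ^^ n) x)) \<and> b \<le> C * ln (norm ((F ^^ n) x'))"
        using ex[of N] by blast
      have b: "b \<ge> 0" "tame M0 ((F ^^ n) x) b" "tame M0 ((F ^^ n) x') b"
        "b \<le> C * ln (norm ((F ^^ n) x))" "b \<le> C * ln (norm ((F ^^ n) x'))"
        using b0 tame_mono[of "max M0 0" _ b M0] by auto
      define p where "p y = Ln ((F ^^ n) y)" for y
      have p: "p y \<in> rhp L" "exp (p y) = (F ^^ n) y" "Re (p y) = ln (norm ((F ^^ n) y))" "1 \<le> Re (p y)" if "y \<in> KK" for y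
      proof -
        have big: "L < norm ((F ^^ n) y)" using KK_funpow[OF that, of n] by (auto simp: KK_def dest: spec[of _ 0])
        then have nz: "(F ^^ n) y \<noteq> 0" using L(1) by auto
        show "p y \<in> rhp L" unfolding p_def by (rule Ln_in_rhp[OF _ big]) (use L(1) in simp)
        then have "ln L < Re (p y)" by (simp add: rhp_def)
        then show "1 \<le> Re (p y)" using Lbig pi_gt3 by linarith
        show "exp (p y) = (F ^^ n) y" "Re (p y) = ln (norm ((F ^^ n) y))" using nz by (simp_all add: p_def)
      qed
      have jr: "j s \<in> rhp r" "P (j s) = exp s" if "s \<in> rhp L" for s
        using exp_rhp[of "j s"] j(2)[OF that] psii_in[OF j(3)[OF that]] by (metis, simp add: P_def)
      have start: "\<exists>t E. t \<in> rhp r \<and> plift n E \<and> E (j (p y)) = phi n y \<and> P t = Phi ((F ^^ n) y) \<and> E t = Phi y \<and> norm (t - j (p y)) \<le> b * C0"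
        if y: "y \<in> KK" and tm: "tame M0 ((F ^^ n) y) b" for y
      proof -
        have Pj: "P (j (p y)) = (F ^^ n) y" using jr(2) p(1,2)[OF y] by simp
        obtain E where E: "plift n E" "E (j (p y)) = phi n y"
          using plift_exists[OF jr(1)[OF p(1)[OF y]], of n "phi n y"] phi_funpow[OF KK_Om[OF y], of n] Pj by auto
        show ?thesis using path[OF y b(1) tm jr(1)[OF p(1)[OF y]] Pj E] E by blast
      qed
      obtain t E where t: "t \<in> rhp r" "plift n E" "E (j (p x)) = phi n x" "P t = Phi ((F ^^ n) x)" "E t = Phi x" "norm (t - j (p x)) \<le> b * C0"
        using start[OF x(1) b(2)] by blast
      obtain t' E' where t': "t' \<in> rhp r" "plift n E'" "E' (j (p x')) = phi n x'" "P t' = Phi ((F ^^ n) x')" "E' t' = Phi x'" "norm (t' - j (p x')) \<le> b * C0"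
        using start[OF x(2) b(3)] by blast
      have "P t = P t'" using t(4) t'(4) Phi_funpow[OF x(1), of n] Phi_funpow[OF x(2), of n] eq by simp
      then obtain m :: int where m: "t' = t + of_int m * (2 * of_real pi * \<i>)" using P_eq[OF t(1) t'(1)] by blast
      define d where "d = of_int m * (2 * complex_of_real pi * \<i>)"
      define \<sigma>' where "\<sigma>' = p x' - d"
      have Rd: "Re d = 0" and ed: "exp d = 1" by (auto simp: d_def exp_eq_1)
      have dr: "u + d \<in> rhp v \<longleftrightarrow> u \<in> rhp v" for u v using Rd by (simp add: rhp_def)
      have \<sigma>': "\<sigma>' \<in> rhp L" "exp \<sigma>' = (F ^^ n) x'" "Re \<sigma>' = Re (p x')"
        using p(1,2)[OF x(2)] Rd ed dr[of \<sigma>' L] by (auto simp: \<sigma>'_def exp_diff)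
      have j\<sigma>': "j (p x') = j \<sigma>' + d" using j(4)[OF \<sigma>'(1), of m] by (simp add: \<sigma>'_def d_def)
      have E'': "plift n (\<lambda>u. E' (u + d))"
      proof -
        have "(E' \<circ> (\<lambda>u. u + d)) holomorphic_on rhp r"
          by (rule holomorphic_on_compose_gen[of _ _ _ "rhp r"]) (use t'(2) dr in \<open>auto simp: plift_def intro!: holomorphic_intros\<close>)
        moreover have "P (u + d) = P u" for u using ed by (simp add: P_def exp_add)
        ultimately show ?thesis using t'(2) dr by (simp add: plift_def o_def)
      qed
      have EE: "E u = E' (u + d)" if "u \<in> rhp r" for u
        by (rule plift_eq[OF t(2) E'' t(1) _ that]) (use t(5) t'(5) eq m in \<open>simp add: d_def\<close>)
      have "(E \<circ> j) holomorphic_on rhp L"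
        by (rule holomorphic_on_compose_gen[OF j(1)]) (use t(2) jr in \<open>auto simp: plift_def\<close>)
      then have lE: "lift n (E \<circ> j)" using t(2) jr by (simp add: lift_def plift_def)
      have "norm (j \<sigma>' - j (p x)) \<le> 2 * (b * C0)"
      proof -
        have e: "j \<sigma>' - j (p x) = (t - j (p x)) - (t' - j (p x'))" by (simp add: j\<sigma>' m d_def)
        show ?thesis unfolding e using norm_triangle_ineq4[of "t - j (p x)" "t' - j (p x')"] t(6) t'(6) by simp
      qed
      moreover have e: "\<sigma>' - p x = (j \<sigma>' - j (p x)) - (j \<sigma>' - \<sigma>') + (j (p x) - p x)" by simp
      ultimately have "norm (\<sigma>' - p x) \<le> 2 * (b * C0) + 2 * c"
        unfolding e using norm_triangle_ineq[of "(j \<sigma>' - j (p x)) - (j \<sigma>' - \<sigma>')" "j (p x) - p x"]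
          norm_triangle_ineq4[of "j \<sigma>' - j (p x)" "j \<sigma>' - \<sigma>'"] j(5)[OF \<sigma>'(1)] j(5)[OF p(1)[OF x(1)]] by linarith
      moreover have "2 * (b * C0) + 2 * c \<le> (2 * C0 * C + 2 * c) * R" if "b \<le> C * R" "1 \<le> R" for R
      proof -
        have "b * C0 \<le> (C * R) * C0" using that C0 by (intro mult_right_mono) auto
        moreover have "c * 1 \<le> c * R" using that c0 by (intro mult_left_mono) auto
        ultimately show ?thesis by (simp add: algebra_simps)
      qed
      ultimately have "norm (\<sigma>' - p x) \<le> (2 * C0 * C + 2 * c) * Re (p x)" "norm (\<sigma>' - p x) \<le> (2 * C0 * C + 2 * c) * Re \<sigma>'"
        using b(4,5) p(3,4)[OF x(1)] p(3,4)[OF x(2)] \<sigma>'(3) by (metis order_trans)+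
      moreover have "(E \<circ> j) \<sigma>' = phi n x'" using EE[OF jr(1)[OF \<sigma>'(1)]] t'(3) j\<sigma>' by simp
      ultimately show "\<exists>n\<ge>N. \<exists>\<sigma> \<sigma>' E. lift n E \<and> \<sigma> \<in> rhp L \<and> \<sigma>' \<in> rhp L \<and> exp \<sigma> = (F ^^ n) x \<and> exp \<sigma>' = (F ^^ n) x' \<and>
         E \<sigma> = phi n x \<and> E \<sigma>' = phi n x' \<and> norm (\<sigma>' - \<sigma>) \<le> (2 * C0 * C + 2 * c) * Re \<sigma> \<and> norm (\<sigma>' - \<sigma>) \<le> (2 * C0 * C + 2 * c) * Re \<sigma>'"
        using n lE p(1,2)[OF x(1)] \<sigma>' t(3) by (intro exI[of _ n] conjI exI[of _ "p x"] exI[of _ \<sigma>'] exI[of _ "E \<circ> j"]) simp_all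
    qed
  qed simp
qed

lemma escaping_theta_large:
  assumes "x \<in> escaping_set F" shows "\<forall>\<^sub>F n in sequentially. R < theta ((F ^^ n) x)"
proof -
  have "filterlim (\<lambda>n. (F ^^ n) x) at_infinity sequentially" using assms by (simp add: escaping_set_def)
  then have "\<forall>\<^sub>F n in sequentially. exp (exp R) + 1 \<le> norm ((F ^^ n) x)"
    unfolding filterlim_at_infinity[OF order_refl] using add_pos_pos[OF exp_gt_zero zero_less_one] by blast
  then show ?thesis
  proof eventually_elim
    case (elim n)
    then show ?case using theta_le_imp_norm_le[of "(F ^^ n) x" R] by force
  qed
qed

end

context model
begin

lemma exterior_id: "exterior f PF Q nu R0 L \<epsilon> k L 0 {z. L < norm z} (\<lambda>z. z) (\<lambda>z. z) (\<lambda>z. z)"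
proof
  show "open {z::complex. L < norm z}" by (intro open_Collect_less continuous_intros)
  show "{z. L < norm z} \<inter> (PF \<union> Q) = {}" using L(3) by fastforce
  show "exp s \<in> {z. L < norm z}" if "s \<in> rhp L" for s using exp_in_rhp[of L s] that L(1) by simp
qed (use L(1) in \<open>auto intro: holomorphic_intros\<close>)

text \<open>With the identity for \<open>psii\<close>, \<open>tame\<close> demands
  \<open>wt z \<le> b * norm z\<close> outside \<open>cball 0 L\<close>. So \<open>b\<close> grows
  like \<open>ln (norm a)\<close>, which is the growth that \<open>Phi_inj_tame\<close>
  tolerates.\<close>

lemma Phi_inj_escaping:
  assumes x: "x \<in> KK" "x' \<in> KK" and eq: "Phi x = Phi x'" and esc: "x \<in> escaping_set F"
  shows "x = x'"
proof -
  interpret X: exterior f PF Q nu R0 L \<epsilon> k L 0 "{z. L < norm z}" "\<lambda>z. z" "\<lambda>z. z" "\<lambda>z. z" by (rule exterior_id)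
  obtain M where M: "M \<ge> 0" and inj: "\<And>C. C \<ge> 0 ==>
      (\<And>N. \<exists>n\<ge>N. \<exists>b\<ge>0. X.tame M ((F ^^ n) x) b \<and> X.tame M ((F ^^ n) x') b \<and>
        b \<le> C * ln (norm ((F ^^ n) x)) \<and> b \<le> C * ln (norm ((F ^^ n) x'))) ==> x = x'"
    by (rule X.Phi_inj_tame) (use x eq in blast)
  obtain M1 where M1: "\<And>y. y \<in> KK ==> \<bar>theta (Phi y) - theta y\<bar> \<le> M1" using Phi_theta by blast
  have tame: "X.tame M a b" if a: "theta (of_real L) + M < theta a" "2 * exp (theta a + M) \<le> b" for a b
    unfolding X.tame_def
  proof (intro ballI impI)
    fix z assume z: "\<bar>theta z - theta a\<bar> \<le> M"
    have zL: "L < norm z"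
    proof (rule ccontr)
      assume "\<not> L < norm z"
      then have "theta z \<le> theta (of_real L)" by (intro norm_le_imp_theta_le) simp
      then show False using z a(1) by linarith
    qed
    have "ln (9 + (norm z)\<^sup>2) = exp (theta z)" using ln9_gt_1[of "norm z"] by (simp add: theta_def)
    then have "wt z = (1 + norm z) * exp (theta z)" by (simp add: wt_def)
    also have "\<dots> \<le> (2 * norm z) * exp (theta a + M)" using zL L(1) z by (intro mult_mono) auto
    also have "\<dots> = (2 * exp (theta a + M)) * norm z" by simp
    also have "\<dots> \<le> b * norm z" using a(2) by (intro mult_right_mono) auto
    finally show "z \<in> {z. L < norm z} \<and> norm (deriv (\<lambda>z. z) z) * wt z \<le> b * norm z" using zL by simp
  qed
  \<comment> \<open>\<open>6 = 2 * 3\<close>: the 2 comes from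
    \<open>1 + norm z \<le> 2 * norm z\<close>, the 3 from
    \<open>9 + (norm a)\<^sup>2 \<le> norm a ^ 3\<close>.\<close>
  define C where "C = 6 * exp (2 * M1 + M)"
  have lg: "2 * exp (theta a + 2 * M1 + M) \<le> C * ln (norm a)" if "L < norm a" for a
  proof -
    have "exp 3 \<le> exp (ln L)" using Lbig pi_gt3 by simp
    then have "exp 3 \<le> L" using L(1) by simp
    moreover have "(4::real) \<le> exp 3" using exp_ge_add_one_self[of 3] by simp
    ultimately have a4: "4 \<le> norm a" using that by linarith
    have "9 + (norm a)\<^sup>2 \<le> (norm a) ^ 2 * 4"
      using power_mono[OF a4, of 2] by simp
    also have "\<dots> \<le> (norm a) ^ 2 * norm a" using a4 by (intro mult_left_mono) auto
    finally have "9 + (norm a)\<^sup>2 \<le> (norm a) ^ 3" by (simp add: power3_eq_cube power2_eq_square)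
    then have "ln (9 + (norm a)\<^sup>2) \<le> ln ((norm a) ^ 3)" by (intro ln_mono) (auto simp: add_pos_nonneg)
    also have "\<dots> = 3 * ln (norm a)" using a4 by (subst ln_realpow) auto
    finally have "exp (theta a) \<le> 3 * ln (norm a)" using ln9_gt_1[of "norm a"] by (simp add: theta_def)
    then have "exp (theta a) * exp (2 * M1 + M) \<le> 3 * ln (norm a) * exp (2 * M1 + M)" by (intro mult_right_mono) auto
    then show ?thesis by (simp add: C_def exp_add mult_ac)
  qed
  show ?thesis
  proof (rule inj[of C])
    show "0 \<le> C" by (simp add: C_def)
    fix N
    have "\<forall>\<^sub>F n in sequentially. theta (of_real L) + M + 2 * M1 < theta ((F ^^ n) x) \<and> n \<ge> N"
      using X.escaping_theta_large[OF esc] eventually_ge_at_top by (rule eventually_conj)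
    then obtain n where n: "theta (of_real L) + M + 2 * M1 < theta ((F ^^ n) x)" "n \<ge> N"
      using eventually_happens' sequentially_bot by blast
    define a a' where "a = (F ^^ n) x" and "a' = (F ^^ n) x'"
    have aK: "a \<in> KK" "a' \<in> KK" using KK_funpow x by (auto simp: a_def a'_def)
    have "Phi a = Phi a'" using Phi_funpow[OF x(1), of n] Phi_funpow[OF x(2), of n] eq by (simp add: a_def a'_def)
    then have th: "theta a' \<le> theta a + 2 * M1" "theta a \<le> theta a' + 2 * M1"
      using M1[OF aK(1)] M1[OF aK(2)] by (auto simp: abs_le_iff)
    have M10: "0 \<le> M1" using M1[OF aK(1)] by linarith
    have aL: "L < norm a" "L < norm a'" using aK by (auto simp: KK_def dest: spec[of _ 0])
    define b where "b = 2 * exp (max (theta a) (theta a') + M)"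
    have "b \<le> 2 * exp (theta a + 2 * M1 + M)" "b \<le> 2 * exp (theta a' + 2 * M1 + M)"
      using th M10 by (auto simp: b_def)
    then have "b \<le> C * ln (norm a)" "b \<le> C * ln (norm a')" using lg[OF aL(1)] lg[OF aL(2)] by linarith+
    moreover have "X.tame M a b" by (rule tame) (use n(1) M10 in \<open>auto simp: b_def a_def\<close>)
    moreover have "X.tame M a' b" by (rule tame) (use n(1) th M10 in \<open>auto simp: b_def a_def\<close>)
    moreover have "0 \<le> b" by (simp add: b_def)
    ultimately show "\<exists>n\<ge>N. \<exists>b\<ge>0. X.tame M ((F ^^ n) x) b \<and> X.tame M ((F ^^ n) x') b \<and>
        b \<le> C * ln (norm ((F ^^ n) x)) \<and> b \<le> C * ln (norm ((F ^^ n) x'))" using n(2) unfolding a_def a'_def by blast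
  qed
qed

end

context exterior
begin

text \<open>A nonescaping orbit returns to a bounded set infinitely often, and on the compact set
  \<open>closure Y \<inter> cball 0 R\<close> the logarithmic derivative of \<open>psii\<close> is
  bounded. So one \<open>b\<close> serves for all return times.\<close>

lemma Phi_inj:
  assumes YW: "closure Y \<subseteq> W" and x: "x \<in> KK" "x' \<in> KK" and eq: "Phi x = Phi x'"
  shows "x = x'"
proof (cases "x \<in> escaping_set F")
  case True then show ?thesis using Phi_inj_escaping[OF x eq] by blast
next
  case False
  obtain M where M: "M \<ge> 0" and inj: "\<And>C. C \<ge> 0 ==>
      (\<And>N. \<exists>n\<ge>N. \<exists>b\<ge>0. tame M ((F ^^ n) x) b \<and> tame M ((F ^^ n) x') b \<and>
        b \<le> C * ln (norm ((F ^^ n) x)) \<and> b \<le> C * ln (norm ((F ^^ n) x'))) ==> x = x'"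
    by (rule Phi_inj_tame) (use x eq in blast)
  obtain M1 where M1: "\<And>y. y \<in> KK ==> \<bar>theta (Phi y) - theta y\<bar> \<le> M1" using Phi_theta by blast
  obtain B where B: "\<And>N. \<exists>n\<ge>N. norm ((F ^^ n) x) < B"
    using False unfolding escaping_set_def mem_Collect_eq filterlim_at_infinity[OF order_refl] eventually_sequentially by (auto simp: not_le)
  define R where "R = exp (exp (theta (of_real B) + 2 * M1 + M))"
  let ?G = "\<lambda>z. deriv psii z * of_real (wt z) / psii z"
  have "continuous_on (closure Y \<inter> cball 0 R) ?G"
  proof -
    have "psii z \<noteq> 0" if "z \<in> W" for z using psii_in[OF that] r by auto
    moreover have "9 + (norm z)\<^sup>2 \<noteq> 0" for z :: complex using zero_le_power2[of "norm z"] by linarith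
    ultimately
    have "continuous_on W ?G" unfolding wt_def
      using W(1) psi(2)
      by (intro continuous_intros holomorphic_on_imp_continuous_on holomorphic_deriv) auto
    then show ?thesis using YW continuous_on_subset by blast
  qed
  then have "compact (?G ` (closure Y \<inter> cball 0 R))" by (intro compact_continuous_image closed_Int_compact) auto
  then have "bounded (?G ` (closure Y \<inter> cball 0 R))" by (rule compact_imp_bounded)
  then obtain b where b: "b > 0" "\<And>z. z \<in> closure Y \<inter> cball 0 R ==> norm (?G z) \<le> b"
    unfolding bounded_pos by blast
  have tame: "tame M a b" if a: "theta a \<le> theta (of_real B) + 2 * M1" for a
    unfolding tame_def
  proof (intro ballI impI conjI)
    fix z assume z: "z \<in> closure Y" "\<bar>theta z - theta a\<bar> \<le> M"
    show zW: "z \<in> W" using z YW by blast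
    have "norm z \<le> R" unfolding R_def by (rule theta_le_imp_norm_le) (use z a in linarith)
    then have "norm (?G z) \<le> b" using b(2) z(1) by simp
    then show "norm (deriv psii z) * wt z \<le> b * norm (psii z)"
      using psii_in[OF zW] r less_imp_le[OF wt_pos[of z]] by (simp add: norm_mult norm_divide divide_le_eq split: if_splits)
  qed
  show ?thesis
  proof (rule inj[of b])
    fix N
    obtain n where n: "n \<ge> N" "norm ((F ^^ n) x) < B" using B by blast
    define a a' where "a = (F ^^ n) x" and "a' = (F ^^ n) x'"
    have aK: "a \<in> KK" "a' \<in> KK" using KK_funpow x by (auto simp: a_def a'_def)
    have "Phi a = Phi a'" using Phi_funpow[OF x(1), of n] Phi_funpow[OF x(2), of n] eq by (simp add: a_def a'_def)
    then have th: "theta a' \<le> theta a + 2 * M1" "0 \<le> M1"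
      using M1[OF aK(1)] M1[OF aK(2)] by (auto simp: abs_le_iff)
    have "theta a \<le> theta (of_real B)" using n by (intro norm_le_imp_theta_le) (simp add: a_def)
    then have "tame M a b" "tame M a' b" using th by (auto intro!: tame)
    moreover have "b \<le> b * ln (norm a)" if "a \<in> KK" for a
    proof -
      have "L < norm a" using that by (auto simp: KK_def dest: spec[of _ 0])
      then have "ln L \<le> ln (norm a)" using L(1) by (intro ln_mono) linarith+
      then have "1 \<le> ln (norm a)" using Lbig pi_gt3 by linarith
      then show ?thesis using b(1) by simp
    qed
    ultimately show "\<exists>n\<ge>N. \<exists>b'\<ge>0. tame M ((F ^^ n) x) b' \<and> tame M ((F ^^ n) x') b' \<and>
        b' \<le> b * ln (norm ((F ^^ n) x)) \<and> b' \<le> b * ln (norm ((F ^^ n) x'))"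
      using n(1) b(1) aK unfolding a_def a'_def by (meson less_imp_le)
  qed (use b(1) in simp)
qed

end

section \<open>Exterior uniformization of a continuum\<close>

text \<open>The number of times a loop in the inverted exterior of a full continuum \<open>K0\<close> winds around
  \<open>1 / (z - k0)\<close> is locally constant in \<open>z \<in> K0\<close>, and it vanishes for \<open>z\<close> close to \<open>k0\<close>.\<close>

lemma inverted_exterior_simply_connected:
  fixes K :: "complex set"
  assumes K: "compact K" "connected K" "k0 \<in> K"
  defines "D \<equiv> {w. w = 0 \<or> k0 + 1 / w \<in> outside K}"
  shows "open D" "simply_connected D"
proof -
  define W where "W = outside K"
  have "k0 \<notin> W" using K(3) outside_no_overlap[of K] unfolding W_def by blast
  then have W: "open W" "connected W" "k0 \<notin> W"
    using open_outside[OF compact_imp_closed[OF K(1)]] connected_outside[OF compact_imp_bounded[OF K(1)]] by (auto simp: W_def)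
  have "bounded (- W)" unfolding W_def by (rule cobounded_outside[OF compact_imp_bounded[OF K(1)]])
  then obtain B0 where B0: "\<And>z. z \<notin> W ==> norm z \<le> B0" unfolding bounded_iff by auto
  define B where "B = \<bar>B0\<bar> + norm k0 + 1"
  have B: "B > 0" "\<And>z. norm (z - k0) \<ge> B ==> z \<in> W"
  proof -
    show "z \<in> W" if "norm (z - k0) \<ge> B" for z
      using B0[of z] that norm_triangle_ineq4[of z k0] by (force simp: B_def)
  qed (simp add: B_def add_nonneg_pos)
  have D_eq: "D = (\<lambda>z. 1 / (z - k0)) ` W \<union> {0}"
  proof
    show "D \<subseteq> (\<lambda>z. 1 / (z - k0)) ` W \<union> {0}"
    proof
      fix w assume w: "w \<in> D"
      show "w \<in> (\<lambda>z. 1 / (z - k0)) ` W \<union> {0}"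
      proof (cases "w = 0")
        case False
        then show ?thesis using w by (intro UnI1 image_eqI[of _ _ "k0 + 1 / w"]) (auto simp: D_def W_def)
      qed simp
    qed
  qed (auto simp: D_def W_def)
  have ball0: "ball 0 (1 / B) \<subseteq> D"
  proof
    fix w :: complex assume w: "w \<in> ball 0 (1 / B)"
    show "w \<in> D"
    proof (cases "w = 0")
      case False
      then have "norm (k0 + 1 / w - k0) \<ge> B" using w B(1) by (simp add: norm_divide divide_simps mult_ac)
      then show ?thesis using B(2) by (simp add: D_def W_def)
    qed (simp add: D_def)
  qed
  have "open (- {0} \<inter> (\<lambda>w. k0 + 1 / w) -` W)"
    by (rule continuous_open_preimage) (use W(1) in \<open>auto intro!: continuous_intros\<close>)
  moreover have "D = (- {0} \<inter> (\<lambda>w. k0 + 1 / w) -` W) \<union> ball 0 (1 / B)" using ball0 B(1) by (auto simp: D_def W_def)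
  ultimately show oD: "open D" by (metis open_Un open_ball)
  have "connected ((\<lambda>z. 1 / (z - k0)) ` W)" using W by (intro connected_continuous_image continuous_intros) auto
  moreover have "0 \<in> closure ((\<lambda>z. 1 / (z - k0)) ` W)"
    unfolding closure_approachable
  proof (intro allI impI)
    fix e :: real assume e: "e > 0"
    define R where "R = B + 1 / e"
    have R: "R > 0" "R \<ge> B" "1 / R < e" using B(1) e by (auto simp: R_def field_simps add_pos_pos)
    have "k0 + of_real R \<in> W" using B(2)[of "k0 + of_real R"] R by simp
    moreover have "dist (1 / (k0 + of_real R - k0)) 0 < e" using R by (simp add: norm_divide)
    ultimately show "\<exists>y\<in>(\<lambda>z. 1 / (z - k0)) ` W. dist y 0 < e" by blast
  qed
  ultimately have conD: "connected D"
    by (intro connected_intermediate_closure[of "(\<lambda>z. 1 / (z - k0)) ` W" D]) (auto simp: D_eq intro: subsetD[OF closure_subset])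
  have "winding_number g w = 0" if g: "path g" "path_image g \<subseteq> D" "pathfinish g = pathstart g" and w: "w \<notin> D" for g w
  proof -
    define K0 where "K0 = - W"
    have K0: "connected K0" "k0 \<in> K0"
      using connected_with_inside[OF compact_imp_closed[OF K(1)] K(2)] W(3) by (auto simp: K0_def W_def union_with_inside)
    obtain A where A: "\<And>z. A \<le> norm z ==> winding_number g z = 0" using winding_number_zero_at_infinity[OF g(1,3)] by blast
    define T where "T v = {z. z \<notin> path_image g \<and> winding_number g z = v}" for v
    have oT: "open (T v)" for v unfolding T_def by (rule open_winding_number_levelsets[OF g(1,3)])
    have pre: "open (- {k0} \<inter> (\<lambda>z. 1 / (z - k0)) -` S)" if "open S" for S
      by (rule continuous_open_preimage) (use that in \<open>auto intro!: continuous_intros\<close>)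
    define U1 where "U1 = - {k0} \<inter> (\<lambda>z. 1 / (z - k0)) -` (\<Union>v\<in>- {0}. T v)"
    define U0 where "U0 = (- {k0} \<inter> (\<lambda>z. 1 / (z - k0)) -` T 0) \<union> ball k0 (1 / (\<bar>A\<bar> + 1))"
    have o: "open U1" "open U0" unfolding U1_def U0_def using oT by (auto intro!: pre open_Un)
    have notin: "1 / (z - k0) \<notin> path_image g" if "z \<in> K0" "z \<noteq> k0" for z
      using g(2) that by (auto simp: D_def K0_def W_def)
    have "U0 \<inter> K0 = {} \<or> U1 \<inter> K0 = {}"
    proof (rule connectedD[OF K0(1) o(2,1)])
      have "k0 \<in> U0" by (simp add: U0_def)
      then have "z \<in> U0 \<union> U1" if "z \<in> K0" for z using notin[OF that] by (cases "z = k0") (auto simp: U0_def U1_def T_def)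
      then show "K0 \<subseteq> U0 \<union> U1" by blast
      have "winding_number g (1 / (z - k0)) = 0" if "z \<in> ball k0 (1 / (\<bar>A\<bar> + 1))" "z \<noteq> k0" for z
      proof (rule A)
        have p: "0 < norm (z - k0)" using that by simp
        have "norm (z - k0) * (\<bar>A\<bar> + 1) < 1" using that by (simp add: dist_norm norm_minus_commute less_divide_eq)
        then have "\<bar>A\<bar> + 1 < 1 / norm (z - k0)" using p by (simp add: less_divide_eq mult.commute)
        then show "A \<le> norm (1 / (z - k0))" by (simp add: norm_divide)
      qed
      then show "U0 \<inter> U1 \<inter> K0 = {}" by (auto simp: U0_def U1_def T_def)
    qed
    moreover have "k0 \<in> U0 \<inter> K0" using K0(2) by (simp add: U0_def)
    ultimately have U1: "U1 \<inter> K0 = {}" by blast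
    have w': "w \<noteq> 0" "k0 + 1 / w \<in> K0" using w by (auto simp: D_def K0_def W_def)
    show ?thesis
    proof (rule ccontr)
      assume "winding_number g w \<noteq> 0"
      then have "k0 + 1 / w \<in> U1" using w' g(2) w by (auto simp: U1_def T_def)
      then show False using U1 w' by blast
    qed
  qed
  then show "simply_connected D" using simply_connected_eq_winding_number_zero[OF oD] conD by blast
qed

text \<open>With the Riemann map \<open>R\<close> of the inverted exterior, normalised by
  \<open>R 0 = 0\<close>, \<open>psii z = 1 / R (1 / (z - k0))\<close> is asymptotically linear at
  infinity, so a logarithm of it differs from the logarithm of \<open>z\<close> by a bounded
  function. The second point \<open>k1\<close> keeps the inverted exterior different from the
  plane.\<close>

lemma exterior_uniformization:
  assumes K: "compact K" "connected K" "k0 \<in> K" "k1 \<in> K" "k0 \<noteq> k1" "K \<subseteq> ball 0 L"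
  obtains psi psii j c where "psi holomorphic_on {u. 1 < norm u}" "psii holomorphic_on outside K"
    "\<And>u. 1 < norm u ==> psi u \<in> outside K \<and> psii (psi u) = u" "\<And>z. z \<in> outside K ==> 1 < norm (psii z) \<and> psi (psii z) = z"
    "j holomorphic_on rhp L" "\<And>s. s \<in> rhp L ==> exp (j s) = psii (exp s)" "\<And>s. s \<in> rhp L ==> exp s \<in> outside K"
    "\<And>s (m::int). s \<in> rhp L ==> j (s + of_int m * (2 * of_real pi * \<i>)) = j s + of_int m * (2 * of_real pi * \<i>)"
    "\<And>s. s \<in> rhp L ==> norm (j s - s) \<le> c"
proof -
  define W where "W = outside K"
  define D where "D = {w. w = 0 \<or> k0 + 1 / w \<in> W}"
  have D: "open D" "simply_connected D" using inverted_exterior_simply_connected[OF K(1-3)] by (auto simp: D_def W_def)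
  have KW: "K \<inter> W = {}" using outside_no_overlap[of K] unfolding W_def by blast
  have D0: "0 \<in> D" by (simp add: D_def)
  have "1 / (k1 - k0) \<notin> D" using K(4,5) KW by (auto simp: D_def)
  then have "D \<noteq> {}" "D \<noteq> UNIV" using D0 by auto
  then obtain R0 G0 where R0: "R0 holomorphic_on D" "G0 holomorphic_on ball 0 1" "\<And>z. z \<in> D ==> R0 z \<in> ball 0 1 \<and> G0 (R0 z) = z"
    "\<And>z. z \<in> ball 0 1 ==> G0 z \<in> D \<and> R0 (G0 z) = z"
    using D Riemann_mapping_theorem[of D] by blast
  have "R0 0 \<in> ball 0 1" using R0(3) D0 by blast
  from ball_biholomorphism_exists[OF this] obtain m mi where m: "m (R0 0) = 0" "m holomorphic_on ball 0 1" "m ` ball 0 1 \<subseteq> ball 0 1"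
    "mi holomorphic_on ball 0 1" "mi ` ball 0 1 \<subseteq> ball 0 1" "\<And>z. z \<in> ball 0 1 ==> m (mi z) = z" "\<And>z. z \<in> ball 0 1 ==> mi (m z) = z"
    by blast
  define R G where "R = m \<circ> R0" and "G = G0 \<circ> mi"
  have R: "R holomorphic_on D" "G holomorphic_on ball 0 1" "\<And>z. z \<in> D ==> R z \<in> ball 0 1 \<and> G (R z) = z"
    "\<And>z. z \<in> ball 0 1 ==> G z \<in> D \<and> R (G z) = z" "R 0 = 0"
  proof -
    show "R holomorphic_on D" unfolding R_def by (rule holomorphic_on_compose_gen[OF R0(1) m(2)]) (use R0(3) in auto)
    show "G holomorphic_on ball 0 1" unfolding G_def by (rule holomorphic_on_compose_gen[OF m(4) R0(2)]) (use m(5) in auto)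
    have mb: "m z \<in> ball 0 1" "mi z \<in> ball 0 1" if "z \<in> ball 0 1" for z using m(3,5) that by blast+
    show "R z \<in> ball 0 1 \<and> G (R z) = z" if "z \<in> D" for z
      using mb(1)[of "R0 z"] R0(3)[OF that] m(7)[of "R0 z"] by (simp add: R_def G_def)
    show "G z \<in> D \<and> R (G z) = z" if "z \<in> ball 0 1" for z
      using mb(2)[OF that] R0(4)[of "mi z"] m(6)[OF that] by (simp add: R_def G_def)
    show "R 0 = 0" using m(1) by (simp add: R_def)
  qed
  have G0: "G 0 = 0" using R(3)[OF D0] R(5) by simp
  have Rnz: "R w \<noteq> 0" if "w \<in> D" "w \<noteq> 0" for w using R(3)[OF that(1)] G0 that(2) by auto
  have Gnz: "G w \<noteq> 0" if "w \<in> ball 0 1" "w \<noteq> 0" for w using R(4)[OF that(1)] R(5) that(2) by auto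
  define iv where "iv z = 1 / (z - k0)" for z
  have ivD: "iv z \<in> D" "iv z \<noteq> 0" if "z \<in> W" for z
  proof -
    have "z \<noteq> k0" using that KW K(3) by auto
    then show "iv z \<in> D" "iv z \<noteq> 0" using that by (auto simp: iv_def D_def)
  qed
  define psi psii where "psi u = k0 + 1 / G (1 / u)" and "psii z = 1 / R (iv z)" for u z
  have u1: "1 / u \<in> ball 0 1" "1 / u \<noteq> 0" if "1 < norm u" for u :: complex
  proof -
    have "u \<noteq> 0" using that by auto
    then show "1 / u \<in> ball 0 1" "1 / u \<noteq> 0" using that by (auto simp: norm_divide)
  qed
  have 1: "psi holomorphic_on {u. 1 < norm u}"
  proof -
    have "(G \<circ> (\<lambda>u. 1 / u)) holomorphic_on {u. 1 < norm u}"
      by (rule holomorphic_on_compose_gen[OF _ R(2)]) (use u1 in \<open>auto intro!: holomorphic_intros\<close>)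
    then have "(\<lambda>u. G (1 / u)) holomorphic_on {u. 1 < norm u}" by (simp add: o_def)
    from holomorphic_on_divide[OF holomorphic_on_const[of 1] this]
    have "(\<lambda>u. 1 / G (1 / u)) holomorphic_on {u. 1 < norm u}" using Gnz u1 by blast
    then show ?thesis unfolding psi_def by (intro holomorphic_on_add holomorphic_on_const)
  qed
  have iv: "iv holomorphic_on W" unfolding iv_def using KW K(3) by (intro holomorphic_intros) auto
  have 2: "psii holomorphic_on W"
  proof -
    have "(R \<circ> iv) holomorphic_on W" by (rule holomorphic_on_compose_gen[OF iv R(1)]) (use ivD in auto)
    then have "(\<lambda>z. R (iv z)) holomorphic_on W" by (simp add: o_def)
    from holomorphic_on_divide[OF holomorphic_on_const[of 1] this]
    show ?thesis unfolding psii_def using Rnz ivD by blast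
  qed
  have 3: "psi u \<in> W \<and> psii (psi u) = u" if "1 < norm u" for u
  proof -
    have g: "G (1 / u) \<in> D" "R (G (1 / u)) = 1 / u" "G (1 / u) \<noteq> 0" using R(4)[OF u1(1)[OF that]] Gnz[OF u1[OF that]] by auto
    then have "psi u \<in> W" by (auto simp: D_def psi_def)
    moreover have "iv (psi u) = G (1 / u)" using g(3) by (simp add: iv_def psi_def)
    ultimately show ?thesis using g(2) by (simp add: psii_def)
  qed
  have 4: "1 < norm (psii z) \<and> psi (psii z) = z" if "z \<in> W" for z
  proof -
    have r: "R (iv z) \<in> ball 0 1" "G (R (iv z)) = iv z" "R (iv z) \<noteq> 0" using R(3)[OF ivD(1)[OF that]] Rnz[OF ivD[OF that]] by auto
    moreover have "k0 + 1 / iv z = z" by (simp add: iv_def)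
    ultimately show ?thesis by (simp add: psii_def psi_def norm_divide less_divide_eq)
  qed
  \<comment> \<open>\<open>R w / w\<close> with its singularity removed; it has no zeros and hence a
    logarithm on the simply connected \<open>D\<close>.\<close>
  define q where "q w = (if w = 0 then deriv R 0 else (R w - R 0) / (w - 0))" for w
  have q: "q holomorphic_on D" unfolding q_def using pole_lemma[OF R(1), of 0] D(1) D0 by (simp add: interior_open)
  have "q w \<noteq> 0" if "w \<in> D" for w
  proof (cases "w = 0")
    case True
    have "((G \<circ> R) has_field_derivative deriv G (R 0) * deriv R 0) (at 0)"
      by (rule DERIV_chain[OF holomorphic_derivI[OF R(2)] holomorphic_derivI[OF R(1) D(1) D0]]) (auto simp: R(5))
    moreover have "((G \<circ> R) has_field_derivative 1) (at 0)"
      by (rule has_field_derivative_transform_within_open[OF DERIV_ident D(1) D0]) (use R(3) in simp)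
    ultimately have "deriv G (R 0) * deriv R 0 = 1" by (rule DERIV_unique)
    then show ?thesis using True by (auto simp: q_def)
  next
    case False then show ?thesis using Rnz[OF that] R(5) by (simp add: q_def)
  qed
  then obtain h where h: "h holomorphic_on D" "\<And>w. w \<in> D ==> q w = exp (h w)"
    using simply_connected_eq_holomorphic_log[OF D(1)] D(2) q by metis
  define H where "H w = Ln (1 + k0 * w) + h w" for w
  \<comment> \<open>Inversion of \<open>{z. L \<le> norm z}\<close> together with 0: for
    \<open>w \<noteq> 0\<close> the condition says \<open>L \<le> norm (k0 + 1 / w)\<close>. The set
    is compact because \<open>norm k0 < L\<close>, so \<open>H\<close> is bounded on it.\<close>
  define S where "S = {w. L * norm w \<le> norm (1 + k0 * w)}"
  have k0L: "norm k0 < L" using K(3,6) by auto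
  then have L0: "0 < L" using norm_ge_zero[of k0] by linarith
  have far: "z \<in> W" if "L \<le> norm z" for z
  proof -
    have "- ball 0 L \<subseteq> W" unfolding W_def by (rule outside_subset_convex[OF convex_ball K(6)])
    then show ?thesis using that by auto
  qed
  have SD: "w \<in> D" "1 + k0 * w \<notin> \<real>\<^sub>\<le>\<^sub>0" if "w \<in> S" for w
  proof -
    have wS: "L * norm w \<le> norm (1 + k0 * w)" using that by (simp add: S_def)
    have nz: "1 + k0 * w \<noteq> 0" using wS L0 by (cases "w = 0") (auto simp: mult_le_0_iff)
    show "w \<in> D"
    proof (cases "w = 0")
      case False
      have "k0 + 1 / w = (1 + k0 * w) / w" using False by (simp add: field_simps)
      then have "L \<le> norm (k0 + 1 / w)" using wS False by (simp add: norm_divide le_divide_eq)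
      then show ?thesis using far by (simp add: D_def)
    qed (simp add: D0)
    show "1 + k0 * w \<notin> \<real>\<^sub>\<le>\<^sub>0"
    proof
      assume "1 + k0 * w \<in> \<real>\<^sub>\<le>\<^sub>0"
      then obtain x where x: "1 + k0 * w = of_real x" "x \<le> 0" by (auto elim!: nonpos_Reals_cases)
      then have "k0 * w = of_real (x - 1)" by (simp add: eq_diff_eq add.commute)
      then have "norm (k0 * w) = 1 - x" using x(2) by (simp only: norm_of_real)
      moreover have "norm k0 * norm w \<le> L * norm w" using k0L by (intro mult_right_mono) auto
      ultimately show False using wS x by (simp add: norm_mult)
    qed
  qed
  have "closed S" unfolding S_def by (intro closed_Collect_le continuous_intros)
  moreover have "bounded S"
    unfolding bounded_iff
  proof (intro exI ballI)
    fix w assume "w \<in> S"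
    then have "L * norm w \<le> 1 + norm k0 * norm w" using norm_triangle_ineq[of 1 "k0 * w"] by (simp add: S_def norm_mult)
    then have "norm w * (L - norm k0) \<le> 1" by (simp add: algebra_simps)
    then show "norm w \<le> 1 / (L - norm k0)" using k0L by (simp add: le_divide_eq)
  qed
  ultimately have cS: "compact S" by (simp add: compact_eq_bounded_closed)
  have HS: "continuous_on S H" unfolding H_def
    using SD by (intro continuous_intros continuous_on_subset[OF holomorphic_on_imp_continuous_on[OF h(1)]]) auto
  have "bounded (H ` S)" by (rule compact_imp_bounded[OF compact_continuous_image[OF HS cS]])
  then obtain c where c: "\<And>w. w \<in> S ==> norm (H w) \<le> c" unfolding bounded_iff by blast
  have s: "L < norm (exp s)" "iv (exp s) \<in> S" "1 + k0 * iv (exp s) = exp s / (exp s - k0)" "exp s \<in> W" if "s \<in> rhp L" for s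
  proof -
    show 1: "L < norm (exp s)" using exp_in_rhp[OF L0] that by simp
    have ne: "exp s \<noteq> k0" using 1 k0L by auto
    then show 2: "1 + k0 * iv (exp s) = exp s / (exp s - k0)" by (simp add: iv_def field_simps)
    have "L / norm (exp s - k0) \<le> norm (exp s) / norm (exp s - k0)" using 1 by (intro divide_right_mono) auto
    then show "iv (exp s) \<in> S" unfolding S_def mem_Collect_eq 2 by (simp add: iv_def norm_divide)
    show "exp s \<in> W" using far 1 by simp
  qed
  \<comment> \<open>For \<open>w = iv (exp s)\<close>, \<open>exp (H w)\<close> equals
    \<open>exp s * R w\<close>; dividing \<open>exp s\<close> by it leaves \<open>1 / R w\<close>,
    which is \<open>psii (exp s)\<close>.\<close>
  define j where "j s = s - H (iv (exp s))" for s
  have 5: "j holomorphic_on rhp L"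
  proof -
    have "(iv \<circ> exp) holomorphic_on rhp L"
      by (rule holomorphic_on_compose_gen[OF _ iv]) (use s(4) in \<open>auto intro!: holomorphic_intros\<close>)
    then have iv': "(\<lambda>s. iv (exp s)) holomorphic_on rhp L" by (simp add: o_def)
    have "(h \<circ> (\<lambda>s. iv (exp s))) holomorphic_on rhp L"
      by (rule holomorphic_on_compose_gen[OF iv' h(1)]) (use s(2) SD in auto)
    then show ?thesis unfolding j_def H_def
      using s(2) SD(2) iv' by (auto intro!: holomorphic_intros simp: o_def)
  qed
  have 6: "exp (j s) = psii (exp s)" if S: "s \<in> rhp L" for s
  proof -
    let ?w = "iv (exp s)"
    have ne: "exp s \<noteq> k0" using s(1)[OF S] k0L by auto
    have w0: "?w \<noteq> 0" using ivD(2)[OF s(4)[OF S]] .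
    have "exp (H ?w) = (exp s / (exp s - k0)) * q ?w"
      using h(2)[OF SD(1)[OF s(2)[OF S]]] s(3)[OF S] ne by (simp add: H_def exp_add)
    also have "\<dots> = exp s * R ?w" using w0 R(5) by (simp add: q_def iv_def)
    finally show ?thesis by (simp add: j_def exp_diff psii_def)
  qed
  have 7: "j (s + of_int m * (2 * of_real pi * \<i>)) = j s + of_int m * (2 * of_real pi * \<i>)" for s and m :: int
  proof -
    have "exp (of_int m * (2 * complex_of_real pi * \<i>)) = 1" unfolding exp_eq_1 by auto
    then show ?thesis by (simp add: j_def exp_add)
  qed
  have 8: "norm (j s - s) \<le> c" if "s \<in> rhp L" for s using c[OF s(2)[OF that]] by (simp add: j_def)
  show ?thesis by (rule that[OF 1 2[unfolded W_def] 3[unfolded W_def] 4[unfolded W_def] 5 6 s(4)[unfolded W_def] 7 8])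
qed

text \<open>Points near \<open>K\<close> have orbits bounded by \<open>L\<close>, and by the maximum
  principle so have the points of \<open>inside K\<close>. Hence \<open>closure Y\<close> lies in
  \<open>outside K\<close>, as \<open>Phi_inj\<close> requires.\<close>

lemma (in model) Phi_inj_continuum:
  assumes K: "compact K" "connected K" "k0 \<in> K" "k1 \<in> K" "k0 \<noteq> k1" "K \<subseteq> ball 0 L" "PF \<union> Q \<subseteq> K"
    and e: "e > 0" "\<And>p z n. p \<in> K ==> dist z p < e ==> norm ((f ^^ n) z) \<le> L"
    and x: "x \<in> KK" "x' \<in> KK" "Phi x = Phi x'"
  shows "x = x'"
proof -
  obtain psi psii j c where *: "psi holomorphic_on {u. 1 < norm u}" "psii holomorphic_on outside K"
    "\<And>u. 1 < norm u ==> psi u \<in> outside K \<and> psii (psi u) = u" "\<And>z. z \<in> outside K ==> 1 < norm (psii z) \<and> psi (psii z) = z"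
    "j holomorphic_on rhp L" "\<And>s. s \<in> rhp L ==> exp (j s) = psii (exp s)" "\<And>s. s \<in> rhp L ==> exp s \<in> outside K"
    "\<And>s (m::int). s \<in> rhp L ==> j (s + of_int m * (2 * of_real pi * \<i>)) = j s + of_int m * (2 * of_real pi * \<i>)"
    "\<And>s. s \<in> rhp L ==> norm (j s - s) \<le> c"
    by (rule exterior_uniformization[OF K(1-6)]) (rule that; assumption)
  have cK: "closed K" using K(1) compact_imp_closed by blast
  have "outside K \<inter> (PF \<union> Q) = {}" using K(7) outside_no_overlap[of K] by blast
  then interpret X: exterior f PF Q nu R0 L \<epsilon> k 1 c "outside K" psi psii j
    by unfold_locales (use * open_outside[OF cK] in auto)
  have "closure Y \<subseteq> outside K"
  proof
    fix w assume w: "w \<in> closure Y"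
    show "w \<in> outside K"
    proof (rule ccontr)
      assume "w \<notin> outside K"
      then have wK: "w \<in> K \<union> inside K" using union_with_inside[of K] by auto
      have ins: "norm ((f ^^ n) z) \<le> L" if "z \<in> inside K" for n z
      proof (rule maximum_modulus_frontier[OF funpow_hol _ bounded_inside[OF compact_imp_bounded[OF K(1)]] _ that])
        show "continuous_on (closure (inside K)) (f ^^ n)" using holomorphic_on_imp_continuous_on[OF funpow_hol] .
        show "norm ((f ^^ n) z) \<le> L" if "z \<in> frontier (inside K)" for z
          using e(2)[of z z n] e(1) frontier_inside_subset[OF cK] that by auto
      qed
      have "open (inside K \<union> (\<Union>p\<in>K. ball p e))" using open_inside[OF cK] by auto
      moreover have "w \<in> inside K \<union> (\<Union>p\<in>K. ball p e)" using wK e(1) by force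
      ultimately obtain y where y: "y \<in> Y" "y \<in> inside K \<union> (\<Union>p\<in>K. ball p e)"
        using w unfolding closure_iff_nhds_not_empty by blast
      then have "norm ((f ^^ n) y) \<le> L" for n using ins e(2)[of _ y n] by (auto simp: dist_commute)
      then show False using y(1) by (auto simp: Y_def not_less[symmetric])
    qed
  qed
  then show ?thesis using X.Phi_inj x by blast
qed

section \<open>Orbits near the postsingular set\<close>

context entire_map
begin

text \<open>If the orbits starting in the disc are not uniformly bounded, choose iterates
  \<open>k i\<close> that exceed \<open>i\<close> somewhere in it. A convergent subsequence of these
  is not bounded, so it diverges on the whole disc.\<close>

lemma fatou_orbit_dichotomy:
  assumes z: "z \<in> fatou_set f"
  shows "\<exists>e>0. (\<exists>B. \<forall>w\<in>ball z e. \<forall>n. norm ((f ^^ n) w) \<le> B) \<or> (\<forall>w\<in>ball z e. \<forall>B. \<exists>n. B < norm ((f ^^ n) w))"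
proof -
  obtain e where e: "e > 0" "\<And>k::nat=>nat. \<exists>r. strict_mono r \<and>
    ((\<exists>B. \<forall>n. \<forall>w\<in>cball z e. norm ((f ^^ k (r n)) w) \<le> B) \<or>
     (\<forall>B. \<forall>\<^sub>F n in sequentially. \<forall>w\<in>cball z e. B < norm ((f ^^ k (r n)) w)))"
    by (rule fatou_dichotomy[OF entire z]) (rule that; assumption)
  show ?thesis
  proof (cases "\<exists>B. \<forall>w\<in>ball z e. \<forall>n. norm ((f ^^ n) w) \<le> B")
    case True then show ?thesis using e(1) by blast
  next
    case False
    then have "\<exists>n w. w \<in> ball z e \<and> real i < norm ((f ^^ n) w)" for i :: nat by (meson not_le)
    then obtain k w where k: "\<And>i::nat. w i \<in> ball z e \<and> real i < norm ((f ^^ k i) (w i))" by metis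
    obtain r where r: "strict_mono (r :: nat => nat)" "(\<exists>B. \<forall>n. \<forall>w\<in>cball z e. norm ((f ^^ k (r n)) w) \<le> B) \<or>
     (\<forall>B. \<forall>\<^sub>F n in sequentially. \<forall>w\<in>cball z e. B < norm ((f ^^ k (r n)) w))"
      using e(2)[of k] by blast
    have "\<not> (\<exists>B. \<forall>n. \<forall>w\<in>cball z e. norm ((f ^^ k (r n)) w) \<le> B)"
    proof
      assume "\<exists>B. \<forall>n. \<forall>w\<in>cball z e. norm ((f ^^ k (r n)) w) \<le> B"
      then obtain B where B: "\<And>n w. w \<in> cball z e ==> norm ((f ^^ k (r n)) w) \<le> B" by blast
      obtain m :: nat where m: "B < real m" using reals_Archimedean2 by blast
      have "real m \<le> real (r m)" using seq_suble[OF r(1)] by simp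
      moreover have "w (r m) \<in> cball z e" using k[of "r m"] by simp
      ultimately show False using B[of "w (r m)" m] k[of "r m"] m by linarith
    qed
    then have inf: "\<And>B. \<forall>\<^sub>F n in sequentially. \<forall>w\<in>cball z e. B < norm ((f ^^ k (r n)) w)" using r(2) by blast
    have "\<exists>n. B < norm ((f ^^ n) w)" if "w \<in> ball z e" for w B
      using eventually_happens'[OF sequentially_bot inf[of B]] that by fastforce
    then show ?thesis using e(1) by blast
  qed
qed

lemma fatou_local_bound:
  assumes "z \<in> fatou_set f" and "\<And>n. norm ((f ^^ n) z) \<le> B"
  shows "\<exists>e>0. \<exists>B. \<forall>w\<in>ball z e. \<forall>n. norm ((f ^^ n) w) \<le> B"
proof -
  obtain e where "e > 0" "(\<exists>B. \<forall>w\<in>ball z e. \<forall>n. norm ((f ^^ n) w) \<le> B) \<or> (\<forall>w\<in>ball z e. \<forall>B. \<exists>n. B < norm ((f ^^ n) w))"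
    using fatou_orbit_dichotomy[OF assms(1)] by blast
  then show ?thesis using assms(2) by (meson centre_in_ball not_le)
qed

text \<open>By the dichotomy both having a bounded and having an unbounded orbit are open conditions
  on the Fatou set, so connectedness spreads boundedness from the single point
  \<open>p\<close>.\<close>

lemma connected_fatou_local_bound:
  assumes con: "connected (fatou_set f)" and p: "p \<in> fatou_set f" "\<And>n. norm ((f ^^ n) p) \<le> B" and z: "z \<in> fatou_set f"
  shows "\<exists>e>0. \<exists>B. \<forall>w\<in>ball z e. \<forall>n. norm ((f ^^ n) w) \<le> B"
proof -
  define G where "G = {z. \<exists>B. \<forall>n. norm ((f ^^ n) z) \<le> B}"
  have *: "\<exists>e>0. ball z e \<subseteq> G \<or> ball z e \<subseteq> - G" if z: "z \<in> fatou_set f" for z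
  proof -
    obtain e where e: "e > 0" "(\<exists>B. \<forall>w\<in>ball z e. \<forall>n. norm ((f ^^ n) w) \<le> B) \<or> (\<forall>w\<in>ball z e. \<forall>B. \<exists>n. B < norm ((f ^^ n) w))"
      using fatou_orbit_dichotomy[OF z] by blast
    from e(2) have "ball z e \<subseteq> G \<or> ball z e \<subseteq> - G"
    proof
      assume "\<forall>w\<in>ball z e. \<forall>B. \<exists>n. B < norm ((f ^^ n) w)"
      then have "ball z e \<subseteq> - G" unfolding G_def by (force simp: not_le[symmetric])
      then show ?thesis ..
    qed (auto simp: G_def)
    then show ?thesis using e(1) by blast
  qed
  define U where "U A = \<Union>{ball z e | z e. ball z e \<subseteq> A}" for A :: "complex set"
  have U: "open (U A)" "U A \<subseteq> A" for A unfolding U_def by auto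
  have "fatou_set f \<subseteq> U G \<union> U (- G)"
  proof
    fix z assume "z \<in> fatou_set f"
    then obtain e where "e > 0" "ball z e \<subseteq> G \<or> ball z e \<subseteq> - G" using * by blast
    then show "z \<in> U G \<union> U (- G)" unfolding U_def using centre_in_ball by blast
  qed
  then have "U G \<inter> fatou_set f = {} \<or> U (- G) \<inter> fatou_set f = {}" using U by (intro connectedD[OF con]) blast+
  moreover have "p \<in> G" using p(2) by (auto simp: G_def)
  ultimately have "z \<in> G" using p(1) z \<open>fatou_set f \<subseteq> _\<close> U(2) by blast
  then show ?thesis using fatou_local_bound[OF z] by (auto simp: G_def)
qed

lemma compact_orbit_bound:
  assumes K: "compact K" and loc: "\<And>z. z \<in> K ==> \<exists>e>0. \<exists>B. \<forall>w\<in>ball z e. \<forall>n. norm ((f ^^ n) w) \<le> B"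
  obtains e B where "e > 0" "\<And>p z n. p \<in> K ==> dist z p < e ==> norm ((f ^^ n) z) \<le> B"
proof -
  \<comment> \<open>One parameter encodes both the bound \<open>C\<close> and the radius
    \<open>1 / C\<close>; enlarging it weakens both, as \<open>compact_local_bound\<close>
    requires.\<close>
  define P where "P C v \<longleftrightarrow> 0 < C \<and> (\<forall>z n. dist z v < 1 / C --> norm ((f ^^ n) z) \<le> C)" for C :: real and v
  have "\<exists>C. \<forall>v\<in>insert 0 K. v \<in> K --> P C v"
  proof (rule compact_local_bound)
    show "compact (insert 0 K)" using K by simp
    fix w :: complex assume "w \<in> insert 0 K"
    show "\<exists>r>0. \<exists>C. \<forall>v\<in>ball w r. v \<in> K --> P C v"
    proof (cases "w \<in> K")
      case True
      obtain e B where e: "e > 0" "\<And>v n. v \<in> ball w e ==> norm ((f ^^ n) v) \<le> B" using loc[OF True] by blast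
      have "P (max (\<bar>B\<bar> + 1) (2 / e)) v" if v: "v \<in> ball w (e / 2)" for v
        unfolding P_def
      proof (intro conjI allI impI)
        fix z n assume z: "dist z v < 1 / max (\<bar>B\<bar> + 1) (2 / e)"
        have "1 / max (\<bar>B\<bar> + 1) (2 / e) \<le> 1 / (2 / e)" using e(1) by (intro divide_left_mono mult_pos_pos) (auto simp: less_max_iff_disj)
        then have "dist z v < e / 2" using z e(1) by simp
        then have "z \<in> ball w e" using v dist_triangle_half_l[of w v e z] by (simp add: dist_commute)
        then show "norm ((f ^^ n) z) \<le> max (\<bar>B\<bar> + 1) (2 / e)" using e(2)[of z n] by linarith
      qed auto
      then show ?thesis using e(1) by (intro exI[of _ "e / 2"] conjI exI[of _ "max (\<bar>B\<bar> + 1) (2 / e)"]) auto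
    next
      case False
      have "open (- K)" using K compact_imp_closed by blast
      then obtain r where "r > 0" "ball w r \<subseteq> - K" using False openE by blast
      then show ?thesis by blast
    qed
  next
    fix C C' :: real and v assume P: "v \<in> K --> P C v" and le: "C \<le> C'"
    have "P C' v" if "P C v"
    proof -
      have "1 / C' \<le> 1 / C" using that le by (intro divide_left_mono mult_pos_pos) (auto simp: P_def)
      then show ?thesis using that le unfolding P_def by (meson less_le_trans order_trans)
    qed
    then show "v \<in> K --> P C' v" using P by blast
  qed
  then obtain C where C: "\<And>v. v \<in> K ==> P C v" by blast
  show ?thesis
  proof (cases "K = {}")
    case True then show ?thesis using that[of 1 0] by auto
  next
    case False
    then have "0 < C" using C by (auto simp: P_def)
    then show ?thesis using that[of "1 / C" C] C by (auto simp: P_def)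
  qed
qed

text \<open>The cycle is superattracting: \<open>f ^^ n\<close> maps a small disc about
  \<open>z\<close> into itself, so all iterates are bounded there, against
  \<open>julia_blowup\<close>.\<close>

lemma critical_periodic_fatou:
  assumes per: "(f ^^ n) z = z" "n \<ge> 1" and crit: "deriv f z = 0" shows "z \<in> fatou_set f"
proof (rule ccontr)
  assume "z \<notin> fatou_set f"
  then have zJ: "z \<in> julia_set f" by (simp add: julia_set_def)
  define g where "g = f ^^ n"
  have gz: "g z = z" using per by (simp add: g_def)
  have "deriv g z = 0" using deriv_funpow_add[of "n - 1" 1 z] per(2) crit by (simp add: g_def)
  then have "(g has_field_derivative 0) (at z)" using funpow_has_deriv[of n z] by (simp add: g_def)
  then have "((\<lambda>w. (g w - g z) / (w - z)) \<longlongrightarrow> 0) (at z)" by (simp add: has_field_derivative_iff)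
  then have "\<forall>\<^sub>F w in at z. norm ((g w - g z) / (w - z)) < 1" using order_tendstoD(2)[OF tendsto_norm_zero] zero_less_one by blast
  then obtain e where e: "e > 0" "\<And>w. w \<noteq> z ==> dist w z < e ==> norm ((g w - g z) / (w - z)) < 1"
    unfolding eventually_at by blast
  have step: "g w \<in> cball z (e / 2)" if "w \<in> cball z (e / 2)" for w
  proof (cases "w = z")
    case True then show ?thesis using gz e(1) by simp
  next
    case False
    have "norm ((g w - g z) / (w - z)) < 1" using e False that by (auto simp: dist_commute)
    then have "norm (g w - z) < norm (w - z)" using False gz by (simp add: norm_divide divide_less_eq)
    then show ?thesis using that by (simp add: dist_norm norm_minus_commute)
  qed
  then have iter: "(g ^^ m) w \<in> cball z (e / 2)" if "w \<in> cball z (e / 2)" for m w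
    using that by (induction m) auto
  have "\<exists>B. \<forall>w\<in>cball z (e / 2). norm ((f ^^ i) w) \<le> B" for i
    using compact_imp_bounded[OF compact_continuous_image[OF continuous_on_subset[OF funpow_cont] compact_cball]]
    unfolding bounded_iff by (metis image_eqI subset_UNIV)
  then obtain B where B: "\<And>i w. w \<in> cball z (e / 2) ==> norm ((f ^^ i) w) \<le> B i" by metis
  define M where "M = Max (B ` {..<n})"
  have bd: "norm ((f ^^ k) w) \<le> M" if "w \<in> cball z (e / 2)" for k w
  proof -
    have "f ^^ k = (f ^^ (k mod n)) \<circ> (g ^^ (k div n))"
      by (simp add: g_def funpow_mult funpow_add[symmetric])
    then have "norm ((f ^^ k) w) \<le> B (k mod n)" using B[OF iter[OF that]] by simp
    also have "\<dots> \<le> M" unfolding M_def using per(2) by (intro Max_ge) auto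
    finally show ?thesis .
  qed
  obtain m u where "u \<in> ball z (e / 2)" "(f ^^ m) u = of_real (\<bar>M\<bar> + 1) \<or> (f ^^ m) u = of_real (\<bar>M\<bar> + 2)"
    by (rule julia_blowup[OF zJ open_ball[of z "e / 2"], of "of_real (\<bar>M\<bar> + 1)" "of_real (\<bar>M\<bar> + 2)"]) (use e(1) in auto)
  then show False using bd[of u m] by (auto simp del: of_real_add)
qed

end

context expanding
begin

text \<open>With \<open>PF\<close> and \<open>Q\<close> empty the identity is admissible on every
  disc, and its lifts on growing discs fit together.\<close>

lemma global_section:
  assumes e: "PF = {}" "Q = {}"
  obtains H where "H holomorphic_on UNIV" "\<And>z. f (H z) = z" "H (f z0) = z0"
proof -
  define a where "a = f z0"
  have "\<exists>H. H holomorphic_on ball a (real (Suc i)) \<and> (\<forall>z\<in>ball a (real (Suc i)). f (H z) = z) \<and> H a = z0" for i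
  proof -
    have B: "open (ball a (real (Suc i)))" "simply_connected (ball a (real (Suc i)))" "a \<in> ball a (real (Suc i))"
      using convex_imp_simply_connected[OF convex_ball] by auto
    have Bu: "ball a (real (Suc i)) \<noteq> UNIV" by (metis bounded_ball not_bounded_UNIV)
    have "adm (ball a (real (Suc i))) (\<lambda>z. z)"
    proof (rule adm_unramified)
      have "a \<in> ball a (real (Suc i))" "a + of_real (1/2) \<in> ball a (real (Suc i))" by (auto simp: dist_norm)
      then show "\<not> (\<lambda>z. z) constant_on ball a (real (Suc i))" unfolding constant_on_def by (metis add_cancel_left_right of_real_eq_0_iff divide_eq_0_iff one_neq_zero zero_neq_numeral)
    qed (use assms in \<open>auto intro: holomorphic_intros\<close>)
    from adm_lift[OF B(1,2) Bu B(3) this, of z0]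
    obtain H where "adm (ball a (real (Suc i))) H" "\<And>zeta. zeta \<in> ball a (real (Suc i)) ==> f (H zeta) = zeta" "H a = z0"
      by (auto simp: a_def)
    then show ?thesis by (auto simp: adm_def)
  qed
  then obtain H where H: "\<And>i. H i holomorphic_on ball a (real (Suc i))" "\<And>i z. z \<in> ball a (real (Suc i)) ==> f (H i z) = z" "\<And>i. H i a = z0"
    by metis
  have eq: "H i x = H j x" if x: "x \<in> ball a (real (Suc i))" "x \<in> ball a (real (Suc j))" for i j x
  proof (rule hol_lift_unique[of "ball a (min (real (Suc i)) (real (Suc j)))" "H i" "H j" a x])
    let ?D = "ball a (min (real (Suc i)) (real (Suc j)))"
    show "open ?D" "connected ?D" "a \<in> ?D" "x \<in> ?D" using x by auto
    show "H i holomorphic_on ?D" "H j holomorphic_on ?D" by (auto intro: holomorphic_on_subset[OF H(1)])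
    show "f (H i y) = f (H j y)" if "y \<in> ?D" for y using H(2)[of y i] H(2)[of y j] that by simp
    show "H i a = H j a" by (simp add: H(3))
    have "deriv (\<lambda>z. z) a = deriv f (H i a) * deriv (H i) a" by (rule deriv_lift[OF open_ball H(1,2)]) auto
    then show "deriv f (H i a) \<noteq> 0" by auto
  qed
  obtain G where G: "G holomorphic_on (\<Union>i\<in>UNIV. ball a (real (Suc i)))" "\<And>i x. i \<in> UNIV ==> x \<in> ball a (real (Suc i)) ==> G x = H i x"
    by (rule holomorphic_glue[of UNIV "\<lambda>i. ball a (real (Suc i))" H, OF open_ball H(1) eq]) (assumption | rule that; assumption)+
  have U: "\<exists>i. x \<in> ball a (real (Suc i))" for x
  proof -
    obtain n :: nat where "dist a x < real n" using reals_Archimedean2 by blast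
    then show ?thesis by (intro exI[of _ n]) simp
  qed
  show ?thesis
  proof (rule that)
    have "(\<Union>i\<in>UNIV. ball a (real (Suc i))) = UNIV" using U by blast
    then show "G holomorphic_on UNIV" using G(1) by metis
    show "f (G z) = z" for z using U[of z] G(2) H(2) by (metis UNIV_I)
    show "G (f z0) = z0" using G(2)[of 0 a] H(3) by (simp add: a_def)
  qed
qed

text \<open>Otherwise \<open>f\<close> has global sections. A surjective one would confine
  \<open>{z. norm (f z) \<le> R0}\<close> to the image of a compact disc, against
  \<open>no_circle\<close>. If one is not surjective, there is a second one with disjoint range; it
  omits a disc and is constant by Liouville's theorem.\<close>

lemma PF_Un_Q_nonempty: "PF \<union> Q \<noteq> {}"
proof
  assume "PF \<union> Q = {}"
  then have e: "PF = {}" "Q = {}" by auto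
  obtain H where H: "H holomorphic_on UNIV" "\<And>z. f (H z) = z" by (rule global_section[OF e, of 0]) (rule that; assumption)
  show False
  proof (cases "surj H")
    case True
    have "compact (H ` cball 0 R0)"
      using holomorphic_on_imp_continuous_on[OF H(1)] by (intro compact_continuous_image) (auto intro: continuous_on_subset)
    then obtain B where B: "B > 0" "\<And>u. u \<in> cball 0 R0 ==> norm (H u) \<le> B"
      using compact_imp_bounded bounded_pos by (metis image_eqI)
    obtain z where z: "norm z = B + 1" "norm (f z) \<le> R0" using no_circle[of "B + 1"] B(1) by auto
    obtain u where "z = H u" using True by (metis surjD)
    then show False using B(2)[of u] z H(2) by simp
  next
    case False
    then obtain z2 where z2: "z2 \<notin> range H" by auto
    obtain H2 where H2: "H2 holomorphic_on UNIV" "\<And>z. f (H2 z) = z" "H2 (f z2) = z2" by (rule global_section[OF e, of z2]) (rule that; assumption)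
    have disj: "H u \<noteq> H2 v" for u v
    proof
      assume "H u = H2 v"
      then have "u = v" "H u = H2 u" using H(2)[of u] H2(2)[of v] by auto
      have "deriv (\<lambda>z. z) u = deriv f (H u) * deriv H u" by (rule deriv_lift[OF open_UNIV H(1)]) (use H(2) in auto)
      then have "deriv f (H u) \<noteq> 0" by auto
      then have "H (f z2) = H2 (f z2)"
        using hol_lift_unique[OF open_UNIV connected_UNIV H(1) H2(1), of u "f z2"] H(2) H2(2) \<open>H u = H2 u\<close> by simp
      then show False using H2(3) z2 by (metis rangeI)
    qed
    have "\<not> H constant_on UNIV" using H(2) unfolding constant_on_def by (metis UNIV_I zero_neq_one)
    then have "open (range H)" using open_mapping_thm[OF H(1) open_UNIV connected_UNIV open_UNIV subset_UNIV] by blast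
    then obtain r where r: "r > 0" "ball (H 0) r \<subseteq> range H" using openE by blast
    have far: "r \<le> norm (H2 v - H 0)" for v
    proof (rule ccontr)
      assume "\<not> r \<le> norm (H2 v - H 0)"
      then have "H2 v \<in> range H" using r(2) by (auto simp: dist_norm norm_minus_commute)
      then show False using disj by (metis imageE)
    qed
    then have nz: "H2 v - H 0 \<noteq> 0" for v using r(1) by (metis norm_zero not_le)
    have "(\<lambda>v. 1 / (H2 v - H 0)) constant_on UNIV"
    proof (rule Liouville_theorem)
      show "(\<lambda>v. 1 / (H2 v - H 0)) holomorphic_on UNIV" using nz by (intro holomorphic_intros H2) auto
      have "norm (1 / (H2 v - H 0)) \<le> 1 / r" for v using far[of v] r(1) by (simp add: norm_divide frac_le)
      then show "bounded (range (\<lambda>v. 1 / (H2 v - H 0)))" unfolding bounded_iff by blast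
    qed
    then obtain d where "\<And>v. 1 / (H2 v - H 0) = d" by (auto simp: constant_on_def)
    then have "H2 0 = H2 1" using nz by (metis diff_add_cancel div_by_1 divide_divide_eq_right mult_cancel_left1 nonzero_divide_eq_eq one_neq_zero)
    then show False using H2(2)[of 0] H2(2)[of 1] by simp
  qed
qed

end

text \<open>The factorial in \<open>nu\<close> is a common multiple of the local degrees on the
  Julia set. A weight constant on \<open>Q\<close> would leave no room for the degree at a critical
  point in \<open>Q\<close>, so its exponent counts the critical points of \<open>Q\<close> on the
  way. That the Julia set contains no asymptotic values puts all of them into
  \<open>PF\<close>.\<close>

lemma strongly_subhyperbolic_expanding:
  assumes "strongly_subhyperbolic f"
  obtains nu R0 \<epsilon> L0 where "\<And>L. L0 \<le> L ==> expanding f (postsingular_set f \<inter> fatou_set f) (postsingular_set f \<inter> julia_set f) nu R0 L \<epsilon>"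
proof -
  define P where "P = postsingular_set f"
  define PF Q where "PF = P \<inter> fatou_set f" and "Q = P \<inter> julia_set f"
  have te: "transcendental_entire f" and PFc: "compact PF" and Qf: "finite Q" and JA: "julia_set f \<inter> asymptotic_values f = {}"
    using assms by (auto simp: strongly_subhyperbolic_def subhyperbolic_def PF_def Q_def P_def)
  obtain N :: real where N: "\<And>z. z \<in> julia_set f ==> real (local_degree f z) < N"
    using assms by (auto simp: strongly_subhyperbolic_def)
  interpret entire_map f by (rule transcendental_entire_map[OF te])
  have P_eq: "P = PF \<union> Q" by (auto simp: PF_def Q_def julia_set_def)
  have J_fw: "f z \<in> julia_set f" if "z \<in> julia_set f" for z using fatou_backward[of z] that by (auto simp: julia_set_def)
  have J_bw: "z \<in> julia_set f" if "f z \<in> julia_set f" for z using fatou_forward[of z] that by (auto simp: julia_set_def)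
  have S_P: "singular_values f \<subseteq> P"
  proof -
    have "(f ^^ 0) ` singular_values f \<subseteq> P" unfolding P_def postsingular_set_def by (rule order_trans[OF _ closure_subset]) blast
    then show ?thesis by simp
  qed
  have P_inv: "f z \<in> P" if "z \<in> P" for z
  proof -
    let ?U = "\<Union>n. (f ^^ n) ` singular_values f"
    have "f ` closure ?U \<subseteq> closure (f ` ?U)"
      by (rule image_closure_subset[OF cont closed_closure closure_subset])
    also have "f ` ?U \<subseteq> ?U"
    proof
      fix y assume "y \<in> f ` ?U"
      then obtain n s where "s \<in> singular_values f" "y = (f ^^ Suc n) s" by auto
      then show "y \<in> ?U" by blast
    qed
    then have "closure (f ` ?U) \<subseteq> closure ?U" by (rule closure_mono)
    finally show ?thesis using that unfolding P_def postsingular_set_def by blast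
  qed
  have crit_P: "f z \<in> P" if "deriv f z = 0" for z
    using that S_P closure_subset by (fastforce simp: singular_values_def critical_values_def)
  have asym_P: "asymptotic_values f \<subseteq> P" using S_P closure_subset[of "critical_values f \<union> asymptotic_values f"] by (auto simp: singular_values_def)
  define crit where "crit w = {c \<in> Q. deriv f c = 0 \<and> (\<exists>n\<ge>1. (f ^^ n) c = w)}" for w
  \<comment> \<open>Critical points in \<open>Q\<close> are not periodic, so the exponent increases strictly at each of them.\<close>
  define nu where "nu w = (if w \<in> Q then fact (nat \<lceil>N\<rceil>) ^ (1 + card (crit w)) else (1::nat))" for w
  have fin: "finite (crit w)" for w using Qf by (simp add: crit_def)
  have deg1: "local_degree f z = 1" if "deriv f z \<noteq> 0" for z
    using local_degree_eq_1_iff[OF entire open_UNIV connected_UNIV _ nonconst, of z] that by simp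
  have deg_fact: "local_degree f z dvd fact (nat \<lceil>N\<rceil>)" if "z \<in> julia_set f" for z
  proof (rule dvd_fact)
    obtain r g where "0 < local_degree f z" by (rule local_degree_factor[OF entire open_UNIV connected_UNIV UNIV_I[of z] nonconst]) (rule that; assumption)
    then show "1 \<le> local_degree f z" by simp
    show "local_degree f z \<le> nat \<lceil>N\<rceil>" using N[OF that] by linarith
  qed
  have om: "orbimap f PF Q nu"
  proof
    show "f ` PF \<subseteq> PF" using P_inv fatou_forward by (auto simp: PF_def)
    show "asymptotic_values f \<subseteq> PF" using asym_P JA by (auto simp: PF_def julia_set_def)
    show "nu z = 1" if "z \<notin> Q" for z using that by (simp add: nu_def)
    show "nu z > 0" for z by (simp add: nu_def)
    fix z assume fz: "f z \<notin> PF"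
    show "local_degree f z * nu z dvd nu (f z)"
    proof (cases "f z \<in> Q")
      case False
      then have "f z \<notin> P" using fz P_eq by blast
      then have "deriv f z \<noteq> 0" "z \<notin> Q" using crit_P P_inv by (auto simp: Q_def)
      then show ?thesis using deg1 by (simp add: nu_def)
    next
      case True
      then have zJ: "z \<in> julia_set f" using J_bw by (simp add: Q_def)
      have sub: "crit z \<subseteq> crit (f z)"
      proof
        fix c assume "c \<in> crit z"
        then obtain n where "c \<in> Q" "deriv f c = 0" "n \<ge> 1" "(f ^^ n) c = z" by (auto simp: crit_def)
        then show "c \<in> crit (f z)" by (auto simp: crit_def intro!: exI[of _ "Suc n"])
      qed
      show ?thesis
      proof (cases "z \<in> Q")
        case False
        then show ?thesis using True dvd_mult2[OF deg_fact[OF zJ]] by (simp add: nu_def)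
      next
        case zQ: True
        show ?thesis
        proof (cases "deriv f z = 0")
          case False
          then show ?thesis using True zQ card_mono[OF fin sub] deg1[OF False] by (simp add: nu_def le_imp_power_dvd)
        next
          case crit0: True
          have "z \<notin> crit z" using critical_periodic_fatou[OF _ _ crit0] zJ by (auto simp: crit_def julia_set_def)
          moreover have "z \<in> crit (f z)" using zQ crit0 by (auto simp: crit_def intro!: exI[of _ 1])
          ultimately have "crit z \<subset> crit (f z)" using sub by blast
          then have "card (crit z) < card (crit (f z))" by (rule psubset_card_mono[OF fin])
          then have "fact (nat \<lceil>N\<rceil>) ^ (1 + (1 + card (crit z))) dvd (fact (nat \<lceil>N\<rceil>) ^ (1 + card (crit (f z))) :: nat)"
            by (intro le_imp_power_dvd) simp
          moreover have "local_degree f z * fact (nat \<lceil>N\<rceil>) ^ (1 + card (crit z)) dvd (fact (nat \<lceil>N\<rceil>) * fact (nat \<lceil>N\<rceil>) ^ (1 + card (crit z)) :: nat)"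
            by (intro mult_dvd_mono deg_fact[OF zJ] dvd_refl)
          moreover have "nu z = fact (nat \<lceil>N\<rceil>) ^ (1 + card (crit z))" "nu (f z) = fact (nat \<lceil>N\<rceil>) ^ (1 + card (crit (f z)))"
            using True zQ by (simp_all add: nu_def)
          ultimately show ?thesis by (metis dvd_trans power_Suc plus_1_eq_Suc)
        qed
      qed
    qed
  qed
  have "bounded P" using P_eq PFc Qf by (simp add: compact_imp_bounded finite_imp_bounded)
  then obtain B1 where B1: "\<And>z. z \<in> P ==> norm z \<le> B1" unfolding bounded_iff by blast
  define R0 where "R0 = max 1 (max B1 (norm (f 0)))"
  have R0: "1 \<le> R0" "\<And>z. z \<in> P ==> norm z \<le> R0" "norm (f 0) \<le> R0" using B1 by (auto simp: R0_def le_max_iff_disj)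
  have cb: "classB f R0"
  proof
    show "\<exists>z. A \<le> norm z \<and> B * norm z ^ n < norm (f z)" for A B n using transcendental_growth[OF te] .
  qed (use R0 asym_P crit_P in auto)
  then interpret C: classB f R0 .
  have "(f ^^ n) p \<in> PF" if "p \<in> PF" for p n
    using that P_inv fatou_forward by (induction n) (auto simp: PF_def)
  then have "norm ((f ^^ n) p) \<le> R0" if "p \<in> PF" for p n using that R0(2) P_eq by blast
  then have "\<exists>e>0. \<exists>B. \<forall>w\<in>ball p e. \<forall>n. norm ((f ^^ n) w) \<le> B" if "p \<in> PF" for p
    using that fatou_local_bound[of p R0] by (auto simp: PF_def)
  from compact_orbit_bound[OF PFc this] obtain \<epsilon> B where eps: "\<epsilon> > 0" "\<And>p z n. p \<in> PF ==> dist z p < \<epsilon> ==> norm ((f ^^ n) z) \<le> B"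
    by blast
  obtain e1 where e1: "f e1 = e1" using C.large_fixed_point by blast
  obtain e2 where e2: "norm e2 > norm e1" "f e2 = e2" using C.large_fixed_point by blast
  show ?thesis
  proof (rule that[of "max (R0 + 1) (max B (norm e2))" nu R0 \<epsilon>, folded P_def, folded PF_def Q_def])
    fix L assume L: "max (R0 + 1) (max B (norm e2)) \<le> L"
    show "expanding f PF Q nu R0 L \<epsilon>"
      using om cb unfolding expanding_def
    proof (intro conjI expanding_axioms.intro)
      show "compact PF" "finite Q" "f ` Q \<subseteq> Q" "PF \<inter> Q = {}" using PFc Qf P_inv J_fw by (auto simp: PF_def Q_def julia_set_def)
      show "1 \<le> L" "R0 \<le> L" using L R0(1) by auto
      have "norm z < L" if "z \<in> P" for z using R0(2)[OF that] L by linarith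
      then show "PF \<union> Q \<subseteq> ball 0 L" using P_eq by auto
      show "norm ((f ^^ n) z) \<le> L" if "p \<in> PF" "dist z p < \<epsilon>" for p z n using eps(2)[OF that, of n] L by linarith
      have "norm e1 \<le> L \<and> norm e2 \<le> L" using L e2(1) by linarith
      then show "\<exists>e1 e2. e1 \<noteq> e2 \<and> f e1 = e1 \<and> f e2 = e2 \<and> norm e1 \<le> L \<and> norm e2 \<le> L"
        using e1 e2 by (intro exI[of _ e1] exI[of _ e2]) auto
    qed (use eps in auto)
  qed
qed

lemma (in expanding) small_multiplier:
  assumes "24 * pi \<le> ln L" "Q \<subseteq> julia_set f"
  obtains d where "d > 0" "\<And>k. k \<noteq> 0 ==> norm k \<le> d ==> model f PF Q nu R0 L \<epsilon> k"
proof -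
  have "bounded (f ` cball 0 (L + 1))" by (intro compact_imp_bounded compact_continuous_image cont compact_cball)
  then obtain B where B: "B > 0" "\<And>z. z \<in> cball 0 (L + 1) ==> norm (f z) \<le> B" unfolding bounded_pos by blast
  show ?thesis
  proof (rule that[of "min (1 / R0) (1 / (2 * B))"])
    show "min (1 / R0) (1 / (2 * B)) > 0" using R0 B(1) by simp
    fix k :: complex assume k: "k \<noteq> 0" "norm k \<le> min (1 / R0) (1 / (2 * B))"
    show "model f PF Q nu R0 L \<epsilon> k"
    proof
      have "norm k * R0 \<le> 1 / R0 * R0" using k(2) R0 by (intro mult_right_mono) auto
      then show "norm k * R0 \<le> 1" using R0 by simp
      fix z :: complex assume "norm z \<le> L + 1"
      then have "norm k * norm (f z) \<le> 1 / (2 * B) * B" using k(2) B by (intro mult_mono) auto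
      then show "norm (k * f z) < L" using B(1) L(1) by (simp add: norm_mult)
    qed (use k assms in auto)
  qed
qed

text \<open>The set is a finite union of closed discs, each joined to the common point
  \<open>p\<close> by a path in \<open>S\<close>.\<close>

lemma compact_connected_superset:
  fixes S C :: "complex set"
  assumes S: "open S" "connected S" and C: "compact C" "C \<subseteq> S" "C \<noteq> {}"
  obtains K k0 k1 where "compact K" "connected K" "C \<subseteq> K" "K \<subseteq> S" "k0 \<in> K" "k1 \<in> K" "k0 \<noteq> k1"
proof -
  obtain p where p: "p \<in> C" using C(3) by blast
  have "\<exists>T e. e > 0 \<and> ball z e \<subseteq> T \<and> compact T \<and> connected T \<and> p \<in> T \<and> T \<subseteq> S" if z: "z \<in> C" for z
  proof -
    have zS: "z \<in> S" "p \<in> S" using z p C(2) by auto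
    obtain e where e: "e > 0" "cball z e \<subseteq> S" using S(1) zS(1) open_contains_cball by blast
    obtain g where g: "path g" "path_image g \<subseteq> S" "pathstart g = p" "pathfinish g = z"
      using connected_open_path_connected[OF S] zS unfolding path_connected_def by blast
    have zp: "z \<in> path_image g" "p \<in> path_image g" using g pathstart_in_path_image pathfinish_in_path_image by blast+
    have "z \<in> cball z e" using e(1) by simp
    then have "cball z e \<inter> path_image g \<noteq> {}" using zp(1) by blast
    then have con: "connected (cball z e \<union> path_image g)" using g(1) by (intro connected_Un) auto
    then show ?thesis using e g zp con
      by (intro exI[of _ "cball z e \<union> path_image g"] exI[of _ e]) (auto intro: compact_Un)
  qed
  then have "\<forall>z\<in>C. \<exists>Te. snd Te > 0 \<and> ball z (snd Te) \<subseteq> fst Te \<and> compact (fst Te) \<and> connected (fst Te) \<and> p \<in> fst Te \<and> fst Te \<subseteq> S" by force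
  then obtain Te where Te: "\<forall>z\<in>C. snd (Te z) > 0 \<and> ball z (snd (Te z)) \<subseteq> fst (Te z) \<and> compact (fst (Te z)) \<and> connected (fst (Te z)) \<and> p \<in> fst (Te z) \<and> fst (Te z) \<subseteq> S"
    unfolding bchoice_iff by blast
  define T e where "T z = fst (Te z)" and "e z = snd (Te z)" for z
  have T: "e z > 0" "ball z (e z) \<subseteq> T z" "compact (T z)" "connected (T z)" "p \<in> T z" "T z \<subseteq> S" if "z \<in> C" for z
    using Te that by (auto simp: T_def e_def)
  have "C \<subseteq> (\<Union>z\<in>C. ball z (e z))" using T(1) by force
  then obtain C' where C': "C' \<subseteq> C" "finite C'" "C \<subseteq> (\<Union>z\<in>C'. ball z (e z))"
    by (rule compactE_image[OF C(1), rotated]) auto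
  define K where "K = (\<Union>z\<in>insert p C'. T z)"
  have pC': "z \<in> C" if "z \<in> insert p C'" for z using that C'(1) p by blast
  have "ball p (e p) \<subseteq> K" using T(2)[OF p] by (auto simp: K_def)
  then have "p \<in> K" "p + of_real (e p / 2) \<in> K" using T(1)[OF p] by (auto simp: dist_norm subset_iff)
  moreover have "p \<noteq> p + of_real (e p / 2)" using T(1)[OF p] by simp
  moreover have "compact K" unfolding K_def using C'(2) T(3) pC' by (intro compact_UN) auto
  moreover have "connected K" unfolding K_def
  proof (rule connected_Union)
    have "p \<in> \<Inter> (T ` insert p C')" using T(5) pC' by blast
    then show "\<Inter> (T ` insert p C') \<noteq> {}" by blast
  qed (use T(4) pC' in blast)
  moreover have "C \<subseteq> K" using C'(3) T(2) C'(1) by (fastforce simp: K_def)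
  moreover have "K \<subseteq> S" using T(6) pC' by (auto simp: K_def)
  ultimately show ?thesis using that by blast
qed

text \<open>The value at a critical point in the Julia set would be a postsingular point of the
  Julia set; so all local degrees there are 1, below the strict bound 2.\<close>

lemma hyperbolic_imp_strongly_subhyperbolic:
  assumes "hyperbolic g" shows "strongly_subhyperbolic g" "postsingular_set g \<inter> fatou_set g = postsingular_set g" "postsingular_set g \<inter> julia_set g = {}"
proof -
  show 1: "postsingular_set g \<inter> fatou_set g = postsingular_set g" and 2: "postsingular_set g \<inter> julia_set g = {}"
    using assms by (auto simp: hyperbolic_def julia_set_def)
  have te: "transcendental_entire g" using assms by (simp add: hyperbolic_def)
  interpret entire_map g by (rule transcendental_entire_map[OF te])
  have "(g ^^ 0) ` singular_values g \<subseteq> postsingular_set g" unfolding postsingular_set_def by (rule order_trans[OF _ closure_subset]) blast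
  then have S: "critical_values g \<subseteq> postsingular_set g" "asymptotic_values g \<subseteq> postsingular_set g"
    using closure_subset[of "critical_values g \<union> asymptotic_values g"] by (auto simp: singular_values_def)
  have "real (local_degree g z) < 2" if z: "z \<in> julia_set g" for z
  proof -
    have "g z \<in> julia_set g" using fatou_backward[of z] z by (auto simp: julia_set_def)
    then have "deriv g z \<noteq> 0" using S(1) 2 by (auto simp: critical_values_def)
    then have "local_degree g z = 1" using local_degree_eq_1_iff[OF entire open_UNIV connected_UNIV UNIV_I nonconst] by simp
    then show ?thesis by simp
  qed
  then show "strongly_subhyperbolic g"
    unfolding strongly_subhyperbolic_def subhyperbolic_def using te assms 1 2 S(2)
    by (intro conjI exI[of _ "2::real"]) (auto simp: hyperbolic_def)
qed

text \<open>The inclusion of the escaping set in the Julia set is part of the conclusion because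
  restricting \<open>\<phi>\<close> to the escaping set presupposes it.\<close>

theorem theorem1p2:
  fixes f g :: "complex \<Rightarrow> complex" and c :: complex
  assumes "strongly_subhyperbolic f"
    and "g = (\<lambda>z. f (c * z))"
    and "hyperbolic g"
    and "connected (fatou_set g)"
  shows "\<exists>\<phi> :: complex \<Rightarrow> complex.
           continuous_on (julia_set g) \<phi> \<and>
           \<phi> ` julia_set g = julia_set f \<and>
           (\<forall>z\<in>julia_set g. f (\<phi> z) = \<phi> (g z)) \<and>
           escaping_set g \<subseteq> julia_set g \<and>
           (\<exists>\<psi>. homeomorphism (escaping_set g) (escaping_set f) \<phi> \<psi>)"
proof -
  note hyp = hyperbolic_imp_strongly_subhyperbolic[OF assms(3)]
  have te: "transcendental_entire g" using assms(3) by (simp add: hyperbolic_def)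
  have c0: "c \<noteq> 0"
  proof
    assume "c = 0"
    then have "g = poly [:f 0:]" using assms(2) by (simp add: fun_eq_iff)
    then show False using te by (auto simp: transcendental_entire_def)
  qed
  define Pg where "Pg = postsingular_set g"
  obtain nuf Rf ef Lf where ef: "\<And>L. Lf \<le> L ==> expanding f (postsingular_set f \<inter> fatou_set f) (postsingular_set f \<inter> julia_set f) nuf Rf L ef"
    by (rule strongly_subhyperbolic_expanding[OF assms(1)]) (rule that; assumption)
  obtain nug Rg eg Lg where eg: "\<And>L. Lg \<le> L ==> expanding g Pg {} nug Rg L eg"
    by (rule strongly_subhyperbolic_expanding[OF hyp(1), unfolded hyp(2,3), folded Pg_def]) (rule that; assumption)
  interpret g: entire_map g by (rule transcendental_entire_map[OF te])
  have PgF: "compact Pg" "Pg \<subseteq> fatou_set g" using assms(3) by (auto simp: hyperbolic_def Pg_def)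
  \<comment> \<open>Provides a Fatou point with bounded orbit, from which boundedness spreads over
    the connected Fatou set.\<close>
  have Pg: "Pg \<noteq> {}" using expanding.PF_Un_Q_nonempty[OF eg[OF order_refl]] by simp
  obtain K k0 k1 where K: "compact K" "connected K" "Pg \<subseteq> K" "K \<subseteq> fatou_set g" "k0 \<in> K" "k1 \<in> K" "k0 \<noteq> k1"
    by (rule compact_connected_superset[OF open_fatou assms(4) PgF Pg]) (rule that; assumption)
  obtain p where p: "p \<in> Pg" using Pg by blast
  have "norm ((g ^^ n) p) \<le> Lg" for n
    using expanding.orbit_bound[OF eg[OF order_refl] p, of p n] expanding.eps[OF eg[OF order_refl]] by simp
  then have "\<exists>e>0. \<exists>B. \<forall>w\<in>ball z e. \<forall>n. norm ((g ^^ n) w) \<le> B" if "z \<in> K" for z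
    using g.connected_fatou_local_bound[OF assms(4), of p Lg z] p PgF(2) K(4) that by blast
  from g.compact_orbit_bound[OF K(1) this] obtain e B where e: "e > 0" "\<And>p z n. p \<in> K ==> dist z p < e ==> norm ((g ^^ n) z) \<le> B"
    by blast
  obtain B' where B': "K \<subseteq> ball 0 B'" using compact_imp_bounded[OF K(1)] bounded_subset_ballD by blast
  \<comment> \<open>The model of \<open>g\<close> lives outside the disc of radius \<open>L\<close>,
    that of \<open>f\<close> outside the disc of radius \<open>norm c * L\<close>; hence the
    divisions by \<open>norm c\<close>.\<close>
  define L where "L = max (max Lg B) (max (max B' (exp (24 * pi))) (max (Lf / norm c) (exp (24 * pi) / norm c)))"
  have L: "Lg \<le> L" "B \<le> L" "B' \<le> L" "exp (24 * pi) \<le> L" "Lf / norm c \<le> L" "exp (24 * pi) / norm c \<le> L" by (auto simp: L_def)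
  \<comment> \<open>The models \<open>k g\<close> (with \<open>L\<close>) and \<open>c k f\<close> (with \<open>L' = \<bar>c\<bar> L\<close>) are conjugate by \<open>z \<mapsto> c z\<close>.\<close>
  define L' where "L' = norm c * L"
  have L': "Lf \<le> L'" "exp (24 * pi) \<le> L'" using L(5,6) c0 by (auto simp: L'_def divide_le_eq mult.commute)
  have lnL: "24 * pi \<le> ln L" "24 * pi \<le> ln L'"
    using ln_ge_iff[OF less_le_trans[OF exp_gt_zero L(4)]] ln_ge_iff[OF less_le_trans[OF exp_gt_zero L'(2)]] L(4) L'(2) by simp_all
  obtain dg where dg: "dg > 0" "\<And>k. k \<noteq> 0 ==> norm k \<le> dg ==> model g Pg {} nug Rg L eg k"
    by (rule expanding.small_multiplier[OF eg[OF L(1)] lnL(1)]) (use that in auto)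
  obtain df where df: "df > 0" "\<And>k. k \<noteq> 0 ==> norm k \<le> df ==>
      model f (postsingular_set f \<inter> fatou_set f) (postsingular_set f \<inter> julia_set f) nuf Rf L' ef k"
    by (rule expanding.small_multiplier[OF ef[OF L'(1)] lnL(2)]) (use that in auto)
  \<comment> \<open>The multiplier on the side of \<open>f\<close> is \<open>c * k\<close>, hence
    \<open>df / norm c\<close>.\<close>
  define k :: complex where "k = of_real (min dg (df / norm c))"
  have k: "k \<noteq> 0" "norm k \<le> dg" "norm (c * k) \<le> df"
    using dg(1) df(1) c0 by (auto simp: k_def norm_mult min_def field_simps)
  interpret G: model g Pg "{}" nug Rg L eg k by (rule dg(2)[OF k(1,2)])
  interpret F: model f "postsingular_set f \<inter> fatou_set f" "postsingular_set f \<inter> julia_set f" nuf Rf L' ef "c * k"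
    by (rule df(2)) (use k c0 in auto)
  define M where "M z = c * z" for z
  have FM: "F.F (M z) = M (G.F z)" for z unfolding F.F_def G.F_def M_def by (subst assms(2)) simp
  have FMn: "(F.F ^^ n) (M z) = M ((G.F ^^ n) z)" for n z by (induction n) (auto simp: FM)
  have KM: "M z \<in> F.KK \<longleftrightarrow> z \<in> G.KK" for z
    unfolding F.KK_def G.KK_def mem_Collect_eq FMn using c0 by (simp add: M_def norm_mult L'_def)
  have surjM: "M (z / c) = z" for z using c0 by (simp add: M_def)
  have MK: "M ` G.KK = F.KK" using KM surjM by (metis (no_types, lifting) image_iff set_eqI)
  have Mesc: "M z \<in> escaping_set F.F \<longleftrightarrow> z \<in> escaping_set G.F" for z
  proof -
    have "filterlim (\<lambda>n. M ((G.F ^^ n) z)) at_infinity sequentially \<longleftrightarrow> filterlim (\<lambda>n. (G.F ^^ n) z) at_infinity sequentially"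
      unfolding M_def filterlim_at_infinity_conv_norm_at_top norm_mult
      using c0 filterlim_tendsto_pos_mult_at_top_iff[OF tendsto_const[of "norm c"]] by simp
    then show ?thesis unfolding escaping_set_def mem_Collect_eq FMn .
  qed
  have injG: "x = x'" if "x \<in> G.KK" "x' \<in> G.KK" "G.Phi x = G.Phi x'" for x x'
  proof (rule G.Phi_inj_continuum[OF K(1,2,5,6,7) _ _ e(1) _ that])
    show "K \<subseteq> ball 0 L" using B' L(3) by auto
    show "Pg \<union> {} \<subseteq> K" using K(3) by simp
    show "norm ((g ^^ n) z) \<le> L" if "p \<in> K" "dist z p < e" for p z n using e(2)[OF that, of n] L(2) by linarith
  qed
  obtain ig where ig: "homeomorphism G.KK (julia_set g) G.Phi ig"
    by (rule G.Phi_homeo[OF order_refl injG, unfolded G.Phi_image]) (assumption | rule that; assumption)+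
  define Ef Eg where "Ef = F.KK \<inter> escaping_set F.F" and "Eg = G.KK \<inter> escaping_set G.F"
  have escg: "escaping_set g \<subseteq> julia_set g" by (rule G.escaping_subset_julia) simp
  have PEg: "G.Phi ` Eg = escaping_set g" unfolding Eg_def by (rule G.Phi_escaping_image)
  have PEf: "F.Phi ` Ef = escaping_set f" unfolding Ef_def by (rule F.Phi_escaping_image)
  have "x = x'" if "x \<in> Ef" "x' \<in> F.KK" "F.Phi x = F.Phi x'" for x x'
    using F.Phi_inj_escaping[of x x'] that by (auto simp: Ef_def)
  then obtain hf where hf: "homeomorphism Ef (escaping_set f) F.Phi hf"
    using F.Phi_homeo[of Ef] PEf by (metis Ef_def inf_le1)
  have hM: "homeomorphism Eg Ef M (\<lambda>z. z / c)"
  proof (rule homeomorphismI)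
    show "continuous_on Eg M" "continuous_on Ef (\<lambda>z. z / c)" unfolding M_def using c0 by (auto intro!: continuous_intros)
    show "M ` Eg \<subseteq> Ef" using KM Mesc by (auto simp: Eg_def Ef_def)
    show "(\<lambda>z. z / c) ` Ef \<subseteq> Eg" using KM Mesc surjM by (auto simp: Eg_def Ef_def) metis+
  qed (use c0 surjM in \<open>auto simp: M_def\<close>)
  have hg: "homeomorphism (escaping_set g) Eg ig G.Phi"
    by (rule homeomorphism_symD, rule homeomorphism_of_subsets[OF ig _ _ PEg]) (use escg in \<open>auto simp: Eg_def\<close>)
  \<comment> \<open>Back from the Julia set of \<open>g\<close> to its model by the inverse of
    \<open>G.Phi\<close>, across by the conjugacy \<open>M\<close>, and on to the Julia set of
    \<open>f\<close> by \<open>F.Phi\<close>.\<close>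
  define \<phi> where "\<phi> = F.Phi \<circ> (M \<circ> ig)"
  have igK: "ig ` julia_set g = G.KK" "continuous_on (julia_set g) ig" "\<And>z. z \<in> julia_set g ==> G.Phi (ig z) = z" "\<And>x. x \<in> G.KK ==> ig (G.Phi x) = x"
    using ig by (auto simp: homeomorphism_def)
  have img: "(M \<circ> ig) ` julia_set g = F.KK" using igK(1) MK by (simp only: image_comp[symmetric])
  show ?thesis
  proof (rule exI[of _ \<phi>], intro conjI ballI escg)
    have "continuous_on (julia_set g) (M \<circ> ig)" unfolding M_def o_def by (intro continuous_intros igK)
    then have "continuous_on (julia_set g) (\<lambda>z. F.Phi ((M \<circ> ig) z))"
      by (rule continuous_on_compose2[OF F.Phi_continuous]) (simp only: img order_refl)
    then show "continuous_on (julia_set g) \<phi>" by (simp add: \<phi>_def o_def)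
    show "\<phi> ` julia_set g = julia_set f" unfolding \<phi>_def image_comp[symmetric] img[unfolded image_comp[symmetric]] by (rule F.Phi_image)
    show "f (\<phi> z) = \<phi> (g z)" if z: "z \<in> julia_set g" for z
    proof -
      have x: "ig z \<in> G.KK" "M (ig z) \<in> F.KK" using igK(1) z KM by auto
      have "g z = G.Phi (G.F (ig z))" using G.Phi_semiconj[OF x(1)] igK(3)[OF z] by simp
      then have "ig (g z) = G.F (ig z)" using igK(4)[OF G.KK_F[OF x(1)]] by simp
      then show ?thesis using F.Phi_semiconj[OF x(2)] by (simp add: \<phi>_def FM)
    qed
    show "\<exists>\<psi>. homeomorphism (escaping_set g) (escaping_set f) \<phi> \<psi>"
      unfolding \<phi>_def by (rule exI, rule homeomorphism_compose[OF homeomorphism_compose[OF hg hM] hf])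
  qed
qed

end
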